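(* Let $b>0$, $V(\lambda,y)=\lambda\mathbf{1}_{|y|\ge b}+\beta\mathbf{1}_{|y|<b}+\alpha\delta_0(y)$, where $k_*\in\mathbb{N}$, $\beta<1$ and $\lambda_*<1$ are given and $\alpha>0$ is determined by $$\alpha=\frac{2\sqrt{1-\beta}}{k_*}\cdot\frac{\sqrt{1-\beta}\sinh(k_*\sqrt{1-\beta}\,b)+\sqrt{1-\lambda_*}\cosh(k_*\sqrt{1-\beta}\,b)}{\sqrt{1-\beta}\cosh(k_*\sqrt{1-\beta}\,b)+\sqrt{1-\lambda_*}\sinh(k_*\sqrt{1-\beta}\,b)}.$$ Set $V_0=\mathbf{1}_{|y|\ge b}$ and $V_1=\beta\mathbf{1}_{|y|<b}+\alpha\delta_0$, and for $k\in\mathbb{N}$, $\lambda\in\mathbb{R}$ let $L_\lambda^k=-\frac{d^2}{dy^2}+k^2(1-\lambda V_0-V_1)$. Then: (a) $V_0\in L^\infty(\mathbb{R})$ and $V_1:H^1(\mathbb{R})\to H^{-1}(\mathbb{R})$ is bounded; (b) $L_\lambda^k$ is self-adjoint in $L^2(\mathbb{R})$ for all $k\in\mathbb{N}$, $\lambda\in\mathbb{R}$; (c) there is an open interval $I_{\lambda_*}\subset\mathbb{R}$ containing $\lambda_*$ such that zero is an isolated simple eigenvalue of $L_{\lambda_*}^{k_*}$ and $0\in\rho(L_\lambda^k)$ for all $(k,\lambda)\in\mathbb{N}\times I_{\lambda_*}$ with $(k,\lambda)\neq(k_*,\lambda_* )$; (d) there are $C>0$ and $k_0\in\mathbb{N}$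 such that for all $k\ge k_0$ and $\lambda\in I_{\lambda_*}$: if $L_\lambda^k\phi=f$ with $f\in L^2(\mathbb{R})$, then $\|\phi\|_{L^2(\mathbb{R})}\le\frac{C}{k^2}\|f\|_{L^2(\mathbb{R})}$ and $\|\phi'\|_{L^2(\mathbb{R})}\le\frac{C}{k}\|f\|_{L^2(\mathbb{R})}$; (e) $\langle V_0\phi^*,\phi^*\rangle_{L^2(\mathbb{R})}\ne0$, where $\phi^*$ spans the kernel of $L_{\lambda_*}^{k_*}$.
   Context: $\mathbb{N}=\{1,2,\dots\}$; $\rho(\cdot)$ is the resolvent set; $\mathbf{1}_A$ is the indicator function; $\delta_0$ acts as the operator $H^1(\mathbb{R})\to H^{-1}(\mathbb{R})$ with $\langle\delta_0f,g\rangle=f(0)g(0)$. $L_\lambda^k$ is the operator in $L^2(\mathbb{R})$ with domain $D(L_\lambda^k)=\{\phi\in H^1(\mathbb{R}):\phi\in H^2(-\infty,0)\cap H^2(0,\infty),\ \phi'(0_+)-\phi'(0_-)=-k^2\alpha\phi(0)\}$, acting as $-\phi''+k^2(1-\lambda\mathbf{1}_{|y|\ge b}-\beta\mathbf{1}_{|y|<b})\phi$ on $\mathbb{R}\setminus\{0\}$. *)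

theory Defs
  imports "HOL-Analysis.Analysis"
begin

text \<open>
  Elements of \<open>L\<^sup>2\<close> and of the Sobolev spaces are represented by functions
  \<open>real \<Rightarrow> complex\<close>; equality of elements is equality almost everywhere.
  A function space over an open set \<open>\<Omega>\<close> only looks at the values on \<open>\<Omega>\<close>.
\<close>

abbreviation eq_ae :: "(real \<Rightarrow> complex) \<Rightarrow> (real \<Rightarrow> complex) \<Rightarrow> bool" where
  "eq_ae f g \<equiv> (AE x in lebesgue. f x = g x)"

definition L2 :: "real set \<Rightarrow> (real \<Rightarrow> complex) set" where
  "L2 \<Omega> = {f. f \<in> borel_measurable (lebesgue_on \<Omega>) \<and>
              integrable (lebesgue_on \<Omega>) (\<lambda>x. (cmod (f x))\<^sup>2)}"

definition L2_inner :: "(real \<Rightarrow> complex) \<Rightarrow> (real \<Rightarrow> complex) \<Rightarrow> complex" where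
  "L2_inner f g = (LINT x|lebesgue. f x * cnj (g x))"

definition L2_norm :: "(real \<Rightarrow> complex) \<Rightarrow> real" where
  "L2_norm f = sqrt (LINT x|lebesgue. (cmod (f x))\<^sup>2)"

definition Linf :: "(real \<Rightarrow> real) set" where
  "Linf = {f. f \<in> borel_measurable lebesgue \<and> (\<exists>C. AE x in lebesgue. \<bar>f x\<bar> \<le> C)}"


subsection \<open>Weak derivatives and Sobolev spaces\<close>

definition test_funs :: "real set \<Rightarrow> (real \<Rightarrow> real) set" where
  "test_funs \<Omega> = {\<eta>. (\<forall>n x. (deriv ^^ n) \<eta> differentiable (at x)) \<and>
                     compact (closure {x. \<eta> x \<noteq> 0}) \<and> closure {x. \<eta> x \<noteq> 0} \<subseteq> \<Omega>}"

definition locally_integrable :: "real set \<Rightarrow> (real \<Rightarrow> complex) \<Rightarrow> bool" where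
  "locally_integrable \<Omega> f \<longleftrightarrow> (\<forall>K. compact K \<and> K \<subseteq> \<Omega> \<longrightarrow> f absolutely_integrable_on K)"

definition has_weak_deriv :: "real set \<Rightarrow> (real \<Rightarrow> complex) \<Rightarrow> (real \<Rightarrow> complex) \<Rightarrow> bool" where
  "has_weak_deriv \<Omega> f g \<longleftrightarrow> locally_integrable \<Omega> f \<and> locally_integrable \<Omega> g \<and>
     (\<forall>\<eta>\<in>test_funs \<Omega>. (LINT x|lebesgue_on \<Omega>. f x * of_real (deriv \<eta> x))
                    = - (LINT x|lebesgue_on \<Omega>. g x * of_real (\<eta> x)))"

text \<open>A representative of the weak derivative, which is unique up to null sets;
  unspecified if there is no weak derivative.\<close>

definition wderiv :: "real set \<Rightarrow> (real \<Rightarrow> complex) \<Rightarrow> real \<Rightarrow> complex" where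
  "wderiv \<Omega> f = (SOME g. has_weak_deriv \<Omega> f g)"

definition H1 :: "real set \<Rightarrow> (real \<Rightarrow> complex) set" where
  "H1 \<Omega> = {f \<in> L2 \<Omega>. \<exists>g\<in>L2 \<Omega>. has_weak_deriv \<Omega> f g}"

definition H2 :: "real set \<Rightarrow> (real \<Rightarrow> complex) set" where
  "H2 \<Omega> = {f \<in> L2 \<Omega>. \<exists>g\<in>H1 \<Omega>. has_weak_deriv \<Omega> f g}"

definition H1_norm :: "(real \<Rightarrow> complex) \<Rightarrow> real" where
  "H1_norm f = sqrt ((L2_norm f)\<^sup>2 + (L2_norm (wderiv UNIV f))\<^sup>2)"

text \<open>The continuous representative (unique on an open \<open>\<Omega>\<close>). Point values and one-sided
  limits of Sobolev functions always refer to it.\<close>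

definition cont_rep :: "real set \<Rightarrow> (real \<Rightarrow> complex) \<Rightarrow> real \<Rightarrow> complex" where
  "cont_rep \<Omega> f = (SOME g. continuous_on \<Omega> g \<and> (AE x in lebesgue_on \<Omega>. g x = f x))"

definition deriv_right0 :: "(real \<Rightarrow> complex) \<Rightarrow> complex" where
  "deriv_right0 f = Lim (at_right 0) (cont_rep {0<..} (wderiv {0<..} f))"

definition deriv_left0 :: "(real \<Rightarrow> complex) \<Rightarrow> complex" where
  "deriv_left0 f = Lim (at_left 0) (cont_rep {..<0} (wderiv {..<0} f))"


subsection \<open>The dual space of \<open>H\<^sup>1\<close>\<close>

text \<open>\<open>H\<^sup>-\<^sup>1\<close> consists of the bounded linear functionals on \<open>H\<^sup>1\<close>; the pairing
  \<open>\<langle>F, g\<rangle> = F g\<close> is bilinear, in accordance with \<open>\<langle>\<delta>\<^sub>0 f, g\<rangle> = f(0) g(0)\<close>.\<close>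

definition Hm1 :: "((real \<Rightarrow> complex) \<Rightarrow> complex) set" where
  "Hm1 = {F. (\<forall>g\<in>H1 UNIV. \<forall>h\<in>H1 UNIV. F (\<lambda>x. g x + h x) = F g + F h) \<and>
             (\<forall>c. \<forall>g\<in>H1 UNIV. F (\<lambda>x. c * g x) = c * F g) \<and>
             (\<exists>C. \<forall>g\<in>H1 UNIV. cmod (F g) \<le> C * H1_norm g)}"

definition Hm1_norm :: "((real \<Rightarrow> complex) \<Rightarrow> complex) \<Rightarrow> real" where
  "Hm1_norm F = (SUP g\<in>{g \<in> H1 UNIV. H1_norm g \<le> 1}. cmod (F g))"

definition bounded_operator_H1_Hm1 ::
  "((real \<Rightarrow> complex) \<Rightarrow> (real \<Rightarrow> complex) \<Rightarrow> complex) \<Rightarrow> bool" where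
  "bounded_operator_H1_Hm1 T \<longleftrightarrow>
     (\<forall>f\<in>H1 UNIV. T f \<in> Hm1) \<and>
     (\<forall>f\<in>H1 UNIV. \<forall>h\<in>H1 UNIV. \<forall>g\<in>H1 UNIV. T (\<lambda>x. f x + h x) g = T f g + T h g) \<and>
     (\<forall>c. \<forall>f\<in>H1 UNIV. \<forall>g\<in>H1 UNIV. T (\<lambda>x. c * f x) g = c * T f g) \<and>
     (\<exists>C. \<forall>f\<in>H1 UNIV. Hm1_norm (T f) \<le> C * H1_norm f)"

definition delta0 :: "(real \<Rightarrow> complex) \<Rightarrow> (real \<Rightarrow> complex) \<Rightarrow> complex" where
  "delta0 f g = cont_rep UNIV f 0 * cont_rep UNIV g 0"

definition mult_op :: "(real \<Rightarrow> real) \<Rightarrow> (real \<Rightarrow> complex) \<Rightarrow> (real \<Rightarrow> complex) \<Rightarrow> complex" where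
  "mult_op W f g = (LINT y|lebesgue. of_real (W y) * f y * g y)"


subsection \<open>Unbounded operators in \<open>L\<^sup>2\<close>\<close>

text \<open>An operator is given by its domain \<open>D\<close> and its action \<open>T\<close>. As the functions represent
  classes, the domain has to be closed under, and the action compatible with, \<^const>\<open>eq_ae\<close>.\<close>

definition L2_operator ::
  "(real \<Rightarrow> complex) set \<Rightarrow> ((real \<Rightarrow> complex) \<Rightarrow> (real \<Rightarrow> complex)) \<Rightarrow> bool" where
  "L2_operator D T \<longleftrightarrow>
     D \<subseteq> L2 UNIV \<and> T ` D \<subseteq> L2 UNIV \<and>
     (\<lambda>x. 0) \<in> D \<and>
     (\<forall>\<phi>\<in>D. \<forall>\<psi>\<in>D. (\<lambda>x. \<phi> x + \<psi> x) \<in> D \<and>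
        eq_ae (T (\<lambda>x. \<phi> x + \<psi> x)) (\<lambda>x. T \<phi> x + T \<psi> x)) \<and>
     (\<forall>c. \<forall>\<phi>\<in>D. (\<lambda>x. c * \<phi> x) \<in> D \<and> eq_ae (T (\<lambda>x. c * \<phi> x)) (\<lambda>x. c * T \<phi> x)) \<and>
     (\<forall>\<phi>\<in>D. \<forall>\<psi>. eq_ae \<psi> \<phi> \<longrightarrow> \<psi> \<in> D \<and> eq_ae (T \<psi>) (T \<phi>))"

definition densely_defined :: "(real \<Rightarrow> complex) set \<Rightarrow> bool" where
  "densely_defined D \<longleftrightarrow> (\<forall>f\<in>L2 UNIV. \<forall>e>0. \<exists>\<phi>\<in>D. L2_norm (\<lambda>x. f x - \<phi> x) < e)"

definition op_graph ::
  "(real \<Rightarrow> complex) set \<Rightarrow> ((real \<Rightarrow> complex) \<Rightarrow> (real \<Rightarrow> complex)) \<Rightarrow>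
   ((real \<Rightarrow> complex) \<times> (real \<Rightarrow> complex)) set" where
  "op_graph D T = {(\<phi>, f). \<phi> \<in> D \<and> f \<in> L2 UNIV \<and> eq_ae (T \<phi>) f}"

definition adjoint_graph ::
  "((real \<Rightarrow> complex) \<times> (real \<Rightarrow> complex)) set \<Rightarrow> ((real \<Rightarrow> complex) \<times> (real \<Rightarrow> complex)) set" where
  "adjoint_graph G = {(\<psi>, h). \<psi> \<in> L2 UNIV \<and> h \<in> L2 UNIV \<and>
                        (\<forall>(\<phi>, f)\<in>G. L2_inner f \<psi> = L2_inner \<phi> h)}"

definition self_adjoint ::
  "(real \<Rightarrow> complex) set \<Rightarrow> ((real \<Rightarrow> complex) \<Rightarrow> (real \<Rightarrow> complex)) \<Rightarrow> bool" where
  "self_adjoint D T \<longleftrightarrow> L2_operator D T \<and> densely_defined D \<and>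
     adjoint_graph (op_graph D T) = op_graph D T"

definition resolvent_set ::
  "(real \<Rightarrow> complex) set \<Rightarrow> ((real \<Rightarrow> complex) \<Rightarrow> (real \<Rightarrow> complex)) \<Rightarrow> complex set" where
  "resolvent_set D T = {z.
     (\<forall>f\<in>L2 UNIV. \<exists>\<phi>\<in>D. eq_ae (\<lambda>x. T \<phi> x - z * \<phi> x) f) \<and>
     (\<forall>\<phi>\<in>D. eq_ae (\<lambda>x. T \<phi> x - z * \<phi> x) (\<lambda>x. 0) \<longrightarrow> eq_ae \<phi> (\<lambda>x. 0)) \<and>
     (\<exists>C. \<forall>\<phi>\<in>D. L2_norm \<phi> \<le> C * L2_norm (\<lambda>x. T \<phi> x - z * \<phi> x))}"

definition spectrum ::
  "(real \<Rightarrow> complex) set \<Rightarrow> ((real \<Rightarrow> complex) \<Rightarrow> (real \<Rightarrow> complex)) \<Rightarrow> complex set" where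
  "spectrum D T = - resolvent_set D T"

text \<open>\<open>ker_pow D T z n\<close> is the kernel of \<open>(T - z)\<^sup>n\<close> with its natural domain.\<close>

fun ker_pow ::
  "(real \<Rightarrow> complex) set \<Rightarrow> ((real \<Rightarrow> complex) \<Rightarrow> (real \<Rightarrow> complex)) \<Rightarrow> complex \<Rightarrow> nat \<Rightarrow>
   (real \<Rightarrow> complex) set" where
  "ker_pow D T z 0 = {\<phi>. eq_ae \<phi> (\<lambda>x. 0)}"
| "ker_pow D T z (Suc n) = {\<phi> \<in> D. (\<lambda>x. T \<phi> x - z * \<phi> x) \<in> ker_pow D T z n}"

definition op_kernel ::
  "(real \<Rightarrow> complex) set \<Rightarrow> ((real \<Rightarrow> complex) \<Rightarrow> (real \<Rightarrow> complex)) \<Rightarrow> (real \<Rightarrow> complex) set" where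
  "op_kernel D T = {\<phi> \<in> D. eq_ae (T \<phi>) (\<lambda>x. 0)}"

definition eigenvalue ::
  "(real \<Rightarrow> complex) set \<Rightarrow> ((real \<Rightarrow> complex) \<Rightarrow> (real \<Rightarrow> complex)) \<Rightarrow> complex \<Rightarrow> bool" where
  "eigenvalue D T z \<longleftrightarrow> (\<exists>\<phi>\<in>D. \<not> eq_ae \<phi> (\<lambda>x. 0) \<and> eq_ae (T \<phi>) (\<lambda>x. z * \<phi> x))"

text \<open>\<open>N\<close> is assumed to be a linear subspace in the next definition.\<close>

definition spans :: "(real \<Rightarrow> complex) \<Rightarrow> (real \<Rightarrow> complex) set \<Rightarrow> bool" where
  "spans \<phi> N \<longleftrightarrow> \<phi> \<in> N \<and> (\<forall>\<psi>\<in>N. \<exists>c. eq_ae \<psi> (\<lambda>x. c * \<phi> x))"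

text \<open>Simple means algebraically simple: the generalized eigenspace is one-dimensional.\<close>

definition isolated_simple_eigenvalue ::
  "(real \<Rightarrow> complex) set \<Rightarrow> ((real \<Rightarrow> complex) \<Rightarrow> (real \<Rightarrow> complex)) \<Rightarrow> complex \<Rightarrow> bool" where
  "isolated_simple_eigenvalue D T z \<longleftrightarrow>
     eigenvalue D T z \<and> z isolated_in spectrum D T \<and>
     (\<exists>\<phi>. \<not> eq_ae \<phi> (\<lambda>x. 0) \<and> spans \<phi> (\<Union>n. ker_pow D T z n))"


subsection \<open>The potentials and the operators\<close>

definition V0 :: "real \<Rightarrow> real \<Rightarrow> real" where
  "V0 b y = indicator {y. \<bar>y\<bar> \<ge> b} y"

definition V1 :: "real \<Rightarrow> real \<Rightarrow> real \<Rightarrow> (real \<Rightarrow> complex) \<Rightarrow> (real \<Rightarrow> complex) \<Rightarrow> complex" where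
  "V1 b \<beta> \<alpha> f g = mult_op (\<lambda>y. \<beta> * indicator {y. \<bar>y\<bar> < b} y) f g + of_real \<alpha> * delta0 f g"

definition L_dom :: "real \<Rightarrow> nat \<Rightarrow> (real \<Rightarrow> complex) set" where
  "L_dom \<alpha> k = {\<phi> \<in> H1 UNIV. \<phi> \<in> H2 {..<0} \<inter> H2 {0<..} \<and>
     deriv_right0 \<phi> - deriv_left0 \<phi> = - of_real ((real k)\<^sup>2 * \<alpha>) * cont_rep UNIV \<phi> 0}"

text \<open>The second derivative is the weak one on \<open>\<real> \<setminus> {0}\<close>; the delta
  part of the potential is encoded in the jump condition of \<open>L_dom\<close>.\<close>

definition L_op ::
  "real \<Rightarrow> real \<Rightarrow> nat \<Rightarrow> real \<Rightarrow> (real \<Rightarrow> complex) \<Rightarrow> real \<Rightarrow> complex" where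
  "L_op b \<beta> k lam \<phi> y = - wderiv (- {0}) (wderiv (- {0}) \<phi>) y
     + of_real ((real k)\<^sup>2 * (1 - lam * V0 b y - \<beta> * indicator {y. \<bar>y\<bar> < b} y)) * \<phi> y"

end

theory Submission
  imports Defs
begin

text \<open>
  An \<open>H\<^sup>1\<close> function is replaced by its continuous representative, and a function in the domain of
  \<open>L\<close> by its representative together with the one-sided primitives of its second derivative. Green's
  formula then turns the operator into its quadratic form.

  Self-adjointness follows from the solvability of \<open>-\<phi>'' + \<mu> \<phi> = f\<close> with the jump condition (Riesz'
  theorem for a coercive form on \<open>H\<^sup>1\<close>), since the rest of the operator is a bounded multiplication.
  For a self-adjoint operator a lower bound on \<open>T - z\<close> and \<open>T - cnj z\<close> puts \<open>z\<close> into the resolvent set.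

  The delta part makes the form indefinite, but only through \<open>\<phi>(0)\<close>. Testing \<open>L \<phi> = f\<close> with the
  explicit decaying even solution \<open>\<psi>\<close> of the equation off the origin, \<open>\<psi>(0) = 1\<close>, gives
  \<open>(2 \<kappa> - k\<^sup>2 \<alpha>) \<phi>(0) = \<langle>f, \<psi>\<rangle>\<close>, where \<open>-2 \<kappa>\<close> is the jump of \<open>\<psi>'\<close>; this bounds \<open>\<phi>(0)\<close>
  unless \<open>k\<^sup>2 \<alpha> = 2 \<kappa>\<close>, and the energy identity bounds the rest. When \<open>k\<^sup>2 \<alpha> = 2 \<kappa>\<close>, \<open>\<psi>\<close> spans the kernel,
  and the energy identity for \<open>\<phi> - \<phi>(0) \<psi>\<close> gives the spectral gap.
\<close>

section \<open>Semi-inner product spaces and the Riesz representation theorem\<close>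

text \<open>Elements are functions and not classes, so the forms are only positive semidefinite. A
  Riesz theorem without uniqueness is used three times: in the L2-closure of a domain (density), in
  a domain with the form <(T - cnj z) \<phi>, (T - cnj z) \<psi>> (solvability), and in H1 with the
  shifted delta form. The obstacle in (c) and (d) is uniformity in k: one interval of \<lambda> must
  serve infinitely many operators. For \<lambda> < 1, zero is in the spectrum exactly at a resonance
  k^2 \<alpha> = 2 \<kappa>(k, \<lambda>), and the formula for \<alpha> says that
  (\<open>ks\<close>, \<open>lams\<close>) is one. For fixed \<lambda> the quotient \<kappa> / k^2
  is strictly decreasing in k, and for fixed k the map \<lambda> -> \<kappa> is injective, so no
  other resonance shares a coordinate with this one. As \<kappa> grows at most linearly in k, 2
  \<kappa> is at most k^2 \<alpha> / 2 for all large k, locally uniformly in \<lambda>; for the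
  finitely many other k, continuity in \<lambda> shrinks the interval. The same gap keeps the
  constants in (d) independent of k.\<close>

locale semi_inner_space =
  fixes V :: "('a \<Rightarrow> complex) set" and ip :: "('a \<Rightarrow> complex) \<Rightarrow> ('a \<Rightarrow> complex) \<Rightarrow> complex"
  assumes zero_mem: "(\<lambda>x. 0) \<in> V"
    and add_mem: "\<And>f g. f \<in> V \<Longrightarrow> g \<in> V \<Longrightarrow> (\<lambda>x. f x + g x) \<in> V"
    and scale_mem: "\<And>c f. f \<in> V \<Longrightarrow> (\<lambda>x. c * f x) \<in> V"
    and ip_add_left: "\<And>f g h. f \<in> V \<Longrightarrow> g \<in> V \<Longrightarrow> h \<in> V \<Longrightarrow> ip (\<lambda>x. f x + g x) h = ip f h + ip g h"
    and ip_scale_left: "\<And>c f h. f \<in> V \<Longrightarrow> h \<in> V \<Longrightarrow> ip (\<lambda>x. c * f x) h = c * ip f h"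
    and ip_commute: "\<And>f g. f \<in> V \<Longrightarrow> g \<in> V \<Longrightarrow> ip g f = cnj (ip f g)"
    and ip_nonneg: "\<And>f. f \<in> V \<Longrightarrow> Re (ip f f) \<ge> 0"
begin

definition nsq :: "('a \<Rightarrow> complex) \<Rightarrow> real" where "nsq f = Re (ip f f)"

definition complete :: bool where
  "complete \<longleftrightarrow> (\<forall>X::nat \<Rightarrow> 'a \<Rightarrow> complex. (\<forall>n. X n \<in> V) \<and>
     (\<forall>e>0. \<exists>N. \<forall>m\<ge>N. \<forall>n\<ge>N. nsq (\<lambda>x. X m x - X n x) < e) \<longrightarrow>
     (\<exists>v\<in>V. (\<lambda>n. nsq (\<lambda>x. X n x - v x)) \<longlonglongrightarrow> 0))"

lemma diff_mem: "f \<in> V \<Longrightarrow> g \<in> V \<Longrightarrow> (\<lambda>x. f x - g x) \<in> V"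
  using add_mem[OF _ scale_mem[of g "-1"], of f] by simp

lemma ip_add_right: "f \<in> V \<Longrightarrow> g \<in> V \<Longrightarrow> h \<in> V \<Longrightarrow> ip h (\<lambda>x. f x + g x) = ip h f + ip h g"
  using ip_commute[of "\<lambda>x. f x + g x" h] by (simp add: add_mem ip_add_left ip_commute[of h])

lemma ip_scale_right: "f \<in> V \<Longrightarrow> h \<in> V \<Longrightarrow> ip h (\<lambda>x. c * f x) = cnj c * ip h f"
  using ip_commute[of "\<lambda>x. c * f x" h] by (simp add: scale_mem ip_scale_left ip_commute[of h])

lemma ip_diff_left:
  assumes "f \<in> V" "g \<in> V" "h \<in> V" shows "ip (\<lambda>x. f x - g x) h = ip f h - ip g h"
  using assms ip_add_left[OF _ scale_mem[of g "-1"], of f h] ip_scale_left[of g h "-1"] by simp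

lemma ip_diff_right:
  assumes "f \<in> V" "g \<in> V" "h \<in> V" shows "ip h (\<lambda>x. f x - g x) = ip h f - ip h g"
  using assms ip_add_right[OF _ scale_mem[of g "-1"], of f h] ip_scale_right[of g h "-1"] by simp

lemma nsq_nonneg: "f \<in> V \<Longrightarrow> nsq f \<ge> 0"
  by (simp add: nsq_def ip_nonneg)

lemma ip_self: "f \<in> V \<Longrightarrow> ip f f = of_real (nsq f)"
  using ip_commute[of f f] unfolding nsq_def
  by (metis Reals_cnj_iff of_real_Re)

lemma nsq_add_scale:
  assumes "f \<in> V" "g \<in> V"
  shows "nsq (\<lambda>x. f x + c * g x) = nsq f + 2 * Re (cnj c * ip f g) + (cmod c)\<^sup>2 * nsq g"
proof -
  have "ip (\<lambda>x. f x + c * g x) (\<lambda>x. f x + c * g x) =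
      ip f f + cnj c * ip f g + (c * cnj (ip f g) + c * cnj c * ip g g)"
    using assms by (simp add: ip_add_left ip_add_right ip_scale_left ip_scale_right add_mem scale_mem
        ip_commute[of f g] algebra_simps)
  also have "Re \<dots> = nsq f + 2 * Re (cnj c * ip f g) + (cmod c)\<^sup>2 * nsq g"
    using assms by (simp add: ip_self complex_norm_square[symmetric] flip: of_real_mult)
  finally show ?thesis by (simp add: nsq_def)
qed

lemma nsq_add: "f \<in> V \<Longrightarrow> g \<in> V \<Longrightarrow> nsq (\<lambda>x. f x + g x) = nsq f + 2 * Re (ip f g) + nsq g"
  using nsq_add_scale[of f g 1] by simp

lemma nsq_diff: "f \<in> V \<Longrightarrow> g \<in> V \<Longrightarrow> nsq (\<lambda>x. f x - g x) = nsq f - 2 * Re (ip f g) + nsq g"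
  using nsq_add_scale[of f g "-1"] by simp

lemma nsq_scale: "f \<in> V \<Longrightarrow> nsq (\<lambda>x. c * f x) = (cmod c)\<^sup>2 * nsq f"
  unfolding nsq_def 
  by (simp add: ip_scale_left ip_scale_right scale_mem ip_self flip: mult.assoc complex_norm_square of_real_mult)

text \<open>The form is nonnegative on f + c g. Taking c = - s \<open>ip f g\<close> with s real
  makes the cross term real and leaves an inequality quadratic in s. The best s is 1 /
  \<open>nsq g\<close>; if \<open>nsq g\<close> vanishes, which can happen for g nonzero, a large s
  forces \<open>ip f g\<close> = 0.\<close>

lemma Cauchy_Schwarz_sq:
  assumes "f \<in> V" "g \<in> V" shows "(cmod (ip f g))\<^sup>2 \<le> nsq f * nsq g"
proof -
  let ?z = "ip f g"
  have q: "2 * s * (cmod ?z)\<^sup>2 \<le> nsq f + s\<^sup>2 * (cmod ?z)\<^sup>2 * nsq g" for s :: real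
  proof -
    have "0 \<le> nsq (\<lambda>x. f x + (- of_real s * ?z) * g x)"
      using assms by (intro nsq_nonneg add_mem scale_mem)
    also have "\<dots> = nsq f - 2 * s * (cmod ?z)\<^sup>2 + s\<^sup>2 * (cmod ?z)\<^sup>2 * nsq g"
    proof -
      have "cnj (- of_real s * ?z) * ?z = of_real (- s * (cmod ?z)\<^sup>2)"
        by (simp only: of_real_mult complex_norm_square) simp
      then have "Re (cnj (- of_real s * ?z) * ?z) = - s * (cmod ?z)\<^sup>2"
        by (simp only: Re_complex_of_real)
      then show ?thesis
        using assms by (simp only: nsq_add_scale) (simp add: norm_mult power_mult_distrib)
    qed
    finally show ?thesis by simp
  qed
  show ?thesis
  proof (cases "nsq g = 0")
    case True
    have "(cmod ?z)\<^sup>2 = 0"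
    proof (rule ccontr)
      assume nz: "(cmod ?z)\<^sup>2 \<noteq> 0"
      have "2 * ((nsq f + 1) / (cmod ?z)\<^sup>2) * (cmod ?z)\<^sup>2 \<le> nsq f"
        using q[of "(nsq f + 1) / (cmod ?z)\<^sup>2"] True by simp
      then have "2 * (nsq f + 1) \<le> nsq f" using nz by simp
      then show False using nsq_nonneg[OF assms(1)] by simp
    qed
    then show ?thesis using True by simp
  next
    case False
    then have pos: "nsq g > 0" using nsq_nonneg[OF assms(2)] by linarith
    show ?thesis using q[of "1 / nsq g"] pos by (simp add: field_simps power2_eq_square)
  qed
qed

lemma Cauchy_Schwarz:
  assumes "f \<in> V" "g \<in> V" shows "cmod (ip f g) \<le> sqrt (nsq f) * sqrt (nsq g)"
  using Cauchy_Schwarz_sq[OF assms] by (simp add: real_le_rsqrt real_sqrt_mult[symmetric])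

lemma norm_triangle:
  assumes "f \<in> V" "g \<in> V" shows "sqrt (nsq (\<lambda>x. f x + g x)) \<le> sqrt (nsq f) + sqrt (nsq g)"
proof (rule real_le_lsqrt)
  have "Re (ip f g) \<le> sqrt (nsq f) * sqrt (nsq g)"
    using Cauchy_Schwarz[OF assms] complex_Re_le_cmod order_trans by blast
  then show "nsq (\<lambda>x. f x + g x) \<le> (sqrt (nsq f) + sqrt (nsq g))\<^sup>2"
    using assms by (simp add: nsq_add power2_sum nsq_nonneg)
qed (use assms in \<open>auto simp: nsq_nonneg\<close>)

lemma parallelogram:
  assumes "f \<in> V" "g \<in> V"
  shows "nsq (\<lambda>x. f x - g x) = 2 * nsq f + 2 * nsq g - 4 * nsq (\<lambda>x. (1/2) * (f x + g x))"
  using assms by (simp only: nsq_scale[OF add_mem[OF assms]])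
    (simp add: nsq_add nsq_diff power2_eq_square field_simps)

text \<open>Direct method: J f = \<open>nsq f\<close> - 2 Re (l f) is minimised, instead of
  projecting onto the kernel of l. By the parallelogram law minimising sequences are Cauchy, and the
  Euler equation of a minimiser is the representation. Only existence is claimed, since v is
  determined only up to null vectors.\<close>

theorem Riesz_representation:
  assumes "complete"
    and add: "\<And>f g. f \<in> V \<Longrightarrow> g \<in> V \<Longrightarrow> l (\<lambda>x. f x + g x) = l f + l g"
    and scale: "\<And>c f. f \<in> V \<Longrightarrow> l (\<lambda>x. c * f x) = c * l f"
    and bound: "\<And>f. f \<in> V \<Longrightarrow> cmod (l f) \<le> C * sqrt (nsq f)"
  shows "\<exists>v\<in>V. \<forall>f\<in>V. l f = ip f v"
proof -
  define J where "J f = nsq f - 2 * Re (l f)" for f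
  \<comment> \<open>Completing the square: J f >= (sqrt (nsq f) - C)^2 - C^2.\<close>
  have lower: "J f \<ge> - C\<^sup>2" if "f \<in> V" for f
  proof -
    have "Re (l f) \<le> C * sqrt (nsq f)"
      using bound[OF that] complex_Re_le_cmod order_trans by blast
    then have "J f \<ge> (sqrt (nsq f))\<^sup>2 - 2 * (C * sqrt (nsq f))"
      by (simp add: J_def nsq_nonneg[OF that])
    moreover have "(sqrt (nsq f) - C)\<^sup>2 \<ge> 0" by simp
    ultimately show ?thesis by (simp add: power2_diff algebra_simps)
  qed
  define d where "d = (INF f\<in>V. J f)"
  have bdd: "bdd_below (J ` V)" using lower by (auto simp: bdd_below_def)
  have d_le: "d \<le> J f" if "f \<in> V" for f
    unfolding d_def using bdd that by (intro cINF_lower)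
  have "\<exists>f\<in>V. J f < d + 1 / real (Suc n)" for n
    using cINF_less_iff[of V J "d + 1 / real (Suc n)"] bdd zero_mem unfolding d_def by force
  then obtain X where X: "\<And>n. X n \<in> V" "\<And>n. J (X n) < d + 1 / real (Suc n)" by metis
  \<comment> \<open>In the parallelogram law the values of l cancel, because l is linear and the
    third vector is the midpoint \<open>h\<close>. With J h >= d the distance is bounded by twice
    the two excesses over d.\<close>
  have close: "nsq (\<lambda>x. X m x - X n x) < 2 / real (Suc m) + 2 / real (Suc n)" for m n
  proof -
    define h where "h = (\<lambda>x. (1/2) * (X m x + X n x))"
    have mid: "h \<in> V" unfolding h_def using X by (intro scale_mem add_mem)
    have "l h = (1/2) * (l (X m) + l (X n))"
      unfolding h_def using X scale[OF add_mem, of "X m" "X n" "1/2"] add by simp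
    then have "l h = of_real (1/2) * (l (X m) + l (X n))" by simp
    then have "Re (l h) = (1/2) * (Re (l (X m)) + Re (l (X n)))"
      by (simp only: times_complex.sel plus_complex.sel Re_complex_of_real Im_complex_of_real)
    then have "nsq (\<lambda>x. X m x - X n x) = 2 * J (X m) + 2 * J (X n) - 4 * J h"
      unfolding parallelogram[OF X(1) X(1)] J_def h_def[symmetric] by (simp add: algebra_simps)
    then show ?thesis using X(2)[of m] X(2)[of n] d_le[OF mid] by simp
  qed
  have "\<exists>N. \<forall>m\<ge>N. \<forall>n\<ge>N. nsq (\<lambda>x. X m x - X n x) < e" if "e > 0" for e
  proof -
    obtain N where N: "1 / real (Suc N) < e / 4"
      using nat_approx_posE[of "e/4"] \<open>e > 0\<close> by auto
    have le: "2 / real (Suc m) \<le> 2 / real (Suc N)" if "m \<ge> N" for m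
      using that by (intro divide_left_mono) auto
    have "2 / real (Suc N) < e / 2" using N by (simp add: field_simps)
    then have "nsq (\<lambda>x. X m x - X n x) < e" if "m \<ge> N" "n \<ge> N" for m n
      using close[of m n] le[OF that(1)] le[OF that(2)] by linarith
    then show ?thesis by blast
  qed
  then obtain v where v: "v \<in> V" "(\<lambda>n. nsq (\<lambda>x. X n x - v x)) \<longlonglongrightarrow> 0"
    using assms(1) X(1) unfolding complete_def by blast
  define E where "E n = (\<lambda>x. X n x - v x)" for n
  have E: "E n \<in> V" for n unfolding E_def using X v by (intro diff_mem)
  have nE: "(\<lambda>n. sqrt (nsq (E n))) \<longlonglongrightarrow> 0"
    using tendsto_real_sqrt[OF v(2)] by (simp add: E_def)
  \<comment> \<open>J is expanded at X n = v + E n and the seminorm of E n tends to 0; this takes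
    the place of continuity of J.\<close>
  have "J v \<le> d"
  proof (rule LIMSEQ_le_const)
    show "(\<lambda>n. d + 1 / real (Suc n) + 2 * sqrt (nsq v) * sqrt (nsq (E n)) + 2 * C * sqrt (nsq (E n))) \<longlonglongrightarrow> d"
    proof -
      have "(\<lambda>n. d + 1 / real (Suc n) + 2 * sqrt (nsq v) * sqrt (nsq (E n)) + 2 * C * sqrt (nsq (E n)))
        \<longlonglongrightarrow> d + 0 + 2 * sqrt (nsq v) * 0 + 2 * C * 0"
        by (intro tendsto_add tendsto_mult tendsto_const nE)
          (use LIMSEQ_inverse_real_of_nat in \<open>simp add: inverse_eq_divide\<close>)
      then show ?thesis by simp
    qed
    have "J v \<le> d + 1 / real (Suc n) + 2 * sqrt (nsq v) * sqrt (nsq (E n)) + 2 * C * sqrt (nsq (E n))" for n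
    proof -
      have Xn: "X n = (\<lambda>x. v x + E n x)" by (simp add: E_def)
      have "J (X n) = J v + 2 * Re (ip v (E n)) + nsq (E n) - 2 * Re (l (E n))"
        unfolding Xn J_def using v(1) E by (simp add: nsq_add add)
      moreover have "\<bar>Re (ip v (E n))\<bar> \<le> sqrt (nsq v) * sqrt (nsq (E n))"
        using Cauchy_Schwarz[OF v(1) E] abs_Re_le_cmod order_trans by blast
      moreover have "\<bar>Re (l (E n))\<bar> \<le> C * sqrt (nsq (E n))"
        using bound[OF E] abs_Re_le_cmod order_trans by blast
      ultimately show ?thesis using X(2)[of n] nsq_nonneg[OF E, of n] by linarith
    qed
    then show "\<exists>N. \<forall>n\<ge>N. J v \<le> d + 1 / real (Suc n) + 2 * sqrt (nsq v) * sqrt (nsq (E n)) + 2 * C * sqrt (nsq (E n))"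
      by blast
  qed
  have "l f = ip f v" if f: "f \<in> V" for f
  proof -
    define z where "z = ip v f - cnj (l f)"
    have arith: "0 \<le> 2 * (p - r) + q" if "t \<le> t + 2 * p + q - 2 * r" for p q r t :: real
      using that by simp
    \<comment> \<open>\<open>z\<close> is the defect of the Euler equation. Moving v by - s z f
      changes J to first order by - 2 s |z|^2, which minimality must compensate by the quadratic
      term.\<close>
    have *: "2 * s * (cmod z)\<^sup>2 \<le> s\<^sup>2 * (cmod z)\<^sup>2 * nsq f" for s :: real
    proof -
      let ?c = "- of_real s * z"
      have "J v \<le> J (\<lambda>x. v x + ?c * f x)"
        using \<open>J v \<le> d\<close> d_le[OF add_mem[OF v(1) scale_mem[OF f]], of ?c] by linarith
      also have "\<dots> = J v + 2 * Re (cnj ?c * ip v f) + (cmod ?c)\<^sup>2 * nsq f - 2 * Re (?c * l f)"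
        unfolding J_def using v(1) f by (simp only: nsq_add_scale add scale scale_mem) simp
      also have "Re (?c * l f) = Re (cnj ?c * cnj (l f))"
        by simp
      finally have "0 \<le> 2 * (Re (cnj ?c * ip v f) - Re (cnj ?c * cnj (l f))) + (cmod ?c)\<^sup>2 * nsq f"
        by (rule arith)
      also have "Re (cnj ?c * ip v f) - Re (cnj ?c * cnj (l f)) = Re (cnj ?c * z)"
        unfolding z_def by (simp only: right_diff_distrib minus_complex.sel)
      also have "cnj ?c * z = of_real (- s * (cmod z)\<^sup>2)"
        by (simp only: of_real_mult complex_norm_square) simp
      also have "Re \<dots> = - s * (cmod z)\<^sup>2" by (rule Re_complex_of_real)
      also have "(cmod ?c)\<^sup>2 = s\<^sup>2 * (cmod z)\<^sup>2"
        by (simp add: norm_mult power_mult_distrib)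
      finally show ?thesis by simp
    qed
    have "(cmod z)\<^sup>2 = 0"
    proof (rule ccontr)
      assume "(cmod z)\<^sup>2 \<noteq> 0"
      then have pos: "(cmod z)\<^sup>2 > 0" by simp
      have n0: "nsq f \<ge> 0" by (rule nsq_nonneg[OF f])
      \<comment> \<open>Small enough that the quadratic term stays below the first-order
        gain.\<close>
      define s where "s = 1 / (nsq f + 1)"
      have "s > 0" using n0 by (simp add: s_def)
      have "2 * s \<le> s\<^sup>2 * nsq f"
        using *[of s] pos by (simp add: mult.assoc mult.left_commute[of _ "(cmod z)\<^sup>2"])
      then have "2 \<le> s * nsq f" using \<open>s > 0\<close> by (simp add: power2_eq_square)
      moreover have "s * nsq f \<le> 1" using n0 by (simp add: s_def)
      ultimately show False by linarith
    qed
    then have "ip v f = cnj (l f)" by (simp add: z_def)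
    then show ?thesis using ip_commute[OF v(1) f] by simp
  qed
  then show ?thesis using v(1) by blast
qed

end

section \<open>The space of square integrable functions\<close>

lemma L2_UNIV_iff:
  "f \<in> L2 UNIV \<longleftrightarrow> f \<in> borel_measurable lebesgue \<and> integrable lebesgue (\<lambda>x. (cmod (f x))\<^sup>2)"
  by (simp add: L2_def lebesgue_on_UNIV_eq)

lemma L2_UNIV_D:
  assumes "f \<in> L2 UNIV"
  shows "f \<in> borel_measurable lebesgue" "integrable lebesgue (\<lambda>x. (cmod (f x))\<^sup>2)"
  using assms by (auto simp: L2_UNIV_iff)

lemma L2_UNIV_bounded_by:
  assumes "f \<in> borel_measurable lebesgue" "integrable lebesgue g" "\<And>x. (cmod (f x))\<^sup>2 \<le> g x"
  shows "f \<in> L2 UNIV"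
proof -
  note [measurable] = assms(1)
  have "integrable lebesgue (\<lambda>x. (cmod (f x))\<^sup>2)"
    by (rule Bochner_Integration.integrable_bound[OF assms(2)]) (auto intro!: AE_I2 intro: order_trans[OF assms(3)])
  then show ?thesis using assms(1) by (simp add: L2_UNIV_iff)
qed

lemma borel_measurable_cnj [measurable (raw)]:
  "f \<in> borel_measurable M \<Longrightarrow> (\<lambda>x. cnj (f x)) \<in> borel_measurable M"
  by (rule borel_measurable_continuous_on[OF continuous_on_cnj[OF continuous_on_id]])

lemma L2_zero: "(\<lambda>x. 0) \<in> L2 UNIV"
  by (simp add: L2_UNIV_iff)

lemma L2_add:
  assumes "f \<in> L2 UNIV" "g \<in> L2 UNIV" shows "(\<lambda>x. f x + g x) \<in> L2 UNIV"
proof (rule L2_UNIV_bounded_by)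
  note [measurable] = L2_UNIV_D(1)[OF assms(1)] L2_UNIV_D(1)[OF assms(2)]
  show "(\<lambda>x. f x + g x) \<in> borel_measurable lebesgue" by measurable
  show "integrable lebesgue (\<lambda>x. 2 * (cmod (f x))\<^sup>2 + 2 * (cmod (g x))\<^sup>2)"
    using L2_UNIV_D(2)[OF assms(1)] L2_UNIV_D(2)[OF assms(2)] by simp
  show "(cmod (f x + g x))\<^sup>2 \<le> 2 * (cmod (f x))\<^sup>2 + 2 * (cmod (g x))\<^sup>2" for x
  proof -
    have "(cmod (f x + g x))\<^sup>2 \<le> (cmod (f x) + cmod (g x))\<^sup>2"
      by (intro power_mono norm_triangle_ineq) simp
    also have "\<dots> \<le> 2 * (cmod (f x))\<^sup>2 + 2 * (cmod (g x))\<^sup>2"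
      using sum_squares_bound[of "cmod (f x)" "cmod (g x)"] by (simp add: power2_sum)
    finally show ?thesis .
  qed
qed

lemma L2_mult_bounded:
  assumes "f \<in> L2 UNIV" "q \<in> borel_measurable lebesgue" "\<And>x. cmod (q x) \<le> B"
  shows "(\<lambda>x. q x * f x) \<in> L2 UNIV"
proof (rule L2_UNIV_bounded_by)
  note [measurable] = L2_UNIV_D(1)[OF assms(1)] assms(2)
  show "(\<lambda>x. q x * f x) \<in> borel_measurable lebesgue" by measurable
  show "integrable lebesgue (\<lambda>x. B\<^sup>2 * (cmod (f x))\<^sup>2)"
    using L2_UNIV_D(2)[OF assms(1)] by simp
  show "(cmod (q x * f x))\<^sup>2 \<le> B\<^sup>2 * (cmod (f x))\<^sup>2" for x
    using assms(3)[of x] by (simp add: norm_mult power_mult_distrib mult_right_mono power_mono)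
qed

lemma L2_scale: "f \<in> L2 UNIV \<Longrightarrow> (\<lambda>x. c * f x) \<in> L2 UNIV"
  by (rule L2_mult_bounded[where B = "cmod c"]) auto

lemma L2_diff: "f \<in> L2 UNIV \<Longrightarrow> g \<in> L2 UNIV \<Longrightarrow> (\<lambda>x. f x - g x) \<in> L2 UNIV"
  using L2_add[OF _ L2_scale[of g "-1"], of f] by simp

lemma L2_uminus: "f \<in> L2 UNIV \<Longrightarrow> (\<lambda>x. - f x) \<in> L2 UNIV"
  using L2_scale[of f "-1"] by simp

lemma L2_cnj: "f \<in> L2 UNIV \<Longrightarrow> (\<lambda>x. cnj (f x)) \<in> L2 UNIV"
  using borel_measurable_cnj[of f lebesgue] by (simp add: L2_UNIV_iff)

lemma L2_cong_ae:
  assumes "f \<in> L2 UNIV" "eq_ae f g" shows "g \<in> L2 UNIV"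
proof -
  have g: "g \<in> borel_measurable lebesgue"
    using borel_measurable_AE[OF _ assms(2)] L2_UNIV_D[OF assms(1)] by blast
  note [measurable] = g L2_UNIV_D(1)[OF assms(1)]
  have "integrable lebesgue (\<lambda>x. (cmod (g x))\<^sup>2)"
    by (rule integrable_cong_AE_imp[OF L2_UNIV_D(2)[OF assms(1)]]) (use assms(2) in auto)
  then show ?thesis using g by (simp add: L2_UNIV_iff)
qed

lemma L2_mult_integrable:
  assumes "f \<in> L2 UNIV" "g \<in> L2 UNIV"
  shows "integrable lebesgue (\<lambda>x. f x * g x)"
proof -
  note [measurable] = L2_UNIV_D(1)[OF assms(1)] L2_UNIV_D(1)[OF assms(2)]
  have "integrable lebesgue (\<lambda>x. (cmod (f x))\<^sup>2 + (cmod (g x))\<^sup>2)"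
    using L2_UNIV_D(2)[OF assms(1)] L2_UNIV_D(2)[OF assms(2)] by simp
  then show ?thesis
  proof (rule Bochner_Integration.integrable_bound)
    show "(\<lambda>x. f x * g x) \<in> borel_measurable lebesgue" by measurable
    have "cmod (f x) * cmod (g x) \<le> (cmod (f x))\<^sup>2 + (cmod (g x))\<^sup>2" for x
      using sum_squares_bound[of "cmod (f x)" "cmod (g x)"] 
        mult_nonneg_nonneg[OF norm_ge_zero norm_ge_zero, of "f x" "g x"] by linarith
    then show "AE x in lebesgue. norm (f x * g x) \<le> norm ((cmod (f x))\<^sup>2 + (cmod (g x))\<^sup>2)"
      by (simp add: norm_mult)
  qed
qed

lemma L2_inner_integrable:
  assumes "f \<in> L2 UNIV" "g \<in> L2 UNIV"
  shows "integrable lebesgue (\<lambda>x. f x * cnj (g x))"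
  by (rule L2_mult_integrable[OF assms(1) L2_cnj[OF assms(2)]])

lemma L2_inner_self: "L2_inner f f = of_real (LINT x|lebesgue. (cmod (f x))\<^sup>2)"
  unfolding L2_inner_def complex_norm_square[symmetric] by (rule integral_complex_of_real)

lemma L2_inner_cong:
  assumes "f \<in> L2 UNIV" "g \<in> L2 UNIV" "eq_ae f f'" "eq_ae g g'"
  shows "L2_inner f g = L2_inner f' g'"
proof -
  note [measurable] = L2_UNIV_D(1)[OF assms(1)] L2_UNIV_D(1)[OF assms(2)]
    L2_UNIV_D(1)[OF L2_cong_ae[OF assms(1,3)]] L2_UNIV_D(1)[OF L2_cong_ae[OF assms(2,4)]]
  show ?thesis unfolding L2_inner_def
    by (rule integral_cong_AE) (use assms(3,4) in auto)
qed

lemma L2_norm_cong: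
  assumes "f \<in> L2 UNIV" "eq_ae f f'"
  shows "L2_norm f = L2_norm f'"
proof -
  have "complex_of_real (LINT x|lebesgue. (cmod (f x))\<^sup>2) = of_real (LINT x|lebesgue. (cmod (f' x))\<^sup>2)"
    using L2_inner_cong[OF assms(1) assms(1) assms(2) assms(2)] by (simp only: L2_inner_self)
  then show ?thesis by (simp add: L2_norm_def)
qed

interpretation L2: semi_inner_space "L2 UNIV" L2_inner
proof
  fix f g h :: "real \<Rightarrow> complex" and c :: complex
  show "(\<lambda>x. 0) \<in> L2 UNIV" by (rule L2_zero)
  show "(\<lambda>x. f x + g x) \<in> L2 UNIV" if "f \<in> L2 UNIV" "g \<in> L2 UNIV" using that by (rule L2_add)
  show "(\<lambda>x. c * f x) \<in> L2 UNIV" if "f \<in> L2 UNIV" using that by (rule L2_scale)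
  show "L2_inner (\<lambda>x. f x + g x) h = L2_inner f h + L2_inner g h"
    if "f \<in> L2 UNIV" "g \<in> L2 UNIV" "h \<in> L2 UNIV"
    using that by (simp add: L2_inner_def distrib_right L2_inner_integrable)
  show "L2_inner (\<lambda>x. c * f x) h = c * L2_inner f h" if "f \<in> L2 UNIV" "h \<in> L2 UNIV"
    by (simp add: L2_inner_def mult.assoc)
  show "L2_inner g f = cnj (L2_inner f g)" if "f \<in> L2 UNIV" "g \<in> L2 UNIV"
  proof -
    have "(\<lambda>x. g x * cnj (f x)) = (\<lambda>x. cnj (f x * cnj (g x)))" by (simp add: fun_eq_iff)
    then have "L2_inner g f = (LINT x|lebesgue. cnj (f x * cnj (g x)))" 
      unfolding L2_inner_def by (rule arg_cong)
    also have "\<dots> = cnj (L2_inner f g)"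
      unfolding L2_inner_def by (rule Bochner_Integration.integral_cnj)
    finally show ?thesis .
  qed
  show "0 \<le> Re (L2_inner f f)" if "f \<in> L2 UNIV"
    by (simp add: L2_inner_self)
qed

lemma L2_nsq: "L2.nsq f = (L2_norm f)\<^sup>2"
  by (simp add: L2.nsq_def L2_inner_self L2_norm_def)

lemma L2_norm_nonneg: "L2_norm f \<ge> 0"
  by (simp add: L2_norm_def)

lemma L2_sqrt_nsq: "sqrt (L2.nsq f) = L2_norm f"
  by (simp add: L2_nsq L2_norm_nonneg)

lemma L2_inner_self_norm: "L2_inner f f = of_real ((L2_norm f)\<^sup>2)"
  by (simp add: L2_inner_self L2_norm_def)

lemma L2_norm_sq: "(L2_norm f)\<^sup>2 = (LINT x|lebesgue. (cmod (f x))\<^sup>2)"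
  by (simp add: L2_norm_def)

lemma L2_Cauchy_Schwarz:
  "f \<in> L2 UNIV \<Longrightarrow> g \<in> L2 UNIV \<Longrightarrow> cmod (L2_inner f g) \<le> L2_norm f * L2_norm g"
  using L2.Cauchy_Schwarz by (simp add: L2_sqrt_nsq)

lemma L2_norm_triangle:
  "f \<in> L2 UNIV \<Longrightarrow> g \<in> L2 UNIV \<Longrightarrow> L2_norm (\<lambda>x. f x + g x) \<le> L2_norm f + L2_norm g"
  using L2.norm_triangle by (simp add: L2_sqrt_nsq)

lemma L2_norm_scale: "f \<in> L2 UNIV \<Longrightarrow> L2_norm (\<lambda>x. c * f x) = cmod c * L2_norm f"
  using L2.nsq_scale[of f c] by (metis L2_sqrt_nsq real_sqrt_mult real_sqrt_abs abs_norm_cancel)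

lemma L2_norm_minus_commute: "L2_norm (\<lambda>x. f x - g x) = L2_norm (\<lambda>x. g x - f x)"
  by (simp add: L2_norm_def norm_minus_commute)

lemma L2_norm_eq_0_iff:
  assumes "f \<in> L2 UNIV" shows "L2_norm f = 0 \<longleftrightarrow> eq_ae f (\<lambda>x. 0)"
  using integral_nonneg_eq_0_iff_AE[OF L2_UNIV_D(2)[OF assms]] by (simp add: L2_norm_def)

lemma L2_eq_ae_iff:
  assumes "f \<in> L2 UNIV" "g \<in> L2 UNIV" 
  shows "L2_norm (\<lambda>x. f x - g x) = 0 \<longleftrightarrow> eq_ae f g"
  using L2_norm_eq_0_iff[OF L2_diff[OF assms]] by simp

lemma nn_integral_cmod_sq:
  "f \<in> L2 UNIV \<Longrightarrow> (\<integral>\<^sup>+x. ennreal ((cmod (f x))\<^sup>2) \<partial>lebesgue) = ennreal ((L2_norm f)\<^sup>2)"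
  by (subst nn_integral_eq_integral) (auto simp: L2_UNIV_D L2_norm_sq)

text \<open>Riesz-Fischer: a fast subsequence converges almost everywhere by telescoping, and
  Fatou's lemma in j, applied to X n - X (r j), carries the Cauchy estimate over to X n - v for the
  whole sequence.\<close>

theorem L2_complete: "L2.complete"
  unfolding L2.complete_def L2_nsq
proof (intro allI impI, elim conjE)
  fix X :: "nat \<Rightarrow> real \<Rightarrow> complex"
  assume "\<forall>n. X n \<in> L2 UNIV"
    and C: "\<forall>e>0. \<exists>N. \<forall>m\<ge>N. \<forall>n\<ge>N. (L2_norm (\<lambda>x. X m x - X n x))\<^sup>2 < e"
  then have X: "X n \<in> L2 UNIV" for n by blast
  have [measurable]: "X n \<in> borel_measurable lebesgue" for n using L2_UNIV_D(1)[OF X] .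
  have XX: "(\<lambda>x. X m x - X n x) \<in> L2 UNIV" for m n by (intro L2_diff X)
  obtain M where M: "\<And>k m n. m \<ge> M k \<Longrightarrow> n \<ge> M k \<Longrightarrow> (L2_norm (\<lambda>x. X m x - X n x))\<^sup>2 < (1/8)^k"
  proof -
    have "\<forall>k::nat. \<exists>N. \<forall>m\<ge>N. \<forall>n\<ge>N. (L2_norm (\<lambda>x. X m x - X n x))\<^sup>2 < (1/8)^k" using C by simp
    then show ?thesis using that by metis
  qed
  \<comment> \<open>The sum dominates each M i and the summand k gives r k >= k, so r k and r (Suc
    k) both lie beyond M k.\<close>
  define r where "r k = (\<Sum>i\<le>k. M i) + k" for k
  have rM: "r k \<ge> M k" "r (Suc k) \<ge> M k" "r k \<ge> k" for k
  proof -
    have "M k \<le> (\<Sum>i\<le>k. M i)" by (rule member_le_sum) auto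
    then show "r k \<ge> M k" "r k \<ge> k" unfolding r_def by linarith+
    then show "r (Suc k) \<ge> M k" unfolding r_def sum.atMost_Suc by linarith
  qed
  \<comment> \<open>The increments have squared norm at most 8^(-k). Weighted by 4^k their integrals
    still have a finite sum, and finiteness of the weighted sum at x gives |D k x| <= c 2^(-k), so
    the telescoping series converges there.\<close>
  define D where "D k x = X (r (Suc k)) x - X (r k) x" for k x
  have [measurable]: "D k \<in> borel_measurable lebesgue" for k unfolding D_def by measurable
  have D: "D k \<in> L2 UNIV" "(L2_norm (D k))\<^sup>2 \<le> (1/8)^k" for k
    using XX[of "r (Suc k)" "r k"] M[of k "r (Suc k)" "r k"] rM[of k] by (auto simp: D_def[abs_def])
  have "(\<integral>\<^sup>+x. (\<Sum>k. ennreal (4^k * (cmod (D k x))\<^sup>2)) \<partial>lebesgue) \<noteq> \<infinity>"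
  proof -
    have "(\<integral>\<^sup>+x. (\<Sum>k. ennreal (4^k * (cmod (D k x))\<^sup>2)) \<partial>lebesgue) 
        = (\<Sum>k. \<integral>\<^sup>+x. ennreal (4^k * (cmod (D k x))\<^sup>2) \<partial>lebesgue)"
      by (rule nn_integral_suminf) simp
    also have "\<dots> \<le> (\<Sum>k. ennreal ((1/2)^k))"
    proof (rule suminf_le)
      fix k
      have "(\<integral>\<^sup>+x. ennreal (4^k * (cmod (D k x))\<^sup>2) \<partial>lebesgue) = ennreal (4^k) * ennreal ((L2_norm (D k))\<^sup>2)"
        by (simp add: ennreal_mult nn_integral_cmult nn_integral_cmod_sq[OF D(1)])
      also have "\<dots> = ennreal (4^k * (L2_norm (D k))\<^sup>2)" by (simp add: ennreal_mult)
      also have "\<dots> \<le> ennreal (4^k * (1/8)^k)"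
        by (intro ennreal_leI mult_left_mono D(2)) simp
      also have "(4::real)^k * (1/8)^k = (1/2)^k" unfolding power_mult_distrib[symmetric] by simp
      finally show "(\<integral>\<^sup>+x. ennreal (4^k * (cmod (D k x))\<^sup>2) \<partial>lebesgue) \<le> ennreal ((1/2)^k)" .
    qed auto
    also have "\<dots> = ennreal (\<Sum>k. (1/2)^k)" by (rule suminf_ennreal2) (auto simp: summable_geometric)
    finally show ?thesis by (auto simp: top_unique)
  qed
  then have "AE x in lebesgue. (\<Sum>k. ennreal (4^k * (cmod (D k x))\<^sup>2)) \<noteq> \<infinity>"
    by (intro nn_integral_PInf_AE borel_measurable_suminf) simp_all
  then have conv: "AE x in lebesgue. convergent (\<lambda>k. X (r k) x)"
  proof eventually_elim
    fix x assume fin: "(\<Sum>k. ennreal (4^k * (cmod (D k x))\<^sup>2)) \<noteq> \<infinity>"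
    define g where "g k = ennreal (4^k * (cmod (D k x))\<^sup>2)" for k
    define c where "c = sqrt (enn2real (suminf g))"
    have fin: "suminf g < top" using fin unfolding g_def[abs_def] by (simp add: top.not_eq_extremum)
    have "cmod (D k x) \<le> c * (1/2)^k" for k
    proof -
      have "sum g {k} = g k" by simp
      moreover have "sum g {k} \<le> suminf g" by (rule sum_le_suminf) auto
      ultimately have "g k \<le> suminf g" by (rule subst)
      then have "enn2real (g k) \<le> enn2real (suminf g)" by (rule enn2real_mono[OF _ fin])
      moreover have "enn2real (g k) = 4^k * (cmod (D k x))\<^sup>2" unfolding g_def by (rule enn2real_ennreal) simp
      ultimately have "4^k * (cmod (D k x))\<^sup>2 \<le> enn2real (suminf g)" by simp
      then have "sqrt (4^k * (cmod (D k x))\<^sup>2) \<le> c" unfolding c_def by (rule real_sqrt_le_mono)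
      moreover have "sqrt (4^k * (cmod (D k x))\<^sup>2) = 2^k * cmod (D k x)"
      proof (rule real_sqrt_unique)
        have "(2::real)^k * 2^k = 4^k" unfolding power_mult_distrib[symmetric] by simp
        then show "(2^k * cmod (D k x))\<^sup>2 = 4^k * (cmod (D k x))\<^sup>2"
          by (simp add: power_mult_distrib power2_eq_square)
      qed simp
      ultimately have "2^k * cmod (D k x) \<le> c" by simp
      then show ?thesis by (simp add: power_one_over pos_le_divide_eq mult.commute)
    qed
    moreover have "summable (\<lambda>k. c * (1/2)^k)"
      by (rule summable_mult[OF summable_geometric]) simp
    ultimately have "summable (\<lambda>k. D k x)"
      by (rule summable_comparison_test'[rotated])
    then have "convergent (\<lambda>n. \<Sum>k<n. D k x)" by (simp add: summable_iff_convergent)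
    then have "convergent (\<lambda>n. X (r n) x - X (r 0) x)"
      unfolding D_def sum_lessThan_telescope[of "\<lambda>k. X (r k) x"] .
    then show "convergent (\<lambda>n. X (r n) x)"
      using convergent_diff_const_right_iff[of "\<lambda>n. X (r n) x" "X (r 0) x"] by simp
  qed
  define v where "v x = lim (\<lambda>k. X (r k) x)" for x
  have [measurable]: "v \<in> borel_measurable lebesgue"
    unfolding v_def[abs_def] by (rule borel_measurable_lim_metric) simp
  have fatou: "(\<integral>\<^sup>+x. ennreal ((cmod (X n x - v x))\<^sup>2) \<partial>lebesgue) \<le> ennreal ((1/8)^k)"
    if "n \<ge> M k" for n k
  proof -
    have "(\<integral>\<^sup>+x. ennreal ((cmod (X n x - v x))\<^sup>2) \<partial>lebesgue) 
      = (\<integral>\<^sup>+x. liminf (\<lambda>j. ennreal ((cmod (X n x - X (r j) x))\<^sup>2)) \<partial>lebesgue)"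
    proof (rule nn_integral_cong_AE)
      show "AE x in lebesgue. ennreal ((cmod (X n x - v x))\<^sup>2) = liminf (\<lambda>j. ennreal ((cmod (X n x - X (r j) x))\<^sup>2))"
        using conv
      proof eventually_elim
        fix x assume "convergent (\<lambda>k. X (r k) x)"
        then have "(\<lambda>k. X (r k) x) \<longlonglongrightarrow> v x" by (simp add: v_def convergent_LIMSEQ_iff)
        then have "(\<lambda>j. ennreal ((cmod (X n x - X (r j) x))\<^sup>2)) \<longlonglongrightarrow> ennreal ((cmod (X n x - v x))\<^sup>2)"
          by (intro tendsto_intros tendsto_ennrealI)
        then show "ennreal ((cmod (X n x - v x))\<^sup>2) = liminf (\<lambda>j. ennreal ((cmod (X n x - X (r j) x))\<^sup>2))"
          by (intro lim_imp_Liminf[symmetric] trivial_limit_sequentially)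
      qed
    qed
    also have "\<dots> \<le> liminf (\<lambda>j. \<integral>\<^sup>+x. ennreal ((cmod (X n x - X (r j) x))\<^sup>2) \<partial>lebesgue)"
      by (rule nn_integral_liminf) simp
    also have "\<dots> \<le> liminf (\<lambda>j. ennreal ((1/8)^k))"
    proof (rule Liminf_mono)
      show "\<forall>\<^sub>F j in sequentially. (\<integral>\<^sup>+x. ennreal ((cmod (X n x - X (r j) x))\<^sup>2) \<partial>lebesgue) \<le> ennreal ((1/8)^k)"
        using eventually_ge_at_top[of "M k"]
      proof eventually_elim
        fix j assume "M k \<le> j"
        then have "(L2_norm (\<lambda>x. X n x - X (r j) x))\<^sup>2 < (1/8)^k"
          using M[of k n "r j"] that rM(3)[of j] by auto
        then show "(\<integral>\<^sup>+x. ennreal ((cmod (X n x - X (r j) x))\<^sup>2) \<partial>lebesgue) \<le> ennreal ((1/8)^k)"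
          by (simp add: nn_integral_cmod_sq[OF XX] ennreal_leI del: power_one_over)
      qed
    qed
    also have "\<dots> = ennreal ((1/8)^k)" by (simp add: Liminf_const)
    finally show ?thesis .
  qed
  \<comment> \<open>One index with X n - v in L2 is enough to place v in L2.\<close>
  have Xv: "(\<lambda>x. X n x - v x) \<in> L2 UNIV" if "n \<ge> M 0" for n
    unfolding L2_UNIV_iff
  proof
    show "integrable lebesgue (\<lambda>x. (cmod (X n x - v x))\<^sup>2)"
      using fatou[OF that] by (intro integrableI_bounded) (auto simp: le_less_trans)
  qed simp
  have v: "v \<in> L2 UNIV"
    using L2_diff[OF X Xv[of "M 0"], of "M 0"] by simp
  have "(\<lambda>n. (L2_norm (\<lambda>x. X n x - v x))\<^sup>2) \<longlonglongrightarrow> 0"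
  proof (rule LIMSEQ_I)
    fix e :: real assume "e > 0"
    then obtain k where k: "(1/8)^k < e" using real_arch_pow_inv[of e "1/8"] by auto
    have "norm ((L2_norm (\<lambda>x. X n x - v x))\<^sup>2 - 0) < e" if "n \<ge> M k" for n
    proof -
      have "ennreal ((L2_norm (\<lambda>x. X n x - v x))\<^sup>2) \<le> ennreal ((1/8)^k)"
        using fatou[OF that] by (simp add: nn_integral_cmod_sq[OF L2_diff[OF X v]])
      then show ?thesis using k by (simp add: ennreal_le_iff)
    qed
    then show "\<exists>N. \<forall>n\<ge>N. norm ((L2_norm (\<lambda>x. X n x - v x))\<^sup>2 - 0) < e" by blast
  qed
  then show "\<exists>v\<in>L2 UNIV. (\<lambda>n. (L2_norm (\<lambda>x. X n x - v x))\<^sup>2) \<longlonglongrightarrow> 0"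
    using v by blast
qed

section \<open>Smooth test functions\<close>

definition smooth :: "(real \<Rightarrow> real) \<Rightarrow> bool" where
  "smooth f \<longleftrightarrow> (\<forall>n x. (deriv ^^ n) f differentiable (at x))"

text \<open>Coinduction: it suffices to exhibit a family closed under taking a derivative, instead
  of a formula for the n-th derivative.\<close>

lemma smooth_coinduct:
  assumes "f \<in> A" "\<And>g. g \<in> A \<Longrightarrow> \<exists>g'\<in>A. \<forall>x. (g has_real_derivative g' x) (at x)"
  shows "smooth f"
proof -
  have mem: "(deriv ^^ n) f \<in> A" for n
  proof (induction n)
    case (Suc n)
    then obtain g' where g': "g' \<in> A" "\<And>x. ((deriv ^^ n) f has_real_derivative g' x) (at x)"
      using assms(2) by blast
    have "(deriv ^^ Suc n) f = g'"
      unfolding funpow.simps o_apply by (rule ext) (rule DERIV_imp_deriv[OF g'(2)])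
    then show ?case using g' by simp
  qed (use assms in simp)
  show ?thesis unfolding smooth_def
  proof (intro allI)
    fix n x
    obtain g' where "((deriv ^^ n) f has_real_derivative g' x) (at x)"
      using assms(2)[OF mem[of n]] by blast
    then show "(deriv ^^ n) f differentiable at x" unfolding real_differentiable_def by blast
  qed
qed

lemma smooth_deriv:
  assumes "smooth f" 
  shows "smooth (deriv f)" "(f has_real_derivative deriv f x) (at x)"
proof -
  show "smooth (deriv f)" unfolding smooth_def
  proof (intro allI)
    fix n x
    have "(deriv ^^ Suc n) f differentiable at x" using assms unfolding smooth_def by blast
    then show "(deriv ^^ n) (deriv f) differentiable at x" unfolding funpow_Suc_right o_apply .
  qed
  have "(deriv ^^ 0) f differentiable at x" using assms unfolding smooth_def by blast
  then have "f differentiable at x" by simp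
  then obtain D where D: "(f has_real_derivative D) (at x)" unfolding real_differentiable_def by blast
  then show "(f has_real_derivative deriv f x) (at x)"
    unfolding DERIV_imp_deriv[OF D] .
qed

lemma smooth_primitive:
  assumes "smooth g" "\<And>x. (f has_real_derivative g x) (at x)" shows "smooth f"
proof (rule smooth_coinduct[of f "insert f {h. smooth h}"])
  fix h assume "h \<in> insert f {h. smooth h}"
  then show "\<exists>g'\<in>insert f {h. smooth h}. \<forall>x. (h has_real_derivative g' x) (at x)"
  proof
    assume "h = f"
    then show ?thesis using assms by (intro bexI[of _ g]) auto
  next
    assume "h \<in> {h. smooth h}"
    then show ?thesis using smooth_deriv[of h] by (intro bexI[of _ "deriv h"]) auto
  qed
qed simp

lemma smooth_continuous: "smooth f \<Longrightarrow> continuous_on S f"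
  by (rule DERIV_continuous_on[of S f "deriv f"]) (rule has_field_derivative_at_within[OF smooth_deriv(2)])

lemma smooth_const: "smooth (\<lambda>x. c)"
proof (rule smooth_coinduct[of _ "range (\<lambda>c x. c)"])
  fix g :: "real \<Rightarrow> real" assume "g \<in> range (\<lambda>c x. c)"
  then show "\<exists>g'\<in>range (\<lambda>c x. c). \<forall>x. (g has_real_derivative g' x) (at x)"
    by (intro bexI[of _ "\<lambda>x. 0"]) auto
qed auto

lemma smooth_add: 
  assumes "smooth f" "smooth g" shows "smooth (\<lambda>x. f x + g x)"
proof (rule smooth_coinduct[of _ "{\<lambda>x. f x + g x |f g. smooth f \<and> smooth g}"])
  fix h assume "h \<in> {\<lambda>x. f x + g x |f g. smooth f \<and> smooth g}"
  then obtain f g where h: "h = (\<lambda>x. f x + g x)" "smooth f" "smooth g" by blast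
  have "\<forall>x. (h has_real_derivative deriv f x + deriv g x) (at x)"
    unfolding h(1) by (intro allI DERIV_add smooth_deriv(2) h)
  then show "\<exists>g'\<in>{\<lambda>x. f x + g x |f g. smooth f \<and> smooth g}. \<forall>x. (h has_real_derivative g' x) (at x)"
    using smooth_deriv(1)[OF h(2)] smooth_deriv(1)[OF h(3)] by (intro bexI[of _ "\<lambda>x. deriv f x + deriv g x"]) auto
qed (use assms in auto)

text \<open>Products alone are not closed under differentiation, finite sums of products are. This
  is the family for the coinduction in \<open>smooth_mult\<close>.\<close>

inductive_set prod_sums :: "(real \<Rightarrow> real) set" where
  prod: "smooth f \<Longrightarrow> smooth g \<Longrightarrow> (\<lambda>x. f x * g x) \<in> prod_sums"
| sum: "f \<in> prod_sums \<Longrightarrow> g \<in> prod_sums \<Longrightarrow> (\<lambda>x. f x + g x) \<in> prod_sums"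

lemma smooth_mult:
  assumes "smooth f" "smooth g" shows "smooth (\<lambda>x. f x * g x)"
proof (rule smooth_coinduct[OF prod_sums.prod[OF assms]])
  fix h assume "h \<in> prod_sums"
  then show "\<exists>g'\<in>prod_sums. \<forall>x. (h has_real_derivative g' x) (at x)"
  proof induction
    case (prod f g)
    have "\<forall>x. ((\<lambda>x. f x * g x) has_real_derivative deriv f x * g x + f x * deriv g x) (at x)"
      using DERIV_mult'[OF smooth_deriv(2)[OF prod(1)] smooth_deriv(2)[OF prod(2)]] by (simp add: add.commute)
    moreover have "(\<lambda>x. deriv f x * g x + f x * deriv g x) \<in> prod_sums"
      by (intro prod_sums.intros smooth_deriv prod)
    ultimately show ?case by (intro bexI)
  next
    case (sum f g)
    then obtain f' g' where "f' \<in> prod_sums" "g' \<in> prod_sums"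
      "\<forall>x. (f has_real_derivative f' x) (at x)" "\<forall>x. (g has_real_derivative g' x) (at x)" by blast
    then show ?case
      by (intro bexI[of _ "\<lambda>x. f' x + g' x"] allI DERIV_add prod_sums.sum) blast+
  qed
qed

lemma smooth_affine:
  assumes "smooth f" shows "smooth (\<lambda>x. f (a * x + c))"
proof (rule smooth_coinduct[of _ "{\<lambda>x. s * f (a * x + c) |f s. smooth f}"])
  fix h assume "h \<in> {\<lambda>x. s * f (a * x + c) |f s. smooth f}"
  then obtain f s where h: "h = (\<lambda>x. s * f (a * x + c))" "smooth f" by blast
  have "\<forall>x. (h has_real_derivative (s * a) * deriv f (a * x + c)) (at x)"
  proof
    fix x
    have "((\<lambda>x. a * x + c) has_real_derivative a) (at x)" by (auto intro!: derivative_eq_intros)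
    from DERIV_chain2[OF smooth_deriv(2)[OF h(2)] this]
    show "(h has_real_derivative (s * a) * deriv f (a * x + c)) (at x)"
      unfolding h(1) by (auto intro!: derivative_eq_intros)
  qed
  then show "\<exists>g'\<in>{\<lambda>x. s * f (a * x + c) |f s. smooth f}. \<forall>x. (h has_real_derivative g' x) (at x)"
    using smooth_deriv(1)[OF h(2)] by (intro bexI[of _ "\<lambda>x. (s * a) * deriv f (a * x + c)"]) blast+
next
  have "(\<lambda>x. f (a * x + c)) = (\<lambda>x. 1 * f (a * x + c))" by simp
  then show "(\<lambda>x. f (a * x + c)) \<in> {\<lambda>x. s * f (a * x + c) |f s. smooth f}" using assms by blast
qed

section \<open>Functions flat at the origin, cutoffs and bumps\<close>

definition flat :: "real poly \<Rightarrow> real \<Rightarrow> real" where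
  "flat p x = (if x > 0 then poly p (1 / x) * exp (- 1 / x) else 0)"

lemma poly_exp_tendsto_0: "((\<lambda>t. poly p t * exp (- t)) \<longlongrightarrow> (0::real)) at_top"
proof -
  have "((\<lambda>t. \<Sum>i\<le>degree p. coeff p i * (t ^ i / exp t)) \<longlongrightarrow> (\<Sum>i\<le>degree p. coeff p i * 0)) at_top"
    by (intro tendsto_intros tendsto_power_div_exp_0)
  moreover have "poly p t * exp (- t) = (\<Sum>i\<le>degree p. coeff p i * (t ^ i / exp t))" for t
    by (simp add: poly_altdef sum_distrib_right exp_minus divide_inverse mult.assoc)
  ultimately show ?thesis by simp
qed

text \<open>Differentiating p(1/x) exp(-1/x) gives q(1/x) exp(-1/x) with q(t) = t^2 (p(t) - p'(t)),
  so the functions \<open>flat p\<close> are closed under differentiation. At the origin the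
  difference quotient from the right is t p(t) exp(-t) with t = 1/x, which tends to 0.\<close>

lemma flat_has_derivative:
  "(flat p has_real_derivative flat ([:0, 0, 1:] * (p - pderiv p)) x) (at x)"
proof -
  consider "x > 0" | "x < 0" | "x = 0" by linarith
  then show ?thesis
  proof cases
    case 1
    have "((\<lambda>x. poly p (1 / x) * exp (- 1 / x)) has_real_derivative
        poly (pderiv p) (1 / x) * (- 1 / x\<^sup>2) * exp (- 1 / x) + poly p (1 / x) * (exp (- 1 / x) * (1 / x\<^sup>2))) (at x)"
      using 1 by (auto intro!: derivative_eq_intros DERIV_chain2[OF poly_DERIV] simp: power2_eq_square field_simps)
    moreover have "poly (pderiv p) (1 / x) * (- 1 / x\<^sup>2) * exp (- 1 / x) + poly p (1 / x) * (exp (- 1 / x) * (1 / x\<^sup>2))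
        = flat ([:0, 0, 1:] * (p - pderiv p)) x"
      using 1 by (simp add: flat_def power2_eq_square field_simps)
    ultimately have "((\<lambda>x. poly p (1 / x) * exp (- 1 / x)) has_real_derivative 
        flat ([:0, 0, 1:] * (p - pderiv p)) x) (at x)" by (simp only:)
    then show ?thesis
    proof (rule has_field_derivative_transform_within_open)
      show "open {0::real<..}" "x \<in> {0<..}" using 1 by auto
    qed (auto simp: flat_def)
  next
    case 2
    have "((\<lambda>x. 0) has_real_derivative flat ([:0, 0, 1:] * (p - pderiv p)) x) (at x)"
      using 2 by (simp add: flat_def)
    then show ?thesis
    proof (rule has_field_derivative_transform_within_open)
      show "open {..<0::real}" "x \<in> {..<0}" using 2 by auto
    qed (auto simp: flat_def)
  next
    case 3
    have "((\<lambda>h. flat p h / h) \<longlongrightarrow> 0) (at 0)"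
    proof (rule filterlim_split_at)
      show "((\<lambda>h. flat p h / h) \<longlongrightarrow> 0) (at_left 0)"
        by (rule tendsto_eventually) (auto simp: flat_def eventually_at_filter)
      have "((\<lambda>h. poly ([:0, 1:] * p) (inverse h) * exp (- inverse h)) \<longlongrightarrow> 0) (at_right 0)"
        by (rule filterlim_compose[OF poly_exp_tendsto_0 filterlim_inverse_at_top_right])
      then show "((\<lambda>h. flat p h / h) \<longlongrightarrow> 0) (at_right 0)"
        by (rule Lim_transform_eventually) (auto simp: flat_def eventually_at_filter field_simps)
    qed
    then show ?thesis using 3 by (simp add: has_field_derivative_iff flat_def)
  qed
qed

lemma smooth_flat: "smooth (flat p)"
  by (rule smooth_coinduct[of _ "range flat"]) (use flat_has_derivative in blast)+

definition cutoff :: "real \<Rightarrow> real" where "cutoff x = (if x > 0 then exp (- 1 / x) else 0)"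

lemma smooth_cutoff: "smooth cutoff"
proof -
  have "cutoff = flat 1" by (auto simp: cutoff_def flat_def)
  then show ?thesis using smooth_flat[of 1] by (simp only:)
qed

lemma cutoff_bounds: "0 \<le> cutoff x" "cutoff x \<le> 1" "x > 0 \<Longrightarrow> cutoff x > 0" "x \<le> 0 \<Longrightarrow> cutoff x = 0"
  by (auto simp: cutoff_def)

lemma test_funs_iff:
  "\<eta> \<in> test_funs \<Omega> \<longleftrightarrow> smooth \<eta> \<and> compact (closure {x. \<eta> x \<noteq> 0}) \<and> closure {x. \<eta> x \<noteq> 0} \<subseteq> \<Omega>"
  by (auto simp: test_funs_def smooth_def)

lemma test_funsI:
  assumes "smooth \<eta>" "{p..q} \<subseteq> \<Omega>" "\<And>x. x < p \<or> q < x \<Longrightarrow> \<eta> x = 0" shows "\<eta> \<in> test_funs \<Omega>"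
proof -
  have "x \<in> {p..q}" if "\<eta> x \<noteq> 0" for x using assms(3)[of x] that by (cases "x < p"; cases "q < x") auto
  then have "{x. \<eta> x \<noteq> 0} \<subseteq> {p..q}" by blast
  then have sub: "closure {x. \<eta> x \<noteq> 0} \<subseteq> {p..q}" by (simp add: closure_minimal)
  then have "compact (closure {x. \<eta> x \<noteq> 0})"
    by (meson bounded_closed_interval bounded_subset closed_closure compact_eq_bounded_closed)
  then show ?thesis using assms sub by (auto simp: test_funs_iff)
qed

text \<open>One factor switches on at p, the other off at q. Growing n steepens both, so the bumps
  tend to the indicator of the open interval; n = 0 serves as one fixed bump.\<close>

definition bump :: "real \<Rightarrow> real \<Rightarrow> nat \<Rightarrow> real \<Rightarrow> real" where
  "bump p q n x = cutoff (real (Suc n) * (x - p)) * cutoff (real (Suc n) * (q - x))"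

lemma smooth_bump: "smooth (bump p q n)"
proof -
  have "smooth (\<lambda>x. cutoff (real (Suc n) * x + real (Suc n) * (-p)) * 
      cutoff ((- real (Suc n)) * x + real (Suc n) * q))"
    by (intro smooth_mult smooth_affine smooth_cutoff)
  then show ?thesis by (simp add: bump_def[abs_def] algebra_simps)
qed

lemma bump_bounds: "0 \<le> bump p q n x" "bump p q n x \<le> 1"
  by (auto simp: bump_def cutoff_bounds intro!: mult_le_one)

lemma bump_eq_0: "x \<le> p \<or> q \<le> x \<Longrightarrow> bump p q n x = 0"
  by (auto simp: bump_def cutoff_bounds(4) mult_nonneg_nonpos)

lemma bump_pos: "p < x \<Longrightarrow> x < q \<Longrightarrow> bump p q n x > 0"
  by (auto simp: bump_def intro!: mult_pos_pos cutoff_bounds(3))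

lemma cutoff_tendsto_1: 
  assumes "x > 0" shows "(\<lambda>n. cutoff (real (Suc n) * x)) \<longlonglongrightarrow> 1"
proof -
  have "(\<lambda>n. exp (- (inverse (real (Suc n))) * inverse x)) \<longlonglongrightarrow> exp (- 0 * inverse x)"
    by (intro tendsto_intros LIMSEQ_inverse_real_of_nat)
  then show ?thesis using assms by (simp add: cutoff_def divide_inverse)
qed

lemma bump_tendsto: "p < x \<Longrightarrow> x < q \<Longrightarrow> (\<lambda>n. bump p q n x) \<longlonglongrightarrow> 1"
  unfolding bump_def using tendsto_mult[OF cutoff_tendsto_1[of "x - p"] cutoff_tendsto_1[of "q - x"]] by simp

lemma bump_test_fun: "{p..q} \<subseteq> \<Omega> \<Longrightarrow> bump p q n \<in> test_funs \<Omega>"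
  by (rule test_funsI[OF smooth_bump]) (auto intro!: bump_eq_0)

text \<open>Openness leaves room to widen the hull of K on both sides. For empty K the lemma just
  supplies a nondegenerate compact interval inside \<Omega>.\<close>

lemma compact_in_open_interval:
  fixes \<Omega> :: "real set"
  assumes "open \<Omega>" "is_interval \<Omega>" "\<Omega> \<noteq> {}" "compact K" "K \<subseteq> \<Omega>"
  shows "\<exists>p q. p < q \<and> {p..q} \<subseteq> \<Omega> \<and> K \<subseteq> {p<..<q}"
proof -
  obtain l u where lu: "l \<in> \<Omega>" "u \<in> \<Omega>" "l \<le> u" "K \<subseteq> {l..u}"
  proof (cases "K = {}")
    case True
    then show ?thesis using assms(3) that by blast
  next
    case False
    then obtain l u where "l \<in> K" "\<forall>x\<in>K. l \<le> x" "u \<in> K" "\<forall>x\<in>K. x \<le> u"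
      using compact_attains_inf[OF assms(4)] compact_attains_sup[OF assms(4)] by metis
    then show ?thesis using assms(5) by (intro that[of l u]) auto
  qed
  obtain e1 where e1: "e1 > 0" "cball l e1 \<subseteq> \<Omega>" using lu(1) assms(1) open_contains_cball by blast
  obtain e2 where e2: "e2 > 0" "cball u e2 \<subseteq> \<Omega>" using lu(2) assms(1) open_contains_cball by blast
  have "l - e1 \<in> \<Omega>" "u + e2 \<in> \<Omega>" using e1 e2 by (auto simp: subset_iff dist_real_def)
  then have "{l - e1..u + e2} \<subseteq> \<Omega>" 
    using interval_subset_is_interval[OF assms(2), of "l - e1" "u + e2"] by simp
  then show ?thesis using lu e1 e2 by (intro exI[of _ "l - e1"] exI[of _ "u + e2"]) auto
qed

text \<open>The primitive vanishing at p is constant on either side of [p, q], and mean zero forces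
  the constant on the right to be 0 as well.\<close>

lemma test_fun_primitive:
  assumes "smooth \<theta>" "p < q" "{p..q} \<subseteq> \<Omega>" "\<And>x. x \<le> p \<or> q \<le> x \<Longrightarrow> \<theta> x = 0"
    and int: "(\<theta> has_integral 0) {p..q}"
  shows "\<exists>\<eta>\<in>test_funs \<Omega>. deriv \<eta> = \<theta>"
proof -
  have cont: "isCont \<theta> x" for x
    by (rule DERIV_isCont[OF smooth_deriv(2)[OF assms(1)]])
  have "\<exists>F. \<forall>x::real. -\<infinity> < ereal x \<longrightarrow> ereal x < \<infinity> \<longrightarrow> (F has_vector_derivative \<theta> x) (at x)"
    by (rule einterval_antiderivative) (simp_all add: cont)
  then obtain F where "\<forall>x::real. -\<infinity> < ereal x \<longrightarrow> ereal x < \<infinity> \<longrightarrow> (F has_vector_derivative \<theta> x) (at x)" ..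
  then have F: "(F has_vector_derivative \<theta> x) (at x)" for x by simp
  define \<eta> where "\<eta> x = F x - F p" for x
  have V: "(\<eta> has_vector_derivative \<theta> x) (at x)" for x
    using has_vector_derivative_diff[OF F[of x] has_vector_derivative_const[of "F p"]]
    by (simp add: \<eta>_def[abs_def])
  have D: "(\<eta> has_real_derivative \<theta> x) (at x)" for x
    using V[of x] by (simp add: has_real_derivative_iff_has_vector_derivative)
  have ftc: "(\<theta> has_integral (\<eta> y - \<eta> x)) {x..y}" if "x \<le> y" for x y
    by (rule fundamental_theorem_of_calculus[OF that]) (rule has_vector_derivative_at_within[OF V])
  have zero: "\<eta> y = \<eta> x" if "x \<le> y" "y \<le> p \<or> q \<le> x" for x y
  proof -
    have "\<theta> t = 0" if "t \<in> {x..y}" for t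
      by (rule assms(4)) (use that \<open>y \<le> p \<or> q \<le> x\<close> in auto)
    then have "(\<theta> has_integral 0) {x..y}" by (rule has_integral_is_0)
    then have "\<eta> y - \<eta> x = 0" by (rule has_integral_unique[OF ftc[OF that(1)]])
    then show ?thesis by simp
  qed
  have p0: "\<eta> p = 0" by (simp add: \<eta>_def)
  have "\<eta> q - \<eta> p = 0" 
    by (rule has_integral_unique[OF ftc[OF less_imp_le[OF assms(2)]] int])
  then have q0: "\<eta> q = 0" using p0 by simp
  have "\<eta> x = 0" if "x < p \<or> q < x" for x
    using that
  proof
    assume "x < p"
    then show ?thesis using zero[of x p] p0 by simp
  next
    assume "q < x"
    then show ?thesis using zero[of q x] q0 by simp
  qed
  then have "\<eta> \<in> test_funs \<Omega>"
    by (rule test_funsI[OF smooth_primitive[OF assms(1) D] assms(3)])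
  moreover have "deriv \<eta> = \<theta>" by (intro ext DERIV_imp_deriv D)
  ultimately show ?thesis by blast
qed

section \<open>The fundamental lemma of the calculus of variations\<close>

lemma AE_lebesgue_on_iff_negligible:
  assumes "S \<in> sets lebesgue"
  shows "(AE x in lebesgue_on S. P x) \<longleftrightarrow> negligible {x \<in> S. \<not> P x}"
proof -
  have "(AE x in lebesgue_on S. P x) \<longleftrightarrow> (AE x in lebesgue. x \<in> S \<longrightarrow> P x)"
    using assms by (simp add: AE_restrict_space_iff)
  also have "\<dots> \<longleftrightarrow> {x \<in> S. \<not> P x} \<in> null_sets lebesgue"
    by (simp add: completion.AE_iff_null_sets)
  finally show ?thesis by (simp add: negligible_iff_null_sets)
qed

lemma lebesgue_on_integral_restrict:
  fixes f :: "real \<Rightarrow> complex"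
  assumes "S \<in> sets lebesgue" "T \<in> sets lebesgue" "S \<subseteq> T" "\<And>x. x \<in> T - S \<Longrightarrow> f x = 0"
  shows "(LINT x|lebesgue_on T. f x) = (LINT x|lebesgue_on S. f x)"
proof -
  have "(LINT x|lebesgue_on T. f x) = (LINT x|lebesgue_on T. (if x \<in> S then f x else 0))"
    using assms by (intro Bochner_Integration.integral_cong) auto
  also have "\<dots> = (LINT x|lebesgue_on (S \<inter> T). f x)"
    using assms by (intro Lebesgue_Measure.integral_restrict_Int)
  also have "S \<inter> T = S" using assms by blast
  finally show ?thesis .
qed

text \<open>Lebesgue differentiation: at almost every x the averages of h over [x, x + t] tend to h
  x, and for small t they all vanish here.\<close>

lemma integrals_zero_imp_negligible:
  fixes h :: "real \<Rightarrow> complex"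
  assumes "h integrable_on {a..b}" "\<And>p q. a < p \<Longrightarrow> p < q \<Longrightarrow> q < b \<Longrightarrow> integral {p..q} h = 0"
  shows "negligible {x \<in> {a<..<b}. h x \<noteq> 0}"
proof -
  define F where "F x = (if x \<in> {a..b} then h x else 0)" for x
  have "F integrable_on UNIV" using assms(1) unfolding F_def[abs_def] Henstock_Kurzweil_Integration.integrable_restrict_UNIV .
  then have Fint: "F integrable_on cbox c d" for c d by (rule integrable_on_subcbox) simp
  obtain N where N: "negligible N" 
    "\<And>x e. \<lbrakk>x \<notin> N; 0 < e\<rbrakk> \<Longrightarrow> \<exists>d>0. \<forall>h. 0 < h \<and> h < d \<longrightarrow> norm (integral (cbox x (x + h *\<^sub>R One)) F /\<^sub>R h ^ DIM(real) - F x) < e"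
  proof (rule integrable_ccontinuous_explicit[OF Fint])
    fix N assume N: "negligible N"
      "\<And>x e. \<lbrakk>x \<notin> N; 0 < e\<rbrakk> \<Longrightarrow> \<exists>d>0. \<forall>h. 0 < h \<and> h < d \<longrightarrow> norm (integral (cbox x (x + h *\<^sub>R One)) F /\<^sub>R h ^ DIM(real) - F x) < e"
    show thesis by (rule that[OF N])
  qed
  have "h x = 0" if x: "a < x" "x < b" "x \<notin> N" for x
  proof (rule ccontr)
    assume "h x \<noteq> 0"
    then obtain d where d: "d > 0" "\<And>t. 0 < t \<Longrightarrow> t < d \<Longrightarrow> norm (integral {x..x + t} F /\<^sub>R t - F x) < norm (h x)"
      using N(2)[OF x(3), of "norm (h x)"] by auto
    define t where "t = min (d / 2) ((b - x) / 2)"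
    have t: "0 < t" "t < d" "x + t < b" using d(1) x by (auto simp: t_def min_def field_simps)
    have "integral {x..x + t} F = integral {x..x + t} h"
      using x t by (intro Henstock_Kurzweil_Integration.integral_cong) (auto simp: F_def)
    also have "\<dots> = 0" using assms(2) x t by simp
    finally have "norm (F x) < norm (h x)" using d(2)[OF t(1,2)] by simp
    then show False using x by (simp add: F_def)
  qed
  then show ?thesis by (intro negligible_subset[OF N(1)]) auto
qed

lemma open_sets_lebesgue: "open S \<Longrightarrow> S \<in> sets lebesgue"
  by (simp add: borel_open sets_completionI_sets)

text \<open>Bumps tend to the indicator of an interval, so by dominated convergence the integral of
  h over every compact interval inside \<Omega> vanishes, and h vanishes almost everywhere on such
  an interval.\<close>

lemma fundamental_lemma:
  fixes h :: "real \<Rightarrow> complex"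
  assumes "open \<Omega>" "locally_integrable \<Omega> h"
    and test: "\<And>\<eta>. \<eta> \<in> test_funs \<Omega> \<Longrightarrow> (LINT x|lebesgue_on \<Omega>. h x * of_real (\<eta> x)) = 0"
  shows "AE x in lebesgue_on \<Omega>. h x = 0"
proof -
  have zero: "integral {p..q} h = 0" if pq: "{p..q} \<subseteq> \<Omega>" for p q
  proof -
    let ?M = "lebesgue_on {p<..<q}"
    have "h absolutely_integrable_on {p..q}"
      using assms(2) pq by (auto simp: locally_integrable_def)
    then have "h absolutely_integrable_on {p<..<q}"
      by (rule set_integrable_subset) auto
    then have int: "integrable ?M h"
      by (simp add: integrable_restrict_space set_integrable_def)
    note [measurable] = borel_measurable_integrable[OF int]
    have lim: "(\<lambda>n. LINT x|?M. h x * of_real (bump p q n x)) \<longlonglongrightarrow> (LINT x|?M. h x)"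
    proof (rule integral_dominated_convergence[where w = "\<lambda>x. norm (h x)"])
      have "continuous_on {p<..<q} (\<lambda>x. complex_of_real (bump p q n x))" for n
        by (intro continuous_intros smooth_continuous[OF smooth_bump])
      then have "(\<lambda>x. complex_of_real (bump p q n x)) \<in> borel_measurable ?M" for n
        by (rule continuous_imp_measurable_on_sets_lebesgue) simp
      then show "(\<lambda>x. h x * of_real (bump p q n x)) \<in> borel_measurable ?M" for n by measurable
      have "(\<lambda>n. h x * of_real (bump p q n x)) \<longlonglongrightarrow> h x" if "x \<in> {p<..<q}" for x
      proof -
        have "(\<lambda>n. h x * of_real (bump p q n x)) \<longlonglongrightarrow> h x * of_real 1"
          by (rule tendsto_mult[OF tendsto_const tendsto_of_real[OF bump_tendsto]]) (use that in auto)
        then show ?thesis by simp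
      qed
      then show "AE x in ?M. (\<lambda>n. h x * of_real (bump p q n x)) \<longlonglongrightarrow> h x" by (intro AE_I2) auto
      show "AE x in ?M. norm (h x * of_real (bump p q n x)) \<le> norm (h x)" for n
      proof (rule AE_I2)
        fix x
        show "norm (h x * of_real (bump p q n x)) \<le> norm (h x)"
          using mult_left_le[of "bump p q n x" "norm (h x)"] bump_bounds[of p q n x] by (simp add: norm_mult)
      qed
      show "h \<in> borel_measurable ?M" "integrable ?M (\<lambda>x. norm (h x))" using int by simp_all
    qed
    have "(LINT x|?M. h x * of_real (bump p q n x)) = 0" for n
    proof -
      have "(LINT x|lebesgue_on \<Omega>. h x * of_real (bump p q n x)) = (LINT x|?M. h x * of_real (bump p q n x))"
      proof (rule lebesgue_on_integral_restrict)
        show "{p<..<q} \<subseteq> \<Omega>" using pq greaterThanLessThan_subseteq_atLeastAtMost_iff[of p q p q] by blast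
        show "h x * of_real (bump p q n x) = 0" if "x \<in> \<Omega> - {p<..<q}" for x
          using that bump_eq_0[of x p q n] by force
      qed (simp_all add: open_sets_lebesgue assms(1))
      then show ?thesis using test[OF bump_test_fun[OF pq]] by simp
    qed
    then have "(LINT x|?M. h x) = 0" using lim by (simp only: LIMSEQ_const_iff)
    then have "integral {p<..<q} h = 0"
      using lebesgue_integral_eq_integral[OF int] by simp
    then show ?thesis by (simp add: integral_open_interval_real)
  qed
  \<comment> \<open>Rational end points make the family countable while it still covers \<Omega>, so
    the exceptional null sets may be united.\<close>
  define I where "I = {(a, b) \<in> \<rat> \<times> \<rat>. {a..b} \<subseteq> \<Omega>}"
  have neg: "negligible {x \<in> {a<..<b}. h x \<noteq> 0}" if "{a..b} \<subseteq> \<Omega>" for a b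
  proof (rule integrals_zero_imp_negligible)
    show "h integrable_on {a..b}" 
    proof -
      have "h absolutely_integrable_on {a..b}" using assms(2) that by (auto simp: locally_integrable_def)
      then show ?thesis by (rule set_lebesgue_integral_eq_integral(1))
    qed
    show "integral {p..q} h = 0" if "a < p" "p < q" "q < b" for p q
      using \<open>{a..b} \<subseteq> \<Omega>\<close> that by (intro zero) auto
  qed
  have "countable I" by (rule countable_subset[of _ "\<rat> \<times> \<rat>"]) (auto simp: I_def countable_rat)
  then have "negligible (\<Union>(a, b)\<in>I. {x \<in> {a<..<b}. h x \<noteq> 0})"
  proof (intro negligible_countable_Union)
    fix S assume "S \<in> (\<lambda>(a, b). {x \<in> {a<..<b}. h x \<noteq> 0}) ` I"
    then obtain a b where "{a..b} \<subseteq> \<Omega>" "S = {x \<in> {a<..<b}. h x \<noteq> 0}" by (auto simp: I_def)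
    then show "negligible S" using neg by simp
  qed (rule countable_image)
  moreover have "{x \<in> \<Omega>. h x \<noteq> 0} \<subseteq> (\<Union>(a, b)\<in>I. {x \<in> {a<..<b}. h x \<noteq> 0})"
  proof clarify
    fix x assume x: "x \<in> \<Omega>" "h x \<noteq> 0"
    then obtain e where e: "e > 0" "cball x e \<subseteq> \<Omega>" using assms(1) open_contains_cball by blast
    obtain a where a: "a \<in> \<rat>" "x - e < a" "a < x" using Rats_dense_in_real[of "x - e" x] e by auto
    obtain b where b: "b \<in> \<rat>" "x < b" "b < x + e" using Rats_dense_in_real[of x "x + e"] e by auto
    have "{a..b} \<subseteq> cball x e" using a b by (auto simp: dist_real_def)
    then have "(a, b) \<in> I" using a b e by (auto simp: I_def)
    then show "x \<in> (\<Union>(a, b)\<in>I. {x \<in> {a<..<b}. h x \<noteq> 0})" using a b x by force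
  qed
  ultimately have "negligible {x \<in> \<Omega>. h x \<noteq> 0}" using negligible_subset by blast
  then show ?thesis using assms(1) by (simp add: AE_lebesgue_on_iff_negligible open_sets_lebesgue)
qed

section \<open>Primitives of locally integrable functions\<close>

text \<open>Absolute continuity of u, written as the fundamental theorem of calculus. S may be a
  closed half-line; then v is integrable up to the end point and the one-sided boundary value of u
  is meaningful.\<close>

definition primitive_on :: "real set \<Rightarrow> (real \<Rightarrow> complex) \<Rightarrow> (real \<Rightarrow> complex) \<Rightarrow> bool" where
  "primitive_on S u v \<longleftrightarrow> (\<forall>x\<in>S. \<forall>y\<in>S. x \<le> y \<longrightarrow>
     v absolutely_integrable_on {x..y} \<and> (v has_integral (u y - u x)) {x..y})"

lemma primD:
  assumes "primitive_on S u v" "x \<in> S" "y \<in> S" "x \<le> y"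
  shows "v absolutely_integrable_on {x..y}" "(v has_integral (u y - u x)) {x..y}"
  using assms unfolding primitive_on_def by auto

lemma primI:
  assumes "\<And>x y. x \<in> S \<Longrightarrow> y \<in> S \<Longrightarrow> x \<le> y \<Longrightarrow> v absolutely_integrable_on {x..y}"
    "\<And>x y. x \<in> S \<Longrightarrow> y \<in> S \<Longrightarrow> x \<le> y \<Longrightarrow> (v has_integral (u y - u x)) {x..y}"
  shows "primitive_on S u v"
  using assms unfolding primitive_on_def by auto

lemma primitive_on_subset: "primitive_on S u v \<Longrightarrow> T \<subseteq> S \<Longrightarrow> primitive_on T u v"
  unfolding primitive_on_def by blast

lemma interval_Icc_subset:
  fixes S :: "real set"
  assumes "is_interval S" "x \<in> S" "y \<in> S" shows "{x..y} \<subseteq> S"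
  using interval_subset_is_interval[OF assms(1), of x y] assms by simp

text \<open>Point values of u are used later, so u is replaced only pointwise, whereas its
  derivative may change on a null set.\<close>

lemma primitive_on_cong:
  assumes "primitive_on S u v" "is_interval S" "\<And>x. x \<in> S \<Longrightarrow> u x = u' x" "negligible {x \<in> S. v x \<noteq> v' x}"
  shows "primitive_on S u' v'"
proof (rule primI)
  fix x y assume xy: "x \<in> S" "y \<in> S" "x \<le> y"
  have eq: "v' t = v t" if "t \<in> {x..y} - {x \<in> S. v x \<noteq> v' x}" for t
    using that interval_Icc_subset[OF assms(2) xy(1,2)] by (auto simp: subset_iff)
  show "v' absolutely_integrable_on {x..y}"
    by (rule absolutely_integrable_spike[OF primD(1)[OF assms(1) xy] assms(4) eq])
  have "(v' has_integral (u y - u x)) {x..y}"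
    by (rule has_integral_spike[OF assms(4) eq primD(2)[OF assms(1) xy]])
  then show "(v' has_integral (u' y - u' x)) {x..y}" using assms(3) xy by simp
qed

lemma primitive_on_add:
  assumes "primitive_on S u v" "primitive_on S p q" shows "primitive_on S (\<lambda>x. u x + p x) (\<lambda>x. v x + q x)"
proof (rule primI)
  fix x y assume xy: "x \<in> S" "y \<in> S" "x \<le> y"
  show "(\<lambda>x. v x + q x) absolutely_integrable_on {x..y}"
    by (rule set_integral_add(1)[OF primD(1)[OF assms(1) xy] primD(1)[OF assms(2) xy]])
  show "((\<lambda>x. v x + q x) has_integral u y + p y - (u x + p x)) {x..y}"
    using has_integral_add[OF primD(2)[OF assms(1) xy] primD(2)[OF assms(2) xy]] by (simp add: algebra_simps)
qed

lemma primitive_on_scale: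
  assumes "primitive_on S u v" shows "primitive_on S (\<lambda>x. c * u x) (\<lambda>x. c * v x)"
proof (rule primI)
  fix x y assume xy: "x \<in> S" "y \<in> S" "x \<le> y"
  show "(\<lambda>x. c * v x) absolutely_integrable_on {x..y}"
    using absolutely_integrable_linear[OF primD(1)[OF assms xy] bounded_linear_mult_right[of c]] by (simp add: o_def)
  show "((\<lambda>x. c * v x) has_integral c * u y - c * u x) {x..y}"
    using has_integral_mult_right[OF primD(2)[OF assms xy], of c] by (simp add: algebra_simps)
qed

lemma primitive_on_shift: "primitive_on S u v \<Longrightarrow> primitive_on S (\<lambda>x. u x + c) v"
  unfolding primitive_on_def by simp

lemma primitive_on_cnj:
  assumes "primitive_on S u v" shows "primitive_on S (\<lambda>x. cnj (u x)) (\<lambda>x. cnj (v x))"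
proof (rule primI)
  fix x y assume xy: "x \<in> S" "y \<in> S" "x \<le> y"
  show "(\<lambda>x. cnj (v x)) absolutely_integrable_on {x..y}"
    using absolutely_integrable_linear[OF primD(1)[OF assms xy] bounded_linear_cnj] by (simp add: o_def)
  show "((\<lambda>x. cnj (v x)) has_integral cnj (u y) - cnj (u x)) {x..y}"
    using has_integral_linear[OF primD(2)[OF assms xy] bounded_linear_cnj] by (simp add: o_def)
qed

lemma primitive_on_reflect:
  assumes "primitive_on {..0} u v" shows "primitive_on {0..} (\<lambda>x. u (- x)) (\<lambda>x. - v (- x))"
proof (rule primI)
  fix x y :: real assume xy: "x \<in> {0..}" "y \<in> {0..}" "x \<le> y"
  then have xy': "-y \<in> {..0}" "-x \<in> {..0}" "-y \<le> -x" by auto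
  have h: "(v has_integral (u (-x) - u (-y))) {-y..-x}" using primD(2)[OF assms xy'] .
  show "((\<lambda>x. - v (- x)) has_integral (u (- y) - u (- x))) {x..y}"
    using has_integral_neg[OF has_integral_reflect_lemma_real[OF h]] by simp
  show "(\<lambda>x. - v (- x)) absolutely_integrable_on {x..y}"
  proof -
    have "(\<lambda>x. v (- x)) absolutely_integrable_on {x..y}"
      using primD(1)[OF assms xy'] absolutely_integrable_reflect_real[where f = v and a = "-y" and b = "-x"] by simp
    from absolutely_integrable_linear[OF this bounded_linear_minus[OF bounded_linear_ident]]
    show ?thesis by (simp add: o_def)
  qed
qed

lemma primitive_on_glue:
  assumes "primitive_on {..c} u v" "primitive_on {c..} u v" shows "primitive_on UNIV u v"
proof (rule primI)
  fix x y :: real assume xy: "x \<le> y"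
  consider "y \<le> c" | "c \<le> x" | "x \<le> c" "c \<le> y" using xy by linarith
  then have "v absolutely_integrable_on {x..y} \<and> (v has_integral (u y - u x)) {x..y}"
  proof cases
    case 3
    have l: "v absolutely_integrable_on {x..c}" "(v has_integral (u c - u x)) {x..c}"
      using primD[OF assms(1), of x c] 3 by auto
    have r: "v absolutely_integrable_on {c..y}" "(v has_integral (u y - u c)) {c..y}"
      using primD[OF assms(2), of c y] 3 by auto
    have "{x..c} \<union> {c..y} = {x..y}" using 3 by auto
    then have "v absolutely_integrable_on {x..y}"
      using absolutely_integrable_Un[OF l(1) r(1)] by simp
    moreover have "(v has_integral (u y - u x)) {x..y}"
      using has_integral_combine[OF 3 l(2) r(2)] by simp
    ultimately show ?thesis by blast
  qed (use primD[OF assms(1), of x y] primD[OF assms(2), of x y] xy in auto)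
  then show "v absolutely_integrable_on {x..y}" "(v has_integral (u y - u x)) {x..y}" by auto
qed

lemma primitive_on_exists:
  fixes v :: "real \<Rightarrow> complex"
  assumes "is_interval S" "c \<in> S" and int: "\<And>x y. x \<in> S \<Longrightarrow> y \<in> S \<Longrightarrow> x \<le> y \<Longrightarrow> v absolutely_integrable_on {x..y}"
  shows "\<exists>u. primitive_on S u v \<and> u c = 0"
proof -
  let ?u = "\<lambda>x. if c \<le> x then integral {c..x} v else - integral {x..c} v"
  have "primitive_on S ?u v"
  proof (rule primI)
  fix x y assume xy: "x \<in> S" "y \<in> S" "x \<le> y"
  show "v absolutely_integrable_on {x..y}" by (rule int[OF xy])
  have io: "v integrable_on {p..q}" if "p \<in> S" "q \<in> S" for p q
    using int[OF that] set_lebesgue_integral_eq_integral(1) by (cases "p \<le> q") auto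
  have "integral {x..y} v = ?u y - ?u x"
  proof -
    consider "y < c" | "c \<le> x" | "x < c" "c \<le> y" using xy by linarith
    then show ?thesis
    proof cases
      case 1
      have "integral {x..c} v = integral {x..y} v + integral {y..c} v"
        using Henstock_Kurzweil_Integration.integral_combine[OF xy(3) less_imp_le[OF 1] io[OF xy(1) assms(2)]] by simp
      then show ?thesis using 1 xy by simp
    next
      case 2
      have "integral {c..y} v = integral {c..x} v + integral {x..y} v"
        using Henstock_Kurzweil_Integration.integral_combine[OF 2 xy(3) io[OF assms(2) xy(2)]] by simp
      then show ?thesis using 2 xy by simp
    next
      case 3
      then show ?thesis
        using Henstock_Kurzweil_Integration.integral_combine[OF less_imp_le[OF 3(1)] 3(2) io[OF xy(1,2)]]
        by (auto simp: add.commute)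
    qed
  qed
  then show "(v has_integral ?u y - ?u x) {x..y}"
    using integrable_integral[OF io[OF xy(1,2)]] by simp
  qed
  then show ?thesis by (intro exI[of _ ?u]) simp
qed

lemma primitive_on_continuous_Icc:
  assumes "primitive_on {a..b} u v" shows "continuous_on {a..b} u"
proof (cases "a \<le> b")
  case True
  have int: "v integrable_on {a..b}" using primD(2)[OF assms, of a b] True by auto
  have "continuous_on {a..b} (\<lambda>x. u a + integral {a..x} v)"
    by (intro continuous_intros indefinite_integral_continuous_1 int)
  moreover have "u a + integral {a..x} v = u x" if "x \<in> {a..b}" for x
    using integral_unique[OF primD(2)[OF assms, of a x]] that by auto
  ultimately show ?thesis by (rule continuous_on_eq)
qed simp

lemma primitive_on_continuous_open:
  assumes "primitive_on S u v" "open S" shows "continuous_on S u"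
proof (rule continuous_at_imp_continuous_on, rule ballI)
  fix x assume "x \<in> S"
  then obtain e where e: "e > 0" "cball x e \<subseteq> S" using assms(2) open_contains_cball by blast
  then have "{x - e..x + e} \<subseteq> S" by (simp add: cball_eq_atLeastAtMost)
  then have "continuous_on {x - e..x + e} u"
    by (rule primitive_on_continuous_Icc[OF primitive_on_subset[OF assms(1)]])
  then show "isCont u x" 
    by (rule continuous_on_interior) (use e(1) in \<open>simp add: interior_atLeastAtMost_real\<close>)
qed

lemma absolutely_integrable_continuous_mult:
  fixes g v :: "real \<Rightarrow> complex"
  assumes "continuous_on S g" "compact S" "v absolutely_integrable_on S"
  shows "(\<lambda>x. g x * v x) absolutely_integrable_on S"
proof (rule absolutely_integrable_bounded_measurable_product[of "(*)", OF _ _ _ _ assms(3)])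
  show "bilinear ((*) :: complex \<Rightarrow> _)"
    by (simp add: bilinear_conv_bounded_bilinear bounded_bilinear_mult)
  show S: "S \<in> sets lebesgue" using assms(2) by (simp add: compact_imp_closed borel_closed sets_completionI_sets)
  show "g \<in> borel_measurable (lebesgue_on S)"
    by (rule continuous_imp_measurable_on_sets_lebesgue[OF assms(1) S])
  show "bounded (g ` S)"
    by (rule compact_imp_bounded[OF compact_continuous_image[OF assms(1,2)]])
qed

text \<open>The defect \<open>E\<close> of the product rule is additive over adjacent intervals, and on short intervals it
  is at most \<open>e\<close> times the integral of \<open>|f'| + |g'|\<close>.\<close>

lemma primitive_on_mult_Icc:
  assumes f: "primitive_on {a..b} f f'" and g: "primitive_on {a..b} g g'" and "a \<le> b"
  shows "(\<lambda>x. f' x * g x + f x * g' x) absolutely_integrable_on {a..b}"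
    "((\<lambda>x. f' x * g x + f x * g' x) has_integral (f b * g b - f a * g a)) {a..b}"
proof -
  define h where "h x = f' x * g x + f x * g' x" for x
  have fc: "continuous_on {a..b} f" and gc: "continuous_on {a..b} g"
    by (rule primitive_on_continuous_Icc[OF f], rule primitive_on_continuous_Icc[OF g])
  have f'i: "f' absolutely_integrable_on {a..b}" and g'i: "g' absolutely_integrable_on {a..b}"
    using primD(1)[OF f, of a b] primD(1)[OF g, of a b] \<open>a \<le> b\<close> by auto
  have h1: "h absolutely_integrable_on {a..b}"
    unfolding h_def[abs_def]
    using set_integral_add(1)[OF absolutely_integrable_continuous_mult[OF gc compact_Icc f'i]
        absolutely_integrable_continuous_mult[OF fc compact_Icc g'i]] by (simp add: mult.commute)
  then show "(\<lambda>x. f' x * g x + f x * g' x) absolutely_integrable_on {a..b}" by (simp add: h_def[abs_def])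
  have hi: "h integrable_on {a..b}" by (rule set_lebesgue_integral_eq_integral(1)[OF h1])
  define m where "m x = norm (f' x) + norm (g' x)" for x
  have mi: "m integrable_on {a..b}" unfolding m_def[abs_def]
    using f'i g'i by (intro Henstock_Kurzweil_Integration.integrable_add) (auto simp: absolutely_integrable_on_def)
  define E where "E x y = integral {x..y} h - (f y * g y - f x * g x)" for x y
  have bound: "norm (E a b) \<le> e * integral {a..b} m" if "e > 0" for e
  proof -
    define P where "P x y \<longleftrightarrow> (a \<le> x \<and> x \<le> y \<and> y \<le> b \<longrightarrow> norm (E x y) \<le> e * integral {x..y} m)" for x y
    \<comment> \<open>Compactness enters through Bolzano's principle: joining adjacent intervals and
      treating short intervals around a point is enough.\<close>
    have "P a b" using \<open>a \<le> b\<close>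
    proof (rule Bolzano)
      fix x y z assume P: "P x y" "P y z" and le: "x \<le> y" "y \<le> z"
      show "P x z" unfolding P_def
      proof
        assume xz: "a \<le> x \<and> x \<le> z \<and> z \<le> b"
        have sub: "{x..z} \<subseteq> {a..b}" using xz by auto
        have "integral {x..z} h = integral {x..y} h + integral {y..z} h"
          using Henstock_Kurzweil_Integration.integral_combine[OF le integrable_subinterval_real[OF hi sub]] by simp
        then have 1: "E x z = E x y + E y z" by (simp add: E_def)
        have 2: "integral {x..z} m = integral {x..y} m + integral {y..z} m"
          using Henstock_Kurzweil_Integration.integral_combine[OF le integrable_subinterval_real[OF mi sub]] by simp
        have "norm (E x z) \<le> norm (E x y) + norm (E y z)" unfolding 1 by (rule norm_triangle_ineq)
        also have "\<dots> \<le> e * integral {x..y} m + e * integral {y..z} m"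
          using P xz le unfolding P_def by (intro add_mono) auto
        finally show "norm (E x z) \<le> e * integral {x..z} m" by (simp add: 2 distrib_left)
      qed
    next
      fix x assume x: "a \<le> x" "x \<le> b"
      then have xin: "x \<in> {a..b}" by simp
      \<comment> \<open>Half of e, because values at t and at an end point are compared through the
        value at x.\<close>
      obtain d1 where d1: "d1 > 0" "\<And>t. t \<in> {a..b} \<Longrightarrow> dist t x < d1 \<Longrightarrow> dist (f t) (f x) < e / 2"
        using fc[unfolded continuous_on_iff, rule_format, OF xin, of "e/2"] \<open>e > 0\<close> by auto
      obtain d2 where d2: "d2 > 0" "\<And>t. t \<in> {a..b} \<Longrightarrow> dist t x < d2 \<Longrightarrow> dist (g t) (g x) < e / 2"
        using gc[unfolded continuous_on_iff, rule_format, OF xin, of "e/2"] \<open>e > 0\<close> by auto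
      have "P p q" if pq: "p \<le> x" "x \<le> q" "q - p < min d1 d2" for p q
        unfolding P_def
      proof
        assume "a \<le> p \<and> p \<le> q \<and> q \<le> b"
        then have apq: "a \<le> p" "p \<le> q" "q \<le> b" by auto
        then have sub: "{p..q} \<subseteq> {a..b}" by auto
        have nr: "norm (f t - f q) \<le> e \<and> norm (g t - g p) \<le> e" if "t \<in> {p..q}" for t
        proof -
          have t: "t \<in> {a..b}" "dist t x < d1" "dist t x < d2" "q \<in> {a..b}" "dist q x < d1" "p \<in> {a..b}" "dist p x < d2"
            using that pq apq by (auto simp: dist_real_def)
          have "dist (f t) (f q) < e" using d1(2)[OF t(1,2)] d1(2)[OF t(4,5)] by (rule dist_triangle_half_l)
          moreover have "dist (g t) (g p) < e" using d2(2)[OF t(1,3)] d2(2)[OF t(6,7)] by (rule dist_triangle_half_l)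
          ultimately show ?thesis by (simp add: dist_norm)
        qed
        have if': "(f' has_integral (f q - f p)) {p..q}" and ig': "(g' has_integral (g q - g p)) {p..q}"
          using primD(2)[OF f, of p q] primD(2)[OF g, of p q] apq by auto
        have ih: "(h has_integral (integral {p..q} h)) {p..q}"
          by (rule integrable_integral[OF integrable_subinterval_real[OF hi sub]])
        \<comment> \<open>With g frozen at p and f frozen at q, the derivative integrates exactly to
          f q * g q - f p * g p; what is left over is the defect E.\<close>
        have "((\<lambda>t. h t - (f' t * g p + f q * g' t)) has_integral 
            (integral {p..q} h - ((f q - f p) * g p + f q * (g q - g p)))) {p..q}"
          by (intro has_integral_diff has_integral_add has_integral_mult_left has_integral_mult_right ih if' ig')
        also have "integral {p..q} h - ((f q - f p) * g p + f q * (g q - g p)) = E p q"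
          by (simp add: E_def algebra_simps)
        finally have iE: "((\<lambda>t. h t - (f' t * g p + f q * g' t)) has_integral (E p q)) {p..q}" .
        have "norm (E p q) \<le> integral {p..q} (\<lambda>t. e * m t)"
          unfolding integral_unique[OF iE, symmetric]
        proof (rule Henstock_Kurzweil_Integration.integral_norm_bound_integral)
          show "(\<lambda>t. h t - (f' t * g p + f q * g' t)) integrable_on {p..q}" using iE by blast
          show "(\<lambda>t. e * m t) integrable_on {p..q}"
            using integrable_on_mult_right[OF integrable_subinterval_real[OF mi sub], of e] by simp
          fix t assume t: "t \<in> {p..q}"
          have "h t - (f' t * g p + f q * g' t) = f' t * (g t - g p) + (f t - f q) * g' t"
            by (simp add: h_def algebra_simps)
          then have "norm (h t - (f' t * g p + f q * g' t)) \<le> norm (f' t) * norm (g t - g p) + norm (f t - f q) * norm (g' t)"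
            by (simp add: norm_mult[symmetric] norm_triangle_ineq)
          also have "\<dots> \<le> norm (f' t) * e + e * norm (g' t)"
            using nr[OF t] by (intro add_mono mult_left_mono mult_right_mono) auto
          finally show "norm (h t - (f' t * g p + f q * g' t)) \<le> e * m t" by (simp add: m_def algebra_simps)
        qed
        then show "norm (E p q) \<le> e * integral {p..q} m" by simp
      qed
      then show "\<exists>d>0. \<forall>p q. p \<le> x \<and> x \<le> q \<and> q - p < d \<longrightarrow> P p q"
        using d1(1) d2(1) by (intro exI[of _ "min d1 d2"]) auto
    qed
    then show ?thesis using \<open>a \<le> b\<close> by (simp add: P_def)
  qed
  have "E a b = 0"
  proof (rule ccontr)
    assume "E a b \<noteq> 0"
    then have pos: "norm (E a b) > 0" by simp
    have "integral {a..b} m \<ge> 0" 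
      by (rule Henstock_Kurzweil_Integration.integral_nonneg[OF mi]) (simp add: m_def)
    then have pos': "2 * (integral {a..b} m + 1) > 0" by simp
    \<comment> \<open>This e makes the bound smaller than norm (E a b) itself; the added 1 covers a
      vanishing integral of m.\<close>
    have "norm (E a b) \<le> norm (E a b) / (2 * (integral {a..b} m + 1)) * integral {a..b} m"
      by (rule bound) (use pos pos' in simp)
    also have "\<dots> < norm (E a b)"
    proof -
      have "norm (E a b) * integral {a..b} m < norm (E a b) * (2 * (integral {a..b} m + 1))"
        by (rule mult_strict_left_mono[OF _ pos]) (use pos' in simp)
      then show ?thesis using pos' by (simp only: times_divide_eq_left pos_divide_less_eq)
    qed
    finally show False by simp
  qed
  then show "((\<lambda>x. f' x * g x + f x * g' x) has_integral (f b * g b - f a * g a)) {a..b}"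
    using integrable_integral[OF hi] by (simp add: E_def h_def[abs_def])
qed

lemma primitive_on_mult:
  assumes "primitive_on S f f'" "primitive_on S g g'" "is_interval S"
  shows "primitive_on S (\<lambda>x. f x * g x) (\<lambda>x. f' x * g x + f x * g' x)"
proof (rule primI)
  fix x y assume xy: "x \<in> S" "y \<in> S" "x \<le> y"
  have sub: "{x..y} \<subseteq> S" by (rule interval_Icc_subset[OF assms(3) xy(1,2)])
  note * = primitive_on_mult_Icc[OF primitive_on_subset[OF assms(1) sub] primitive_on_subset[OF assms(2) sub] xy(3)]
  show "(\<lambda>x. f' x * g x + f x * g' x) absolutely_integrable_on {x..y}" by (rule *(1))
  show "((\<lambda>x. f' x * g x + f x * g' x) has_integral (f y * g y - f x * g x)) {x..y}" by (rule *(2))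
qed

section \<open>Weak derivatives on intervals\<close>

lemma compact_sets_lebesgue: "compact (S :: real set) \<Longrightarrow> S \<in> sets lebesgue"
  by (simp add: compact_imp_closed borel_closed sets_completionI_sets)

lemma LINT_restrict:
  fixes F :: "real \<Rightarrow> complex"
  assumes "S \<in> sets lebesgue"
  shows "(LINT x|lebesgue_on S. F x) = (LINT x|lebesgue. (if x \<in> S then F x else 0))"
  using integral_restrict_space[of S lebesgue F] assms by (simp add: indicator_scaleR_eq_if)

text \<open>Over a complete measure both integrands are measurable or neither is, and in the second
  case both integrals take the default value 0.\<close>

lemma LINT_cong_ae:
  fixes F G :: "real \<Rightarrow> complex"
  assumes S: "S \<in> sets lebesgue" and ae: "AE x in lebesgue_on S. F x = G x"
  shows "(LINT x|lebesgue_on S. F x) = (LINT x|lebesgue_on S. G x)"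
proof -
  let ?F = "\<lambda>x. if x \<in> S then F x else 0" and ?G = "\<lambda>x. if x \<in> S then G x else 0"
  have ae': "AE x in lebesgue. x \<in> S \<longrightarrow> F x = G x"
    using ae S by (simp add: AE_restrict_space_iff)
  have FG: "AE x in lebesgue. ?F x = ?G x" using ae' by eventually_elim simp
  then have GF: "AE x in lebesgue. ?G x = ?F x" by eventually_elim simp
  have "(LINT x|lebesgue. ?F x) = (LINT x|lebesgue. ?G x)"
  proof (cases "?F \<in> borel_measurable lebesgue")
    case True
    then show ?thesis using integral_cong_AE[OF True borel_measurable_AE[OF True FG] FG] by simp
  next
    case False
    then have "?G \<notin> borel_measurable lebesgue" using borel_measurable_AE[OF _ GF] by blast
    then have "\<not> integrable lebesgue ?G" using borel_measurable_integrable by metis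
    moreover have "\<not> integrable lebesgue ?F" using False borel_measurable_integrable by metis
    ultimately show ?thesis by (metis not_integrable_integral_eq)
  qed
  then show ?thesis by (simp only: LINT_restrict[OF S])
qed

lemma LINT_Icc:
  fixes F :: "real \<Rightarrow> complex"
  assumes "S \<in> sets lebesgue" "{p..q} \<subseteq> S" "F absolutely_integrable_on {p..q}" "\<And>x. x \<in> S - {p..q} \<Longrightarrow> F x = 0"
  shows "(LINT x|lebesgue_on S. F x) = integral {p..q} F"
proof -
  have m: "{p..q} \<in> sets lebesgue" by simp
  have "(LINT x|lebesgue_on S. F x) = (LINT x|lebesgue_on {p..q}. F x)"
    by (rule lebesgue_on_integral_restrict[OF m assms(1,2,4)])
  also have "\<dots> = integral {p..q} F"
    using assms(3) by (intro lebesgue_integral_eq_integral) (simp_all add: integrable_restrict_space set_integrable_def)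
  finally show ?thesis .
qed

lemma locally_integrable_Icc: "locally_integrable \<Omega> f \<Longrightarrow> {p..q} \<subseteq> \<Omega> \<Longrightarrow> f absolutely_integrable_on {p..q}"
  unfolding locally_integrable_def by simp

lemma locally_integrable_subset: "locally_integrable \<Omega> f \<Longrightarrow> \<Omega>' \<subseteq> \<Omega> \<Longrightarrow> locally_integrable \<Omega>' f"
  unfolding locally_integrable_def by (meson subset_trans)

lemma locally_integrable_diff:
  assumes "locally_integrable \<Omega> f" "locally_integrable \<Omega> g" shows "locally_integrable \<Omega> (\<lambda>x. f x - g x)"
  unfolding locally_integrable_def
proof (intro allI impI)
  fix K assume K: "compact K \<and> K \<subseteq> \<Omega>"
  show "(\<lambda>x. f x - g x) absolutely_integrable_on K"
    by (rule set_integral_diff(1)) (use assms K in \<open>auto simp: locally_integrable_def\<close>)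
qed

lemma locally_integrable_cong:
  assumes "locally_integrable \<Omega> f" "open \<Omega>" "AE x in lebesgue_on \<Omega>. f x = g x"
  shows "locally_integrable \<Omega> g"
  unfolding locally_integrable_def
proof (intro allI impI)
  fix K assume K: "compact K \<and> K \<subseteq> \<Omega>"
  have N: "negligible {x \<in> \<Omega>. f x \<noteq> g x}"
    using assms(2,3) by (simp add: AE_lebesgue_on_iff_negligible open_sets_lebesgue)
  have fK: "f absolutely_integrable_on K" using assms(1) K unfolding locally_integrable_def by simp
  show "g absolutely_integrable_on K"
    by (rule absolutely_integrable_spike[OF fK N]) (use K in auto)
qed

lemma locally_integrable_interval:
  assumes "open \<Omega>" "is_interval \<Omega>" and int: "\<And>p q. p < q \<Longrightarrow> {p..q} \<subseteq> \<Omega> \<Longrightarrow> f absolutely_integrable_on {p..q}"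
  shows "locally_integrable \<Omega> f"
proof (cases "\<Omega> = {}")
  case True
  then show ?thesis by (simp add: locally_integrable_def)
next
  case False
  show ?thesis unfolding locally_integrable_def
  proof (intro allI impI)
    fix K assume K: "compact K \<and> K \<subseteq> \<Omega>"
    then obtain p q where pq: "p < q" "{p..q} \<subseteq> \<Omega>" "K \<subseteq> {p<..<q}"
      using compact_in_open_interval[OF assms(1,2) False, of K] by auto
    have "K \<subseteq> {p..q}" using pq(3) by auto
    then show "f absolutely_integrable_on K"
      using K by (intro set_integrable_subset[OF int[OF pq(1,2)]] compact_sets_lebesgue) auto
  qed
qed

lemma primitive_on_locally_integrable:
  assumes "primitive_on \<Omega> u v" "open \<Omega>" "is_interval \<Omega>"
  shows "locally_integrable \<Omega> u" "locally_integrable \<Omega> v"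
proof -
  show "locally_integrable \<Omega> u"
  proof (rule locally_integrable_interval[OF assms(2,3)])
    fix p q assume "{p..q} \<subseteq> \<Omega>"
    then have "continuous_on {p..q} u" by (rule primitive_on_continuous_Icc[OF primitive_on_subset[OF assms(1)]])
    then show "u absolutely_integrable_on {p..q}" by (rule absolutely_integrable_continuous_real)
  qed
  show "locally_integrable \<Omega> v"
  proof (rule locally_integrable_interval[OF assms(2,3)])
    fix p q :: real assume "p < q" "{p..q} \<subseteq> \<Omega>"
    then show "v absolutely_integrable_on {p..q}"
      using primD(1)[OF assms(1), of p q] by (auto simp: subset_iff)
  qed
qed

lemma test_fun_smooth: "\<eta> \<in> test_funs \<Omega> \<Longrightarrow> smooth \<eta>"
  by (simp add: test_funs_iff)

lemma test_fun_zero: "x \<notin> closure {x. \<eta> x \<noteq> 0} \<Longrightarrow> \<eta> x = (0::real)"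
proof (rule ccontr)
  assume "x \<notin> closure {x. \<eta> x \<noteq> 0}" "\<eta> x \<noteq> 0"
  then show False using subsetD[OF closure_subset, of x "{x. \<eta> x \<noteq> 0}"] by simp
qed

lemma deriv_eq_0_open:
  assumes "open U" "x \<in> U" "\<And>y. y \<in> U \<Longrightarrow> \<eta> y = (0::real)" shows "deriv \<eta> x = 0"
proof (rule DERIV_imp_deriv)
  show "(\<eta> has_real_derivative 0) (at x)"
    by (rule has_field_derivative_transform_within_open[OF DERIV_const assms(1,2)]) (simp add: assms(3))
qed

lemma test_fun_deriv_zero:
  assumes "x \<notin> closure {x. \<eta> x \<noteq> 0}" shows "deriv \<eta> x = (0::real)"
proof (rule deriv_eq_0_open)
  show "open (- closure {x. \<eta> x \<noteq> 0})" "x \<in> - closure {x. \<eta> x \<noteq> 0}" using assms by (auto simp: open_Compl)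
  show "\<eta> y = 0" if "y \<in> - closure {x. \<eta> x \<noteq> 0}" for y by (rule test_fun_zero) (use that in simp)
qed

lemma continuous_smooth_complex: "smooth \<eta> \<Longrightarrow> continuous_on S (\<lambda>x. complex_of_real (\<eta> x))"
  by (intro continuous_intros smooth_continuous)

lemma primitive_on_smooth: 
  assumes "smooth \<eta>" shows "primitive_on S (\<lambda>x. of_real (\<eta> x)) (\<lambda>x. of_real (deriv \<eta> x))"
proof (rule primI)
  fix x y :: real assume "x \<le> y"
  show "(\<lambda>x. complex_of_real (deriv \<eta> x)) absolutely_integrable_on {x..y}"
    by (intro absolutely_integrable_continuous_real continuous_smooth_complex smooth_deriv(1) assms)
  have "(deriv \<eta> has_integral (\<eta> y - \<eta> x)) {x..y}"
  proof (rule fundamental_theorem_of_calculus[OF \<open>x \<le> y\<close>])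
    fix t
    have "(\<eta> has_vector_derivative deriv \<eta> t) (at t)"
      using smooth_deriv(2)[OF assms, of t] by (simp add: has_real_derivative_iff_has_vector_derivative)
    then show "(\<eta> has_vector_derivative deriv \<eta> t) (at t within {x..y})"
      by (rule has_vector_derivative_at_within)
  qed
  from has_integral_linear[OF this bounded_linear_of_real[where 'a = complex]]
  show "((\<lambda>x. complex_of_real (deriv \<eta> x)) has_integral complex_of_real (\<eta> y) - complex_of_real (\<eta> x)) {x..y}"
    by (simp add: o_def)
qed

text \<open>\<open>c\<close> stands for \<eta> and for its derivative; both are continuous and
  vanish off the support of \<eta>.\<close>

lemma test_fun_integrable:
  assumes \<eta>: "\<eta> \<in> test_funs \<Omega>" and \<Omega>: "open \<Omega>" and g: "locally_integrable \<Omega> g"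
    and c: "continuous_on UNIV c" "\<And>x. x \<notin> closure {x. \<eta> x \<noteq> 0} \<Longrightarrow> c x = 0"
  shows "integrable (lebesgue_on \<Omega>) (\<lambda>x. g x * of_real (c x))"
proof -
  let ?K = "closure {x. \<eta> x \<noteq> 0}"
  have K: "compact ?K" "?K \<subseteq> \<Omega>" using \<eta> by (simp_all add: test_funs_iff)
  have Km: "?K \<in> sets lebesgue" by (rule compact_sets_lebesgue[OF K(1)])
  have cc: "continuous_on ?K (\<lambda>x. complex_of_real (c x))"
    by (rule continuous_on_of_real[OF continuous_on_subset[OF c(1)]]) simp
  have gK: "g absolutely_integrable_on ?K" using g K unfolding locally_integrable_def by simp
  have "(\<lambda>x. g x * of_real (c x)) absolutely_integrable_on ?K"
    using absolutely_integrable_continuous_mult[OF cc K(1) gK] by (simp add: mult.commute)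
  then have "(\<lambda>x. if x \<in> ?K then g x * of_real (c x) else 0) absolutely_integrable_on UNIV"
    by (rule absolutely_integrable_restrict_UNIV[THEN iffD2])
  then have "integrable lebesgue (\<lambda>x. if x \<in> ?K then g x * of_real (c x) else 0)"
    by (simp add: set_integrable_def)
  also have "(\<lambda>x. if x \<in> ?K then g x * of_real (c x) else 0) = (\<lambda>x. if x \<in> \<Omega> then g x * of_real (c x) else 0)"
    using c(2) K(2) by (auto simp: fun_eq_iff)
  finally show ?thesis
    using \<Omega> by (simp add: Lebesgue_Measure.integrable_restrict_UNIV open_sets_lebesgue)
qed

lemma test_fun_mult_integrable:
  assumes "\<eta> \<in> test_funs \<Omega>" "open \<Omega>" "locally_integrable \<Omega> g"
  shows "integrable (lebesgue_on \<Omega>) (\<lambda>x. g x * of_real (\<eta> x))"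
    "integrable (lebesgue_on \<Omega>) (\<lambda>x. g x * of_real (deriv \<eta> x))"
proof -
  note s = test_fun_smooth[OF assms(1)]
  show "integrable (lebesgue_on \<Omega>) (\<lambda>x. g x * of_real (\<eta> x))"
    by (rule test_fun_integrable[OF assms smooth_continuous[OF s]]) (rule test_fun_zero)
  show "integrable (lebesgue_on \<Omega>) (\<lambda>x. g x * of_real (deriv \<eta> x))"
    by (rule test_fun_integrable[OF assms smooth_continuous[OF smooth_deriv(1)[OF s]]]) (rule test_fun_deriv_zero)
qed

text \<open>Integration by parts without boundary terms. Compactness is asked of the part of the
  support inside S, so that a test function on the punctured line can be used on each half-line
  separately.\<close>

lemma primitive_on_test_fun:
  assumes "primitive_on S u g" "open S" "is_interval S" "S \<noteq> {}" "smooth \<eta>" "compact (closure {x. \<eta> x \<noteq> 0} \<inter> S)"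
  shows "(LINT x|lebesgue_on S. u x * of_real (deriv \<eta> x)) = - (LINT x|lebesgue_on S. g x * of_real (\<eta> x))"
proof -
  let ?K = "closure {x. \<eta> x \<noteq> 0}"
  obtain p q where pq: "p < q" "{p..q} \<subseteq> S" "?K \<inter> S \<subseteq> {p<..<q}"
    using compact_in_open_interval[OF assms(2-4,6)] by auto
  have zero: "\<eta> x = 0" "deriv \<eta> x = 0" if "x \<in> S" "x \<notin> {p<..<q}" for x
  proof -
    have "x \<notin> ?K" using pq(3) that by blast
    then show "\<eta> x = 0" "deriv \<eta> x = 0" by (rule test_fun_zero, rule test_fun_deriv_zero)
  qed
  have S: "S \<in> sets lebesgue" by (rule open_sets_lebesgue[OF assms(2)])
  have u: "primitive_on {p..q} u g" by (rule primitive_on_subset[OF assms(1) pq(2)])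
  have li: "u absolutely_integrable_on {p..q}" "g absolutely_integrable_on {p..q}"
    using primitive_on_locally_integrable[OF assms(1-3)] locally_integrable_Icc[OF _ pq(2)] by auto
  have i1: "(\<lambda>x. u x * of_real (deriv \<eta> x)) absolutely_integrable_on {p..q}"
    using absolutely_integrable_continuous_mult[OF continuous_smooth_complex[OF smooth_deriv(1)[OF assms(5)]] compact_Icc li(1)]
    by (simp add: mult.commute)
  have i2: "(\<lambda>x. g x * of_real (\<eta> x)) absolutely_integrable_on {p..q}"
    using absolutely_integrable_continuous_mult[OF continuous_smooth_complex[OF assms(5)] compact_Icc li(2)]
    by (simp add: mult.commute)
  have h1: "((\<lambda>x. g x * of_real (\<eta> x) + u x * of_real (deriv \<eta> x)) has_integral
      (u q * of_real (\<eta> q) - u p * of_real (\<eta> p))) {p..q}"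
    by (rule primitive_on_mult_Icc(2)[OF u primitive_on_smooth[OF assms(5)]]) (use pq in simp)
  have "p \<in> S" "q \<in> S" using pq(1,2) by auto
  then have "\<eta> p = 0" "\<eta> q = 0" using zero(1) by auto
  then have "integral {p..q} (\<lambda>x. g x * of_real (\<eta> x) + u x * of_real (deriv \<eta> x)) = 0"
    using integral_unique[OF h1] by simp
  then have "integral {p..q} (\<lambda>x. g x * of_real (\<eta> x)) + integral {p..q} (\<lambda>x. u x * of_real (deriv \<eta> x)) = 0"
    using set_lebesgue_integral_eq_integral(1)[OF i1] set_lebesgue_integral_eq_integral(1)[OF i2]
    by (simp add: Henstock_Kurzweil_Integration.integral_add)
  moreover have "(LINT x|lebesgue_on S. u x * of_real (deriv \<eta> x)) = integral {p..q} (\<lambda>x. u x * of_real (deriv \<eta> x))"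
    by (rule LINT_Icc[OF S pq(2) i1]) (use zero in auto)
  moreover have "(LINT x|lebesgue_on S. g x * of_real (\<eta> x)) = integral {p..q} (\<lambda>x. g x * of_real (\<eta> x))"
    by (rule LINT_Icc[OF S pq(2) i2]) (use zero in auto)
  ultimately show ?thesis by (simp add: add_eq_0_iff)
qed

lemma primitive_on_weak_deriv:
  assumes "primitive_on S u g" "open S" "is_interval S" "S \<noteq> {}"
  shows "has_weak_deriv S u g"
  unfolding has_weak_deriv_def
proof (intro conjI ballI primitive_on_locally_integrable[OF assms(1-3)])
  fix \<eta> assume \<eta>: "\<eta> \<in> test_funs S"
  have "closure {x. \<eta> x \<noteq> 0} \<inter> S = closure {x. \<eta> x \<noteq> 0}" using \<eta> by (auto simp: test_funs_iff)
  then show "(LINT x|lebesgue_on S. u x * of_real (deriv \<eta> x)) = - (LINT x|lebesgue_on S. g x * of_real (\<eta> x))"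
    using \<eta> by (intro primitive_on_test_fun[OF assms]) (simp_all add: test_funs_iff)
qed

lemma has_weak_deriv_cong:
  assumes "has_weak_deriv \<Omega> f g" "open \<Omega>" "AE x in lebesgue_on \<Omega>. f x = f' x" "AE x in lebesgue_on \<Omega>. g x = g' x"
  shows "has_weak_deriv \<Omega> f' g'"
  unfolding has_weak_deriv_def
proof (intro conjI ballI)
  show "locally_integrable \<Omega> f'" "locally_integrable \<Omega> g'"
    using assms(1) locally_integrable_cong[OF _ assms(2,3)] locally_integrable_cong[OF _ assms(2,4)]
    unfolding has_weak_deriv_def by auto
  fix \<eta> assume \<eta>: "\<eta> \<in> test_funs \<Omega>"
  note S = open_sets_lebesgue[OF assms(2)]
  have 1: "AE x in lebesgue_on \<Omega>. f x * of_real (deriv \<eta> x) = f' x * of_real (deriv \<eta> x)"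
    using assms(3) by eventually_elim simp
  have 2: "AE x in lebesgue_on \<Omega>. g x * of_real (\<eta> x) = g' x * of_real (\<eta> x)"
    using assms(4) by eventually_elim simp
  show "(LINT x|lebesgue_on \<Omega>. f' x * of_real (deriv \<eta> x)) = - (LINT x|lebesgue_on \<Omega>. g' x * of_real (\<eta> x))"
    using assms(1) \<eta> unfolding has_weak_deriv_def LINT_cong_ae[OF S 1, symmetric] LINT_cong_ae[OF S 2, symmetric] by simp
qed

lemma test_funs_mono: "\<Omega>' \<subseteq> \<Omega> \<Longrightarrow> \<eta> \<in> test_funs \<Omega>' \<Longrightarrow> \<eta> \<in> test_funs \<Omega>"
  unfolding test_funs_iff by blast

lemma has_weak_deriv_subset:
  assumes "has_weak_deriv \<Omega> f g" "\<Omega>' \<subseteq> \<Omega>" "open \<Omega>" "open \<Omega>'"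
  shows "has_weak_deriv \<Omega>' f g"
  unfolding has_weak_deriv_def
proof (intro conjI ballI)
  show "locally_integrable \<Omega>' f" "locally_integrable \<Omega>' g"
    using assms(1) locally_integrable_subset[OF _ assms(2)] unfolding has_weak_deriv_def by auto
  fix \<eta> assume \<eta>: "\<eta> \<in> test_funs \<Omega>'"
  note S = open_sets_lebesgue[OF assms(4)] open_sets_lebesgue[OF assms(3)]
  have K: "closure {x. \<eta> x \<noteq> 0} \<subseteq> \<Omega>'" using \<eta> by (simp add: test_funs_iff)
  have "(LINT x|lebesgue_on \<Omega>. f x * of_real (deriv \<eta> x)) = (LINT x|lebesgue_on \<Omega>'. f x * of_real (deriv \<eta> x))"
  proof (rule lebesgue_on_integral_restrict[OF S assms(2)])
    fix x assume "x \<in> \<Omega> - \<Omega>'"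
    then have "x \<notin> closure {x. \<eta> x \<noteq> 0}" using K by blast
    then show "f x * of_real (deriv \<eta> x) = 0" 
      using test_fun_deriv_zero[of x \<eta>] by simp
  qed
  moreover have "(LINT x|lebesgue_on \<Omega>. g x * of_real (\<eta> x)) = (LINT x|lebesgue_on \<Omega>'. g x * of_real (\<eta> x))"
  proof (rule lebesgue_on_integral_restrict[OF S assms(2)])
    fix x assume "x \<in> \<Omega> - \<Omega>'"
    then have "x \<notin> closure {x. \<eta> x \<noteq> 0}" using K by blast
    then have "\<eta> x = 0" by (rule test_fun_zero)
    then show "g x * of_real (\<eta> x) = 0" by simp
  qed
  ultimately show "(LINT x|lebesgue_on \<Omega>'. f x * of_real (deriv \<eta> x)) = - (LINT x|lebesgue_on \<Omega>'. g x * of_real (\<eta> x))"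
    using assms(1) test_funs_mono[OF assms(2) \<eta>] unfolding has_weak_deriv_def by auto
qed

text \<open>The difference of two weak derivatives annihilates all test functions, so the
  fundamental lemma applies.\<close>

lemma has_weak_deriv_unique:
  assumes "has_weak_deriv \<Omega> f g" "has_weak_deriv \<Omega> f g'" "open \<Omega>"
  shows "AE x in lebesgue_on \<Omega>. g x = g' x"
proof -
  have l: "locally_integrable \<Omega> g" "locally_integrable \<Omega> g'" using assms unfolding has_weak_deriv_def by auto
  have "AE x in lebesgue_on \<Omega>. g x - g' x = 0"
  proof (rule fundamental_lemma[OF assms(3) locally_integrable_diff[OF l]])
    fix \<eta> assume \<eta>: "\<eta> \<in> test_funs \<Omega>"
    have i: "integrable (lebesgue_on \<Omega>) (\<lambda>x. g x * of_real (\<eta> x))" "integrable (lebesgue_on \<Omega>) (\<lambda>x. g' x * of_real (\<eta> x))"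
      by (rule test_fun_mult_integrable(1)[OF \<eta> assms(3) l(1)], rule test_fun_mult_integrable(1)[OF \<eta> assms(3) l(2)])
    have "- (LINT x|lebesgue_on \<Omega>. g x * of_real (\<eta> x)) = - (LINT x|lebesgue_on \<Omega>. g' x * of_real (\<eta> x))"
      using assms(1,2) \<eta> unfolding has_weak_deriv_def by metis
    then show "(LINT x|lebesgue_on \<Omega>. (g x - g' x) * of_real (\<eta> x)) = 0"
      using i by (simp add: left_diff_distrib)
  qed
  then show ?thesis by eventually_elim simp
qed

text \<open>Du Bois-Reymond: fix a test function \<zeta> of integral 1. For a test function \<theta>
  with integral I the function \<theta> - I \<zeta> has mean zero and is the derivative of a test
  function, so h sees \<theta> only through I, and h - c annihilates all test functions.\<close>

lemma weak_deriv_zero_imp_const: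
  assumes "open \<Omega>" "is_interval \<Omega>" "\<Omega> \<noteq> {}" "locally_integrable \<Omega> h"
    and z: "\<And>\<eta>. \<eta> \<in> test_funs \<Omega> \<Longrightarrow> (LINT x|lebesgue_on \<Omega>. h x * of_real (deriv \<eta> x)) = 0"
  shows "\<exists>c. AE x in lebesgue_on \<Omega>. h x = c"
proof -
  obtain p0 q0 where pq0: "p0 < q0" "{p0..q0} \<subseteq> \<Omega>"
    using compact_in_open_interval[OF assms(1-3), of "{}"] by auto
  define Z where "Z = integral {p0..q0} (bump p0 q0 0)"
  have bc: "continuous_on S (bump p0 q0 0)" for S by (rule smooth_continuous[OF smooth_bump])
  have "Z \<noteq> 0"
  proof
    assume "Z = 0"
    then have "\<forall>x\<in>{p0..q0}. bump p0 q0 0 x = 0"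
      using integral_eq_0_iff[OF bc pq0(1)] bump_bounds(1) unfolding Z_def by auto
    moreover have "(p0 + q0) / 2 \<in> {p0..q0}" using pq0(1) by auto
    moreover have "bump p0 q0 0 ((p0 + q0) / 2) > 0" using pq0(1) by (intro bump_pos) auto
    ultimately show False by fastforce
  qed
  define \<zeta> where "\<zeta> x = 1 / Z * bump p0 q0 0 x" for x
  have \<zeta>: "smooth \<zeta>" unfolding \<zeta>_def[abs_def] by (rule smooth_mult[OF smooth_const smooth_bump])
  have \<zeta>0: "\<zeta> x = 0" if "x \<le> p0 \<or> q0 \<le> x" for x using bump_eq_0[OF that, of 0] by (simp add: \<zeta>_def)
  have \<zeta>t: "\<zeta> \<in> test_funs \<Omega>" by (rule test_funsI[OF \<zeta> pq0(2)]) (use \<zeta>0 in auto)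
  \<comment> \<open>The constant that h has to be, read off with \<zeta>.\<close>
  define c where "c = (LINT x|lebesgue_on \<Omega>. h x * of_real (\<zeta> x))"
  have lc: "locally_integrable \<Omega> (\<lambda>x. c)"
    by (rule locally_integrable_interval[OF assms(1,2)]) (auto intro!: absolutely_integrable_continuous_real)
  have "AE x in lebesgue_on \<Omega>. h x - c = 0"
  proof (rule fundamental_lemma[OF assms(1) locally_integrable_diff[OF assms(4) lc]])
    fix \<theta> assume \<theta>: "\<theta> \<in> test_funs \<Omega>"
    let ?K = "closure {x. \<theta> x \<noteq> 0}"
    have K: "compact (?K \<union> {p0..q0})" "?K \<union> {p0..q0} \<subseteq> \<Omega>" 
      using \<theta> pq0 by (simp_all add: test_funs_iff compact_Un)
    obtain p q where pq: "p < q" "{p..q} \<subseteq> \<Omega>" "?K \<union> {p0..q0} \<subseteq> {p<..<q}"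
      using compact_in_open_interval[OF assms(1-3) K] by auto
    have p0q0: "p < p0" "q0 < q" "{p0..q0} \<subseteq> {p..q}" using pq(3) pq0(1) by (auto simp: subset_iff)
    have \<theta>0: "\<theta> x = 0" if "x \<le> p \<or> q \<le> x" for x
      by (rule test_fun_zero) (use pq(3) that in \<open>auto simp: subset_iff\<close>)
    define I where "I = integral {p..q} \<theta>"
    have \<theta>i: "(\<theta> has_integral I) {p..q}" unfolding I_def
      by (intro integrable_integral integrable_continuous_real smooth_continuous test_fun_smooth[OF \<theta>])
    have "(bump p0 q0 0 has_integral Z) {p0..q0}" unfolding Z_def
      by (intro integrable_integral integrable_continuous_real bc)
    then have "(bump p0 q0 0 has_integral Z) {p..q}"
      by (rule has_integral_on_superset[OF _ _ p0q0(3)]) (auto intro!: bump_eq_0)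
    from has_integral_mult_right[OF this, of "1/Z"]
    have \<zeta>i: "(\<zeta> has_integral 1) {p..q}" using \<open>Z \<noteq> 0\<close> by (simp add: \<zeta>_def[abs_def])
    have "smooth (\<lambda>x. \<theta> x + - I * \<zeta> x)" 
      by (intro smooth_add smooth_mult smooth_const test_fun_smooth[OF \<theta>] \<zeta>)
    moreover have "\<theta> x + - I * \<zeta> x = 0" if "x \<le> p \<or> q \<le> x" for x
      using \<theta>0[OF that] \<zeta>0[of x] that p0q0(1,2) by auto
    moreover have "((\<lambda>x. \<theta> x + - I * \<zeta> x) has_integral 0) {p..q}"
      using has_integral_add[OF \<theta>i has_integral_mult_right[OF \<zeta>i, of "- I"]] by simp
    ultimately obtain \<eta> where \<eta>: "\<eta> \<in> test_funs \<Omega>" "deriv \<eta> = (\<lambda>x. \<theta> x + - I * \<zeta> x)"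
      using test_fun_primitive[OF _ pq(1,2)] by (smt (verit))
    have ih\<theta>: "integrable (lebesgue_on \<Omega>) (\<lambda>x. h x * of_real (\<theta> x))"
      by (rule test_fun_mult_integrable(1)[OF \<theta> assms(1,4)])
    have ic\<theta>: "integrable (lebesgue_on \<Omega>) (\<lambda>x. c * of_real (\<theta> x))"
      by (rule test_fun_mult_integrable(1)[OF \<theta> assms(1) lc])
    have ih\<zeta>: "integrable (lebesgue_on \<Omega>) (\<lambda>x. h x * of_real (\<zeta> x))"
      by (rule test_fun_mult_integrable(1)[OF \<zeta>t assms(1,4)])
    have "0 = (LINT x|lebesgue_on \<Omega>. h x * of_real (\<theta> x) - of_real I * (h x * of_real (\<zeta> x)))"
      using z[OF \<eta>(1)] unfolding \<eta>(2) by (simp add: algebra_simps)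
    also have "\<dots> = (LINT x|lebesgue_on \<Omega>. h x * of_real (\<theta> x)) - of_real I * c"
      unfolding c_def using ih\<theta> ih\<zeta> by simp
    also have "of_real I * c = (LINT x|lebesgue_on \<Omega>. c * of_real (\<theta> x))"
    proof -
      have e: "(LINT x|lebesgue_on \<Omega>. c * of_real (\<theta> x)) = integral {p..q} (\<lambda>x. c * of_real (\<theta> x))"
      proof (rule LINT_Icc[OF open_sets_lebesgue[OF assms(1)] pq(2)])
        show "(\<lambda>x. c * complex_of_real (\<theta> x)) absolutely_integrable_on {p..q}"
          by (intro absolutely_integrable_continuous_real continuous_intros smooth_continuous test_fun_smooth[OF \<theta>])
      qed (use \<theta>0 in auto)
      have i: "((\<lambda>x. c * of_real (\<theta> x)) has_integral c * of_real I) {p..q}"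
        using has_integral_mult_right[OF has_integral_linear[OF \<theta>i bounded_linear_of_real[where 'a = complex]], of c]
        by (simp add: o_def)
      show ?thesis unfolding e integral_unique[OF i] by (rule mult.commute)
    qed
    finally show "(LINT x|lebesgue_on \<Omega>. (h x - c) * of_real (\<theta> x)) = 0"
      using ih\<theta> ic\<theta> by (simp add: left_diff_distrib)
  qed
  then have "AE x in lebesgue_on \<Omega>. h x = c" by eventually_elim simp
  then show ?thesis by blast
qed

text \<open>Subtracting a primitive of g leaves a function with vanishing weak derivative, hence a
  constant. This yields the continuous representative on which all point values rest.\<close>

theorem weak_deriv_imp_prim:
  assumes "has_weak_deriv \<Omega> f g" "open \<Omega>" "is_interval \<Omega>" "\<Omega> \<noteq> {}"
  shows "\<exists>u. primitive_on \<Omega> u g \<and> (AE x in lebesgue_on \<Omega>. f x = u x)"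
proof -
  have l: "locally_integrable \<Omega> f" "locally_integrable \<Omega> g" using assms(1) unfolding has_weak_deriv_def by auto
  obtain a where "a \<in> \<Omega>" using assms(4) by blast
  obtain F where F: "primitive_on \<Omega> F g"
    using primitive_on_exists[OF assms(3) \<open>a \<in> \<Omega>\<close>, of g] locally_integrable_Icc[OF l(2)] interval_Icc_subset[OF assms(3)] by blast
  have wF: "has_weak_deriv \<Omega> F g" by (rule primitive_on_weak_deriv[OF F assms(2-4)])
  have lF: "locally_integrable \<Omega> F" using wF unfolding has_weak_deriv_def by simp
  have "\<exists>c. AE x in lebesgue_on \<Omega>. f x - F x = c"
  proof (rule weak_deriv_zero_imp_const[OF assms(2-4) locally_integrable_diff[OF l(1) lF]])
    fix \<eta> assume \<eta>: "\<eta> \<in> test_funs \<Omega>"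
    have "integrable (lebesgue_on \<Omega>) (\<lambda>x. f x * of_real (deriv \<eta> x))"
      by (rule test_fun_mult_integrable(2)[OF \<eta> assms(2) l(1)])
    moreover have "integrable (lebesgue_on \<Omega>) (\<lambda>x. F x * of_real (deriv \<eta> x))"
      by (rule test_fun_mult_integrable(2)[OF \<eta> assms(2) lF])
    moreover have "(LINT x|lebesgue_on \<Omega>. f x * of_real (deriv \<eta> x)) = (LINT x|lebesgue_on \<Omega>. F x * of_real (deriv \<eta> x))"
      using assms(1) wF \<eta> unfolding has_weak_deriv_def by simp
    ultimately show "(LINT x|lebesgue_on \<Omega>. (f x - F x) * of_real (deriv \<eta> x)) = 0"
      by (simp add: left_diff_distrib)
  qed
  then obtain c where c: "AE x in lebesgue_on \<Omega>. f x - F x = c" by blast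
  have "primitive_on \<Omega> (\<lambda>x. F x + c) g" by (rule primitive_on_shift[OF F])
  moreover have "AE x in lebesgue_on \<Omega>. f x = F x + c" using c by eventually_elim (auto simp: algebra_simps)
  ultimately show ?thesis by blast
qed

section \<open>One-dimensional Sobolev spaces\<close>

lemma AE_lebesgue_on_UNIV: "(AE x::real in lebesgue_on UNIV. P x) \<longleftrightarrow> (AE x in lebesgue. P x)"
  by (simp only: lebesgue_on_UNIV_eq)

lemma AE_lebesgue_iff_negligible: "(AE x in lebesgue. P x) \<longleftrightarrow> negligible {x::real. \<not> P x}"
  using AE_lebesgue_on_iff_negligible[of UNIV P] unfolding AE_lebesgue_on_UNIV by simp

lemma AE_lebesgue_on_if: "(AE x::real in lebesgue. P x) \<Longrightarrow> S \<in> sets lebesgue \<Longrightarrow> AE x in lebesgue_on S. P x"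
  by (simp add: AE_restrict_space_iff) (erule AE_mp, simp)

lemma AE_punctured:
  assumes "AE x::real in lebesgue_on (- {0}). P x" shows "AE x in lebesgue. P x"
proof -
  have "negligible {x \<in> - {0}. \<not> P x}"
    using assms by (simp add: AE_lebesgue_on_iff_negligible)
  then have "negligible (insert 0 {x \<in> - {0}. \<not> P x})" by (simp only: negligible_insert)
  then have "negligible {x. \<not> P x}" by (rule negligible_subset) auto
  then show ?thesis by (simp add: AE_lebesgue_iff_negligible)
qed

lemma continuous_ae_eq:
  fixes f g :: "real \<Rightarrow> complex"
  assumes "open S" "continuous_on S f" "continuous_on S g" "AE x in lebesgue_on S. f x = g x" "x \<in> S"
  shows "f x = g x"
proof (rule ccontr)
  assume ne: "f x \<noteq> g x"
  have "open {x \<in> S. f x - g x \<in> - {0}}"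
    by (rule continuous_open_preimage[OF continuous_on_diff[OF assms(2,3)] assms(1), unfolded vimage_def Int_def, simplified]) auto
  moreover have "{x \<in> S. f x - g x \<in> - {0}} = {x \<in> S. f x \<noteq> g x}" by auto
  moreover have "negligible {x \<in> S. f x \<noteq> g x}"
    using assms(4) by (simp add: AE_lebesgue_on_iff_negligible open_sets_lebesgue[OF assms(1)])
  ultimately have "{x \<in> S. f x \<noteq> g x} = {}" using open_not_negligible by metis
  then show False using ne assms(5) by blast
qed

text \<open>\<open>cont_rep\<close> is a choice, but continuous functions that agree almost
  everywhere on an open set agree there everywhere, so any continuous representative computes
  it.\<close>

lemma cont_rep_eq:
  assumes "open S" "continuous_on S u" "AE x in lebesgue_on S. u x = f x" "x \<in> S"
  shows "cont_rep S f x = u x"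
proof -
  have c: "continuous_on S (cont_rep S f) \<and> (AE x in lebesgue_on S. cont_rep S f x = f x)"
    unfolding cont_rep_def by (rule someI[of _ u]) (use assms in blast)
  have "AE x in lebesgue_on S. cont_rep S f x = u x"
    using conjunct2[OF c] assms(3) by eventually_elim simp
  then show ?thesis using continuous_ae_eq[OF assms(1) conjunct1[OF c] assms(2) _ assms(4)] by blast
qed

lemma wderiv_ae:
  assumes "has_weak_deriv \<Omega> f g" "open \<Omega>"
  shows "has_weak_deriv \<Omega> f (wderiv \<Omega> f)" "AE x in lebesgue_on \<Omega>. wderiv \<Omega> f x = g x"
proof -
  show h: "has_weak_deriv \<Omega> f (wderiv \<Omega> f)" unfolding wderiv_def by (rule someI[of _ g]) (rule assms(1))
  show "AE x in lebesgue_on \<Omega>. wderiv \<Omega> f x = g x" by (rule has_weak_deriv_unique[OF h assms])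
qed

lemma L2_restrict:
  assumes "S \<in> sets lebesgue"
  shows "(\<lambda>x. if x \<in> S then f x else 0) \<in> L2 UNIV \<longleftrightarrow> f \<in> L2 S"
proof -
  have e: "(\<lambda>x. (cmod (if x \<in> S then f x else 0))\<^sup>2) = (\<lambda>x. if x \<in> S then (cmod (f x))\<^sup>2 else 0)" by auto
  show ?thesis unfolding L2_UNIV_iff e
    using Lebesgue_Measure.integrable_restrict_UNIV[OF assms, of "\<lambda>x. (cmod (f x))\<^sup>2"] borel_measurable_if[OF assms, of f]
    by (simp add: L2_def)
qed

lemma L2_indicator_mult:
  assumes "f \<in> L2 UNIV" "S \<in> sets lebesgue" shows "(\<lambda>x. if x \<in> S then f x else 0) \<in> L2 UNIV"
proof -
  have "(\<lambda>x. complex_of_real (indicat_real S x)) \<in> borel_measurable lebesgue"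
    using assms(2) by measurable
  then have "(\<lambda>x. of_real (indicat_real S x) * f x) \<in> L2 UNIV"
    by (rule L2_mult_bounded[OF assms(1), of _ 1]) (simp add: indicator_def)
  also have "(\<lambda>x. of_real (indicat_real S x) * f x) = (\<lambda>x. if x \<in> S then f x else 0)" by (auto simp: indicator_def)
  finally show ?thesis .
qed

lemma L2_subset: "f \<in> L2 UNIV \<Longrightarrow> S \<in> sets lebesgue \<Longrightarrow> f \<in> L2 S"
  using L2_indicator_mult L2_restrict by blast

lemma L2_Icc_integrable:
  assumes "f \<in> L2 UNIV" shows "f absolutely_integrable_on {a..b}"
proof -
  have i: "(\<lambda>x. if x \<in> {a..b} then 1 else 0) \<in> L2 UNIV"
  proof (rule L2_UNIV_bounded_by)
    show "(\<lambda>x. if x \<in> {a..b} then 1 else 0 :: complex) \<in> borel_measurable lebesgue"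
      by (rule borel_measurable_if_I) simp_all
    have "{a..b} \<in> lmeasurable" by simp
    then show "integrable lebesgue (indicat_real {a..b})" by (simp only: lmeasurable_iff_integrable)
  qed (simp add: indicator_def)
  have "integrable lebesgue (\<lambda>x. (if x \<in> {a..b} then 1 else 0) * f x)" by (rule L2_mult_integrable[OF i assms])
  moreover have "(\<lambda>x. (if x \<in> {a..b} then 1 else 0) * f x) = (\<lambda>x. indicat_real {a..b} x *\<^sub>R f x)"
    by (auto simp: indicator_def)
  ultimately show ?thesis by (simp only: set_integrable_def)
qed

lemma primitive_on_unique:
  assumes "primitive_on S u w" "primitive_on S y w" "c \<in> S" "u c = y c" "x \<in> S" shows "u x = y x"
proof (cases "c \<le> x")
  case True
  then show ?thesis
    using has_integral_unique[OF primD(2)[OF assms(1,3,5) True] primD(2)[OF assms(2,3,5) True]] assms(4) by simp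
next
  case False
  then have "x \<le> c" by simp
  then show ?thesis
    using has_integral_unique[OF primD(2)[OF assms(1,5,3)] primD(2)[OF assms(2,5,3)]] assms(4) by simp
qed

text \<open>w lies in L2 and is therefore integrable up to the boundary, so a primitive on an open
  half-line continues to the closed one. This produces the one-sided derivatives at 0.\<close>

lemma primitive_on_extend:
  assumes "primitive_on S y w" "S \<subseteq> T" "is_interval T" "c \<in> S" "w \<in> L2 UNIV"
  shows "\<exists>v. primitive_on T v w \<and> (\<forall>x\<in>S. v x = y x)"
proof -
  obtain F where F: "primitive_on T F w"
    using primitive_on_exists[OF assms(3), of c w] assms(2,4) L2_Icc_integrable[OF assms(5)] by blast
  define v where "v x = F x + (y c - F c)" for x
  have v: "primitive_on T v w" unfolding v_def[abs_def] by (rule primitive_on_shift[OF F])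
  have "v x = y x" if "x \<in> S" for x
    by (rule primitive_on_unique[OF primitive_on_subset[OF v assms(2)] assms(1,4) _ that]) (simp add: v_def)
  then show ?thesis using v by blast
qed

definition piece :: "(real \<Rightarrow> complex) \<Rightarrow> (real \<Rightarrow> complex) \<Rightarrow> real \<Rightarrow> complex" where
  "piece f g x = (if 0 \<le> x then f x else g x)"

lemma piece_L2:
  assumes "f \<in> L2 {0<..}" "g \<in> L2 {..<0}" shows "piece f g \<in> L2 UNIV"
proof (rule L2_cong_ae)
  show "(\<lambda>x. (if x \<in> {0<..} then f x else 0) + (if x \<in> {..<0} then g x else 0)) \<in> L2 UNIV"
    using assms by (intro L2_add) (simp_all only: L2_restrict open_sets_lebesgue open_greaterThan open_lessThan)
  have "negligible {x. (if x \<in> {0<..} then f x else 0) + (if x \<in> {..<0} then g x else 0) \<noteq> piece f g x}"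
    by (rule negligible_subset[of "{0}"]) (auto simp: piece_def split: if_splits)
  then show "eq_ae (\<lambda>x. (if x \<in> {0<..} then f x else 0) + (if x \<in> {..<0} then g x else 0)) (piece f g)"
    by (simp only: AE_lebesgue_iff_negligible)
qed

text \<open>A compact subset of the punctured line meets both half-lines in compact sets, so
  integrating by parts on each half leaves no term at the origin, whatever the jump of u
  there.\<close>

lemma punctured_weak_deriv:
  assumes r: "primitive_on {0<..} u g" and l: "primitive_on {..<0} u g"
  shows "has_weak_deriv (- {0}) u g"
proof -
  have open0: "open (- {0::real})" by (simp add: open_Compl)
  have li: "locally_integrable (- {0}) f" if "locally_integrable {0<..} f" "locally_integrable {..<0} f" for f :: "real \<Rightarrow> complex"
    unfolding locally_integrable_def
  proof (intro allI impI)
    fix K :: "real set" assume K: "compact K \<and> K \<subseteq> - {0}"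
    have "compact (K \<inter> {0..})" "compact (K \<inter> {..0})" using K by (simp_all add: compact_Int_closed)
    moreover have "K \<inter> {0..} \<subseteq> {0<..}" "K \<inter> {..0} \<subseteq> {..<0}" using K by (auto simp: less_le)
    ultimately have "f absolutely_integrable_on (K \<inter> {0..})" "f absolutely_integrable_on (K \<inter> {..0})"
      using that unfolding locally_integrable_def by auto
    from absolutely_integrable_Un[OF this]
    have "f absolutely_integrable_on (K \<inter> {0..} \<union> K \<inter> {..0})" .
    also have "K \<inter> {0..} \<union> K \<inter> {..0} = K" by auto
    finally show "f absolutely_integrable_on K" .
  qed
  have lu: "locally_integrable (- {0}) u" and lg: "locally_integrable (- {0}) g"
    using primitive_on_locally_integrable[OF r] primitive_on_locally_integrable[OF l]
    by (auto intro!: li simp: is_interval_oi is_interval_io)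
  have split: "(LINT x|lebesgue_on (- {0}). F x) = (LINT x|lebesgue_on {0<..}. F x) + (LINT x|lebesgue_on {..<0}. F x)"
    if F: "integrable (lebesgue_on (- {0})) F" for F :: "real \<Rightarrow> complex"
  proof -
    have S: "- {0::real} \<in> sets lebesgue" "{0::real<..} \<in> sets lebesgue" "{..<0::real} \<in> sets lebesgue"
      by (simp_all add: open_sets_lebesgue)
    have F0: "integrable lebesgue (\<lambda>x. if x \<in> - {0} then F x else 0)"
      by (rule Lebesgue_Measure.integrable_restrict_UNIV[THEN iffD2, OF S(1) F])
    have i1: "integrable lebesgue (\<lambda>x. if x \<in> {0<..} then F x else 0)"
    proof -
      have "(\<lambda>x. indicat_real {0<..} x *\<^sub>R (if x \<in> - {0} then F x else 0)) = (\<lambda>x. if x \<in> {0<..} then F x else 0)"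
        by (auto simp: fun_eq_iff indicator_def)
      then show ?thesis using integrable_mult_indicator[OF S(2) F0] by (simp only:)
    qed
    have i2: "integrable lebesgue (\<lambda>x. if x \<in> {..<0} then F x else 0)"
    proof -
      have "(\<lambda>x. indicat_real {..<0} x *\<^sub>R (if x \<in> - {0} then F x else 0)) = (\<lambda>x. if x \<in> {..<0} then F x else 0)"
        by (auto simp: fun_eq_iff indicator_def)
      then show ?thesis using integrable_mult_indicator[OF S(3) F0] by (simp only:)
    qed
    have "(\<lambda>x. if x \<in> - {0} then F x else 0) = (\<lambda>x. (if x \<in> {0<..} then F x else 0) + (if x \<in> {..<0} then F x else 0))"
      by (auto simp: fun_eq_iff)
    then show ?thesis
      unfolding LINT_restrict[OF S(1)] LINT_restrict[OF S(2)] LINT_restrict[OF S(3)]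
      using Bochner_Integration.integral_add[OF i1 i2] by simp
  qed
  show ?thesis unfolding has_weak_deriv_def
  proof (intro conjI ballI lu lg)
    fix \<eta> assume \<eta>: "\<eta> \<in> test_funs (- {0})"
    let ?K = "closure {x. \<eta> x \<noteq> 0}"
    have K: "compact ?K" "?K \<subseteq> - {0}" and s: "smooth \<eta>" using \<eta> by (simp_all add: test_funs_iff)
    have "?K \<inter> {0<..} = ?K \<inter> {0..}" "?K \<inter> {..<0} = ?K \<inter> {..0}" using K(2) by (auto simp: less_le)
    then have c: "compact (?K \<inter> {0<..})" "compact (?K \<inter> {..<0})" using K(1) by (simp_all add: compact_Int_closed)
    have "(LINT x|lebesgue_on {0<..}. u x * of_real (deriv \<eta> x)) = - (LINT x|lebesgue_on {0<..}. g x * of_real (\<eta> x))"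
      by (rule primitive_on_test_fun[OF r _ _ _ s c(1)]) (auto simp: is_interval_oi)
    moreover have "(LINT x|lebesgue_on {..<0}. u x * of_real (deriv \<eta> x)) = - (LINT x|lebesgue_on {..<0}. g x * of_real (\<eta> x))"
      by (rule primitive_on_test_fun[OF l _ _ _ s c(2)]) (auto simp: is_interval_io)
    ultimately show "(LINT x|lebesgue_on (- {0}). u x * of_real (deriv \<eta> x)) = - (LINT x|lebesgue_on (- {0}). g x * of_real (\<eta> x))"
      using split[OF test_fun_mult_integrable(1)[OF \<eta> open0 lg]] split[OF test_fun_mult_integrable(2)[OF \<eta> open0 lu]]
      by simp
  qed
qed

text \<open>\<open>u\<close> is the continuous representative of \<phi> and \<open>v\<close> its
  derivative. A relation, instead of the chosen \<open>cont_rep\<close> and \<open>wderiv\<close>,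
  allows explicit functions to be inserted.\<close>

definition H1_rep :: "(real \<Rightarrow> complex) \<Rightarrow> (real \<Rightarrow> complex) \<Rightarrow> (real \<Rightarrow> complex) \<Rightarrow> bool" where
  "H1_rep \<phi> u v \<longleftrightarrow> u \<in> L2 UNIV \<and> v \<in> L2 UNIV \<and> primitive_on UNIV u v \<and> eq_ae \<phi> u"

lemma H1_repD:
  assumes "H1_rep \<phi> u v"
  shows "u \<in> L2 UNIV" "v \<in> L2 UNIV" "primitive_on UNIV u v" "eq_ae \<phi> u" "\<phi> \<in> L2 UNIV" "has_weak_deriv UNIV \<phi> v"
proof -
  show *: "u \<in> L2 UNIV" "v \<in> L2 UNIV" "primitive_on UNIV u v" "eq_ae \<phi> u" using assms by (simp_all add: H1_rep_def)
  have u\<phi>: "eq_ae u \<phi>" using *(4) by eventually_elim simp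
  show "\<phi> \<in> L2 UNIV" by (rule L2_cong_ae[OF *(1) u\<phi>])
  have w: "has_weak_deriv UNIV u v" by (rule primitive_on_weak_deriv[OF *(3)]) auto
  show "has_weak_deriv UNIV \<phi> v"
    by (rule has_weak_deriv_cong[OF w open_UNIV u\<phi>[folded AE_lebesgue_on_UNIV]]) simp
qed

lemma H1_iff: "\<phi> \<in> H1 UNIV \<longleftrightarrow> (\<exists>u v. H1_rep \<phi> u v)"
proof
  assume "\<phi> \<in> H1 UNIV"
  then obtain v where v: "\<phi> \<in> L2 UNIV" "v \<in> L2 UNIV" "has_weak_deriv UNIV \<phi> v" unfolding H1_def by blast
  obtain u where u: "primitive_on UNIV u v" "eq_ae \<phi> u"
    using weak_deriv_imp_prim[OF v(3)] unfolding AE_lebesgue_on_UNIV by auto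
  have "u \<in> L2 UNIV" by (rule L2_cong_ae[OF v(1) u(2)])
  then show "\<exists>u v. H1_rep \<phi> u v" using u v unfolding H1_rep_def by blast
next
  assume "\<exists>u v. H1_rep \<phi> u v"
  then obtain u v where "H1_rep \<phi> u v" by blast
  from H1_repD[OF this] show "\<phi> \<in> H1 UNIV" unfolding H1_def by blast
qed

lemma H1_rep_wderiv:
  assumes "H1_rep \<phi> u v"
  shows "eq_ae (wderiv UNIV \<phi>) v" "wderiv UNIV \<phi> \<in> L2 UNIV"
proof -
  show w: "eq_ae (wderiv UNIV \<phi>) v" using wderiv_ae(2)[OF H1_repD(6)[OF assms]] unfolding AE_lebesgue_on_UNIV by simp
  have "eq_ae v (wderiv UNIV \<phi>)" using w by eventually_elim simp
  then show "wderiv UNIV \<phi> \<in> L2 UNIV" by (rule L2_cong_ae[OF H1_repD(2)[OF assms]])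
qed

lemma H1_rep_cont_rep:
  assumes "H1_rep \<phi> u v" shows "cont_rep UNIV \<phi> x = u x"
proof (rule cont_rep_eq)
  show "continuous_on UNIV u" by (rule primitive_on_continuous_open[OF H1_repD(3)[OF assms]]) simp
  show "AE x in lebesgue_on UNIV. u x = \<phi> x"
    using H1_repD(4)[OF assms] unfolding lebesgue_on_UNIV_eq by eventually_elim simp
qed auto

lemma H1_rep_add:
  assumes "H1_rep \<phi> u v" "H1_rep \<psi> y z" shows "H1_rep (\<lambda>x. \<phi> x + \<psi> x) (\<lambda>x. u x + y x) (\<lambda>x. v x + z x)"
  unfolding H1_rep_def
proof (intro conjI L2_add primitive_on_add H1_repD[OF assms(1)] H1_repD[OF assms(2)])
  show "eq_ae (\<lambda>x. \<phi> x + \<psi> x) (\<lambda>x. u x + y x)"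
    using H1_repD(4)[OF assms(1)] H1_repD(4)[OF assms(2)] by eventually_elim simp
qed

lemma H1_rep_scale:
  assumes "H1_rep \<phi> u v" shows "H1_rep (\<lambda>x. c * \<phi> x) (\<lambda>x. c * u x) (\<lambda>x. c * v x)"
  unfolding H1_rep_def
proof (intro conjI L2_scale primitive_on_scale H1_repD[OF assms(1)])
  show "eq_ae (\<lambda>x. c * \<phi> x) (\<lambda>x. c * u x)"
    using H1_repD(4)[OF assms(1)] by eventually_elim simp
qed

lemma H1_rep_norm:
  assumes "H1_rep \<phi> u v" 
  shows "L2_norm \<phi> = L2_norm u" "L2_norm (wderiv UNIV \<phi>) = L2_norm v"
    "(H1_norm \<phi>)\<^sup>2 = (L2_norm u)\<^sup>2 + (L2_norm v)\<^sup>2"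
proof -
  show *: "L2_norm \<phi> = L2_norm u" "L2_norm (wderiv UNIV \<phi>) = L2_norm v"
    by (rule L2_norm_cong[OF H1_repD(5,4)[OF assms]], rule L2_norm_cong[OF H1_rep_wderiv(2,1)[OF assms]])
  show "(H1_norm \<phi>)\<^sup>2 = (L2_norm u)\<^sup>2 + (L2_norm v)\<^sup>2" unfolding H1_norm_def * by simp
qed

lemma H1_rep_zero: "H1_rep (\<lambda>x. 0) (\<lambda>x. 0) (\<lambda>x. 0)"
  unfolding H1_rep_def by (simp add: L2_zero primitive_on_def)

section \<open>Green's formula on the punctured line\<close>

lemma integral_Icc_tendsto:
  fixes f :: "real \<Rightarrow> 'a::euclidean_space"
  assumes "integrable lebesgue (\<lambda>x. if x \<in> {0..} then f x else 0)"
  shows "(\<lambda>n. integral {0..real n} f) \<longlonglongrightarrow> (LINT x|lebesgue. (if x \<in> {0..} then f x else 0))"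
proof -
  let ?F = "\<lambda>x. if x \<in> {0..} then f x else 0"
  let ?s = "\<lambda>n x. if x \<in> {0..real n} then f x else 0"
  have s_eq: "?s n = (\<lambda>x. indicat_real {0..real n} x *\<^sub>R ?F x)" for n
    by (auto simp: fun_eq_iff indicator_def)
  have m: "{0..real n} \<in> sets lebesgue" for n by simp
  have si: "integrable lebesgue (?s n)" for n
    unfolding s_eq by (rule integrable_mult_indicator[OF m assms])
  have "(\<lambda>n. LINT x|lebesgue. ?s n x) \<longlonglongrightarrow> (LINT x|lebesgue. ?F x)"
  proof (rule integral_dominated_convergence[where w = "\<lambda>x. norm (?F x)"])
    show "?F \<in> borel_measurable lebesgue" "integrable lebesgue (\<lambda>x. norm (?F x))"
      using assms by (rule borel_measurable_integrable, intro integrable_norm assms)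
    show "?s n \<in> borel_measurable lebesgue" for n by (rule borel_measurable_integrable[OF si])
    show "AE x in lebesgue. (\<lambda>n. ?s n x) \<longlonglongrightarrow> ?F x"
    proof (rule AE_I2)
      fix x :: real
      obtain N where "x \<le> real N" using real_arch_simple by blast
      then have "eventually (\<lambda>n. ?s n x = ?F x) sequentially"
        by (intro eventually_sequentiallyI[of N]) auto
      then show "(\<lambda>n. ?s n x) \<longlonglongrightarrow> ?F x" by (rule tendsto_eventually)
    qed
    show "AE x in lebesgue. norm (?s n x) \<le> norm (?F x)" for n by (rule AE_I2) auto
  qed
  moreover have "(LINT x|lebesgue. ?s n x) = integral {0..real n} f" for n
  proof -
    have "(?s n has_integral (LINT x|lebesgue. ?s n x)) UNIV" by (rule has_integral_integral_lebesgue[OF si])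
    then have "(f has_integral (LINT x|lebesgue. ?s n x)) {0..real n}"
      unfolding has_integral_restrict_UNIV .
    then show ?thesis by (simp add: integral_unique)
  qed
  ultimately show ?thesis by simp
qed

lemma integral_unit_tendsto_0:
  fixes f :: "real \<Rightarrow> 'a::euclidean_space"
  assumes "integrable lebesgue (\<lambda>x. if x \<in> {0..} then f x else 0)"
  shows "(\<lambda>n. integral {real n..real n + 1} f) \<longlonglongrightarrow> 0"
proof -
  have "(\<lambda>x. if x \<in> {0..} then f x else 0) absolutely_integrable_on UNIV"
    using assms by (simp add: set_integrable_def)
  then have f0: "f absolutely_integrable_on {0..}" by (rule absolutely_integrable_restrict_UNIV[THEN iffD1])
  have int: "f integrable_on {0..real n + 1}" for n
    by (rule set_lebesgue_integral_eq_integral(1)[OF set_integrable_subset[OF f0]]) auto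
  have "integral {real n..real n + 1} f = integral {0..real (Suc n)} f - integral {0..real n} f" for n
    using Henstock_Kurzweil_Integration.integral_combine[of 0 "real n" "real n + 1" f, OF _ _ int]
    by (simp add: algebra_simps)
  moreover have "(\<lambda>n. integral {0..real (Suc n)} f - integral {0..real n} f) \<longlonglongrightarrow> 0"
    using tendsto_diff[OF LIMSEQ_Suc[OF integral_Icc_tendsto[OF assms]] integral_Icc_tendsto[OF assms]] by simp
  ultimately show ?thesis by simp
qed

text \<open>An integrable function with integrable derivative vanishes at infinity.\<close>

lemma half_line_right:
  assumes p: "primitive_on {0..} z z'"
    and iz: "integrable lebesgue (\<lambda>x. if x \<in> {0..} then z x else 0)"
    and iz': "integrable lebesgue (\<lambda>x. if x \<in> {0..} then z' x else 0)"
  shows "(LINT x|lebesgue. (if x \<in> {0..} then z' x else 0)) = - z 0"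
proof -
  have nif: "(\<lambda>x. norm (if x \<in> {0..} then f x else 0)) = (\<lambda>x. if x \<in> {0..} then norm (f x) else 0)" for f :: "real \<Rightarrow> complex"
    by auto
  have nz: "integrable lebesgue (\<lambda>x. if x \<in> {0..} then norm (z x) else 0)"
    using integrable_norm[OF iz] unfolding nif .
  have nz': "integrable lebesgue (\<lambda>x. if x \<in> {0..} then norm (z' x) else 0)"
    using integrable_norm[OF iz'] unfolding nif .
  have "(\<lambda>n. z (real n)) \<longlonglongrightarrow> 0"
  proof (rule Lim_null_comparison)
    show "(\<lambda>n. integral {real n..real n + 1} (\<lambda>t. norm (z t)) + integral {real n..real n + 1} (\<lambda>t. norm (z' t))) \<longlonglongrightarrow> 0"
      using tendsto_add[OF integral_unit_tendsto_0[OF nz] integral_unit_tendsto_0[OF nz']] by simp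
    \<comment> \<open>For every t in the unit interval |z n| is at most |z t| plus the integral of
      |z'|. Averaging over t, the interval having length 1, gives the bound.\<close>
    have "norm (z (real n)) \<le> integral {real n..real n + 1} (\<lambda>t. norm (z t)) + integral {real n..real n + 1} (\<lambda>t. norm (z' t))" for n
    proof -
      let ?I = "{real n..real n + 1}"
      define c where "c = integral ?I (\<lambda>t. norm (z' t))"
      have az': "z' absolutely_integrable_on ?I" by (rule primD(1)[OF p]) auto
      have "primitive_on ?I z z'" by (rule primitive_on_subset[OF p]) auto
      then have zc: "continuous_on ?I z" by (rule primitive_on_continuous_Icc)
      have nz'I: "(\<lambda>t. norm (z' t)) integrable_on ?I" using az' by (simp add: absolutely_integrable_on_def)
      have nzI: "(\<lambda>t. norm (z t)) integrable_on ?I" by (intro integrable_continuous_real continuous_intros zc)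
      have le: "norm (z (real n)) \<le> norm (z t) + c" if t: "t \<in> ?I" for t
      proof -
        have h: "(z' has_integral (z t - z (real n))) {real n..t}" by (rule primD(2)[OF p]) (use t in auto)
        have sub: "{real n..t} \<subseteq> ?I" using t by auto
        have n1: "(\<lambda>t. norm (z' t)) integrable_on {real n..t}"
          by (rule integrable_subinterval_real[OF nz'I sub])
        have "norm (z t - z (real n)) \<le> integral {real n..t} (\<lambda>t. norm (z' t))"
          unfolding integral_unique[OF h, symmetric]
          by (rule Henstock_Kurzweil_Integration.integral_norm_bound_integral[OF has_integral_integrable[OF h] n1]) simp
        also have "\<dots> \<le> c" unfolding c_def by (rule integral_subset_le[OF sub n1 nz'I]) simp
        finally show ?thesis
          using norm_triangle_ineq2[of "z (real n)" "z t"] by (simp add: norm_minus_commute)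
      qed
      have "norm (z (real n)) = integral ?I (\<lambda>t. norm (z (real n)))" by simp
      also have "\<dots> \<le> integral ?I (\<lambda>t. norm (z t) + c)"
        by (intro integral_le Henstock_Kurzweil_Integration.integrable_add nzI integrable_const_ivl le)
      also have "\<dots> = integral ?I (\<lambda>t. norm (z t)) + c"
        using nzI by (simp add: Henstock_Kurzweil_Integration.integral_add integrable_const_ivl)
      finally show ?thesis by (simp add: c_def)
    qed
    then show "\<forall>\<^sub>F n in sequentially. norm (z (real n)) \<le> integral {real n..real n + 1} (\<lambda>t. norm (z t)) + integral {real n..real n + 1} (\<lambda>t. norm (z' t))"
      by (simp add: always_eventually)
  qed
  then have "(\<lambda>n. z (real n) - z 0) \<longlonglongrightarrow> 0 - z 0" by (intro tendsto_diff tendsto_const)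
  moreover have "z (real n) - z 0 = integral {0..real n} z'" for n
    using integral_unique[OF primD(2)[OF p, of 0 "real n"]] by simp
  ultimately have "(\<lambda>n. integral {0..real n} z') \<longlonglongrightarrow> - z 0" by simp
  then show ?thesis by (rule LIMSEQ_unique[OF integral_Icc_tendsto[OF iz']])
qed

lemma half_line_left:
  assumes p: "primitive_on {..0} z z'"
    and iz: "integrable lebesgue (\<lambda>x. if x \<in> {..0} then z x else 0)"
    and iz': "integrable lebesgue (\<lambda>x. if x \<in> {..0} then z' x else 0)"
  shows "(LINT x|lebesgue. (if x \<in> {..0} then z' x else 0)) = z 0"
proof -
  have iz1: "integrable lebesgue (\<lambda>x. if x \<in> {0..} then z (- x) else 0)"
  proof -
    have e0: "(\<lambda>x. if x \<in> {0..} then z (- x) else 0) = (\<lambda>x. if 0 + -1 * x \<in> {..0} then z (0 + -1 * x) else 0)"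
      by auto
    show ?thesis unfolding e0 by (rule lebesgue_integrable_real_affine[OF iz]) simp
  qed
  have e: "(\<lambda>x. if x \<in> {0..} then - z' (- x) else 0) = (\<lambda>x. - (if 0 + -1 * x \<in> {..0} then z' (0 + -1 * x) else 0))"
    by auto
  have iz2: "integrable lebesgue (\<lambda>x. if x \<in> {0..} then - z' (- x) else 0)"
    unfolding e by (rule Bochner_Integration.integrable_minus, rule lebesgue_integrable_real_affine[OF iz']) simp
  have "(LINT x|lebesgue. (if x \<in> {0..} then - z' (- x) else 0)) = - z (- 0)"
    by (rule half_line_right[OF primitive_on_reflect[OF p] iz1 iz2])
  moreover have "(LINT x|lebesgue. (if x \<in> {0..} then - z' (- x) else 0)) = - (LINT x|lebesgue. (if x \<in> {..0} then z' x else 0))"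
    unfolding e using lebesgue_integral_real_affine[of "-1" "\<lambda>x. if x \<in> {..0} then z' x else 0" 0] by simp
  ultimately show ?thesis by simp
qed

text \<open>\<open>v1\<close> and \<open>v2\<close> are the derivatives of \<open>u\<close> on the two closed half-lines, so that \<open>v1 0\<close> and
  \<open>v2 0\<close> are the one-sided derivatives at the origin; \<open>w\<close> is the second derivative off the origin.\<close>

definition H2_rep :: "(real \<Rightarrow> complex) \<Rightarrow> (real \<Rightarrow> complex) \<Rightarrow> (real \<Rightarrow> complex) \<Rightarrow> (real \<Rightarrow> complex) \<Rightarrow> (real \<Rightarrow> complex) \<Rightarrow> bool" where
  "H2_rep \<phi> u v1 v2 w \<longleftrightarrow> H1_rep \<phi> u (piece v1 v2) \<and> w \<in> L2 UNIV \<and> primitive_on {0..} v1 w \<and> primitive_on {..0} v2 w"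

lemma H2_repD:
  assumes "H2_rep \<phi> u v1 v2 w"
  shows "H1_rep \<phi> u (piece v1 v2)" "w \<in> L2 UNIV" "primitive_on {0..} v1 w" "primitive_on {..0} v2 w"
  using assms by (simp_all add: H2_rep_def)

text \<open>On each closed half-line the derivative times \<open>cnj c\<close> is integrable with
  integrable derivative, so the integral of the latter is minus the value at 0 on the right and plus
  that value on the left. The two boundary terms combine to the jump.\<close>

lemma Green:
  assumes "H2_rep \<phi> u v1 v2 w" "H1_rep \<psi> c c'"
  shows "L2_inner w c + L2_inner (piece v1 v2) c' = - (v1 0 - v2 0) * cnj (c 0)"
proof -
  note D = H2_repD[OF assms(1)] and C = H1_repD[OF assms(2)]
  let ?v = "piece v1 v2" and ?h = "\<lambda>x. w x * cnj (c x) + piece v1 v2 x * cnj (c' x)"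
  have v: "?v \<in> L2 UNIV" by (rule H1_repD(2)[OF D(1)])
  have cc: "primitive_on UNIV (\<lambda>x. cnj (c x)) (\<lambda>x. cnj (c' x))" by (rule primitive_on_cnj[OF C(3)])
  have i1: "integrable lebesgue (\<lambda>x. w x * cnj (c x))" by (rule L2_inner_integrable[OF D(2) C(1)])
  have i2: "integrable lebesgue (\<lambda>x. ?v x * cnj (c' x))" by (rule L2_inner_integrable[OF v C(2)])
  have i3: "integrable lebesgue (\<lambda>x. ?v x * cnj (c x))" by (rule L2_inner_integrable[OF v C(1)])
  have ih: "integrable lebesgue ?h" by (rule Bochner_Integration.integrable_add[OF i1 i2])
  have restr: "integrable lebesgue (\<lambda>x. if x \<in> S then f x else 0)"
    if "S \<in> sets lebesgue" "integrable lebesgue f" for S and f :: "real \<Rightarrow> complex"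
    using integrable_mult_indicator[OF that] by (simp only: indicator_scaleR_eq_if)
  have R: "(LINT x|lebesgue. (if x \<in> {0..} then w x * cnj (c x) + v1 x * cnj (c' x) else 0)) = - (v1 0 * cnj (c 0))"
  proof (rule half_line_right)
    show "primitive_on {0..} (\<lambda>x. v1 x * cnj (c x)) (\<lambda>x. w x * cnj (c x) + v1 x * cnj (c' x))"
      by (rule primitive_on_mult[OF D(3) primitive_on_subset[OF cc]]) (auto simp: is_interval_ci)
    have "(\<lambda>x. if x \<in> {0..} then v1 x * cnj (c x) else 0) = (\<lambda>x. if x \<in> {0..} then ?v x * cnj (c x) else 0)"
      by (auto simp: piece_def)
    then show "integrable lebesgue (\<lambda>x. if x \<in> {0..} then v1 x * cnj (c x) else 0)"
      using restr[OF _ i3, of "{0..}"] by simp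
    have "(\<lambda>x. if x \<in> {0..} then w x * cnj (c x) + v1 x * cnj (c' x) else 0) = (\<lambda>x. if x \<in> {0..} then ?h x else 0)"
      by (auto simp: piece_def)
    then show "integrable lebesgue (\<lambda>x. if x \<in> {0..} then w x * cnj (c x) + v1 x * cnj (c' x) else 0)"
      using restr[OF _ ih, of "{0..}"] by simp
  qed
  have null0: "{0::real} \<in> null_sets lebesgue" by (simp add: negligible_iff_null_sets[symmetric])
  have ae: "AE x in lebesgue. (x::real) \<noteq> 0" by (rule AE_I'[OF null0]) auto
  have L: "(LINT x|lebesgue. (if x \<in> {..0} then w x * cnj (c x) + v2 x * cnj (c' x) else 0)) = v2 0 * cnj (c 0)"
    and Li: "integrable lebesgue (\<lambda>x. if x \<in> {..0} then w x * cnj (c x) + v2 x * cnj (c' x) else 0)"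
  proof -
    have m: "{..<0::real} \<in> sets lebesgue" by simp
    have p1: "primitive_on {..0} (\<lambda>x. v2 x * cnj (c x)) (\<lambda>x. w x * cnj (c x) + v2 x * cnj (c' x))"
      by (rule primitive_on_mult[OF D(4) primitive_on_subset[OF cc]]) (auto simp: is_interval_ic)
    \<comment> \<open>At the origin \<open>piece\<close> takes the value of v1, so on the left the
      integrands agree only away from 0.\<close>
    have a1: "AE x in lebesgue. (if x \<in> {..<0} then ?v x * cnj (c x) else 0) = (if x \<in> {..0} then v2 x * cnj (c x) else 0)"
      using ae by eventually_elim (auto simp: piece_def)
    have a2: "AE x in lebesgue. (if x \<in> {..<0} then ?h x else 0) = (if x \<in> {..0} then w x * cnj (c x) + v2 x * cnj (c' x) else 0)"
      using ae by eventually_elim (auto simp: piece_def)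
    have q1: "integrable lebesgue (\<lambda>x. if x \<in> {..0} then v2 x * cnj (c x) else 0)"
      using restr[OF m i3] borel_measurable_AE[OF borel_measurable_integrable[OF restr[OF m i3]] a1] a1
      by (rule integrable_cong_AE_imp) 
    have q2: "integrable lebesgue (\<lambda>x. if x \<in> {..0} then w x * cnj (c x) + v2 x * cnj (c' x) else 0)"
      using restr[OF m ih] borel_measurable_AE[OF borel_measurable_integrable[OF restr[OF m ih]] a2] a2
      by (rule integrable_cong_AE_imp)
    show "integrable lebesgue (\<lambda>x. if x \<in> {..0} then w x * cnj (c x) + v2 x * cnj (c' x) else 0)" by (rule q2)
    show "(LINT x|lebesgue. (if x \<in> {..0} then w x * cnj (c x) + v2 x * cnj (c' x) else 0)) = v2 0 * cnj (c 0)"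
      by (rule half_line_left[OF p1 q1 q2])
  qed
  have Ri: "integrable lebesgue (\<lambda>x. if x \<in> {0..} then w x * cnj (c x) + v1 x * cnj (c' x) else 0)"
  proof -
    have "(\<lambda>x. if x \<in> {0..} then w x * cnj (c x) + v1 x * cnj (c' x) else 0) = (\<lambda>x. if x \<in> {0..} then ?h x else 0)"
      by (auto simp: piece_def)
    then show ?thesis using restr[OF _ ih, of "{0..}"] by simp
  qed
  have "L2_inner w c + L2_inner ?v c' = (LINT x|lebesgue. ?h x)"
    unfolding L2_inner_def using i1 i2 by simp
  also have "\<dots> = (LINT x|lebesgue. (if x \<in> {0..} then w x * cnj (c x) + v1 x * cnj (c' x) else 0)
      + (if x \<in> {..0} then w x * cnj (c x) + v2 x * cnj (c' x) else 0))"
  proof (rule integral_cong_AE)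
    show "AE x in lebesgue. ?h x = (if x \<in> {0..} then w x * cnj (c x) + v1 x * cnj (c' x) else 0)
      + (if x \<in> {..0} then w x * cnj (c x) + v2 x * cnj (c' x) else 0)"
      using ae by eventually_elim (auto simp: piece_def)
  qed (intro borel_measurable_integrable ih, intro borel_measurable_integrable Bochner_Integration.integrable_add Ri Li)
  also have "\<dots> = - (v1 0 * cnj (c 0)) + v2 0 * cnj (c 0)"
    by (subst Bochner_Integration.integral_add[OF Ri Li]) (simp only: R L)
  finally show ?thesis by (simp add: algebra_simps)
qed

text \<open>|u 0|^2 is minus the integral of the derivative of |u|^2 over the right half-line, and
  Cauchy-Schwarz gives the product of the norms. The product form lets a delta term of any strength
  be absorbed by the derivative at the price of a larger multiple of the L2 norm.\<close>

lemma trace_bound: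
  assumes "H1_rep \<phi> u v" shows "(cmod (u 0))\<^sup>2 \<le> 2 * L2_norm u * L2_norm v"
proof -
  note D = H1_repD[OF assms]
  let ?R = "\<lambda>f x. if x \<in> {0::real..} then f x else (0::complex)"
  have m: "{0::real..} \<in> sets lebesgue" by simp
  have Ru: "?R u \<in> L2 UNIV" and Rv: "?R v \<in> L2 UNIV" by (rule L2_indicator_mult[OF D(1) m], rule L2_indicator_mult[OF D(2) m])
  have nR: "L2_norm (?R f) \<le> L2_norm f" if f: "f \<in> L2 UNIV" for f
    unfolding L2_norm_def
    by (rule real_sqrt_le_mono, rule integral_mono[OF L2_UNIV_D(2)[OF L2_indicator_mult[OF f m]] L2_UNIV_D(2)[OF f]]) auto
  have e1: "(\<lambda>x. if x \<in> {0..} then u x * cnj (u x) else 0) = (\<lambda>x. ?R u x * cnj (u x))" by auto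
  have e2: "(\<lambda>x. if x \<in> {0..} then v x * cnj (u x) + u x * cnj (v x) else 0) = (\<lambda>x. ?R v x * cnj (u x) + ?R u x * cnj (v x))" by auto
  have i: "integrable lebesgue (\<lambda>x. ?R u x * cnj (u x))" "integrable lebesgue (\<lambda>x. ?R v x * cnj (u x))"
    "integrable lebesgue (\<lambda>x. ?R u x * cnj (v x))"
    by (intro L2_inner_integrable Ru Rv D(1,2))+
  have "(LINT x|lebesgue. (if x \<in> {0..} then v x * cnj (u x) + u x * cnj (v x) else 0)) = - (u 0 * cnj (u 0))"
  proof (rule half_line_right)
    show "primitive_on {0..} (\<lambda>x. u x * cnj (u x)) (\<lambda>x. v x * cnj (u x) + u x * cnj (v x))"
      by (rule primitive_on_mult[OF primitive_on_subset[OF D(3)] primitive_on_subset[OF primitive_on_cnj[OF D(3)]]]) (auto simp: is_interval_ci)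
    show "integrable lebesgue (\<lambda>x. if x \<in> {0..} then u x * cnj (u x) else 0)" unfolding e1 by (rule i)
    show "integrable lebesgue (\<lambda>x. if x \<in> {0..} then v x * cnj (u x) + u x * cnj (v x) else 0)"
      unfolding e2 by (intro Bochner_Integration.integrable_add i)
  qed
  then have "L2_inner (?R v) u + L2_inner (?R u) v = - (u 0 * cnj (u 0))"
    unfolding e2 L2_inner_def using Bochner_Integration.integral_add[OF i(2,3)] by simp
  then have "cmod (- (u 0 * cnj (u 0))) \<le> cmod (L2_inner (?R v) u) + cmod (L2_inner (?R u) v)"
    using norm_triangle_ineq[of "L2_inner (?R v) u" "L2_inner (?R u) v"] by simp
  also have "\<dots> \<le> L2_norm (?R v) * L2_norm u + L2_norm (?R u) * L2_norm v"
    by (intro add_mono L2_Cauchy_Schwarz Ru Rv D(1,2))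
  also have "\<dots> \<le> L2_norm v * L2_norm u + L2_norm u * L2_norm v"
    by (intro add_mono mult_right_mono nR D(1,2) L2_norm_nonneg)
  finally show ?thesis by (simp add: norm_mult power2_eq_square algebra_simps)
qed

section \<open>The domain and the action of the operator\<close>

lemma has_weak_deriv_piece:
  assumes "primitive_on {0..} v1 w" "primitive_on {..0} v2 w"
  shows "has_weak_deriv (- {0}) (piece v1 v2) w" "primitive_on {0<..} (piece v1 v2) w" "primitive_on {..<0} (piece v1 v2) w"
proof -
  show r: "primitive_on {0<..} (piece v1 v2) w"
    by (rule primitive_on_cong[OF primitive_on_subset[OF assms(1), of "{0<..}"]]) (auto simp: piece_def is_interval_oi)
  show l: "primitive_on {..<0} (piece v1 v2) w"
    by (rule primitive_on_cong[OF primitive_on_subset[OF assms(2), of "{..<0}"]]) (auto simp: piece_def is_interval_io)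
  show "has_weak_deriv (- {0}) (piece v1 v2) w" by (rule punctured_weak_deriv[OF r l])
qed

lemma AE_eq_sym: "(AE x in M. f x = g x) \<Longrightarrow> (AE x in M. g x = f x)"
  by (erule AE_mp) simp

lemma H2_rep_wderiv_subset:
  assumes "H2_rep \<phi> u v1 v2 w" "open S"
  shows "AE x in lebesgue_on S. wderiv S \<phi> x = piece v1 v2 x" "has_weak_deriv S \<phi> (piece v1 v2)"
proof -
  show h: "has_weak_deriv S \<phi> (piece v1 v2)"
    by (rule has_weak_deriv_subset[OF H1_repD(6)[OF H2_repD(1)[OF assms(1)]]]) (use assms in auto)
  show "AE x in lebesgue_on S. wderiv S \<phi> x = piece v1 v2 x" by (rule wderiv_ae(2)[OF h assms(2)])
qed

text \<open>On the open half-lines v1 and v2 are the continuous representatives of the weak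
  derivative. As primitives on the closed half-lines they are continuous up to 0, so the limits in
  the definitions exist and are their values there.\<close>

lemma H2_rep_deriv0:
  assumes "H2_rep \<phi> u v1 v2 w" shows "deriv_right0 \<phi> = v1 0" "deriv_left0 \<phi> = v2 0"
proof -
  note D = H2_repD[OF assms]
  have eqr: "cont_rep {0<..} (wderiv {0<..} \<phi>) x = v1 x" if "x > 0" for x
  proof (rule cont_rep_eq)
    show "continuous_on {0<..} v1" by (rule primitive_on_continuous_open[OF primitive_on_subset[OF D(3)]]) auto
    have "v1 x = piece v1 v2 x" if "x \<in> {0<..}" for x using that by (simp add: piece_def)
    then have "AE x in lebesgue_on {0<..}. v1 x = piece v1 v2 x" by (intro AE_I2) simp
    with H2_rep_wderiv_subset(1)[OF assms open_greaterThan[of 0]]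
    show "AE x in lebesgue_on {0<..}. v1 x = wderiv {0<..} \<phi> x" by eventually_elim simp
  qed (use that in auto)
  have "continuous_on {0..1} v1" by (rule primitive_on_continuous_Icc[OF primitive_on_subset[OF D(3)]]) auto
  then have "(v1 \<longlongrightarrow> v1 0) (at_right 0)" by (rule continuous_on_Icc_at_rightD) simp
  moreover have "\<forall>\<^sub>F x in at_right 0. v1 x = cont_rep {0<..} (wderiv {0<..} \<phi>) x"
    unfolding eventually_at_filter by (rule always_eventually) (simp add: eqr)
  ultimately have "(cont_rep {0<..} (wderiv {0<..} \<phi>) \<longlongrightarrow> v1 0) (at_right 0)" by (rule Lim_transform_eventually)
  then show "deriv_right0 \<phi> = v1 0" unfolding deriv_right0_def by (rule tendsto_Lim[rotated]) simp
  have eql: "cont_rep {..<0} (wderiv {..<0} \<phi>) x = v2 x" if "x < 0" for x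
  proof (rule cont_rep_eq)
    show "continuous_on {..<0} v2" by (rule primitive_on_continuous_open[OF primitive_on_subset[OF D(4)]]) auto
    have "v2 x = piece v1 v2 x" if "x \<in> {..<0}" for x using that by (simp add: piece_def)
    then have "AE x in lebesgue_on {..<0}. v2 x = piece v1 v2 x" by (intro AE_I2) simp
    with H2_rep_wderiv_subset(1)[OF assms open_lessThan[of 0]]
    show "AE x in lebesgue_on {..<0}. v2 x = wderiv {..<0} \<phi> x" by eventually_elim simp
  qed (use that in auto)
  have "continuous_on {-1..0} v2" by (rule primitive_on_continuous_Icc[OF primitive_on_subset[OF D(4)]]) auto
  then have "(v2 \<longlongrightarrow> v2 0) (at_left 0)" by (rule continuous_on_Icc_at_leftD) simp
  moreover have "\<forall>\<^sub>F x in at_left 0. v2 x = cont_rep {..<0} (wderiv {..<0} \<phi>) x"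
    unfolding eventually_at_filter by (rule always_eventually) (simp add: eql)
  ultimately have "(cont_rep {..<0} (wderiv {..<0} \<phi>) \<longlongrightarrow> v2 0) (at_left 0)" by (rule Lim_transform_eventually)
  then show "deriv_left0 \<phi> = v2 0" unfolding deriv_left0_def by (rule tendsto_Lim[rotated]) simp
qed

lemma H2_rep_H2:
  assumes "H2_rep \<phi> u v1 v2 w" shows "\<phi> \<in> H2 {..<0}" "\<phi> \<in> H2 {0<..}"
proof -
  note D = H2_repD[OF assms] and P = has_weak_deriv_piece[OF H2_repD(3,4)[OF assms]]
  have v: "piece v1 v2 \<in> L2 UNIV" and p: "\<phi> \<in> L2 UNIV" by (rule H1_repD(2)[OF D(1)], rule H1_repD(5)[OF D(1)])
  have *: "\<phi> \<in> H2 S" if S: "open S" "S \<subseteq> - {0}" for S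
  proof -
    have m: "S \<in> sets lebesgue" by (rule open_sets_lebesgue[OF S(1)])
    have "has_weak_deriv S (piece v1 v2) w"
      by (rule has_weak_deriv_subset[OF P(1) S(2) _ S(1)]) (simp add: open_Compl)
    then have "piece v1 v2 \<in> H1 S" using L2_subset[OF v m] L2_subset[OF D(2) m] unfolding H1_def by blast
    then show ?thesis using L2_subset[OF p m] H2_rep_wderiv_subset(2)[OF assms S(1)] unfolding H2_def by blast
  qed
  show "\<phi> \<in> H2 {..<0}" "\<phi> \<in> H2 {0<..}" by (rule *; auto)+
qed

text \<open>On each half-line the weak derivative of \<phi> is itself weakly differentiable with
  derivative in L2. Its primitive extends to the closed half-line, and the two extensions together
  agree almost everywhere with the derivative of \<phi> on the whole line.\<close>

lemma H2_rep_exists: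
  assumes "\<phi> \<in> H1 UNIV" "\<phi> \<in> H2 {..<0}" "\<phi> \<in> H2 {0<..}"
  shows "\<exists>u v1 v2 w. H2_rep \<phi> u v1 v2 w"
proof -
  obtain u p where up: "H1_rep \<phi> u p" using assms(1) H1_iff by blast
  note U = H1_repD[OF up]
  have half: "\<exists>y w. w \<in> L2 S \<and> primitive_on S y w \<and> (AE x in lebesgue_on S. p x = y x)"
    if S: "open S" "is_interval S" "S \<noteq> {}" and H: "\<phi> \<in> H2 S" for S
  proof -
    obtain g w where g: "w \<in> L2 S" "has_weak_deriv S \<phi> g" "has_weak_deriv S g w"
      using H unfolding H2_def H1_def by blast
    have "has_weak_deriv S \<phi> p" by (rule has_weak_deriv_subset[OF U(6)]) (use S in auto)
    then have pg: "AE x in lebesgue_on S. p x = g x" by (rule has_weak_deriv_unique[OF _ g(2) S(1)])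
    obtain y where y: "primitive_on S y w" "AE x in lebesgue_on S. g x = y x"
      using weak_deriv_imp_prim[OF g(3) S] by blast
    have "AE x in lebesgue_on S. p x = y x" using pg y(2) by eventually_elim simp
    then show ?thesis using g(1) y(1) by blast
  qed
  obtain y1 w1 where 1: "w1 \<in> L2 {0<..}" "primitive_on {0<..} y1 w1" "AE x in lebesgue_on {0<..}. p x = y1 x"
    using half[of "{0<..}"] assms(3) by (auto simp: is_interval_oi)
  obtain y2 w2 where 2: "w2 \<in> L2 {..<0}" "primitive_on {..<0} y2 w2" "AE x in lebesgue_on {..<0}. p x = y2 x"
    using half[of "{..<0}"] assms(2) by (auto simp: is_interval_io lt_ex)
  define w where "w = piece w1 w2"
  have w: "w \<in> L2 UNIV" unfolding w_def by (rule piece_L2[OF 1(1) 2(1)])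
  have "primitive_on {0<..} y1 w" by (rule primitive_on_cong[OF 1(2)]) (auto simp: w_def piece_def is_interval_oi)
  then obtain v1 where v1: "primitive_on {0..} v1 w" "\<forall>x\<in>{0<..}. v1 x = y1 x"
    using primitive_on_extend[of "{0<..}" y1 w "{0..}" 1] w by (auto simp: is_interval_ci subset_iff)
  have "primitive_on {..<0} y2 w" by (rule primitive_on_cong[OF 2(2)]) (auto simp: w_def piece_def is_interval_io)
  then obtain v2 where v2: "primitive_on {..0} v2 w" "\<forall>x\<in>{..<0}. v2 x = y2 x"
    using primitive_on_extend[of "{..<0}" y2 w "{..0}" "-1"] w by (auto simp: is_interval_ic subset_iff)
  have N1: "negligible {x \<in> {0<..}. p x \<noteq> y1 x}" and N2: "negligible {x \<in> {..<0}. p x \<noteq> y2 x}"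
    using 1(3) 2(3) by (simp_all only: AE_lebesgue_on_iff_negligible open_sets_lebesgue open_greaterThan open_lessThan)
  have "negligible ({0} \<union> ({x \<in> {0<..}. p x \<noteq> y1 x} \<union> {x \<in> {..<0}. p x \<noteq> y2 x}))"
    by (intro negligible_Un N1 N2) simp
  then have N: "negligible {x. p x \<noteq> piece v1 v2 x}"
  proof (rule negligible_subset, intro subsetI)
    fix x assume "x \<in> {x. p x \<noteq> piece v1 v2 x}"
    then have x: "p x \<noteq> piece v1 v2 x" by simp
    consider "x = 0" | "x > 0" | "x < 0" by linarith
    then show "x \<in> {0} \<union> ({x \<in> {0<..}. p x \<noteq> y1 x} \<union> {x \<in> {..<0}. p x \<noteq> y2 x})"
      using x v1(2) v2(2) by cases (auto simp: piece_def)
  qed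
  have e: "eq_ae p (piece v1 v2)" using N by (simp only: AE_lebesgue_iff_negligible)
  have "primitive_on UNIV u (piece v1 v2)" by (rule primitive_on_cong[OF U(3)]) (use N in auto)
  then have "H1_rep \<phi> u (piece v1 v2)"
    unfolding H1_rep_def using U L2_cong_ae[OF U(2) e] by blast
  then show ?thesis using w v1(1) v2(1) unfolding H2_rep_def by blast
qed

lemma H2_rep_H1: "H2_rep \<phi> u v1 v2 w \<Longrightarrow> \<phi> \<in> H1 UNIV"
  using H2_repD(1) H1_iff by blast

text \<open>This trades the choices and limits in \<open>L_dom\<close> for explicit representatives
  that satisfy the jump condition.\<close>

lemma L_dom_iff:
  "\<phi> \<in> L_dom \<alpha> k \<longleftrightarrow> (\<exists>u v1 v2 w. H2_rep \<phi> u v1 v2 w \<and> v1 0 - v2 0 = - of_real ((real k)\<^sup>2 * \<alpha>) * u 0)"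
proof
  assume a: "\<phi> \<in> L_dom \<alpha> k"
  then obtain u v1 v2 w where r: "H2_rep \<phi> u v1 v2 w" using H2_rep_exists unfolding L_dom_def by blast
  have "v1 0 - v2 0 = - of_real ((real k)\<^sup>2 * \<alpha>) * u 0"
    using a unfolding L_dom_def by (simp add: H2_rep_deriv0[OF r] H1_rep_cont_rep[OF H2_repD(1)[OF r]])
  then show "\<exists>u v1 v2 w. H2_rep \<phi> u v1 v2 w \<and> v1 0 - v2 0 = - of_real ((real k)\<^sup>2 * \<alpha>) * u 0" using r by blast
next
  assume "\<exists>u v1 v2 w. H2_rep \<phi> u v1 v2 w \<and> v1 0 - v2 0 = - of_real ((real k)\<^sup>2 * \<alpha>) * u 0"
  then obtain u v1 v2 w where r: "H2_rep \<phi> u v1 v2 w" and j: "v1 0 - v2 0 = - of_real ((real k)\<^sup>2 * \<alpha>) * u 0" by blast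
  show "\<phi> \<in> L_dom \<alpha> k"
    unfolding L_dom_def using H2_rep_H1[OF r] H2_rep_H2[OF r] j
    by (simp add: H2_rep_deriv0[OF r] H1_rep_cont_rep[OF H2_repD(1)[OF r]])
qed

lemma H2_rep_add:
  assumes "H2_rep \<phi> u v1 v2 w" "H2_rep \<psi> y z1 z2 q"
  shows "H2_rep (\<lambda>x. \<phi> x + \<psi> x) (\<lambda>x. u x + y x) (\<lambda>x. v1 x + z1 x) (\<lambda>x. v2 x + z2 x) (\<lambda>x. w x + q x)"
proof -
  have e: "piece (\<lambda>x. v1 x + z1 x) (\<lambda>x. v2 x + z2 x) = (\<lambda>x. piece v1 v2 x + piece z1 z2 x)" by (auto simp: piece_def)
  show ?thesis unfolding H2_rep_def e
    by (intro conjI H1_rep_add L2_add primitive_on_add H2_repD[OF assms(1)] H2_repD[OF assms(2)])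
qed

lemma H2_rep_scale:
  assumes "H2_rep \<phi> u v1 v2 w"
  shows "H2_rep (\<lambda>x. c * \<phi> x) (\<lambda>x. c * u x) (\<lambda>x. c * v1 x) (\<lambda>x. c * v2 x) (\<lambda>x. c * w x)"
proof -
  have e: "piece (\<lambda>x. c * v1 x) (\<lambda>x. c * v2 x) = (\<lambda>x. c * piece v1 v2 x)" by (auto simp: piece_def)
  show ?thesis unfolding H2_rep_def e
    by (intro conjI H1_rep_scale L2_scale primitive_on_scale H2_repD[OF assms(1)])
qed

lemma H2_rep_cong:
  assumes "H2_rep \<phi> u v1 v2 w" "eq_ae \<psi> \<phi>" shows "H2_rep \<psi> u v1 v2 w"
proof -
  have "eq_ae \<psi> u" using assms(2) H1_repD(4)[OF H2_repD(1)[OF assms(1)]] by eventually_elim simp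
  then show ?thesis using assms(1) unfolding H2_rep_def H1_rep_def by blast
qed

definition pot :: "real \<Rightarrow> real \<Rightarrow> nat \<Rightarrow> real \<Rightarrow> real \<Rightarrow> real" where
  "pot b \<beta> k lam y = (real k)\<^sup>2 * (1 - lam * V0 b y - \<beta> * indicator {y. \<bar>y\<bar> < b} y)"

lemma pot_cases: "pot b \<beta> k lam y = (if \<bar>y\<bar> < b then (real k)\<^sup>2 * (1 - \<beta>) else (real k)\<^sup>2 * (1 - lam))"
  by (simp add: pot_def V0_def)

lemma pot_measurable: "(\<lambda>y. complex_of_real (pot b \<beta> k lam y)) \<in> borel_measurable lebesgue"
proof -
  have "{y::real. \<bar>y\<bar> < b} = {-b<..<b}" by auto
  then have "{y::real. \<bar>y\<bar> < b} \<in> sets borel" by simp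
  then have "(\<lambda>y. complex_of_real (pot b \<beta> k lam y)) \<in> borel_measurable borel"
    unfolding pot_cases by measurable
  then show ?thesis by (simp add: measurable_completion)
qed

lemma pot_bound: "cmod (complex_of_real (pot b \<beta> k lam y)) \<le> (real k)\<^sup>2 * (\<bar>1 - \<beta>\<bar> + \<bar>1 - lam\<bar>)"
  unfolding norm_of_real pot_cases by (auto simp: abs_mult intro!: mult_left_mono)

text \<open>The inner \<open>wderiv\<close> is known only almost everywhere, which suffices because
  weak derivatives ignore null sets; the point 0 is null as well.\<close>

lemma L_op_ae:
  assumes "H2_rep \<phi> u v1 v2 w"
  shows "AE y in lebesgue. L_op b \<beta> k lam \<phi> y = - w y + of_real (pot b \<beta> k lam y) * u y"
proof -
  note D = H2_repD[OF assms] and P = has_weak_deriv_piece[OF H2_repD(3,4)[OF assms]]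
  have op: "open (- {0::real})" by (simp add: open_Compl)
  let ?q = "wderiv (- {0}) \<phi>"
  have q: "AE x in lebesgue_on (- {0}). ?q x = piece v1 v2 x" by (rule H2_rep_wderiv_subset(1)[OF assms op])
  have "has_weak_deriv (- {0}) ?q w"
    by (rule has_weak_deriv_cong[OF P(1) op AE_eq_sym[OF q]]) simp
  then have "AE x in lebesgue_on (- {0}). wderiv (- {0}) ?q x = w x" by (rule wderiv_ae(2)[OF _ op])
  then have "AE x in lebesgue. wderiv (- {0}) ?q x = w x" by (rule AE_punctured)
  then show ?thesis using H1_repD(4)[OF D(1)]
    by eventually_elim (simp add: L_op_def pot_def)
qed

section \<open>Self-adjointness and resolvent sets\<close>

lemma L2_inner_tendsto:
  assumes "a \<in> L2 UNIV" "v \<in> L2 UNIV" "\<And>n. X n \<in> L2 UNIV" "(\<lambda>n. L2_norm (\<lambda>x. X n x - v x)) \<longlonglongrightarrow> 0"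
  shows "(\<lambda>n. L2_inner a (X n)) \<longlonglongrightarrow> L2_inner a v"
proof -
  have "(\<lambda>n. L2_inner a (X n) - L2_inner a v) \<longlonglongrightarrow> 0"
  proof (rule Lim_null_comparison)
    show "(\<lambda>n. L2_norm a * L2_norm (\<lambda>x. X n x - v x)) \<longlonglongrightarrow> 0"
      using tendsto_mult[OF tendsto_const[of "L2_norm a"] assms(4)] by simp
    have "norm (L2_inner a (X n) - L2_inner a v) \<le> L2_norm a * L2_norm (\<lambda>x. X n x - v x)" for n
      using L2_Cauchy_Schwarz[OF assms(1) L2_diff[OF assms(3)[of n] assms(2)]]
      by (simp only: L2.ip_diff_right[OF assms(3) assms(2) assms(1)])
    then show "\<forall>\<^sub>F n in sequentially. norm (L2_inner a (X n) - L2_inner a v) \<le> L2_norm a * L2_norm (\<lambda>x. X n x - v x)"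
      by (simp add: always_eventually)
  qed
  then show ?thesis by (simp add: LIM_zero_iff)
qed

lemma L2_complete_seq:
  assumes "\<And>n. X n \<in> L2 UNIV" "\<And>e. e > 0 \<Longrightarrow> \<exists>N. \<forall>m\<ge>N. \<forall>n\<ge>N. (L2_norm (\<lambda>x. X m x - X n x))\<^sup>2 < e"
  shows "\<exists>v\<in>L2 UNIV. (\<lambda>n. L2_norm (\<lambda>x. X n x - v x)) \<longlonglongrightarrow> 0"
proof -
  obtain v where v: "v \<in> L2 UNIV" "(\<lambda>n. L2.nsq (\<lambda>x. X n x - v x)) \<longlonglongrightarrow> 0"
    using L2_complete assms unfolding L2.complete_def L2_nsq by blast
  from tendsto_real_sqrt[OF v(2)] show ?thesis using v(1) by (intro bexI[of _ v]) (simp_all add: L2_sqrt_nsq)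
qed

lemma Cauchy_bound:
  assumes "\<And>e::real. e > 0 \<Longrightarrow> \<exists>N::nat. \<forall>m\<ge>N. \<forall>n\<ge>N. a m n < e" "\<And>m n. b m n \<le> K * a m n" "K > 0" "e > 0"
  shows "\<exists>N::nat. \<forall>m\<ge>N. \<forall>n\<ge>N. b m n < e"
proof -
  obtain N where N: "\<And>m n. m \<ge> N \<Longrightarrow> n \<ge> N \<Longrightarrow> a m n < e / K" using assms(1)[of "e / K"] assms(3,4) by auto
  have "b m n < e" if "m \<ge> N" "n \<ge> N" for m n
    using assms(2)[of m n] N[OF that] assms(3) by (simp add: pos_less_divide_eq mult.commute)
  then show ?thesis by blast
qed

lemma L2_operatorD:
  assumes "L2_operator D T"
  shows "\<phi> \<in> D \<Longrightarrow> \<phi> \<in> L2 UNIV" "\<phi> \<in> D \<Longrightarrow> T \<phi> \<in> L2 UNIV" "(\<lambda>x. 0) \<in> D"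
    "\<phi> \<in> D \<Longrightarrow> \<psi> \<in> D \<Longrightarrow> (\<lambda>x. \<phi> x + \<psi> x) \<in> D" "\<phi> \<in> D \<Longrightarrow> \<psi> \<in> D \<Longrightarrow> eq_ae (T (\<lambda>x. \<phi> x + \<psi> x)) (\<lambda>x. T \<phi> x + T \<psi> x)"
    "\<phi> \<in> D \<Longrightarrow> (\<lambda>x. c * \<phi> x) \<in> D" "\<phi> \<in> D \<Longrightarrow> eq_ae (T (\<lambda>x. c * \<phi> x)) (\<lambda>x. c * T \<phi> x)"
    "\<phi> \<in> D \<Longrightarrow> eq_ae \<psi> \<phi> \<Longrightarrow> \<psi> \<in> D" "\<phi> \<in> D \<Longrightarrow> eq_ae \<psi> \<phi> \<Longrightarrow> eq_ae (T \<psi>) (T \<phi>)"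
  using assms unfolding L2_operator_def by blast+

lemma L2_operator_zero:
  assumes "L2_operator D T" "eq_ae \<phi> (\<lambda>x. 0)" shows "eq_ae (T \<phi>) (\<lambda>x. 0)"
proof -
  have "eq_ae (T (\<lambda>x. 0 * 0)) (\<lambda>x. 0 * T (\<lambda>x. 0) x)"
    by (rule L2_operatorD(7)[OF assms(1) L2_operatorD(3)[OF assms(1)]])
  then have "eq_ae (T (\<lambda>x. 0)) (\<lambda>x. 0)" by simp
  moreover have "eq_ae (T \<phi>) (T (\<lambda>x. 0))"
    by (rule L2_operatorD(9)[OF assms(1) L2_operatorD(3)[OF assms(1)] assms(2)])
  ultimately show ?thesis by eventually_elim simp
qed

lemma L2_mult_real_symmetric:
  "L2_inner (\<lambda>x. of_real (Q x) * \<phi> x) \<psi> = L2_inner \<phi> (\<lambda>x. of_real (Q x) * \<psi> x)"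
  unfolding L2_inner_def by (simp add: mult_ac)

text \<open>S = T - Q is symmetric and maps onto L2. If (\<psi>, h) is in the adjoint graph, solve S
  \<xi> = h - Q \<psi>; then \<psi> - \<xi> is orthogonal to the range of S, that is to all of L2,
  so \<psi> = \<xi> almost everywhere and \<psi> lies in D. Density of D comes out of the same
  orthogonality.\<close>

theorem self_adjointI:
  assumes op: "L2_operator D T"
    and sym: "\<And>\<phi> \<psi>. \<phi> \<in> D \<Longrightarrow> \<psi> \<in> D \<Longrightarrow> L2_inner (T \<phi>) \<psi> = L2_inner \<phi> (T \<psi>)"
    and Q: "(\<lambda>x. complex_of_real (Q x)) \<in> borel_measurable lebesgue" "\<And>x. cmod (complex_of_real (Q x)) \<le> B"
    and surj: "\<And>f. f \<in> L2 UNIV \<Longrightarrow> \<exists>\<phi>\<in>D. eq_ae (\<lambda>x. T \<phi> x - of_real (Q x) * \<phi> x) f"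
  shows "self_adjoint D T"
proof -
  note O = L2_operatorD[OF op]
  let ?Q = "\<lambda>\<phi> x. complex_of_real (Q x) * \<phi> x"
  let ?S = "\<lambda>\<phi> x. T \<phi> x - complex_of_real (Q x) * \<phi> x"
  have QL: "?Q \<phi> \<in> L2 UNIV" if "\<phi> \<in> L2 UNIV" for \<phi> by (rule L2_mult_bounded[OF that Q])
  have SL: "?S \<phi> \<in> L2 UNIV" if "\<phi> \<in> D" for \<phi> by (intro L2_diff QL O(1,2) that)
  have Sip: "L2_inner (?S \<phi>) \<psi> = L2_inner (T \<phi>) \<psi> - L2_inner \<phi> (?Q \<psi>)" if "\<phi> \<in> D" "\<psi> \<in> L2 UNIV" for \<phi> \<psi>
    using L2.ip_diff_left[OF O(2)[OF that(1)] QL[OF O(1)[OF that(1)]] that(2)]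
    by (simp only: L2_mult_real_symmetric)
  have Ssym: "L2_inner (?S \<phi>) \<psi> = L2_inner \<phi> (?S \<psi>)" if "\<phi> \<in> D" "\<psi> \<in> D" for \<phi> \<psi>
    unfolding Sip[OF that(1) O(1)[OF that(2)]] sym[OF that]
    using L2.ip_diff_right[OF O(2)[OF that(2)] QL[OF O(1)[OF that(2)]] O(1)[OF that(1)]] by simp
  have ort: "eq_ae g (\<lambda>x. 0)" if g: "g \<in> L2 UNIV" and z: "\<And>\<phi>. \<phi> \<in> D \<Longrightarrow> L2_inner (?S \<phi>) g = 0" for g
  proof -
    obtain \<phi> where \<phi>: "\<phi> \<in> D" "eq_ae (?S \<phi>) g" using surj[OF g] by blast
    have "L2_inner g g = L2_inner (?S \<phi>) g"
      by (rule L2_inner_cong[OF g g AE_eq_sym[OF \<phi>(2)]]) simp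
    then have "L2_norm g = 0" using z[OF \<phi>(1)] by (simp add: L2_inner_self_norm)
    then show ?thesis using L2_norm_eq_0_iff[OF g] by simp
  qed
  have adj: "adjoint_graph (op_graph D T) = op_graph D T"
  proof (intro equalityI subsetI)
    fix p assume "p \<in> adjoint_graph (op_graph D T)"
    then obtain \<psi> h where p: "p = (\<psi>, h)" and \<psi>: "\<psi> \<in> L2 UNIV" and h: "h \<in> L2 UNIV"
      and a: "\<forall>(\<phi>, f)\<in>op_graph D T. L2_inner f \<psi> = L2_inner \<phi> h"
      unfolding adjoint_graph_def by (cases p) simp
    have a': "L2_inner (T \<phi>) \<psi> = L2_inner \<phi> h" if "\<phi> \<in> D" for \<phi>
      using bspec[OF a, of "(\<phi>, T \<phi>)"] that O(2)[OF that] by (simp add: op_graph_def)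
    have hQ: "(\<lambda>x. h x - ?Q \<psi> x) \<in> L2 UNIV" by (intro L2_diff h QL \<psi>)
    obtain \<xi> where \<xi>: "\<xi> \<in> D" "eq_ae (?S \<xi>) (\<lambda>x. h x - ?Q \<psi> x)" using surj[OF hQ] by blast
    have d: "(\<lambda>x. \<psi> x - \<xi> x) \<in> L2 UNIV" by (intro L2_diff \<psi> O(1) \<xi>(1))
    have "eq_ae (\<lambda>x. \<psi> x - \<xi> x) (\<lambda>x. 0)"
    proof (rule ort[OF d])
      fix \<phi> assume \<phi>: "\<phi> \<in> D"
      have "L2_inner (?S \<phi>) \<psi> = L2_inner \<phi> h - L2_inner \<phi> (?Q \<psi>)" by (simp only: Sip[OF \<phi> \<psi>] a'[OF \<phi>])
      also have "\<dots> = L2_inner \<phi> (\<lambda>x. h x - ?Q \<psi> x)"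
        by (rule L2.ip_diff_right[OF h QL[OF \<psi>] O(1)[OF \<phi>], symmetric])
      also have "\<dots> = L2_inner \<phi> (?S \<xi>)"
        by (rule L2_inner_cong[OF O(1)[OF \<phi>] hQ _ AE_eq_sym[OF \<xi>(2)]]) simp
      also have "\<dots> = L2_inner (?S \<phi>) \<xi>" by (rule Ssym[OF \<phi> \<xi>(1), symmetric])
      finally show "L2_inner (?S \<phi>) (\<lambda>x. \<psi> x - \<xi> x) = 0"
        using L2.ip_diff_right[OF \<psi> O(1)[OF \<xi>(1)] SL[OF \<phi>]] by simp
    qed
    then have e: "eq_ae \<psi> \<xi>" by eventually_elim simp
    have "eq_ae (T \<psi>) h"
      using O(9)[OF \<xi>(1) e] \<xi>(2) e by eventually_elim (simp add: algebra_simps)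
    then show "p \<in> op_graph D T" using O(8)[OF \<xi>(1) e] h p by (simp add: op_graph_def)
  next
    fix p assume "p \<in> op_graph D T"
    then obtain \<psi> h where p: "p = (\<psi>, h)" and \<psi>: "\<psi> \<in> D" and h: "h \<in> L2 UNIV" and e: "eq_ae (T \<psi>) h"
      unfolding op_graph_def by blast
    have "L2_inner f \<psi> = L2_inner \<phi> h" if \<phi>: "\<phi> \<in> D" and f: "f \<in> L2 UNIV" and ef: "eq_ae (T \<phi>) f" for \<phi> f
    proof -
      have "L2_inner f \<psi> = L2_inner (T \<phi>) \<psi>" by (rule L2_inner_cong[OF f O(1)[OF \<psi>] AE_eq_sym[OF ef]]) simp
      also have "\<dots> = L2_inner \<phi> (T \<psi>)" by (rule sym[OF \<phi> \<psi>])
      also have "\<dots> = L2_inner \<phi> h" by (rule L2_inner_cong[OF O(1)[OF \<phi>] O(2)[OF \<psi>] _ e]) simp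
      finally show ?thesis .
    qed
    then show "p \<in> adjoint_graph (op_graph D T)"
      unfolding p adjoint_graph_def op_graph_def using O(1)[OF \<psi>] h by auto
  qed
  have dense: "densely_defined D"
  proof -
    \<comment> \<open>The L2-closure of D. Riesz' theorem in V provides the orthogonal projection v
      of f.\<close>
    define V where "V = {v \<in> L2 UNIV. \<forall>e>0. \<exists>\<phi>\<in>D. L2_norm (\<lambda>x. v x - \<phi> x) < e}"
    have VL: "v \<in> L2 UNIV" if "v \<in> V" for v using that by (simp add: V_def)
    have VD: "\<exists>\<phi>\<in>D. L2_norm (\<lambda>x. v x - \<phi> x) < e" if "v \<in> V" "e > 0" for v e
      using that unfolding V_def by simp
    have DV: "\<phi> \<in> V" if "\<phi> \<in> D" for \<phi>
      unfolding V_def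
    proof (intro CollectI conjI allI impI)
      show "\<phi> \<in> L2 UNIV" by (rule O(1)[OF that])
      fix e :: real assume "e > 0"
      then have "L2_norm (\<lambda>x. \<phi> x - \<phi> x) < e" by (simp add: L2_norm_def)
      then show "\<exists>\<psi>\<in>D. L2_norm (\<lambda>x. \<phi> x - \<psi> x) < e" using that by (rule bexI)
    qed
    interpret V: semi_inner_space V L2_inner
    proof
      show "(\<lambda>x. 0) \<in> V" by (rule DV[OF O(3)])
      show "(\<lambda>x. f x + g x) \<in> V" if fg: "f \<in> V" "g \<in> V" for f g
        unfolding V_def
      proof (intro CollectI conjI allI impI)
        show "(\<lambda>x. f x + g x) \<in> L2 UNIV" by (intro L2_add VL fg)
        fix e :: real assume "e > 0"
        then have e2: "e / 2 > 0" by simp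
        obtain \<phi> where \<phi>: "\<phi> \<in> D" "L2_norm (\<lambda>x. f x - \<phi> x) < e / 2" using VD[OF fg(1) e2] ..
        obtain \<psi> where \<psi>: "\<psi> \<in> D" "L2_norm (\<lambda>x. g x - \<psi> x) < e / 2" using VD[OF fg(2) e2] ..
        have "L2_norm (\<lambda>x. f x + g x - (\<phi> x + \<psi> x)) = L2_norm (\<lambda>x. (f x - \<phi> x) + (g x - \<psi> x))"
          by (simp add: algebra_simps)
        also have "\<dots> \<le> L2_norm (\<lambda>x. f x - \<phi> x) + L2_norm (\<lambda>x. g x - \<psi> x)"
          by (intro L2_norm_triangle L2_diff VL[OF fg(1)] VL[OF fg(2)] O(1)[OF \<phi>(1)] O(1)[OF \<psi>(1)])
        also have "\<dots> < e" using \<phi> \<psi> by simp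
        finally show "\<exists>\<phi>\<in>D. L2_norm (\<lambda>x. f x + g x - \<phi> x) < e"
          by (rule bexI[OF _ O(4)[OF \<phi>(1) \<psi>(1)]])
      qed
      show "(\<lambda>x. c * f x) \<in> V" if f: "f \<in> V" for f c
        unfolding V_def
      proof (intro CollectI conjI allI impI)
        show "(\<lambda>x. c * f x) \<in> L2 UNIV" by (intro L2_scale VL f)
        fix e :: real assume "e > 0"
        then have e2: "e / (cmod c + 1) > 0" by (simp add: add_nonneg_pos)
        obtain \<phi> where \<phi>: "\<phi> \<in> D" "L2_norm (\<lambda>x. f x - \<phi> x) < e / (cmod c + 1)"
          using VD[OF f e2] ..
        have "L2_norm (\<lambda>x. c * f x - c * \<phi> x) = L2_norm (\<lambda>x. c * (f x - \<phi> x))" by (simp add: algebra_simps)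
        also have "\<dots> = cmod c * L2_norm (\<lambda>x. f x - \<phi> x)" by (intro L2_norm_scale L2_diff VL[OF f] O(1)[OF \<phi>(1)])
        also have "\<dots> \<le> (cmod c + 1) * L2_norm (\<lambda>x. f x - \<phi> x)" by (intro mult_right_mono) (auto simp: L2_norm_nonneg)
        also have "\<dots> < e" using \<phi>(2) by (simp add: pos_less_divide_eq add_nonneg_pos mult.commute)
        finally show "\<exists>\<phi>\<in>D. L2_norm (\<lambda>x. c * f x - \<phi> x) < e" by (rule bexI[OF _ O(6)[OF \<phi>(1)]])
      qed
      show "L2_inner (\<lambda>x. f x + g x) h = L2_inner f h + L2_inner g h" if "f \<in> V" "g \<in> V" "h \<in> V" for f g h
        by (intro L2.ip_add_left VL that)
      show "L2_inner (\<lambda>x. c * f x) h = c * L2_inner f h" if "f \<in> V" "h \<in> V" for c f h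
        by (intro L2.ip_scale_left VL that)
      show "L2_inner g f = cnj (L2_inner f g)" if "f \<in> V" "g \<in> V" for f g
        by (intro L2.ip_commute VL that)
      show "0 \<le> Re (L2_inner f f)" if "f \<in> V" for f by (intro L2.ip_nonneg VL that)
    qed
    have "V.complete"
      unfolding V.complete_def L2_nsq
    proof (intro allI impI, elim conjE)
      fix X :: "nat \<Rightarrow> real \<Rightarrow> complex"
      assume X: "\<forall>n. X n \<in> V" and C: "\<forall>e>0. \<exists>N. \<forall>m\<ge>N. \<forall>n\<ge>N. (L2_norm (\<lambda>x. X m x - X n x))\<^sup>2 < e"
      have XL: "X n \<in> L2 UNIV" for n using X VL by blast
      have C': "\<exists>N. \<forall>m\<ge>N. \<forall>n\<ge>N. (L2_norm (\<lambda>x. X m x - X n x))\<^sup>2 < e" if "e > 0" for e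
        using C that by simp
      obtain v where v: "v \<in> L2 UNIV" "(\<lambda>n. L2_norm (\<lambda>x. X n x - v x)) \<longlonglongrightarrow> 0"
        using L2_complete_seq[OF XL C'] by blast
      have "\<exists>\<phi>\<in>D. L2_norm (\<lambda>x. v x - \<phi> x) < e" if "e > 0" for e
      proof -
        obtain n where n: "L2_norm (\<lambda>x. X n x - v x) < e / 2"
        proof -
          have "\<forall>\<^sub>F n in sequentially. L2_norm (\<lambda>x. X n x - v x) < e / 2"
            by (rule order_tendstoD(2)[OF v(2)]) (use \<open>e > 0\<close> in simp)
          then show thesis using that unfolding eventually_sequentially by blast
        qed
        obtain \<phi> where \<phi>: "\<phi> \<in> D" "L2_norm (\<lambda>x. X n x - \<phi> x) < e / 2"
          using VD[of "X n" "e / 2"] X \<open>e > 0\<close> by auto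
        have "L2_norm (\<lambda>x. v x - \<phi> x) = L2_norm (\<lambda>x. (v x - X n x) + (X n x - \<phi> x))" by simp
        also have "\<dots> \<le> L2_norm (\<lambda>x. v x - X n x) + L2_norm (\<lambda>x. X n x - \<phi> x)"
          by (intro L2_norm_triangle L2_diff v(1) XL O(1)[OF \<phi>(1)])
        also have "\<dots> < e" using n \<phi>(2) by (simp add: L2_norm_minus_commute)
        finally show ?thesis using \<phi>(1) by blast
      qed
      then have "v \<in> V" using v(1) by (simp add: V_def)
      moreover have "(\<lambda>n. (L2_norm (\<lambda>x. X n x - v x))\<^sup>2) \<longlonglongrightarrow> 0"
        using tendsto_power[OF v(2), of 2] by simp
      ultimately show "\<exists>v\<in>V. (\<lambda>n. (L2_norm (\<lambda>x. X n x - v x))\<^sup>2) \<longlonglongrightarrow> 0" by blast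
    qed
    show ?thesis unfolding densely_defined_def
    proof (intro ballI allI impI)
      fix f :: "real \<Rightarrow> complex" and e :: real assume f: "f \<in> L2 UNIV" and "e > 0"
      have "\<exists>v\<in>V. \<forall>\<phi>\<in>V. L2_inner \<phi> f = L2_inner \<phi> v"
      proof (rule V.Riesz_representation[OF \<open>V.complete\<close>])
        show "cmod (L2_inner \<phi> f) \<le> L2_norm f * sqrt (L2.nsq \<phi>)" if "\<phi> \<in> V" for \<phi>
          using L2_Cauchy_Schwarz[OF VL[OF that] f] by (simp add: L2_sqrt_nsq mult.commute)
        show "L2_inner (\<lambda>x. \<phi> x + \<psi> x) f = L2_inner \<phi> f + L2_inner \<psi> f" if "\<phi> \<in> V" "\<psi> \<in> V" for \<phi> \<psi>
          by (rule L2.ip_add_left[OF VL[OF that(1)] VL[OF that(2)] f])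
        show "L2_inner (\<lambda>x. c * \<phi> x) f = c * L2_inner \<phi> f" if "\<phi> \<in> V" for c \<phi>
          by (rule L2.ip_scale_left[OF VL[OF that] f])
      qed
      then obtain v where v: "v \<in> V" "\<And>\<phi>. \<phi> \<in> V \<Longrightarrow> L2_inner \<phi> f = L2_inner \<phi> v" by blast
      let ?g = "\<lambda>x. f x - v x"
      have g: "?g \<in> L2 UNIV" by (intro L2_diff f VL v)
      have g0: "L2_inner \<phi> ?g = 0" if "\<phi> \<in> D" for \<phi>
        using v(2)[OF DV[OF that]] L2.ip_diff_right[OF f VL[OF v(1)] O(1)[OF that]] by simp
      \<comment> \<open>f - v is orthogonal to D and equals S \<xi>. By symmetry \<xi> is orthogonal
        to the range of S, hence null, and so is f - v.\<close>
      obtain \<xi> where \<xi>: "\<xi> \<in> D" "eq_ae (?S \<xi>) ?g" using surj[OF g] by blast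
      have "eq_ae \<xi> (\<lambda>x. 0)"
      proof (rule ort[OF O(1)[OF \<xi>(1)]])
        fix \<phi> assume \<phi>: "\<phi> \<in> D"
        have "L2_inner \<phi> (?S \<xi>) = L2_inner \<phi> ?g"
          by (rule L2_inner_cong[OF O(1)[OF \<phi>] SL[OF \<xi>(1)] _ \<xi>(2)]) simp
        then show "L2_inner (?S \<phi>) \<xi> = 0" using Ssym[OF \<phi> \<xi>(1)] g0[OF \<phi>] by simp
      qed
      then have "eq_ae ?g (\<lambda>x. 0)"
        using \<xi>(2) L2_operator_zero[OF op \<open>eq_ae \<xi> (\<lambda>x. 0)\<close>] by eventually_elim simp
      then have fv: "eq_ae f v" by eventually_elim simp
      obtain \<phi> where \<phi>: "\<phi> \<in> D" "L2_norm (\<lambda>x. v x - \<phi> x) < e" using VD[OF v(1) \<open>e > 0\<close>] ..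
      have "eq_ae (\<lambda>x. f x - \<phi> x) (\<lambda>x. v x - \<phi> x)" using fv by eventually_elim simp
      then have "L2_norm (\<lambda>x. f x - \<phi> x) = L2_norm (\<lambda>x. v x - \<phi> x)"
        by (rule L2_norm_cong[OF L2_diff[OF f O(1)[OF \<phi>(1)]]])
      from ord_eq_less_trans[OF this \<phi>(2)] show "\<exists>\<phi>\<in>D. L2_norm (\<lambda>x. f x - \<phi> x) < e"
        using \<phi>(1) by (rule bexI)
    qed
  qed
  show ?thesis unfolding self_adjoint_def using op adj dense by blast
qed

section \<open>Resolvent points of a self-adjoint operator\<close>

lemma self_adjoint_symmetric:
  assumes "self_adjoint D T" "\<phi> \<in> D" "\<psi> \<in> D" shows "L2_inner (T \<phi>) \<psi> = L2_inner \<phi> (T \<psi>)"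
proof -
  have O: "L2_operator D T" using assms(1) by (simp add: self_adjoint_def)
  have "(\<psi>, T \<psi>) \<in> adjoint_graph (op_graph D T)"
    using assms L2_operatorD(2)[OF O] by (auto simp: self_adjoint_def op_graph_def)
  moreover have "(\<phi>, T \<phi>) \<in> op_graph D T" using assms L2_operatorD(2)[OF O] by (auto simp: op_graph_def)
  ultimately show ?thesis unfolding adjoint_graph_def by blast
qed

lemma self_adjoint_adjoint:
  assumes "self_adjoint D T" "\<psi> \<in> L2 UNIV" "h \<in> L2 UNIV" "\<And>\<phi>. \<phi> \<in> D \<Longrightarrow> L2_inner (T \<phi>) \<psi> = L2_inner \<phi> h"
  shows "\<psi> \<in> D" "eq_ae (T \<psi>) h"
proof -
  have O: "L2_operator D T" and g: "adjoint_graph (op_graph D T) = op_graph D T"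
    using assms(1) by (simp_all add: self_adjoint_def)
  have "L2_inner f \<psi> = L2_inner \<phi> h" if "\<phi> \<in> D" "f \<in> L2 UNIV" "eq_ae (T \<phi>) f" for \<phi> f
    using L2_inner_cong[OF that(2) assms(2) AE_eq_sym[OF that(3)], of \<psi>] assms(4)[OF that(1)] by simp
  then have "(\<psi>, h) \<in> adjoint_graph (op_graph D T)"
    unfolding adjoint_graph_def op_graph_def using assms(2,3) by auto
  then have "(\<psi>, h) \<in> op_graph D T" using g by simp
  then show "\<psi> \<in> D" "eq_ae (T \<psi>) h" by (simp_all add: op_graph_def)
qed

text \<open>Solvability of (T - z) h = f is dual to the lower bound for S = T - cnj z. D with the
  form <S \<phi>, S \<psi>> is complete, Riesz' theorem represents <\<phi>, f> as <S \<phi>, S v>,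
  and h = S v satisfies the adjoint equation, so self-adjointness puts h into D. The bound for T - z
  itself gives injectivity and the bounded inverse.\<close>

theorem self_adjoint_resolventI:
  assumes sa: "self_adjoint D T"
    and b1: "\<And>\<phi>. \<phi> \<in> D \<Longrightarrow> L2_norm \<phi> \<le> C * L2_norm (\<lambda>x. T \<phi> x - z * \<phi> x)"
    and b2: "\<And>\<phi>. \<phi> \<in> D \<Longrightarrow> L2_norm \<phi> \<le> C * L2_norm (\<lambda>x. T \<phi> x - cnj z * \<phi> x)"
  shows "z \<in> resolvent_set D T"
proof -
  have op: "L2_operator D T" using sa by (simp add: self_adjoint_def)
  note O = L2_operatorD[OF op]
  define S where "S \<phi> = (\<lambda>x. T \<phi> x - cnj z * \<phi> x)" for \<phi>
  have SL: "S \<phi> \<in> L2 UNIV" if "\<phi> \<in> D" for \<phi> unfolding S_def by (intro L2_diff L2_scale O(1,2) that)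
  have Sadd: "eq_ae (S (\<lambda>x. \<phi> x + \<psi> x)) (\<lambda>x. S \<phi> x + S \<psi> x)" if "\<phi> \<in> D" "\<psi> \<in> D" for \<phi> \<psi>
    using O(5)[OF that] unfolding S_def by eventually_elim (simp add: algebra_simps)
  have Sscale: "eq_ae (S (\<lambda>x. c * \<phi> x)) (\<lambda>x. c * S \<phi> x)" if "\<phi> \<in> D" for c \<phi>
    using O(7)[OF that, of c] unfolding S_def by eventually_elim (simp add: algebra_simps)
  interpret V: semi_inner_space D "\<lambda>\<phi> \<psi>. L2_inner (S \<phi>) (S \<psi>)"
  proof
    show "L2_inner (S (\<lambda>x. f x + g x)) (S h) = L2_inner (S f) (S h) + L2_inner (S g) (S h)"
      if d: "f \<in> D" "g \<in> D" "h \<in> D" for f g h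
      using L2_inner_cong[OF SL[OF O(4)[OF d(1,2)]] SL[OF d(3)] Sadd[OF d(1,2)], of "S h"] 
        L2.ip_add_left[OF SL[OF d(1)] SL[OF d(2)] SL[OF d(3)]] by simp
    show "L2_inner (S (\<lambda>x. c * f x)) (S h) = c * L2_inner (S f) (S h)" if d: "f \<in> D" "h \<in> D" for c f h
      using L2_inner_cong[OF SL[OF O(6)[OF d(1)]] SL[OF d(2)] Sscale[OF d(1), of c], of "S h"]
        L2.ip_scale_left[OF SL[OF d(1)] SL[OF d(2)]] by simp
    show "L2_inner (S g) (S f) = cnj (L2_inner (S f) (S g))" if "f \<in> D" "g \<in> D" for f g
      by (intro L2.ip_commute SL that)
    show "0 \<le> Re (L2_inner (S f) (S f))" if "f \<in> D" for f by (intro L2.ip_nonneg SL that)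
  qed (fact O(3), rule O(4), assumption+, rule O(6), assumption)
  have Vnsq: "V.nsq \<phi> = (L2_norm (S \<phi>))\<^sup>2" for \<phi> by (simp add: V.nsq_def L2_inner_self_norm)
  have Sdiff: "eq_ae (S (\<lambda>x. \<phi> x - \<psi> x)) (\<lambda>x. S \<phi> x - S \<psi> x)" if d: "\<phi> \<in> D" "\<psi> \<in> D" for \<phi> \<psi>
  proof -
    have "eq_ae (S (\<lambda>x. \<phi> x - \<psi> x)) (\<lambda>x. S \<phi> x + S (\<lambda>x. - \<psi> x) x)" "eq_ae (S (\<lambda>x. - \<psi> x)) (\<lambda>x. - S \<psi> x)"
      using Sadd[OF d(1) O(6)[OF d(2), of "-1"]] Sscale[OF d(2), of "-1"] by simp_all
    then show ?thesis by eventually_elim simp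
  qed
  have nSdiff: "L2_norm (S (\<lambda>x. \<phi> x - \<psi> x)) = L2_norm (\<lambda>x. S \<phi> x - S \<psi> x)" if d: "\<phi> \<in> D" "\<psi> \<in> D" for \<phi> \<psi>
    by (rule L2_norm_cong[OF SL[OF V.diff_mem[OF d]] Sdiff[OF d]])
  \<comment> \<open>By \<open>b2\<close> both X n and S (X n) converge in L2. Self-adjointness makes
    T closed: the limits satisfy the adjoint identity, so v lies in D and S v is the limit of S (X
    n).\<close>
  have "V.complete"
    unfolding V.complete_def Vnsq
  proof (intro allI impI, elim conjE)
    fix X :: "nat \<Rightarrow> real \<Rightarrow> complex"
    assume X0: "\<forall>n. X n \<in> D" and C0: "\<forall>e>0. \<exists>N. \<forall>m\<ge>N. \<forall>n\<ge>N. (L2_norm (S (\<lambda>x. X m x - X n x)))\<^sup>2 < e"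
    have X: "X n \<in> D" for n using X0 by (rule spec)
    have C: "\<exists>N. \<forall>m\<ge>N. \<forall>n\<ge>N. (L2_norm (S (\<lambda>x. X m x - X n x)))\<^sup>2 < e" if "e > 0" for e
      by (rule C0[rule_format, OF that])
    note XL = O(1)[OF X] and SXL = SL[OF X]
    have CX: "\<exists>N. \<forall>m\<ge>N. \<forall>n\<ge>N. (L2_norm (\<lambda>x. X m x - X n x))\<^sup>2 < e" if "e > 0" for e
    proof (rule Cauchy_bound[OF C])
      show "(L2_norm (\<lambda>x. X m x - X n x))\<^sup>2 \<le> (C\<^sup>2 + 1) * (L2_norm (S (\<lambda>x. X m x - X n x)))\<^sup>2" for m n
      proof -
        have "(L2_norm (\<lambda>x. X m x - X n x))\<^sup>2 \<le> (C * L2_norm (S (\<lambda>x. X m x - X n x)))\<^sup>2"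
          using b2[OF V.diff_mem[OF X X], of m n] unfolding S_def by (intro power_mono L2_norm_nonneg)
        also have "\<dots> \<le> (C\<^sup>2 + 1) * (L2_norm (S (\<lambda>x. X m x - X n x)))\<^sup>2"
          by (simp add: power_mult_distrib distrib_right)
        finally show ?thesis .
      qed
      show "C\<^sup>2 + 1 > 0" by (simp add: add_nonneg_pos)
    qed (use that in simp_all)
    obtain v where v: "v \<in> L2 UNIV" "(\<lambda>n. L2_norm (\<lambda>x. X n x - v x)) \<longlonglongrightarrow> 0"
      using L2_complete_seq[OF XL CX] by blast
    have CS: "\<exists>N. \<forall>m\<ge>N. \<forall>n\<ge>N. (L2_norm (\<lambda>x. S (X m) x - S (X n) x))\<^sup>2 < e" if "e > 0" for e
      using C[OF that] by (simp add: nSdiff[OF X X])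
    obtain g where g: "g \<in> L2 UNIV" "(\<lambda>n. L2_norm (\<lambda>x. S (X n) x - g x)) \<longlonglongrightarrow> 0"
      using L2_complete_seq[OF SXL CS] by blast
    let ?h = "\<lambda>x. g x + cnj z * v x"
    have h: "?h \<in> L2 UNIV" by (intro L2_add L2_scale g v)
    have lim: "L2_inner (T \<phi>) v = L2_inner \<phi> ?h" if \<phi>: "\<phi> \<in> D" for \<phi>
    proof (rule LIMSEQ_unique)
      show "(\<lambda>n. L2_inner (T \<phi>) (X n)) \<longlonglongrightarrow> L2_inner (T \<phi>) v"
        by (rule L2_inner_tendsto[OF O(2)[OF \<phi>] v(1) XL v(2)])
      have "L2_inner (T \<phi>) (X n) = L2_inner \<phi> (S (X n)) + z * L2_inner \<phi> (X n)" for n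
      proof -
        have "T (X n) = (\<lambda>x. S (X n) x + cnj z * X n x)" by (simp add: S_def)
        then have "L2_inner \<phi> (T (X n)) = L2_inner \<phi> (S (X n)) + L2_inner \<phi> (\<lambda>x. cnj z * X n x)"
          using L2.ip_add_right[OF SXL[of n] L2_scale[OF XL[of n]] O(1)[OF \<phi>]] by simp
        then show ?thesis
          using self_adjoint_symmetric[OF sa \<phi> X[of n]] L2.ip_scale_right[OF XL[of n] O(1)[OF \<phi>], of "cnj z"] by simp
      qed
      moreover have "(\<lambda>n. L2_inner \<phi> (S (X n)) + z * L2_inner \<phi> (X n)) \<longlonglongrightarrow> L2_inner \<phi> g + z * L2_inner \<phi> v"
        by (intro tendsto_add tendsto_mult tendsto_const L2_inner_tendsto[OF O(1)[OF \<phi>]] g v XL SXL)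
      moreover have "L2_inner \<phi> ?h = L2_inner \<phi> g + z * L2_inner \<phi> v"
        using L2.ip_add_right[OF g(1) L2_scale[OF v(1)] O(1)[OF \<phi>]] L2.ip_scale_right[OF v(1) O(1)[OF \<phi>], of "cnj z"] by simp
      ultimately show "(\<lambda>n. L2_inner (T \<phi>) (X n)) \<longlonglongrightarrow> L2_inner \<phi> ?h" by simp
    qed
    have vD: "v \<in> D" and Tv: "eq_ae (T v) ?h" using self_adjoint_adjoint[OF sa v(1) h lim] by auto
    have Svg: "eq_ae (S v) g" using Tv unfolding S_def by eventually_elim simp
    have "L2_norm (\<lambda>x. S (X n) x - S v x) = L2_norm (\<lambda>x. S (X n) x - g x)" for n
    proof (rule L2_norm_cong[OF L2_diff[OF SXL SL[OF vD]]])
      show "eq_ae (\<lambda>x. S (X n) x - S v x) (\<lambda>x. S (X n) x - g x)" using Svg by eventually_elim simp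
    qed
    then have "(\<lambda>n. (L2_norm (S (\<lambda>x. X n x - v x)))\<^sup>2) \<longlonglongrightarrow> 0"
      using tendsto_power[OF g(2), of 2] by (simp add: nSdiff[OF X vD])
    then show "\<exists>v\<in>D. (\<lambda>n. (L2_norm (S (\<lambda>x. X n x - v x)))\<^sup>2) \<longlonglongrightarrow> 0" using vD by blast
  qed
  have surj: "\<exists>\<phi>\<in>D. eq_ae (\<lambda>x. T \<phi> x - z * \<phi> x) f" if f: "f \<in> L2 UNIV" for f
  proof -
    have "\<exists>v\<in>D. \<forall>\<phi>\<in>D. L2_inner \<phi> f = L2_inner (S \<phi>) (S v)"
    proof (rule V.Riesz_representation[OF \<open>V.complete\<close>])
      show "cmod (L2_inner \<phi> f) \<le> (C * L2_norm f) * sqrt (V.nsq \<phi>)" if "\<phi> \<in> D" for \<phi>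
      proof -
        have "cmod (L2_inner \<phi> f) \<le> L2_norm \<phi> * L2_norm f" by (rule L2_Cauchy_Schwarz[OF O(1)[OF that] f])
        also have "\<dots> \<le> (C * L2_norm (S \<phi>)) * L2_norm f"
          using b2[OF that] unfolding S_def by (intro mult_right_mono L2_norm_nonneg)
        finally show ?thesis by (simp add: Vnsq L2_norm_nonneg mult_ac)
      qed
      show "L2_inner (\<lambda>x. \<phi> x + \<psi> x) f = L2_inner \<phi> f + L2_inner \<psi> f" if "\<phi> \<in> D" "\<psi> \<in> D" for \<phi> \<psi>
        by (rule L2.ip_add_left[OF O(1)[OF that(1)] O(1)[OF that(2)] f])
      show "L2_inner (\<lambda>x. c * \<phi> x) f = c * L2_inner \<phi> f" if "\<phi> \<in> D" for c \<phi>
        by (rule L2.ip_scale_left[OF O(1)[OF that] f])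
    qed
    then obtain v where v: "v \<in> D" "\<And>\<phi>. \<phi> \<in> D \<Longrightarrow> L2_inner \<phi> f = L2_inner (S \<phi>) (S v)" by blast
    let ?h = "S v"
    note h = SL[OF v(1)]
    have k: "(\<lambda>x. f x + z * ?h x) \<in> L2 UNIV" by (intro L2_add L2_scale f h)
    have "L2_inner (T \<phi>) ?h = L2_inner \<phi> (\<lambda>x. f x + z * ?h x)" if \<phi>: "\<phi> \<in> D" for \<phi>
    proof -
      have "L2_inner (S \<phi>) ?h = L2_inner (T \<phi>) ?h - cnj z * L2_inner \<phi> ?h"
        unfolding S_def[of \<phi>] using L2.ip_diff_left[OF O(2)[OF \<phi>] L2_scale[OF O(1)[OF \<phi>]] h]
          L2.ip_scale_left[OF O(1)[OF \<phi>] h] by simp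
      moreover have "L2_inner \<phi> (\<lambda>x. f x + z * ?h x) = L2_inner \<phi> f + cnj z * L2_inner \<phi> ?h"
        using L2.ip_add_right[OF f L2_scale[OF h] O(1)[OF \<phi>]] L2.ip_scale_right[OF h O(1)[OF \<phi>]] by simp
      ultimately show ?thesis using v(2)[OF \<phi>] by (simp add: algebra_simps)
    qed
    from self_adjoint_adjoint[OF sa h k this]
    have hD: "?h \<in> D" and Th: "eq_ae (T ?h) (\<lambda>x. f x + z * ?h x)" by auto
    have "eq_ae (\<lambda>x. T ?h x - z * ?h x) f" using Th by eventually_elim simp
    then show ?thesis using hD by blast
  qed
  have inj: "eq_ae \<phi> (\<lambda>x. 0)" if "\<phi> \<in> D" "eq_ae (\<lambda>x. T \<phi> x - z * \<phi> x) (\<lambda>x. 0)" for \<phi>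
  proof -
    have "(\<lambda>x. T \<phi> x - z * \<phi> x) \<in> L2 UNIV" by (intro L2_diff L2_scale O(1,2) that)
    then have "L2_norm (\<lambda>x. T \<phi> x - z * \<phi> x) = 0" using L2_norm_eq_0_iff that(2) by blast
    then have "L2_norm \<phi> = 0" using b1[OF that(1)] L2_norm_nonneg[of \<phi>] by simp
    then show ?thesis using L2_norm_eq_0_iff[OF O(1)[OF that(1)]] by simp
  qed
  show ?thesis unfolding resolvent_set_def using surj inj b1 by blast
qed

section \<open>The quadratic form with a delta potential\<close>

lemma L2_locally_integrable: "f \<in> L2 UNIV \<Longrightarrow> open \<Omega> \<Longrightarrow> locally_integrable \<Omega> f"
  by (rule locally_integrable_subset[OF locally_integrable_interval[of UNIV]]) (auto intro: L2_Icc_integrable)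

lemma test_fun_L2:
  assumes \<eta>: "\<eta> \<in> test_funs \<Omega>" and c: "continuous_on UNIV c" "\<And>x. x \<notin> closure {x. \<eta> x \<noteq> 0} \<Longrightarrow> c x = 0"
  shows "(\<lambda>x. complex_of_real (c x)) \<in> L2 UNIV"
proof -
  let ?K = "closure {x. \<eta> x \<noteq> 0}"
  have K: "compact ?K" using \<eta> by (simp add: test_funs_iff)
  have Km: "?K \<in> sets lebesgue" by (rule compact_sets_lebesgue[OF K])
  have cK: "continuous_on ?K c" by (rule continuous_on_subset[OF c(1)]) simp
  have cont: "continuous_on ?K (\<lambda>x. (cmod (complex_of_real (c x)))\<^sup>2)" by (intro continuous_intros cK)
  obtain B where B: "\<And>x. x \<in> ?K \<Longrightarrow> norm ((cmod (complex_of_real (c x)))\<^sup>2) \<le> B"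
    using compact_imp_bounded[OF compact_continuous_image[OF cont K]] unfolding bounded_iff by blast
  have "(\<lambda>x. (cmod (complex_of_real (c x)))\<^sup>2) absolutely_integrable_on ?K"
  proof (rule measurable_bounded_by_integrable_imp_absolutely_integrable[OF _ Km])
    show "(\<lambda>x. (cmod (complex_of_real (c x)))\<^sup>2) \<in> borel_measurable (lebesgue_on ?K)"
      by (rule continuous_imp_measurable_on_sets_lebesgue[OF cont Km])
    show "norm ((cmod (complex_of_real (c x)))\<^sup>2) \<le> B" if "x \<in> ?K" for x by (rule B[OF that])
    have "?K \<in> lmeasurable" by (rule lmeasurable_compact[OF K])
    then show "(\<lambda>x. B) integrable_on ?K" by (rule integrable_on_const)
  qed
  then have "integrable (lebesgue_on ?K) (\<lambda>x. (cmod (complex_of_real (c x)))\<^sup>2)"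
    using Km by (simp add: integrable_restrict_space set_integrable_def)
  moreover have "(\<lambda>x. complex_of_real (c x)) \<in> borel_measurable (lebesgue_on ?K)"
    by (rule continuous_imp_measurable_on_sets_lebesgue[OF continuous_on_of_real[OF cK] Km])
  ultimately have "(\<lambda>x. complex_of_real (c x)) \<in> L2 ?K" by (simp add: L2_def)
  then have "(\<lambda>x. if x \<in> ?K then complex_of_real (c x) else 0) \<in> L2 UNIV"
    by (rule L2_restrict[OF Km, THEN iffD2])
  also have "(\<lambda>x. if x \<in> ?K then complex_of_real (c x) else 0) = (\<lambda>x. complex_of_real (c x))"
    using c(2) by (simp add: fun_eq_iff)
  finally show ?thesis .
qed

lemma test_fun_H1_rep:
  assumes \<eta>: "\<eta> \<in> test_funs \<Omega>"
  shows "H1_rep (\<lambda>x. of_real (\<eta> x)) (\<lambda>x. of_real (\<eta> x)) (\<lambda>x. of_real (deriv \<eta> x))"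
  unfolding H1_rep_def
proof (intro conjI)
  note s = test_fun_smooth[OF \<eta>]
  show "(\<lambda>x. complex_of_real (\<eta> x)) \<in> L2 UNIV"
    by (rule test_fun_L2[OF \<eta> smooth_continuous[OF s]]) (rule test_fun_zero)
  show "(\<lambda>x. complex_of_real (deriv \<eta> x)) \<in> L2 UNIV"
    by (rule test_fun_L2[OF \<eta> smooth_continuous[OF smooth_deriv(1)[OF s]]]) (rule test_fun_deriv_zero)
  show "primitive_on UNIV (\<lambda>x. of_real (\<eta> x)) (\<lambda>x. of_real (deriv \<eta> x))" by (rule primitive_on_smooth[OF s])
qed simp

text \<open>Written with inner products, the relation passes to L2 limits and can be compared with
  the form.\<close>

lemma weak_deriv_L2_iff:
  assumes "open \<Omega>" "f \<in> L2 UNIV" "g \<in> L2 UNIV"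
  shows "has_weak_deriv \<Omega> f g \<longleftrightarrow>
    (\<forall>\<eta>\<in>test_funs \<Omega>. L2_inner (\<lambda>x. of_real (deriv \<eta> x)) f = - L2_inner (\<lambda>x. of_real (\<eta> x)) g)"
proof -
  have *: "(LINT x|lebesgue_on \<Omega>. h x * of_real (c x)) = cnj (L2_inner (\<lambda>x. of_real (c x)) h)"
    if "\<eta> \<in> test_funs \<Omega>" "\<And>x. x \<notin> closure {x. \<eta> x \<noteq> 0} \<Longrightarrow> c x = 0" for \<eta> h c
  proof -
    have K: "closure {x. \<eta> x \<noteq> 0} \<subseteq> \<Omega>" using that(1) by (simp add: test_funs_iff)
    have "(LINT x|lebesgue_on UNIV. h x * of_real (c x)) = (LINT x|lebesgue_on \<Omega>. h x * of_real (c x))"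
    proof (rule lebesgue_on_integral_restrict[OF open_sets_lebesgue[OF assms(1)]])
      fix x assume "x \<in> UNIV - \<Omega>"
      then have "x \<notin> closure {x. \<eta> x \<noteq> 0}" using K by blast
      then show "h x * of_real (c x) = 0" by (simp add: that(2))
    qed auto
    moreover have "cnj (L2_inner (\<lambda>x. of_real (c x)) h) = (LINT x|lebesgue. h x * of_real (c x))"
      unfolding L2_inner_def Bochner_Integration.integral_cnj[symmetric] by (simp add: mult.commute)
    ultimately show ?thesis by (simp only: lebesgue_on_UNIV_eq)
  qed
  have e: "(LINT x|lebesgue_on \<Omega>. f x * of_real (deriv \<eta> x)) = - (LINT x|lebesgue_on \<Omega>. g x * of_real (\<eta> x))
    \<longleftrightarrow> L2_inner (\<lambda>x. of_real (deriv \<eta> x)) f = - L2_inner (\<lambda>x. of_real (\<eta> x)) g" if "\<eta> \<in> test_funs \<Omega>" for \<eta>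
  proof -
    have 1: "(LINT x|lebesgue_on \<Omega>. f x * of_real (deriv \<eta> x)) = cnj (L2_inner (\<lambda>x. of_real (deriv \<eta> x)) f)"
      by (rule *[OF that]) (rule test_fun_deriv_zero)
    have 2: "(LINT x|lebesgue_on \<Omega>. g x * of_real (\<eta> x)) = cnj (L2_inner (\<lambda>x. of_real (\<eta> x)) g)"
      by (rule *[OF that]) (rule test_fun_zero)
    show ?thesis unfolding 1 2 complex_cnj_minus[symmetric] complex_cnj_cancel_iff ..
  qed
  show ?thesis unfolding has_weak_deriv_def
    using L2_locally_integrable[OF assms(2,1)] L2_locally_integrable[OF assms(3,1)] e by simp
qed

text \<open>The constant \<open>2 \<gamma>\<^sup>2 + 1/2\<close> makes the form coercive, since
  \<open>\<gamma> |u(0)|\<^sup>2 \<le> 2 \<gamma> \<parallel>u\<parallel> \<parallel>v\<parallel> \<le> \<parallel>v\<parallel>\<^sup>2 / 2 + 2 \<gamma>\<^sup>2 \<parallel>u\<parallel>\<^sup>2\<close>.\<close>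

definition delta_form :: "real \<Rightarrow> (real \<Rightarrow> complex) \<Rightarrow> (real \<Rightarrow> complex) \<Rightarrow> complex" where
  "delta_form \<gamma> \<phi> \<psi> = L2_inner (wderiv UNIV \<phi>) (wderiv UNIV \<psi>) + of_real (2 * \<gamma>\<^sup>2 + 1/2) * L2_inner \<phi> \<psi>
     - of_real \<gamma> * (cont_rep UNIV \<phi> 0 * cnj (cont_rep UNIV \<psi> 0))"

lemma delta_form_rep:
  assumes "H1_rep \<phi> u v" "H1_rep \<psi> y z"
  shows "delta_form \<gamma> \<phi> \<psi> = L2_inner v z + of_real (2 * \<gamma>\<^sup>2 + 1/2) * L2_inner u y - of_real \<gamma> * (u 0 * cnj (y 0))"
proof -
  have "L2_inner (wderiv UNIV \<phi>) (wderiv UNIV \<psi>) = L2_inner v z"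
    by (rule L2_inner_cong[OF H1_rep_wderiv(2)[OF assms(1)] H1_rep_wderiv(2)[OF assms(2)]
          H1_rep_wderiv(1)[OF assms(1)] H1_rep_wderiv(1)[OF assms(2)]])
  moreover have "L2_inner \<phi> \<psi> = L2_inner u y"
    by (rule L2_inner_cong[OF H1_repD(5)[OF assms(1)] H1_repD(5)[OF assms(2)] H1_repD(4)[OF assms(1)] H1_repD(4)[OF assms(2)]])
  ultimately show ?thesis
    unfolding delta_form_def H1_rep_cont_rep[OF assms(1)] H1_rep_cont_rep[OF assms(2)] by simp
qed

lemma delta_form_self:
  assumes "H1_rep \<phi> u v" 
  shows "Re (delta_form \<gamma> \<phi> \<phi>) = (L2_norm v)\<^sup>2 + (2 * \<gamma>\<^sup>2 + 1/2) * (L2_norm u)\<^sup>2 - \<gamma> * (cmod (u 0))\<^sup>2"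
  unfolding delta_form_rep[OF assms assms] L2_inner_self_norm complex_norm_square[symmetric]
  by (simp flip: of_real_mult of_real_power)

lemma delta_form_lower:
  assumes "H1_rep \<phi> u v" "\<gamma> \<ge> 0"
  shows "(L2_norm u)\<^sup>2 + (L2_norm v)\<^sup>2 \<le> 2 * Re (delta_form \<gamma> \<phi> \<phi>)"
proof -
  have "\<gamma> * (cmod (u 0))\<^sup>2 \<le> \<gamma> * (2 * L2_norm u * L2_norm v)"
    by (rule mult_left_mono[OF trace_bound[OF assms(1)] assms(2)])
  also have "\<dots> \<le> (1/2) * (L2_norm v)\<^sup>2 + 2 * \<gamma>\<^sup>2 * (L2_norm u)\<^sup>2"
    using zero_le_power2[of "L2_norm v - 2 * \<gamma> * L2_norm u"]
    by (simp add: power2_diff power_mult_distrib algebra_simps)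
  finally show ?thesis unfolding delta_form_self[OF assms(1)] by (simp add: algebra_simps)
qed

lemma delta_form_semi_inner:
  assumes "\<gamma> \<ge> 0" shows "semi_inner_space (H1 UNIV) (delta_form \<gamma>)"
proof
  show "(\<lambda>x. 0) \<in> H1 UNIV" using H1_rep_zero H1_iff by blast
next
  fix f g assume "f \<in> H1 UNIV" "g \<in> H1 UNIV"
  then obtain u v y z where "H1_rep f u v" "H1_rep g y z" unfolding H1_iff by blast
  from H1_rep_add[OF this] show "(\<lambda>x. f x + g x) \<in> H1 UNIV" unfolding H1_iff by blast
next
  fix f c assume "f \<in> H1 UNIV"
  then obtain u v where "H1_rep f u v" unfolding H1_iff by blast
  from H1_rep_scale[OF this, of c] show "(\<lambda>x. c * f x) \<in> H1 UNIV" unfolding H1_iff by blast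
next
  fix f g h assume "f \<in> H1 UNIV" "g \<in> H1 UNIV" "h \<in> H1 UNIV"
  then obtain u v y z p q where r: "H1_rep f u v" "H1_rep g y z" "H1_rep h p q" unfolding H1_iff by blast
  show "delta_form \<gamma> (\<lambda>x. f x + g x) h = delta_form \<gamma> f h + delta_form \<gamma> g h"
    unfolding delta_form_rep[OF H1_rep_add[OF r(1,2)] r(3)] delta_form_rep[OF r(1,3)] delta_form_rep[OF r(2,3)]
      L2.ip_add_left[OF H1_repD(1)[OF r(1)] H1_repD(1)[OF r(2)] H1_repD(1)[OF r(3)]]
      L2.ip_add_left[OF H1_repD(2)[OF r(1)] H1_repD(2)[OF r(2)] H1_repD(2)[OF r(3)]]
    by (simp add: algebra_simps)
next
  fix f h c assume "f \<in> H1 UNIV" "h \<in> H1 UNIV"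
  then obtain u v p q where r: "H1_rep f u v" "H1_rep h p q" unfolding H1_iff by blast
  show "delta_form \<gamma> (\<lambda>x. c * f x) h = c * delta_form \<gamma> f h"
    unfolding delta_form_rep[OF H1_rep_scale[OF r(1)] r(2)] delta_form_rep[OF r(1,2)]
      L2.ip_scale_left[OF H1_repD(1)[OF r(1)] H1_repD(1)[OF r(2)]]
      L2.ip_scale_left[OF H1_repD(2)[OF r(1)] H1_repD(2)[OF r(2)]]
    by (simp add: algebra_simps)
next
  fix f h assume "f \<in> H1 UNIV" "h \<in> H1 UNIV"
  then obtain u v p q where r: "H1_rep f u v" "H1_rep h p q" unfolding H1_iff by blast
  show "delta_form \<gamma> h f = cnj (delta_form \<gamma> f h)"
    unfolding delta_form_rep[OF r(1,2)] delta_form_rep[OF r(2,1)]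
      L2.ip_commute[OF H1_repD(1)[OF r(1)] H1_repD(1)[OF r(2)]]
      L2.ip_commute[OF H1_repD(2)[OF r(1)] H1_repD(2)[OF r(2)]]
    by (simp add: mult.commute)
next
  fix f assume "f \<in> H1 UNIV"
  then obtain u v where r: "H1_rep f u v" unfolding H1_iff by blast
  have "0 \<le> (L2_norm u)\<^sup>2 + (L2_norm v)\<^sup>2" by simp
  then show "0 \<le> Re (delta_form \<gamma> f f)" using delta_form_lower[OF r assms] by linarith
qed

lemma H1_rep_diff:
  assumes "H1_rep \<phi> u v" "H1_rep \<psi> y z" shows "H1_rep (\<lambda>x. \<phi> x - \<psi> x) (\<lambda>x. u x - y x) (\<lambda>x. v x - z x)"
  using H1_rep_add[OF assms(1) H1_rep_scale[OF assms(2), of "-1"]] by simp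

text \<open>By coercivity the functions and their derivatives both converge in L2, and the weak
  derivative relation survives the limit.\<close>

lemma delta_form_complete:
  assumes "\<gamma> \<ge> 0" shows "semi_inner_space.complete (H1 UNIV) (delta_form \<gamma>)"
proof -
  interpret V: semi_inner_space "H1 UNIV" "delta_form \<gamma>" by (rule delta_form_semi_inner[OF assms])
  show ?thesis unfolding V.complete_def V.nsq_def
  proof (intro allI impI, elim conjE)
    fix X :: "nat \<Rightarrow> real \<Rightarrow> complex"
    assume X: "\<forall>n. X n \<in> H1 UNIV"
      and C0: "\<forall>e>0. \<exists>N. \<forall>m\<ge>N. \<forall>n\<ge>N. Re (delta_form \<gamma> (\<lambda>x. X m x - X n x) (\<lambda>x. X m x - X n x)) < e"
    have C: "\<exists>N. \<forall>m\<ge>N. \<forall>n\<ge>N. Re (delta_form \<gamma> (\<lambda>x. X m x - X n x) (\<lambda>x. X m x - X n x)) < e" if "e > 0" for e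
      by (rule C0[rule_format, OF that])
    have "\<forall>n. \<exists>u v. H1_rep (X n) u v" using X unfolding H1_iff .
    then obtain u v where r: "\<And>n. H1_rep (X n) (u n) (v n)" by metis
    have uL: "u n \<in> L2 UNIV" and vL: "v n \<in> L2 UNIV" for n by (rule H1_repD(1)[OF r], rule H1_repD(2)[OF r])
    have low: "(L2_norm (\<lambda>x. u m x - u n x))\<^sup>2 + (L2_norm (\<lambda>x. v m x - v n x))\<^sup>2
        \<le> 2 * Re (delta_form \<gamma> (\<lambda>x. X m x - X n x) (\<lambda>x. X m x - X n x))" for m n
      by (rule delta_form_lower[OF H1_rep_diff[OF r r] assms])
    have cu: "\<exists>N. \<forall>m\<ge>N. \<forall>n\<ge>N. (L2_norm (\<lambda>x. u m x - u n x))\<^sup>2 < e" if "e > 0" for e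
    proof (rule Cauchy_bound[OF C])
      show "(L2_norm (\<lambda>x. u m x - u n x))\<^sup>2 \<le> 2 * Re (delta_form \<gamma> (\<lambda>x. X m x - X n x) (\<lambda>x. X m x - X n x))" for m n
        using low[of m n] zero_le_power2[of "L2_norm (\<lambda>x. v m x - v n x)"] by linarith
    qed (use that in simp_all)
    have cv: "\<exists>N. \<forall>m\<ge>N. \<forall>n\<ge>N. (L2_norm (\<lambda>x. v m x - v n x))\<^sup>2 < e" if "e > 0" for e
    proof (rule Cauchy_bound[OF C])
      show "(L2_norm (\<lambda>x. v m x - v n x))\<^sup>2 \<le> 2 * Re (delta_form \<gamma> (\<lambda>x. X m x - X n x) (\<lambda>x. X m x - X n x))" for m n
        using low[of m n] zero_le_power2[of "L2_norm (\<lambda>x. u m x - u n x)"] by linarith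
    qed (use that in simp_all)
    obtain U where U: "U \<in> L2 UNIV" "(\<lambda>n. L2_norm (\<lambda>x. u n x - U x)) \<longlonglongrightarrow> 0"
      using L2_complete_seq[OF uL cu] by blast
    obtain W where W: "W \<in> L2 UNIV" "(\<lambda>n. L2_norm (\<lambda>x. v n x - W x)) \<longlonglongrightarrow> 0"
      using L2_complete_seq[OF vL cv] by blast
    have "has_weak_deriv UNIV U W"
      unfolding weak_deriv_L2_iff[OF open_UNIV U(1) W(1)]
    proof
      fix \<eta> assume \<eta>: "\<eta> \<in> test_funs UNIV"
      note T = H1_repD(1,2)[OF test_fun_H1_rep[OF \<eta>]]
      have "L2_inner (\<lambda>x. of_real (deriv \<eta> x)) (u n) = - L2_inner (\<lambda>x. of_real (\<eta> x)) (v n)" for n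
      proof -
        have "has_weak_deriv UNIV (u n) (v n)" by (rule primitive_on_weak_deriv[OF H1_repD(3)[OF r]]) auto
        then show ?thesis using weak_deriv_L2_iff[OF open_UNIV uL vL] \<eta> by blast
      qed
      moreover have "(\<lambda>n. L2_inner (\<lambda>x. of_real (deriv \<eta> x)) (u n)) \<longlonglongrightarrow> L2_inner (\<lambda>x. of_real (deriv \<eta> x)) U"
        by (rule L2_inner_tendsto[OF T(2) U(1) uL U(2)])
      moreover have "(\<lambda>n. - L2_inner (\<lambda>x. of_real (\<eta> x)) (v n)) \<longlonglongrightarrow> - L2_inner (\<lambda>x. of_real (\<eta> x)) W"
        by (rule tendsto_minus[OF L2_inner_tendsto[OF T(1) W(1) vL W(2)]])
      ultimately show "L2_inner (\<lambda>x. of_real (deriv \<eta> x)) U = - L2_inner (\<lambda>x. of_real (\<eta> x)) W"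
        by (simp add: LIMSEQ_unique)
    qed
    then have UH: "U \<in> H1 UNIV" using U(1) W(1) unfolding H1_def by blast
    obtain y z where yz: "H1_rep U y z" using UH unfolding H1_iff by blast
    have zW: "eq_ae z W"
      using has_weak_deriv_unique[OF H1_repD(6)[OF yz] \<open>has_weak_deriv UNIV U W\<close>] unfolding AE_lebesgue_on_UNIV by simp
    have n1: "L2_norm (\<lambda>x. u n x - y x) = L2_norm (\<lambda>x. u n x - U x)" for n
    proof (rule L2_norm_cong[OF L2_diff[OF uL H1_repD(1)[OF yz]]])
      show "eq_ae (\<lambda>x. u n x - y x) (\<lambda>x. u n x - U x)" using H1_repD(4)[OF yz] by eventually_elim simp
    qed
    have n2: "L2_norm (\<lambda>x. v n x - z x) = L2_norm (\<lambda>x. v n x - W x)" for n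
    proof (rule L2_norm_cong[OF L2_diff[OF vL H1_repD(2)[OF yz]]])
      show "eq_ae (\<lambda>x. v n x - z x) (\<lambda>x. v n x - W x)" using zW by eventually_elim simp
    qed
    \<comment> \<open>The trace term enters with a minus sign, so the two L2 distances alone bound
      the form from above.\<close>
    have "(\<lambda>n. Re (delta_form \<gamma> (\<lambda>x. X n x - U x) (\<lambda>x. X n x - U x))) \<longlonglongrightarrow> 0"
    proof (rule Lim_null_comparison)
      show "(\<lambda>n. (L2_norm (\<lambda>x. v n x - W x))\<^sup>2 + (2 * \<gamma>\<^sup>2 + 1/2) * (L2_norm (\<lambda>x. u n x - U x))\<^sup>2) \<longlonglongrightarrow> 0"
        using tendsto_add[OF tendsto_power[OF W(2), of 2] tendsto_mult[OF tendsto_const tendsto_power[OF U(2), of 2]]] by simp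
      have "norm (Re (delta_form \<gamma> (\<lambda>x. X n x - U x) (\<lambda>x. X n x - U x)))
        \<le> (L2_norm (\<lambda>x. v n x - W x))\<^sup>2 + (2 * \<gamma>\<^sup>2 + 1/2) * (L2_norm (\<lambda>x. u n x - U x))\<^sup>2" for n
      proof -
        note d = H1_rep_diff[OF r[of n] yz]
        have "0 \<le> Re (delta_form \<gamma> (\<lambda>x. X n x - U x) (\<lambda>x. X n x - U x))"
          using V.ip_nonneg[OF V.diff_mem[OF _ UH]] X by blast
        moreover have "0 \<le> \<gamma> * (cmod (u n 0 - y 0))\<^sup>2" using assms by simp
        ultimately show ?thesis using delta_form_self[OF d, of \<gamma>] by (simp add: n1 n2)
      qed
      then show "\<forall>\<^sub>F n in sequentially. norm (Re (delta_form \<gamma> (\<lambda>x. X n x - U x) (\<lambda>x. X n x - U x)))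
        \<le> (L2_norm (\<lambda>x. v n x - W x))\<^sup>2 + (2 * \<gamma>\<^sup>2 + 1/2) * (L2_norm (\<lambda>x. u n x - U x))\<^sup>2"
        by (simp add: always_eventually)
    qed
    then show "\<exists>v\<in>H1 UNIV. (\<lambda>n. Re (delta_form \<gamma> (\<lambda>x. X n x - v x) (\<lambda>x. X n x - v x))) \<longlonglongrightarrow> 0" using UH by blast
  qed
qed

text \<open>Riesz' theorem gives a weak solution. Test functions supported off the origin identify
  its second derivative there, and a single test function that does not vanish at 0 then reads the
  jump condition off Green's formula.\<close>

lemma delta_solve:
  assumes "\<gamma> \<ge> 0" and f: "f \<in> L2 UNIV"
  shows "\<exists>\<phi> u v1 v2 w. H2_rep \<phi> u v1 v2 w \<and> v1 0 - v2 0 = - of_real \<gamma> * u 0 \<and>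
    eq_ae (\<lambda>x. - w x + of_real (2 * \<gamma>\<^sup>2 + 1/2) * u x) f"
proof -
  interpret V: semi_inner_space "H1 UNIV" "delta_form \<gamma>" by (rule delta_form_semi_inner[OF assms(1)])
  have HL: "\<phi> \<in> L2 UNIV" if "\<phi> \<in> H1 UNIV" for \<phi> using that by (simp add: H1_def)
  have "\<exists>\<phi>\<in>H1 UNIV. \<forall>\<psi>\<in>H1 UNIV. L2_inner \<psi> f = delta_form \<gamma> \<psi> \<phi>"
  proof (rule V.Riesz_representation[OF delta_form_complete[OF assms(1)]])
    fix \<psi> assume \<psi>: "\<psi> \<in> H1 UNIV"
    then obtain u v where r: "H1_rep \<psi> u v" unfolding H1_iff by blast
    have "(L2_norm \<psi>)\<^sup>2 \<le> 2 * V.nsq \<psi>"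
      using delta_form_lower[OF r assms(1)] zero_le_power2[of "L2_norm v"] unfolding V.nsq_def H1_rep_norm(1)[OF r] by linarith
    then have "L2_norm \<psi> \<le> sqrt (2 * V.nsq \<psi>)" by (rule real_le_rsqrt)
    then have "L2_norm \<psi> * L2_norm f \<le> sqrt (2 * V.nsq \<psi>) * L2_norm f" by (rule mult_right_mono[OF _ L2_norm_nonneg])
    then show "cmod (L2_inner \<psi> f) \<le> (sqrt 2 * L2_norm f) * sqrt (V.nsq \<psi>)"
      using L2_Cauchy_Schwarz[OF HL[OF \<psi>] f] by (simp add: real_sqrt_mult mult_ac)
  next
    fix \<phi> \<psi> assume "\<phi> \<in> H1 UNIV" "\<psi> \<in> H1 UNIV"
    then show "L2_inner (\<lambda>x. \<phi> x + \<psi> x) f = L2_inner \<phi> f + L2_inner \<psi> f" by (intro L2.ip_add_left HL f)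
  next
    fix c \<phi> assume "\<phi> \<in> H1 UNIV"
    then show "L2_inner (\<lambda>x. c * \<phi> x) f = c * L2_inner \<phi> f" by (intro L2.ip_scale_left HL f)
  qed
  then obtain \<phi> where \<phi>: "\<phi> \<in> H1 UNIV" "\<And>\<psi>. \<psi> \<in> H1 UNIV \<Longrightarrow> L2_inner \<psi> f = delta_form \<gamma> \<psi> \<phi>" by blast
  obtain u v where r: "H1_rep \<phi> u v" using \<phi>(1) unfolding H1_iff by blast
  note R = H1_repD[OF r]
  \<comment> \<open>The value that the equation prescribes for the second derivative.\<close>
  define w where "w = (\<lambda>x. of_real (2 * \<gamma>\<^sup>2 + 1/2) * u x - f x)"
  have w: "w \<in> L2 UNIV" unfolding w_def by (intro L2_diff L2_scale R f)
  have wform: "L2_inner y w = of_real (2 * \<gamma>\<^sup>2 + 1/2) * L2_inner y u - L2_inner y f" if "y \<in> L2 UNIV" for y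
    unfolding w_def using L2.ip_diff_right[OF L2_scale[OF R(1)] f that] L2.ip_scale_right[OF R(1) that, of "of_real (2 * \<gamma>\<^sup>2 + 1/2)"]
    by (simp del: of_real_add of_real_mult of_real_power)
  have test: "L2_inner z v + L2_inner y w = of_real \<gamma> * (y 0 * cnj (u 0))" if t: "H1_rep \<psi> y z" for \<psi> y z
  proof -
    have "L2_inner y f = L2_inner \<psi> f"
      by (rule L2_inner_cong[OF H1_repD(1)[OF t] f AE_eq_sym[OF H1_repD(4)[OF t]]]) simp
    also have "\<dots> = delta_form \<gamma> \<psi> \<phi>" by (rule \<phi>(2)) (use t H1_iff in blast)
    finally show ?thesis unfolding delta_form_rep[OF t r] wform[OF H1_repD(1)[OF t]] by (simp add: algebra_simps)
  qed
  have op: "open (- {0::real})" by (simp add: open_Compl)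
  have vw: "has_weak_deriv (- {0}) v w"
    unfolding weak_deriv_L2_iff[OF op R(2) w]
  proof
    fix \<eta> assume \<eta>: "\<eta> \<in> test_funs (- {0})"
    have "0 \<notin> closure {x. \<eta> x \<noteq> 0}" using \<eta> unfolding test_funs_iff by blast
    then have "\<eta> 0 = 0" by (rule test_fun_zero)
    then show "L2_inner (\<lambda>x. of_real (deriv \<eta> x)) v = - L2_inner (\<lambda>x. of_real (\<eta> x)) w"
      using test[OF test_fun_H1_rep[OF \<eta>]] by (simp add: eq_neg_iff_add_eq_0)
  qed
  have H2: "\<phi> \<in> H2 S" if S: "open S" "S \<subseteq> - {0}" for S
  proof -
    have m: "S \<in> sets lebesgue" by (rule open_sets_lebesgue[OF S(1)])
    have "has_weak_deriv S v w" by (rule has_weak_deriv_subset[OF vw S(2) op S(1)])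
    then have "v \<in> H1 S" using L2_subset[OF R(2) m] L2_subset[OF w m] unfolding H1_def by blast
    moreover have "has_weak_deriv S \<phi> v" by (rule has_weak_deriv_subset[OF R(6) _ open_UNIV S(1)]) simp
    ultimately show ?thesis using L2_subset[OF R(5) m] unfolding H2_def by blast
  qed
  have "\<phi> \<in> H2 {..<0}" "\<phi> \<in> H2 {0<..}" by (rule H2; auto)+
  then obtain u' v1 v2 w' where H2_rep: "H2_rep \<phi> u' v1 v2 w'" using H2_rep_exists[OF \<phi>(1)] by blast
  note G = H2_repD[OF H2_rep]
  have u': "u' x = u x" for x using H1_rep_cont_rep[OF r, of x] H1_rep_cont_rep[OF G(1), of x] by simp
  have pv: "eq_ae (piece v1 v2) v"
    using has_weak_deriv_unique[OF H1_repD(6)[OF G(1)] R(6)] unfolding AE_lebesgue_on_UNIV by simp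
  have "has_weak_deriv (- {0}) v w'"
    by (rule has_weak_deriv_cong[OF has_weak_deriv_piece(1)[OF G(3,4)] op AE_lebesgue_on_if[OF pv]])
      (simp_all add: open_sets_lebesgue op)
  then have ww: "eq_ae w' w" using AE_punctured[OF has_weak_deriv_unique[OF _ vw op]] by blast
  have bt: "bump (-1) 1 0 \<in> test_funs UNIV" by (rule bump_test_fun) simp
  define c where "c = bump (-1) 1 0 0"
  have c: "c \<noteq> 0" using bump_pos[of "-1" 0 1 0] by (simp add: c_def)
  let ?y = "\<lambda>x. complex_of_real (bump (-1) 1 0 x)" and ?z = "\<lambda>x. complex_of_real (deriv (bump (-1) 1 0) x)"
  note t = test_fun_H1_rep[OF bt]
  have "L2_inner w' ?y + L2_inner (piece v1 v2) ?z = L2_inner w ?y + L2_inner v ?z"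
    using L2_inner_cong[OF G(2) H1_repD(1)[OF t] ww, of ?y] L2_inner_cong[OF H1_repD(2)[OF G(1)] H1_repD(2)[OF t] pv, of ?z]
    by simp
  \<comment> \<open>Green's formula has the solution in the first slot, \<open>test\<close> has it
    in the second.\<close>
  also have "\<dots> = cnj (L2_inner ?z v + L2_inner ?y w)"
    using L2.ip_commute[OF H1_repD(1)[OF t] w] L2.ip_commute[OF H1_repD(2)[OF t] R(2)] by simp
  also have "\<dots> = of_real \<gamma> * (of_real c * u 0)" unfolding test[OF t] by (simp add: c_def)
  finally have "- (v1 0 - v2 0) * of_real c = of_real \<gamma> * (of_real c * u 0)"
    unfolding Green[OF H2_rep t] by (simp add: c_def)
  then have "of_real c * (- (v1 0 - v2 0)) = of_real c * (of_real \<gamma> * u 0)" by (simp only: mult_ac)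
  then have "- (v1 0 - v2 0) = of_real \<gamma> * u 0" using c by (simp only: mult_cancel_left of_real_eq_0_iff simp_thms)
  then have "v1 0 - v2 0 = - (of_real \<gamma> * u 0)" by (metis minus_minus)
  then have jump: "v1 0 - v2 0 = - of_real \<gamma> * u' 0" unfolding u' by simp
  have "eq_ae (\<lambda>x. - w' x + of_real (2 * \<gamma>\<^sup>2 + 1/2) * u' x) f"
    using ww by eventually_elim (simp add: w_def u')
  then show ?thesis using H2_rep jump by blast
qed

section \<open>Isolated simple eigenvalues and self-adjointness of the operator\<close>

text \<open>The gap condition bounds T below by 1/c on the part of D orthogonal to \<psi>, and on
  \<psi> the operator T - z acts as - z. Both parts have the lower bound |z| for 0 < |z| <= 1/(2c),
  so a punctured ball lies in the resolvent set. In the gap condition s is free, so that any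
  convenient multiple of \<psi> may be subtracted.\<close>

lemma isolated_simple_eigenvalue_zeroI:
  assumes sa: "self_adjoint D T" and \<psi>: "\<psi> \<in> D" "eq_ae (T \<psi>) (\<lambda>x. 0)" "\<not> eq_ae \<psi> (\<lambda>x. 0)"
    and "c > 0" and gap: "\<And>\<phi>. \<phi> \<in> D \<Longrightarrow> \<exists>s. L2_norm (\<lambda>x. \<phi> x - s * \<psi> x) \<le> c * L2_norm (T \<phi>)"
  shows "isolated_simple_eigenvalue D T 0" "spans \<psi> (op_kernel D T)"
proof -
  have op: "L2_operator D T" using sa by (simp add: self_adjoint_def)
  note O = L2_operatorD[OF op]
  note \<psi>L = O(1)[OF \<psi>(1)]
  have n\<psi>: "L2_norm \<psi> > 0" using L2_norm_eq_0_iff[OF \<psi>L] \<psi>(3) L2_norm_nonneg[of \<psi>] by linarith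
  have T\<psi>: "L2_inner \<phi> (T \<psi>) = 0" if "\<phi> \<in> L2 UNIV" for \<phi>
    using L2_inner_cong[OF that O(2)[OF \<psi>(1)] _ \<psi>(2), of \<phi>] by (simp add: L2_inner_def)
  have orth: "L2_inner (T \<phi>) \<psi> = 0" if "\<phi> \<in> D" for \<phi>
    using self_adjoint_symmetric[OF sa that \<psi>(1)] T\<psi>[OF O(1)[OF that]] by simp
  have ker: "\<exists>s. eq_ae \<phi> (\<lambda>x. s * \<psi> x)" if \<phi>: "\<phi> \<in> D" "eq_ae (T \<phi>) (\<lambda>x. 0)" for \<phi>
  proof -
    obtain s where s: "L2_norm (\<lambda>x. \<phi> x - s * \<psi> x) \<le> c * L2_norm (T \<phi>)" using gap[OF \<phi>(1)] by blast
    have "L2_norm (T \<phi>) = 0" using L2_norm_eq_0_iff[OF O(2)[OF \<phi>(1)]] \<phi>(2) by blast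
    then have "L2_norm (\<lambda>x. \<phi> x - s * \<psi> x) = 0" using s L2_norm_nonneg[of "\<lambda>x. \<phi> x - s * \<psi> x"] by simp
    then have "eq_ae \<phi> (\<lambda>x. s * \<psi> x)" using L2_eq_ae_iff[OF O(1)[OF \<phi>(1)] L2_scale[OF \<psi>L]] by blast
    then show ?thesis ..
  qed
  have kp: "\<exists>s. eq_ae \<phi> (\<lambda>x. s * \<psi> x)" if "\<phi> \<in> ker_pow D T 0 n" for \<phi> n
    using that
  proof (induction n arbitrary: \<phi>)
    case 0
    then have "eq_ae \<phi> (\<lambda>x. 0 * \<psi> x)" by simp
    then show ?case ..
  next
    case (Suc n)
    then have \<phi>: "\<phi> \<in> D" by simp
    obtain s where "eq_ae (\<lambda>x. T \<phi> x - 0 * \<phi> x) (\<lambda>x. s * \<psi> x)" using Suc by fastforce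
    then have s: "eq_ae (T \<phi>) (\<lambda>x. s * \<psi> x)" by simp
    \<comment> \<open>T \<phi> is a multiple of \<psi> and also orthogonal to \<psi>, hence null:
      generalised eigenvectors are eigenvectors.\<close>
    have "L2_inner (T \<phi>) (T \<phi>) = L2_inner (T \<phi>) (\<lambda>x. s * \<psi> x)"
      by (rule L2_inner_cong[OF O(2)[OF \<phi>] O(2)[OF \<phi>] _ s]) simp
    also have "\<dots> = 0" using L2.ip_scale_right[OF \<psi>L O(2)[OF \<phi>]] orth[OF \<phi>] by simp
    finally have "L2_norm (T \<phi>) = 0" by (simp add: L2_inner_self_norm)
    then have "eq_ae (T \<phi>) (\<lambda>x. 0)" using L2_norm_eq_0_iff[OF O(2)[OF \<phi>]] by blast
    then show ?case by (rule ker[OF \<phi>])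
  qed
  have "\<psi> \<in> op_kernel D T" using \<psi> by (simp add: op_kernel_def)
  then show "spans \<psi> (op_kernel D T)" unfolding spans_def using ker by (auto simp: op_kernel_def)
  have ev: "eigenvalue D T 0" unfolding eigenvalue_def using \<psi> by (intro bexI[of _ \<psi>]) simp_all
  have "\<psi> \<in> ker_pow D T 0 1" using \<psi> by simp
  then have "spans \<psi> (\<Union>n. ker_pow D T 0 n)" unfolding spans_def using kp by blast
  then have sp: "\<exists>\<phi>. \<not> eq_ae \<phi> (\<lambda>x. 0) \<and> spans \<phi> (\<Union>n. ker_pow D T 0 n)" using \<psi>(3) by blast
  have bound: "L2_norm \<phi> \<le> (1 / cmod z) * L2_norm (\<lambda>x. T \<phi> x - z * \<phi> x)"
    if \<phi>: "\<phi> \<in> D" and z: "z \<noteq> 0" "cmod z \<le> 1 / (2 * c)" for \<phi> z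
  proof -
    \<comment> \<open>Coefficient of the orthogonal projection of \<phi> onto \<psi>.\<close>
    define P where "P = L2_inner \<phi> \<psi> / of_real ((L2_norm \<psi>)\<^sup>2)"
    define q where "q = (\<lambda>x. \<phi> x - P * \<psi> x)"
    have P\<psi>: "(\<lambda>x. - P * \<psi> x) \<in> D" by (rule O(6)[OF \<psi>(1)])
    have "(\<lambda>x. \<phi> x + - P * \<psi> x) \<in> D" by (rule O(4)[OF \<phi> P\<psi>])
    then have qD: "q \<in> D" by (simp add: q_def)
    note qL = O(1)[OF qD] and \<phi>L = O(1)[OF \<phi>]
    have "eq_ae (T (\<lambda>x. \<phi> x + - P * \<psi> x)) (\<lambda>x. T \<phi> x + T (\<lambda>x. - P * \<psi> x) x)" by (rule O(5)[OF \<phi> P\<psi>])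
    with O(7)[OF \<psi>(1), of "- P"] \<psi>(2) have Tq: "eq_ae (T q) (T \<phi>)"
      by eventually_elim (simp add: q_def)
    have q\<psi>: "L2_inner q \<psi> = 0"
      unfolding q_def using L2.ip_diff_left[OF \<phi>L L2_scale[OF \<psi>L] \<psi>L, of P] L2.ip_scale_left[OF \<psi>L \<psi>L, of P] n\<psi>
      by (simp add: P_def L2_inner_self_norm)
    have pyth: "(L2_norm (\<lambda>x. g x + s * \<psi> x))\<^sup>2 = (L2_norm g)\<^sup>2 + (cmod s)\<^sup>2 * (L2_norm \<psi>)\<^sup>2"
      if "g \<in> L2 UNIV" "L2_inner g \<psi> = 0" for g s
      using L2.nsq_add_scale[OF that(1) \<psi>L, of s] that(2) by (simp add: L2_nsq)
    obtain s where "L2_norm (\<lambda>x. \<phi> x - s * \<psi> x) \<le> c * L2_norm (T \<phi>)" using gap[OF \<phi>] by blast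
    \<comment> \<open>The orthogonal projection is the best approximation, so the gap condition
      passes from the unknown s to P.\<close>
    moreover have "L2_norm q \<le> L2_norm (\<lambda>x. \<phi> x - s * \<psi> x)"
    proof (rule power2_le_imp_le[OF _ L2_norm_nonneg])
      have "(\<lambda>x. \<phi> x - s * \<psi> x) = (\<lambda>x. q x + (P - s) * \<psi> x)" by (simp add: q_def algebra_simps)
      then show "(L2_norm q)\<^sup>2 \<le> (L2_norm (\<lambda>x. \<phi> x - s * \<psi> x))\<^sup>2" using pyth[OF qL q\<psi>, of "P - s"] by simp
    qed
    ultimately have "L2_norm q \<le> c * L2_norm (T q)" using L2_norm_cong[OF O(2)[OF qD] Tq] by simp
    then have 1: "L2_norm q / c \<le> L2_norm (T q)" using \<open>c > 0\<close> by (simp add: pos_divide_le_eq mult.commute)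
    let ?r = "\<lambda>x. T q x - z * q x"
    have rL: "?r \<in> L2 UNIV" by (intro L2_diff L2_scale qL O(2)[OF qD])
    have "L2_norm (T q) = L2_norm (\<lambda>x. ?r x + z * q x)" by simp
    also have "\<dots> \<le> L2_norm ?r + cmod z * L2_norm q"
      using L2_norm_triangle[OF rL L2_scale[OF qL, of z]] L2_norm_scale[OF qL] by simp
    finally have "L2_norm q / c \<le> L2_norm ?r + cmod z * L2_norm q" using 1 by linarith
    \<comment> \<open>Half of the gap absorbs the perturbation z q; the other half remains as the
      lower bound |z|.\<close>
    moreover have "2 * cmod z * L2_norm q \<le> L2_norm q / c"
      using mult_right_mono[OF z(2) L2_norm_nonneg[of q]] by (simp add: field_simps)
    ultimately have 2: "cmod z * L2_norm q \<le> L2_norm ?r" by linarith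
    have r\<psi>: "L2_inner ?r \<psi> = 0"
      using L2.ip_diff_left[OF O(2)[OF qD] L2_scale[OF qL] \<psi>L, of z] L2.ip_scale_left[OF qL \<psi>L, of z] orth[OF qD] q\<psi> by simp
    \<comment> \<open>(T - z) \<phi> splits orthogonally into (T - z) q and - z P \<psi>, each at
      least |z| times the matching part of \<phi>.\<close>
    have "(cmod z * L2_norm \<phi>)\<^sup>2 = (cmod z * L2_norm q)\<^sup>2 + (cmod (- z * P))\<^sup>2 * (L2_norm \<psi>)\<^sup>2"
    proof -
      have "\<phi> = (\<lambda>x. q x + P * \<psi> x)" by (simp add: q_def)
      then have "(L2_norm \<phi>)\<^sup>2 = (L2_norm q)\<^sup>2 + (cmod P)\<^sup>2 * (L2_norm \<psi>)\<^sup>2" using pyth[OF qL q\<psi>, of P] by simp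
      then show ?thesis by (simp add: power_mult_distrib norm_mult algebra_simps)
    qed
    also have "\<dots> \<le> (L2_norm ?r)\<^sup>2 + (cmod (- z * P))\<^sup>2 * (L2_norm \<psi>)\<^sup>2"
      using power_mono[OF 2, of 2] L2_norm_nonneg[of q] by simp
    also have "\<dots> = (L2_norm (\<lambda>x. ?r x + (- z * P) * \<psi> x))\<^sup>2" by (rule pyth[OF rL r\<psi>, symmetric])
    also have "L2_norm (\<lambda>x. ?r x + (- z * P) * \<psi> x) = L2_norm (\<lambda>x. T \<phi> x - z * \<phi> x)"
    proof (rule L2_norm_cong[OF L2_add[OF rL L2_scale[OF \<psi>L]]])
      show "eq_ae (\<lambda>x. ?r x + (- z * P) * \<psi> x) (\<lambda>x. T \<phi> x - z * \<phi> x)"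
        using Tq by eventually_elim (simp add: q_def algebra_simps)
    qed
    finally have "cmod z * L2_norm \<phi> \<le> L2_norm (\<lambda>x. T \<phi> x - z * \<phi> x)"
      by (rule power2_le_imp_le[OF _ L2_norm_nonneg])
    then show ?thesis using z(1) by (simp add: field_simps)
  qed
  have res: "z \<in> resolvent_set D T" if z: "z \<noteq> 0" "cmod z \<le> 1 / (2 * c)" for z
  proof (rule self_adjoint_resolventI[OF sa])
    show "L2_norm \<phi> \<le> (1 / cmod z) * L2_norm (\<lambda>x. T \<phi> x - z * \<phi> x)" if "\<phi> \<in> D" for \<phi>
      by (rule bound[OF that z])
    show "L2_norm \<phi> \<le> (1 / cmod z) * L2_norm (\<lambda>x. T \<phi> x - cnj z * \<phi> x)" if "\<phi> \<in> D" for \<phi>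
      using bound[OF that, of "cnj z"] z by simp
  qed
  have "0 \<notin> resolvent_set D T"
  proof
    assume "0 \<in> resolvent_set D T"
    then have "\<forall>\<phi>\<in>D. eq_ae (\<lambda>x. T \<phi> x - 0 * \<phi> x) (\<lambda>x. 0) \<longrightarrow> eq_ae \<phi> (\<lambda>x. 0)" unfolding resolvent_set_def by blast
    then show False using \<psi> by simp
  qed
  then have "ball 0 (1 / (2 * c)) \<inter> spectrum D T = {0}"
    using res \<open>c > 0\<close> unfolding spectrum_def by (auto simp: dist_norm) (meson less_imp_le)
  then have "0 isolated_in spectrum D T"
    unfolding isolated_in_def using open_ball by blast
  then show "isolated_simple_eigenvalue D T 0" unfolding isolated_simple_eigenvalue_def using ev sp by blast
qed

section \<open>The form of the operator and self-adjointness\<close>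

lemma L_op_L2:
  assumes "H2_rep \<phi> u v1 v2 w"
  shows "(\<lambda>y. - w y + of_real (pot b \<beta> k lam y) * u y) \<in> L2 UNIV" "L_op b \<beta> k lam \<phi> \<in> L2 UNIV"
proof -
  note D = H2_repD[OF assms]
  show *: "(\<lambda>y. - w y + of_real (pot b \<beta> k lam y) * u y) \<in> L2 UNIV"
    by (intro L2_add L2_uminus D(2) L2_mult_bounded[OF H1_repD(1)[OF D(1)] pot_measurable pot_bound])
  show "L_op b \<beta> k lam \<phi> \<in> L2 UNIV" by (rule L2_cong_ae[OF * AE_eq_sym[OF L_op_ae[OF assms]]])
qed

text \<open>Inserting the jump condition into Green's formula turns the boundary term into the delta
  potential.\<close>

lemma L_form:
  assumes r: "H2_rep \<phi> u v1 v2 w" and j: "v1 0 - v2 0 = - of_real \<gamma> * u 0" and t: "H1_rep \<psi> y z"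
  shows "L2_inner (L_op b \<beta> k lam \<phi>) \<psi> = L2_inner (piece v1 v2) z - of_real \<gamma> * (u 0 * cnj (y 0))
    + L2_inner (\<lambda>x. of_real (pot b \<beta> k lam x) * u x) y"
proof -
  note D = H2_repD[OF r] and Y = H1_repD[OF t]
  have pu: "(\<lambda>x. of_real (pot b \<beta> k lam x) * u x) \<in> L2 UNIV"
    by (rule L2_mult_bounded[OF H1_repD(1)[OF D(1)] pot_measurable pot_bound])
  have "L2_inner (L_op b \<beta> k lam \<phi>) \<psi> = L2_inner (\<lambda>x. - w x + of_real (pot b \<beta> k lam x) * u x) y"
    by (rule L2_inner_cong[OF L_op_L2(2)[OF r] Y(5) L_op_ae[OF r] Y(4)])
  also have "\<dots> = L2_inner (\<lambda>x. - w x) y + L2_inner (\<lambda>x. of_real (pot b \<beta> k lam x) * u x) y"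
    by (rule L2.ip_add_left[OF L2_uminus[OF D(2)] pu Y(1)])
  also have "L2_inner (\<lambda>x. - w x) y = - L2_inner w y"
    using L2.ip_scale_left[OF D(2) Y(1), of "-1"] by simp
  also have "L2_inner w y = of_real \<gamma> * (u 0 * cnj (y 0)) - L2_inner (piece v1 v2) z"
    using Green[OF r t] unfolding j by (simp add: eq_diff_eq mult_ac)
  finally show ?thesis by simp
qed

lemma L_dom_cases:
  assumes "\<phi> \<in> L_dom \<alpha> k"
  obtains u v1 v2 w where "H2_rep \<phi> u v1 v2 w" "v1 0 - v2 0 = - of_real ((real k)\<^sup>2 * \<alpha>) * u 0"
  using assms unfolding L_dom_iff by blast

lemma L_operator: "L2_operator (L_dom \<alpha> k) (L_op b \<beta> k lam)"
proof -
  let ?g = "complex_of_real ((real k)\<^sup>2 * \<alpha>)" and ?T = "L_op b \<beta> k lam"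
  have a: "L_dom \<alpha> k \<subseteq> L2 UNIV"
  proof
    fix \<phi> assume "\<phi> \<in> L_dom \<alpha> k"
    then obtain u v1 v2 w where "H2_rep \<phi> u v1 v2 w" by (rule L_dom_cases)
    then show "\<phi> \<in> L2 UNIV" by (rule H1_repD(5)[OF H2_repD(1)])
  qed
  have b: "?T ` L_dom \<alpha> k \<subseteq> L2 UNIV"
  proof
    fix f assume "f \<in> ?T ` L_dom \<alpha> k"
    then obtain \<phi> where f: "f = ?T \<phi>" and "\<phi> \<in> L_dom \<alpha> k" by blast
    then obtain u v1 v2 w where "H2_rep \<phi> u v1 v2 w" by (auto elim: L_dom_cases)
    then show "f \<in> L2 UNIV" unfolding f by (rule L_op_L2(2))
  qed
  have "piece (\<lambda>x. 0) (\<lambda>x. 0) = (\<lambda>x. 0)" by (simp add: piece_def fun_eq_iff)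
  then have "H2_rep (\<lambda>x. 0) (\<lambda>x. 0) (\<lambda>x. 0) (\<lambda>x. 0) (\<lambda>x. 0)"
    unfolding H2_rep_def using H1_rep_zero L2_zero by (simp add: primitive_on_def)
  then have c: "(\<lambda>x. 0) \<in> L_dom \<alpha> k" unfolding L_dom_iff by (intro exI conjI) (assumption, simp)
  have d: "(\<lambda>x. \<phi> x + \<psi> x) \<in> L_dom \<alpha> k \<and> eq_ae (?T (\<lambda>x. \<phi> x + \<psi> x)) (\<lambda>x. ?T \<phi> x + ?T \<psi> x)"
    if "\<phi> \<in> L_dom \<alpha> k" "\<psi> \<in> L_dom \<alpha> k" for \<phi> \<psi>
  proof -
    obtain u v1 v2 w where r1: "H2_rep \<phi> u v1 v2 w" "v1 0 - v2 0 = - ?g * u 0" using \<open>\<phi> \<in> _\<close> by (rule L_dom_cases)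
    obtain y z1 z2 q where r2: "H2_rep \<psi> y z1 z2 q" "z1 0 - z2 0 = - ?g * y 0" using \<open>\<psi> \<in> _\<close> by (rule L_dom_cases)
    note r = H2_rep_add[OF r1(1) r2(1)]
    have "(v1 0 + z1 0) - (v2 0 + z2 0) = (v1 0 - v2 0) + (z1 0 - z2 0)" by simp
    also have "\<dots> = - ?g * (u 0 + y 0)" unfolding r1(2) r2(2) by (simp only: distrib_left)
    finally have "(\<lambda>x. \<phi> x + \<psi> x) \<in> L_dom \<alpha> k" unfolding L_dom_iff using r by blast
    moreover have "eq_ae (?T (\<lambda>x. \<phi> x + \<psi> x)) (\<lambda>x. ?T \<phi> x + ?T \<psi> x)"
      using L_op_ae[OF r, of b \<beta> k lam] L_op_ae[OF r1(1), of b \<beta> k lam] L_op_ae[OF r2(1), of b \<beta> k lam]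
      by eventually_elim (simp add: distrib_left)
    ultimately show ?thesis by blast
  qed
  have e: "(\<lambda>x. s * \<phi> x) \<in> L_dom \<alpha> k \<and> eq_ae (?T (\<lambda>x. s * \<phi> x)) (\<lambda>x. s * ?T \<phi> x)" if "\<phi> \<in> L_dom \<alpha> k" for s \<phi>
  proof -
    obtain u v1 v2 w where r1: "H2_rep \<phi> u v1 v2 w" "v1 0 - v2 0 = - ?g * u 0" using \<open>\<phi> \<in> _\<close> by (rule L_dom_cases)
    note r = H2_rep_scale[OF r1(1), of s]
    have "s * v1 0 - s * v2 0 = s * (v1 0 - v2 0)" by (simp add: right_diff_distrib)
    also have "\<dots> = - ?g * (s * u 0)" unfolding r1(2) by simp
    finally have "(\<lambda>x. s * \<phi> x) \<in> L_dom \<alpha> k" unfolding L_dom_iff using r by blast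
    moreover have "eq_ae (?T (\<lambda>x. s * \<phi> x)) (\<lambda>x. s * ?T \<phi> x)"
      using L_op_ae[OF r, of b \<beta> k lam] L_op_ae[OF r1(1), of b \<beta> k lam]
      by eventually_elim (simp add: distrib_left right_diff_distrib mult.left_commute)
    ultimately show ?thesis by blast
  qed
  have f: "\<psi> \<in> L_dom \<alpha> k \<and> eq_ae (?T \<psi>) (?T \<phi>)" if "\<phi> \<in> L_dom \<alpha> k" and ae: "eq_ae \<psi> \<phi>" for \<phi> \<psi>
  proof -
    obtain u v1 v2 w where r1: "H2_rep \<phi> u v1 v2 w" "v1 0 - v2 0 = - ?g * u 0" using \<open>\<phi> \<in> _\<close> by (rule L_dom_cases)
    note r = H2_rep_cong[OF r1(1) ae]
    have "\<psi> \<in> L_dom \<alpha> k" unfolding L_dom_iff using r r1(2) by blast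
    moreover have "eq_ae (?T \<psi>) (?T \<phi>)"
      using L_op_ae[OF r, of b \<beta> k lam] L_op_ae[OF r1(1), of b \<beta> k lam] by eventually_elim simp
    ultimately show ?thesis by blast
  qed
  show ?thesis unfolding L2_operator_def by (intro a b c d e f conjI ballI allI impI)
qed

text \<open>\<open>delta_solve\<close> solves the equation with the same jump condition and the
  constant potential 2 \<gamma>^2 + 1/2; Q is the bounded difference between the actual potential
  and this constant.\<close>

theorem L_self_adjoint:
  assumes "\<alpha> \<ge> 0" shows "self_adjoint (L_dom \<alpha> k) (L_op b \<beta> k lam)"
proof -
  define \<gamma> where "\<gamma> = (real k)\<^sup>2 * \<alpha>"
  have g: "\<gamma> \<ge> 0" using assms by (simp add: \<gamma>_def)
  define Q where "Q x = pot b \<beta> k lam x - (2 * \<gamma>\<^sup>2 + 1/2)" for x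
  let ?pot = "\<lambda>u x. complex_of_real (pot b \<beta> k lam x) * u x"
  show ?thesis
  proof (rule self_adjointI[OF L_operator])
    fix \<phi> \<psi> assume "\<phi> \<in> L_dom \<alpha> k" "\<psi> \<in> L_dom \<alpha> k"
    obtain u v1 v2 w where r1: "H2_rep \<phi> u v1 v2 w" "v1 0 - v2 0 = - of_real \<gamma> * u 0"
      using \<open>\<phi> \<in> _\<close> unfolding \<gamma>_def by (rule L_dom_cases)
    obtain y z1 z2 q where r2: "H2_rep \<psi> y z1 z2 q" "z1 0 - z2 0 = - of_real \<gamma> * y 0"
      using \<open>\<psi> \<in> _\<close> unfolding \<gamma>_def by (rule L_dom_cases)
    note H1 = H2_repD(1)[OF r1(1)] and H2 = H2_repD(1)[OF r2(1)]
    have yL: "?pot y \<in> L2 UNIV" by (rule L2_mult_bounded[OF H1_repD(1)[OF H2] pot_measurable pot_bound])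
    have "L2_inner \<phi> (L_op b \<beta> k lam \<psi>) = cnj (L2_inner (L_op b \<beta> k lam \<psi>) \<phi>)"
      by (rule L2.ip_commute[OF L_op_L2(2)[OF r2(1)] H1_repD(5)[OF H1]])
    also have "\<dots> = cnj (L2_inner (piece z1 z2) (piece v1 v2)) - of_real \<gamma> * (u 0 * cnj (y 0)) + cnj (L2_inner (?pot y) u)"
      unfolding L_form[OF r2 H1] by (simp add: mult_ac)
    also have "cnj (L2_inner (piece z1 z2) (piece v1 v2)) = L2_inner (piece v1 v2) (piece z1 z2)"
      by (rule L2.ip_commute[OF H1_repD(2)[OF H2] H1_repD(2)[OF H1], symmetric])
    also have "cnj (L2_inner (?pot y) u) = L2_inner u (?pot y)"
      by (rule L2.ip_commute[OF yL H1_repD(1)[OF H1], symmetric])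
    also have "\<dots> = L2_inner (?pot u) y" by (rule L2_mult_real_symmetric[symmetric])
    finally show "L2_inner (L_op b \<beta> k lam \<phi>) \<psi> = L2_inner \<phi> (L_op b \<beta> k lam \<psi>)"
      unfolding L_form[OF r1 H2] by simp
  next
    have "(\<lambda>x. complex_of_real (pot b \<beta> k lam x) - of_real (2 * \<gamma>\<^sup>2 + 1/2)) \<in> borel_measurable lebesgue"
      using pot_measurable[of b \<beta> k lam] by (intro borel_measurable_diff) auto
    then show "(\<lambda>x. complex_of_real (Q x)) \<in> borel_measurable lebesgue"
      by (simp only: Q_def of_real_diff)
    fix x
    have "\<bar>Q x\<bar> \<le> \<bar>pot b \<beta> k lam x\<bar> + \<bar>2 * \<gamma>\<^sup>2 + 1/2\<bar>" unfolding Q_def by (rule abs_triangle_ineq4)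
    also have "\<dots> \<le> (real k)\<^sup>2 * (\<bar>1 - \<beta>\<bar> + \<bar>1 - lam\<bar>) + \<bar>2 * \<gamma>\<^sup>2 + 1/2\<bar>"
      using pot_bound[of b \<beta> k lam x] by simp
    finally show "cmod (complex_of_real (Q x)) \<le> (real k)\<^sup>2 * (\<bar>1 - \<beta>\<bar> + \<bar>1 - lam\<bar>) + \<bar>2 * \<gamma>\<^sup>2 + 1/2\<bar>"
      by (simp only: norm_of_real)
  next
    fix f assume "f \<in> L2 UNIV"
    from delta_solve[OF g this] obtain \<phi> u v1 v2 w where r: "H2_rep \<phi> u v1 v2 w" "v1 0 - v2 0 = - of_real \<gamma> * u 0"
      and e: "eq_ae (\<lambda>x. - w x + of_real (2 * \<gamma>\<^sup>2 + 1/2) * u x) f" by blast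
    have "\<phi> \<in> L_dom \<alpha> k" unfolding L_dom_iff \<gamma>_def[symmetric] using r by blast
    moreover have "eq_ae (\<lambda>x. L_op b \<beta> k lam \<phi> x - of_real (Q x) * \<phi> x) f"
      using e L_op_ae[OF r(1), of b \<beta> k lam] H1_repD(4)[OF H2_repD(1)[OF r(1)]]
      by eventually_elim (simp add: Q_def algebra_simps)
    ultimately show "\<exists>\<phi>\<in>L_dom \<alpha> k. eq_ae (\<lambda>x. L_op b \<beta> k lam \<phi> x - of_real (Q x) * \<phi> x) f" by blast
  qed
qed

section \<open>The decaying even solution\<close>

lemma primitive_on_mirror:
  assumes "primitive_on {0..} u v" shows "primitive_on {..0} (\<lambda>x. u (- x)) (\<lambda>x. - v (- x))"
proof (rule primI)
  fix x y :: real assume xy: "x \<in> {..0}" "y \<in> {..0}" "x \<le> y"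
  then have xy': "-y \<in> {0..}" "-x \<in> {0..}" "-y \<le> -x" by auto
  have h: "(v has_integral (u (-x) - u (-y))) {-y..-x}" using primD(2)[OF assms xy'] .
  show "((\<lambda>x. - v (- x)) has_integral (u (- y) - u (- x))) {x..y}"
    using has_integral_neg[OF has_integral_reflect_lemma_real[OF h]] by simp
  have "(\<lambda>x. v (- x)) absolutely_integrable_on {x..y}"
    using primD(1)[OF assms xy'] absolutely_integrable_reflect_real[where f = v and a = "-y" and b = "-x"] by simp
  from absolutely_integrable_linear[OF this bounded_linear_minus[OF bounded_linear_ident]]
  show "(\<lambda>x. - v (- x)) absolutely_integrable_on {x..y}" by (simp add: o_def)
qed

lemma exp_abs_integrable:
  fixes c :: real assumes "c > 0" shows "integrable lebesgue (\<lambda>x. exp (- c * \<bar>x\<bar>))"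
proof -
  let ?E = "\<lambda>x. if x \<in> {0..} then exp (- c * x) else 0"
  have "(\<lambda>x. exp (- c * x)) integrable_on {0..}"
    using has_integral_exp_minus_to_infinity[OF assms, of 0] by blast
  then have "(\<lambda>x. exp (- c * x)) absolutely_integrable_on {0..}"
    by (simp add: absolutely_integrable_on_iff_nonneg)
  then have "?E absolutely_integrable_on UNIV" by (rule absolutely_integrable_restrict_UNIV[THEN iffD2])
  then have E: "integrable lebesgue ?E" by (simp add: set_integrable_def)
  have E': "integrable lebesgue (\<lambda>x. ?E (0 + -1 * x))" by (rule lebesgue_integrable_real_affine[OF E]) simp
  show ?thesis
  proof (rule Bochner_Integration.integrable_bound[OF Bochner_Integration.integrable_add[OF E E']])
    have "(\<lambda>x. exp (- c * \<bar>x\<bar>)) \<in> borel_measurable borel" by measurable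
    then show "(\<lambda>x. exp (- c * \<bar>x\<bar>)) \<in> borel_measurable lebesgue" by (simp add: measurable_completion)
    show "AE x in lebesgue. norm (exp (- c * \<bar>x\<bar>)) \<le> norm (?E x + ?E (0 + -1 * x))"
      by (rule AE_I2) (auto simp: abs_if)
  qed
qed

lemma L2_exp_bound:
  assumes "f \<in> borel_measurable lebesgue" "\<And>x. cmod (f x) \<le> K * exp (- c * \<bar>x\<bar>)" "c > 0"
  shows "f \<in> L2 UNIV"
proof (rule L2_UNIV_bounded_by[OF assms(1)])
  show "integrable lebesgue (\<lambda>x. K\<^sup>2 * exp (- (2 * c) * \<bar>x\<bar>))"
    using exp_abs_integrable[of "2 * c"] assms(3) by simp
  show "(cmod (f x))\<^sup>2 \<le> K\<^sup>2 * exp (- (2 * c) * \<bar>x\<bar>)" for x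
  proof -
    have "(cmod (f x))\<^sup>2 \<le> (K * exp (- c * \<bar>x\<bar>))\<^sup>2" by (rule power_mono[OF assms(2)]) simp
    also have "\<dots> = K\<^sup>2 * exp (- (2 * c) * \<bar>x\<bar>)"
      by (simp add: power_mult_distrib power2_eq_square flip: exp_add)
    finally show ?thesis .
  qed
qed

text \<open>The quotient by the exponential is bounded on [0, b] by compactness and constant beyond
  b.\<close>

lemma exp_tail_bound:
  fixes h :: "real \<Rightarrow> real"
  assumes "continuous_on UNIV h" "\<And>t. t > b \<Longrightarrow> h t = C * exp (- M * t)" "M > 0" "b > 0"
  shows "\<exists>K. \<forall>t\<ge>0. \<bar>h t\<bar> \<le> K * exp (- M * t)"
proof -
  have "continuous_on {0..b} (\<lambda>t. h t * exp (M * t))" 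
    by (intro continuous_intros) (rule continuous_on_subset[OF assms(1)], simp)
  then have "bounded ((\<lambda>t. h t * exp (M * t)) ` {0..b})" by (intro compact_imp_bounded compact_continuous_image) auto
  then obtain B where B: "\<And>t. t \<in> {0..b} \<Longrightarrow> norm (h t * exp (M * t)) \<le> B" unfolding bounded_iff by blast
  have "\<bar>h t\<bar> \<le> max B \<bar>C\<bar> * exp (- M * t)" if "t \<ge> 0" for t
  proof (cases "t \<le> b")
    case True
    then have "\<bar>h t\<bar> * exp (M * t) \<le> max B \<bar>C\<bar>" using B[of t] that by (simp add: abs_mult le_max_iff_disj)
    then have "\<bar>h t\<bar> * exp (M * t) * exp (- M * t) \<le> max B \<bar>C\<bar> * exp (- M * t)" by (rule mult_right_mono) simp
    then show ?thesis by (simp add: mult.assoc flip: exp_add)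
  next
    case False
    then show ?thesis using assms(2)[of t] by (simp add: abs_mult mult_right_mono)
  qed
  then show ?thesis by blast
qed

text \<open>Beyond b the solution is a multiple of exp(- M |y|). Matching value and derivative at b
  continues it inwards as a combination of cosh and sinh in A (b - |y|). The even extension leaves a
  kink only at the origin, where the jump is twice the right-hand derivative.\<close>

lemma psi_exists:
  fixes b \<beta> lam :: real and k :: nat
  assumes "b > 0" "k \<ge> 1" "\<beta> < 1" "lam < 1"
  defines "a \<equiv> sqrt (1 - \<beta>)" and "m \<equiv> sqrt (1 - lam)"
  shows "\<exists>u v1 v2. H2_rep u u v1 v2 (\<lambda>y. of_real (pot b \<beta> k lam y) * u y) \<and> u 0 = 1 \<and>
    v1 0 - v2 0 = - of_real (2 * (real k * a * ((a * sinh (real k * a * b) + m * cosh (real k * a * b)) /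
      (a * cosh (real k * a * b) + m * sinh (real k * a * b))))) \<and> (\<forall>y. \<bar>y\<bar> > b \<longrightarrow> u y \<noteq> 0)"
proof -
  define A M where "A = real k * a" and "M = real k * m"
  have ap: "a > 0" and mp: "m > 0" using assms(3,4) by (simp_all add: a_def m_def)
  have Ap: "A > 0" and Mp: "M > 0" using ap mp assms(2) by (simp_all add: A_def M_def)
  have A2: "A\<^sup>2 = (real k)\<^sup>2 * (1 - \<beta>)" and M2: "M\<^sup>2 = (real k)\<^sup>2 * (1 - lam)"
    using assms(3,4) by (simp_all add: A_def M_def a_def m_def power_mult_distrib)
  \<comment> \<open>The value of the unnormalised solution at 0, so that u 0 = 1.\<close>
  define N where "N = cosh (A * b) + M / A * sinh (A * b)"
  have "sinh (A * b) > 0" using Ap assms(1) by simp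
  then have Np: "N > 0" unfolding N_def using Ap Mp by (intro add_pos_pos mult_pos_pos divide_pos_pos) auto
  define g where "g t = (if t \<le> b then (cosh (A * (b - t)) + M / A * sinh (A * (b - t))) / N else exp (- M * (t - b)) / N)" for t
  define gd where "gd t = (if t \<le> b then - (A * sinh (A * (b - t)) + M * cosh (A * (b - t))) / N else - (M * exp (- M * (t - b))) / N)" for t
  have cg: "continuous_on UNIV g" unfolding g_def
    by (rule continuous_on_cases_le[where g = "\<lambda>t. exp (- M * (t - b)) / N" and h = "\<lambda>t. t" and a = b, simplified])
      (use Ap Np in \<open>auto intro!: continuous_intros\<close>)
  have cgd: "continuous_on UNIV gd" unfolding gd_def
    by (rule continuous_on_cases_le[where g = "\<lambda>t. - (M * exp (- M * (t - b))) / N" and h = "\<lambda>t. t" and a = b, simplified])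
      (use Ap Np in \<open>auto intro!: continuous_intros\<close>)
  have dg: "(g has_real_derivative gd t) (at t)" if "t \<noteq> b" for t
  proof (cases "t < b")
    case True
    have "((\<lambda>t. (cosh (A * (b - t)) + M / A * sinh (A * (b - t))) / N) has_real_derivative gd t) (at t)"
      using True Ap Np by (auto intro!: derivative_eq_intros simp: gd_def field_simps)
    then show ?thesis
      by (rule has_field_derivative_transform_within_open[of _ _ _ "{..<b}"]) (use True in \<open>auto simp: g_def\<close>)
  next
    case False
    then have t: "t > b" using that by simp
    have "((\<lambda>t. exp (- M * (t - b)) / N) has_real_derivative gd t) (at t)"
      using t Np by (auto intro!: derivative_eq_intros simp: gd_def field_simps)
    then show ?thesis
      by (rule has_field_derivative_transform_within_open[of _ _ _ "{b<..}"]) (use t in \<open>auto simp: g_def\<close>)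
  qed
  have dgd: "(gd has_real_derivative (pot b \<beta> k lam t * g t)) (at t)" if "t \<noteq> b" "t > 0" for t
  proof (cases "t < b")
    case True
    have p: "pot b \<beta> k lam t = A\<^sup>2" using True that by (simp add: pot_cases A2)
    have "((\<lambda>t. - (A * sinh (A * (b - t)) + M * cosh (A * (b - t))) / N) has_real_derivative pot b \<beta> k lam t * g t) (at t)"
      unfolding p using True Ap Np by (auto intro!: derivative_eq_intros simp: g_def field_simps power2_eq_square)
    then show ?thesis
      by (rule has_field_derivative_transform_within_open[of _ _ _ "{..<b}"]) (use True in \<open>auto simp: gd_def\<close>)
  next
    case False
    then have t: "t > b" using that by simp
    have p: "pot b \<beta> k lam t = M\<^sup>2" using False that by (simp add: pot_cases M2)
    have "((\<lambda>t. - (M * exp (- M * (t - b))) / N) has_real_derivative pot b \<beta> k lam t * g t) (at t)"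
      unfolding p using t Np by (auto intro!: derivative_eq_intros simp: g_def field_simps power2_eq_square)
    then show ?thesis
      by (rule has_field_derivative_transform_within_open[of _ _ _ "{b<..}"]) (use t in \<open>auto simp: gd_def\<close>)
  qed
  have ex: "exp (- M * (t - b)) = exp (M * b) * exp (- M * t)" for t
    by (simp add: algebra_simps flip: exp_add)
  have "\<exists>K. \<forall>t\<ge>0. \<bar>g t\<bar> \<le> K * exp (- M * t)"
    by (rule exp_tail_bound[OF cg _ Mp assms(1), of "exp (M * b) / N"]) (simp add: g_def ex[simplified])
  then obtain K where K: "\<And>t. t \<ge> 0 \<Longrightarrow> \<bar>g t\<bar> \<le> K * exp (- M * t)" by blast
  have "\<exists>K. \<forall>t\<ge>0. \<bar>gd t\<bar> \<le> K * exp (- M * t)"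
    by (rule exp_tail_bound[OF cgd _ Mp assms(1), of "- (M * exp (M * b) / N)"]) (simp add: gd_def ex[simplified])
  then obtain K' where K': "\<And>t. t \<ge> 0 \<Longrightarrow> \<bar>gd t\<bar> \<le> K' * exp (- M * t)" by blast
  define u where "u y = complex_of_real (g \<bar>y\<bar>)" for y
  define v1 where "v1 y = complex_of_real (gd y)" for y
  \<comment> \<open>The derivative of an even function is odd.\<close>
  define v2 where "v2 y = - v1 (- y)" for y
  define w where "w y = complex_of_real (pot b \<beta> k lam y) * u y" for y
  have [measurable]: "g \<in> borel_measurable borel" "gd \<in> borel_measurable borel"
    by (rule borel_measurable_continuous_onI[OF cg], rule borel_measurable_continuous_onI[OF cgd])
  have uL: "u \<in> L2 UNIV"
  proof (rule L2_exp_bound[OF _ _ Mp])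
    have "u \<in> borel_measurable borel" unfolding u_def[abs_def] by measurable
    then show "u \<in> borel_measurable lebesgue" by (simp add: measurable_completion)
    show "cmod (u x) \<le> K * exp (- M * \<bar>x\<bar>)" for x using K[of "\<bar>x\<bar>"] by (simp add: u_def)
  qed
  have vL: "piece v1 v2 \<in> L2 UNIV"
  proof (rule L2_exp_bound[OF _ _ Mp])
    have "piece v1 v2 \<in> borel_measurable borel" unfolding piece_def[abs_def] v2_def v1_def by measurable
    then show "piece v1 v2 \<in> borel_measurable lebesgue" by (simp add: measurable_completion)
    show "cmod (piece v1 v2 x) \<le> K' * exp (- M * \<bar>x\<bar>)" for x
      using K'[of "\<bar>x\<bar>"] by (cases "0 \<le> x") (simp_all add: piece_def v1_def v2_def)
  qed
  have wL: "w \<in> L2 UNIV" unfolding w_def[abs_def] by (rule L2_mult_bounded[OF uL pot_measurable pot_bound])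
  have p1: "primitive_on {0..} (\<lambda>y. of_real (g y)) v1"
  proof (rule primI)
    fix x y :: real assume xy: "x \<in> {0..}" "y \<in> {0..}" "x \<le> y"
    show "v1 absolutely_integrable_on {x..y}" unfolding v1_def[abs_def]
      by (intro absolutely_integrable_continuous_real continuous_on_of_real) (rule continuous_on_subset[OF cgd], simp)
    have "(gd has_integral (g y - g x)) {x..y}"
    proof (rule fundamental_theorem_of_calculus_interior_strong[of "{b}", OF _ xy(3)])
      show "continuous_on {x..y} g" by (rule continuous_on_subset[OF cg]) simp
      show "(g has_vector_derivative gd t) (at t)" if "t \<in> {x<..<y} - {b}" for t
        using dg[of t] that by (simp add: has_real_derivative_iff_has_vector_derivative)
    qed simp
    from has_integral_linear[OF this bounded_linear_of_real[where 'a = complex]]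
    show "(v1 has_integral of_real (g y) - of_real (g x)) {x..y}" by (simp add: o_def v1_def[abs_def])
  qed
  have p2: "primitive_on {0..} v1 w"
  proof (rule primI)
    fix x y :: real assume xy: "x \<in> {0..}" "y \<in> {0..}" "x \<le> y"
    show "w absolutely_integrable_on {x..y}" by (rule L2_Icc_integrable[OF wL])
    \<comment> \<open>The potential jumps at b, which becomes the exceptional point of the
      fundamental theorem.\<close>
    have "((\<lambda>t. pot b \<beta> k lam t * g t) has_integral (gd y - gd x)) {x..y}"
    proof (rule fundamental_theorem_of_calculus_interior_strong[of "{b}", OF _ xy(3)])
      show "continuous_on {x..y} gd" by (rule continuous_on_subset[OF cgd]) simp
      show "(gd has_vector_derivative pot b \<beta> k lam t * g t) (at t)" if "t \<in> {x<..<y} - {b}" for t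
        using dgd[of t] that xy by (simp add: has_real_derivative_iff_has_vector_derivative)
    qed simp
    from has_integral_linear[OF this bounded_linear_of_real[where 'a = complex]]
    have "((\<lambda>t. of_real (pot b \<beta> k lam t * g t)) has_integral v1 y - v1 x) {x..y}" by (simp add: o_def v1_def)
    then show "(w has_integral v1 y - v1 x) {x..y}"
      by (rule has_integral_eq[rotated]) (use xy in \<open>simp add: w_def u_def\<close>)
  qed
  have p3: "primitive_on {..0} v2 w"
  proof -
    have "pot b \<beta> k lam (- x) = pot b \<beta> k lam x" for x by (simp add: pot_cases)
    then have "w (- x) = w x" for x by (simp add: w_def u_def)
    then show ?thesis using primitive_on_scale[OF primitive_on_mirror[OF p2], of "-1"] by (simp add: v2_def[abs_def])
  qed
  have "primitive_on {..0} u v2"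
    by (rule primitive_on_cong[OF primitive_on_mirror[OF p1]]) (auto simp: is_interval_ic u_def v2_def)
  then have l: "primitive_on {..0} u (piece v1 v2)"
  proof (rule primitive_on_cong)
    show "negligible {x \<in> {..0}. v2 x \<noteq> piece v1 v2 x}"
      by (rule negligible_subset[of "{0}"]) (auto simp: piece_def split: if_splits)
  qed (auto simp: is_interval_ic)
  have r: "primitive_on {0..} u (piece v1 v2)"
    by (rule primitive_on_cong[OF p1]) (auto simp: is_interval_ci u_def piece_def)
  have "H1_rep u u (piece v1 v2)" unfolding H1_rep_def using uL vL primitive_on_glue[OF l r] by simp
  then have H2_rep: "H2_rep u u v1 v2 w" unfolding H2_rep_def using wL p2 p3 by blast
  have u0: "u 0 = 1" using assms(1) Np by (simp add: u_def g_def N_def)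
  have "gd 0 = - (real k * a * ((a * sinh (real k * a * b) + m * cosh (real k * a * b)) /
      (a * cosh (real k * a * b) + m * sinh (real k * a * b))))"
  proof -
    have "N = (a * cosh (real k * a * b) + m * sinh (real k * a * b)) / a"
      unfolding N_def A_def M_def using ap assms(2) by (simp add: field_simps)
    then have "gd 0 = - (A * sinh (A * b) + M * cosh (A * b)) / ((a * cosh (real k * a * b) + m * sinh (real k * a * b)) / a)"
      using assms(1) by (simp add: gd_def)
    \<comment> \<open>This holds for every d: for d = 0 division by zero makes both sides 0.\<close>
    moreover have "- (real k * a * S + real k * m * C) / (d / a) = - (real k * a * ((a * S + m * C) / d))" for S C d
      by (cases "d = 0") (simp_all add: field_simps)
    ultimately show ?thesis unfolding A_def M_def by (simp only:)
  qed
  then have j: "v1 0 - v2 0 = - of_real (2 * (real k * a * ((a * sinh (real k * a * b) + m * cosh (real k * a * b)) /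
      (a * cosh (real k * a * b) + m * sinh (real k * a * b)))))"
    unfolding v2_def v1_def by simp
  have "u y \<noteq> 0" if "\<bar>y\<bar> > b" for y using that Np by (simp add: u_def g_def)
  then show ?thesis using H2_rep[unfolded w_def[abs_def]] u0 j by blast
qed

section \<open>The dispersion relation and energy estimates\<close>

lemma L2_norm_mult_le:
  assumes "f \<in> L2 UNIV" "q \<in> borel_measurable lebesgue" "\<And>x. cmod (q x) \<le> B" "B \<ge> 0"
  shows "L2_norm (\<lambda>x. q x * f x) \<le> B * L2_norm f"
proof (rule power2_le_imp_le)
  have qf: "(\<lambda>x. q x * f x) \<in> L2 UNIV" by (rule L2_mult_bounded[OF assms(1-3)])
  have "(L2_norm (\<lambda>x. q x * f x))\<^sup>2 \<le> (LINT x|lebesgue. B\<^sup>2 * (cmod (f x))\<^sup>2)"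
    unfolding L2_norm_sq
  proof (rule integral_mono[OF L2_UNIV_D(2)[OF qf]])
    show "integrable lebesgue (\<lambda>x. B\<^sup>2 * (cmod (f x))\<^sup>2)" using L2_UNIV_D(2)[OF assms(1)] by simp
    show "(cmod (q x * f x))\<^sup>2 \<le> B\<^sup>2 * (cmod (f x))\<^sup>2" for x
      using assms(3)[of x] by (simp add: norm_mult power_mult_distrib mult_right_mono power_mono)
  qed
  then show "(L2_norm (\<lambda>x. q x * f x))\<^sup>2 \<le> (B * L2_norm f)\<^sup>2"
    by (simp add: L2_norm_sq power_mult_distrib)
qed (use assms(4) L2_norm_nonneg in simp)

lemma H1_rep_trace:
  assumes "H1_rep \<phi> u v" shows "cmod (u 0) \<le> H1_norm \<phi>" "L2_norm \<phi> \<le> H1_norm \<phi>"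
proof -
  have nn: "H1_norm \<phi> \<ge> 0" by (simp add: H1_norm_def)
  have "(cmod (u 0))\<^sup>2 \<le> (L2_norm u)\<^sup>2 + (L2_norm v)\<^sup>2"
    using trace_bound[OF assms] sum_squares_bound[of "L2_norm u" "L2_norm v"] by linarith
  then have "(cmod (u 0))\<^sup>2 \<le> (H1_norm \<phi>)\<^sup>2" by (simp only: H1_rep_norm(3)[OF assms])
  then show "cmod (u 0) \<le> H1_norm \<phi>" by (rule power2_le_imp_le[OF _ nn])
  have "(L2_norm \<phi>)\<^sup>2 \<le> (H1_norm \<phi>)\<^sup>2" by (simp only: H1_rep_norm(1,3)[OF assms]) simp
  then show "L2_norm \<phi> \<le> H1_norm \<phi>" by (rule power2_le_imp_le[OF _ nn])
qed

lemma V0_Linf: "V0 b \<in> Linf"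
proof -
  have "{y::real. \<bar>y\<bar> \<ge> b} \<in> sets borel" by measurable
  then have "V0 b \<in> borel_measurable borel" unfolding V0_def[abs_def] by measurable
  then have "V0 b \<in> borel_measurable lebesgue" by (simp add: measurable_completion)
  moreover have "AE y in lebesgue. \<bar>V0 b y\<bar> \<le> 1" by (rule AE_I2) (simp add: V0_def indicator_def)
  ultimately show ?thesis unfolding Linf_def by blast
qed

lemma V1_bounded: "bounded_operator_H1_Hm1 (V1 b \<beta> \<alpha>)"
proof -
  define W where "W y = complex_of_real (\<beta> * indicator {y. \<bar>y\<bar> < b} y)" for y
  have "{y::real. \<bar>y\<bar> < b} \<in> sets borel" by measurable
  then have "W \<in> borel_measurable borel" unfolding W_def[abs_def] by measurable
  then have Wm: "W \<in> borel_measurable lebesgue" by (simp add: measurable_completion)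
  have Wb: "cmod (W y) \<le> \<bar>\<beta>\<bar>" for y by (simp add: W_def indicator_def)
  let ?V = "V1 b \<beta> \<alpha>" and ?c = "\<lambda>f. cont_rep UNIV f 0"
  have V: "?V f g = (LINT y|lebesgue. W y * f y * g y) + of_real \<alpha> * (?c f * ?c g)" for f g
    by (simp only: V1_def mult_op_def delta0_def W_def)
  have HL: "f \<in> L2 UNIV" if "f \<in> H1 UNIV" for f using that by (simp add: H1_def)
  have int: "integrable lebesgue (\<lambda>y. W y * f y * g y)" if "f \<in> H1 UNIV" "g \<in> H1 UNIV" for f g
    by (rule L2_mult_integrable[OF L2_mult_bounded[OF HL[OF that(1)] Wm Wb] HL[OF that(2)]])
  have cadd: "?c (\<lambda>x. f x + g x) = ?c f + ?c g" if fg: "f \<in> H1 UNIV" "g \<in> H1 UNIV" for f g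
  proof -
    obtain u v y z where r: "H1_rep f u v" "H1_rep g y z" using fg unfolding H1_iff by blast
    show ?thesis unfolding H1_rep_cont_rep[OF H1_rep_add[OF r]] H1_rep_cont_rep[OF r(1)] H1_rep_cont_rep[OF r(2)] ..
  qed
  have cscale: "?c (\<lambda>x. s * f x) = s * ?c f" if f: "f \<in> H1 UNIV" for s f
  proof -
    obtain u v where r: "H1_rep f u v" using f unfolding H1_iff by blast
    show ?thesis unfolding H1_rep_cont_rep[OF H1_rep_scale[OF r]] H1_rep_cont_rep[OF r] ..
  qed
  have add_l: "?V (\<lambda>x. f x + h x) g = ?V f g + ?V h g" if "f \<in> H1 UNIV" "h \<in> H1 UNIV" "g \<in> H1 UNIV" for f h g
  proof -
    have "(LINT y|lebesgue. W y * (f y + h y) * g y) = (LINT y|lebesgue. W y * f y * g y) + (LINT y|lebesgue. W y * h y * g y)"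
      using Bochner_Integration.integral_add[OF int[OF that(1,3)] int[OF that(2,3)]] by (simp add: distrib_left distrib_right)
    then show ?thesis unfolding V cadd[OF that(1,2)] by (simp add: algebra_simps)
  qed
  have add_r: "?V f (\<lambda>x. g x + h x) = ?V f g + ?V f h" if "f \<in> H1 UNIV" "h \<in> H1 UNIV" "g \<in> H1 UNIV" for f h g
  proof -
    have "(LINT y|lebesgue. W y * f y * (g y + h y)) = (LINT y|lebesgue. W y * f y * g y) + (LINT y|lebesgue. W y * f y * h y)"
      using Bochner_Integration.integral_add[OF int[OF that(1,3)] int[OF that(1,2)]] by (simp add: distrib_left)
    then show ?thesis unfolding V cadd[OF that(3,2)] by (simp add: algebra_simps)
  qed
  have scale_l: "?V (\<lambda>x. s * f x) g = s * ?V f g" if "f \<in> H1 UNIV" "g \<in> H1 UNIV" for s f g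
  proof -
    have "(LINT y|lebesgue. W y * (s * f y) * g y) = s * (LINT y|lebesgue. W y * f y * g y)"
      unfolding integral_mult_right_zero[symmetric] by (simp only: mult_ac)
    then show ?thesis unfolding V cscale[OF that(1)] by (simp add: algebra_simps)
  qed
  have scale_r: "?V f (\<lambda>x. s * g x) = s * ?V f g" if "f \<in> H1 UNIV" "g \<in> H1 UNIV" for s f g
  proof -
    have "(LINT y|lebesgue. W y * f y * (s * g y)) = s * (LINT y|lebesgue. W y * f y * g y)"
      unfolding integral_mult_right_zero[symmetric] by (simp only: mult_ac)
    then show ?thesis unfolding V cscale[OF that(2)] by (simp add: algebra_simps)
  qed
  have bound: "cmod (?V f g) \<le> (\<bar>\<beta>\<bar> + \<bar>\<alpha>\<bar>) * H1_norm f * H1_norm g" if fg: "f \<in> H1 UNIV" "g \<in> H1 UNIV" for f g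
  proof -
    obtain u v y z where r: "H1_rep f u v" "H1_rep g y z" using fg unfolding H1_iff by blast
    have nn: "H1_norm f \<ge> 0" for f by (simp add: H1_norm_def)
    \<comment> \<open>The pairing is bilinear and \<open>L2_inner\<close> sesquilinear, so g is
      conjugated before Cauchy-Schwarz.\<close>
    have gc: "(\<lambda>x. cnj (g x)) \<in> L2 UNIV" by (rule L2_cnj[OF HL[OF fg(2)]])
    have "(LINT x|lebesgue. W x * f x * g x) = L2_inner (\<lambda>x. W x * f x) (\<lambda>x. cnj (g x))" by (simp add: L2_inner_def)
    then have "cmod (LINT x|lebesgue. W x * f x * g x) \<le> L2_norm (\<lambda>x. W x * f x) * L2_norm (\<lambda>x. cnj (g x))"
      using L2_Cauchy_Schwarz[OF L2_mult_bounded[OF HL[OF fg(1)] Wm Wb] gc] by simp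
    also have "L2_norm (\<lambda>x. cnj (g x)) = L2_norm g" by (simp add: L2_norm_def)
    also have "L2_norm (\<lambda>x. W x * f x) * L2_norm g \<le> (\<bar>\<beta>\<bar> * H1_norm f) * H1_norm g"
    proof (intro mult_mono)
      have "L2_norm (\<lambda>x. W x * f x) \<le> \<bar>\<beta>\<bar> * L2_norm f" by (rule L2_norm_mult_le[OF HL[OF fg(1)] Wm Wb]) simp
      also have "\<dots> \<le> \<bar>\<beta>\<bar> * H1_norm f" by (rule mult_left_mono[OF H1_rep_trace(2)[OF r(1)]]) simp
      finally show "L2_norm (\<lambda>x. W x * f x) \<le> \<bar>\<beta>\<bar> * H1_norm f" .
      show "L2_norm g \<le> H1_norm g" by (rule H1_rep_trace(2)[OF r(2)])
    qed (simp_all add: nn L2_norm_nonneg)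
    finally have 1: "cmod (LINT x|lebesgue. W x * f x * g x) \<le> \<bar>\<beta>\<bar> * H1_norm f * H1_norm g" .
    have "cmod (u 0) * cmod (y 0) \<le> H1_norm f * H1_norm g"
      by (intro mult_mono H1_rep_trace(1)[OF r(1)] H1_rep_trace(1)[OF r(2)] nn norm_ge_zero)
    then have "\<bar>\<alpha>\<bar> * (cmod (u 0) * cmod (y 0)) \<le> \<bar>\<alpha>\<bar> * (H1_norm f * H1_norm g)" by (rule mult_left_mono) simp
    then have 2: "cmod (of_real \<alpha> * (?c f * ?c g)) \<le> \<bar>\<alpha>\<bar> * (H1_norm f * H1_norm g)"
      unfolding H1_rep_cont_rep[OF r(1)] H1_rep_cont_rep[OF r(2)] by (simp add: norm_mult)
    show ?thesis unfolding V using norm_triangle_mono[OF 1 2] by (simp add: algebra_simps)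
  qed
  have "Hm1_norm (?V f) \<le> (\<bar>\<beta>\<bar> + \<bar>\<alpha>\<bar>) * H1_norm f" if f: "f \<in> H1 UNIV" for f
    unfolding Hm1_norm_def
  proof (rule cSUP_least)
    \<comment> \<open>The zero function keeps the set under the supremum nonempty.\<close>
    have z: "(\<lambda>x. 0) \<in> H1 UNIV" using H1_rep_zero H1_iff by blast
    have "(H1_norm (\<lambda>x. 0))\<^sup>2 = 0" unfolding H1_rep_norm(3)[OF H1_rep_zero] by (simp add: L2_norm_def)
    then have "(\<lambda>x. 0) \<in> {g \<in> H1 UNIV. H1_norm g \<le> 1}" using z by simp
    then show "{g \<in> H1 UNIV. H1_norm g \<le> 1} \<noteq> {}" by blast
    fix g assume g: "g \<in> {g \<in> H1 UNIV. H1_norm g \<le> 1}"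
    have "cmod (?V f g) \<le> (\<bar>\<beta>\<bar> + \<bar>\<alpha>\<bar>) * H1_norm f * H1_norm g" by (rule bound[OF f]) (use g in simp)
    also have "\<dots> \<le> (\<bar>\<beta>\<bar> + \<bar>\<alpha>\<bar>) * H1_norm f * 1"
      by (rule mult_left_mono) (use g in \<open>simp_all add: H1_norm_def\<close>)
    finally show "cmod (?V f g) \<le> (\<bar>\<beta>\<bar> + \<bar>\<alpha>\<bar>) * H1_norm f" by simp
  qed
  then have c1: "\<exists>C. \<forall>f\<in>H1 UNIV. Hm1_norm (?V f) \<le> C * H1_norm f" by blast
  have c2: "?V f \<in> Hm1" if f: "f \<in> H1 UNIV" for f
  proof -
    have "\<exists>C. \<forall>g\<in>H1 UNIV. cmod (?V f g) \<le> C * H1_norm g" using bound[OF f] by blast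
    then show ?thesis unfolding Hm1_def using add_r[OF f] scale_r[OF f] by blast
  qed
  show ?thesis unfolding bounded_operator_H1_Hm1_def using c1 c2 add_l scale_l by simp
qed

section \<open>The dispersion relation\<close>

definition disp_ratio :: "real \<Rightarrow> real \<Rightarrow> real \<Rightarrow> real" where
  "disp_ratio a m t = (a * sinh t + m * cosh t) / (a * cosh t + m * sinh t)"

lemma disp_ratio_den_pos:
  fixes a m t :: real
  assumes "a > 0" "m > 0" "t \<ge> 0" shows "a * cosh t + m * sinh t > 0"
  using assms by (intro add_pos_nonneg) auto

text \<open>Both bounds come from 0 <= sinh t <= cosh t. The upper one makes \<open>kappa\<close>
  grow at most linearly in k, against the quadratic k^2 \<alpha>.\<close>

lemma disp_ratio_bounds:
  assumes "a > 0" "m > 0" "t \<ge> 0"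
  shows "disp_ratio a m t > 0" "a * disp_ratio a m t \<le> a + m"
proof -
  note d = disp_ratio_den_pos[OF assms]
  have S: "sinh t \<ge> 0" "cosh t > 0" "sinh t \<le> cosh t" using assms(3) by (simp_all add: sinh_less_cosh_real[THEN less_imp_le])
  have "a * sinh t + m * cosh t > 0" using assms S by (intro add_nonneg_pos) auto
  then show "disp_ratio a m t > 0" using d by (simp add: disp_ratio_def)
  have "a * (a * sinh t) \<le> a * (a * cosh t)" using assms S by (intro mult_left_mono) auto
  moreover have "0 \<le> a * (m * sinh t)" "0 \<le> m * (m * sinh t)" using assms S by auto
  ultimately have "a * (a * sinh t + m * cosh t) \<le> (a + m) * (a * cosh t + m * sinh t)"
    by (simp add: algebra_simps)
  then show "a * disp_ratio a m t \<le> a + m" using d by (simp add: disp_ratio_def pos_divide_le_eq)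
qed

text \<open>After cross-multiplying, everything cancels except a (m - n) ((cosh t)^2 - (sinh
  t)^2).\<close>

lemma disp_ratio_inj_m:
  assumes "a > 0" "m > 0" "n > 0" "t \<ge> 0" "disp_ratio a m t = disp_ratio a n t" shows "m = n"
proof -
  have "(a * sinh t + m * cosh t) * (a * cosh t + n * sinh t) = (a * sinh t + n * cosh t) * (a * cosh t + m * sinh t)"
    using assms(5) disp_ratio_den_pos[OF assms(1,2,4)] disp_ratio_den_pos[OF assms(1,3,4)] by (simp add: disp_ratio_def frac_eq_eq)
  then have "a * (m - n) * ((cosh t)\<^sup>2 - (sinh t)\<^sup>2) = 0" by (simp add: algebra_simps power2_eq_square)
  then show ?thesis using assms(1) by (simp add: hyperbolic_pythagoras)
qed

lemma le_sinh_real: "0 \<le> (t::real) \<Longrightarrow> t \<le> sinh t"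
proof -
  assume t: "0 \<le> t"
  have "(\<lambda>x. sinh x - x) 0 \<le> (\<lambda>x. sinh x - x) t"
  proof (rule DERIV_nonneg_imp_nondecreasing[OF t])
    show "\<exists>y. ((\<lambda>x. sinh x - x) has_real_derivative y) (at x) \<and> 0 \<le> y" for x :: real
      by (rule exI[of _ "cosh x - 1"]) (auto intro!: derivative_eq_intros simp: cosh_real_ge_1)
  qed
  then show ?thesis by simp
qed

text \<open>With numerator \<open>Nn\<close> and denominator \<open>Dn\<close>, Dn^2 - Nn^2 = a^2 -
  m^2, and the derivative of the quotient at x is negative iff x (a^2 - m^2) < Nn Dn. This follows
  from x <= sinh x and 1 <= cosh x, because Nn Dn contains a^2 sinh x cosh x. The ratio itself
  increases when a > m; dividing by its argument makes it decreasing in every case.\<close>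

lemma disp_ratio_over_decreasing:
  assumes "a > 0" "m > 0" "0 < s" "s < t" shows "disp_ratio a m t / t < disp_ratio a m s / s"
proof (rule DERIV_neg_imp_decreasing[OF assms(4)])
  fix x assume "s \<le> x" "x \<le> t"
  then have x: "x > 0" using assms(3) by linarith
  define Nn Dn where "Nn = a * sinh x + m * cosh x" and "Dn = a * cosh x + m * sinh x"
  have d: "Dn > 0" unfolding Dn_def by (rule disp_ratio_den_pos[OF assms(1,2)]) (use x in simp)
  have S: "sinh x \<ge> x" "sinh x > 0" "cosh x \<ge> 1" using le_sinh_real[of x] x by (simp_all add: cosh_real_ge_1)
  have q: "Dn\<^sup>2 - Nn\<^sup>2 = a\<^sup>2 - m\<^sup>2"
  proof -
    have "Dn\<^sup>2 - Nn\<^sup>2 = (a\<^sup>2 - m\<^sup>2) * ((cosh x)\<^sup>2 - (sinh x)\<^sup>2)"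
      by (simp add: Dn_def Nn_def power2_eq_square algebra_simps)
    then show ?thesis by (simp add: hyperbolic_pythagoras)
  qed
  have "x * (a\<^sup>2 - m\<^sup>2) < Nn * Dn"
  proof -
    have "x * (a\<^sup>2 - m\<^sup>2) \<le> x * a\<^sup>2" using x by simp
    also have "\<dots> \<le> (sinh x * cosh x) * a\<^sup>2"
      using mult_mono[OF S(1) S(3)] x S by (intro mult_right_mono) auto
    also have "\<dots> < (sinh x * cosh x) * a\<^sup>2 + (a * m * ((cosh x)\<^sup>2 + (sinh x)\<^sup>2) + m\<^sup>2 * (sinh x * cosh x))"
      using assms(1,2) S x by (simp add: add_pos_nonneg)
    also have "\<dots> = Nn * Dn" by (simp add: Nn_def Dn_def power2_eq_square algebra_simps)
    finally show ?thesis .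
  qed
  then have neg: "((Dn * Dn - Nn * Nn) / (Dn * Dn) * x - Nn / Dn) / (x * x) < 0"
  proof -
    assume *: "x * (a\<^sup>2 - m\<^sup>2) < Nn * Dn"
    have "(Dn * Dn - Nn * Nn) / (Dn * Dn) * x = x * (a\<^sup>2 - m\<^sup>2) / (Dn * Dn)" using q by (simp add: power2_eq_square)
    also have "\<dots> < Nn * Dn / (Dn * Dn)" by (rule divide_strict_right_mono[OF *]) (use d in simp)
    also have "\<dots> = Nn / Dn" using d by simp
    finally show ?thesis using x by (simp add: divide_neg_pos)
  qed
  have "((\<lambda>x. disp_ratio a m x) has_real_derivative (Dn * Dn - Nn * Nn) / (Dn * Dn)) (at x)"
    unfolding disp_ratio_def Dn_def Nn_def
    by (rule DERIV_divide) (use d in \<open>auto intro!: derivative_eq_intros simp: Dn_def\<close>)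
  then have "((\<lambda>x. disp_ratio a m x / x) has_real_derivative ((Dn * Dn - Nn * Nn) / (Dn * Dn) * x - disp_ratio a m x * 1) / (x * x)) (at x)"
    by (rule DERIV_divide) (use x in auto)
  moreover have "disp_ratio a m x = Nn / Dn" by (simp add: disp_ratio_def Nn_def Dn_def)
  ultimately show "\<exists>y. ((\<lambda>x. disp_ratio a m x / x) has_real_derivative y) (at x) \<and> y < 0" using neg by auto
qed

text \<open>Minus the right-hand derivative at 0 of the decaying even solution with value 1 there.
  That solution satisfies the jump condition exactly when k^2 \<alpha> = 2 \<kappa>.\<close>

definition kappa :: "real \<Rightarrow> real \<Rightarrow> nat \<Rightarrow> real \<Rightarrow> real" where
  "kappa b \<beta> k lam = real k * (sqrt (1 - \<beta>) * disp_ratio (sqrt (1 - \<beta>)) (sqrt (1 - lam)) (real k * sqrt (1 - \<beta>) * b))"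

lemma psi:
  assumes "b > 0" "k \<ge> 1" "\<beta> < 1" "lam < 1"
  obtains u v1 v2 where "H2_rep u u v1 v2 (\<lambda>y. of_real (pot b \<beta> k lam y) * u y)" "u 0 = 1"
    "v1 0 - v2 0 = - of_real (2 * kappa b \<beta> k lam)" "\<And>y. \<bar>y\<bar> > b \<Longrightarrow> u y \<noteq> 0"
  using psi_exists[OF assms] unfolding kappa_def disp_ratio_def mult.assoc[of "real k" "sqrt (1 - \<beta>)", symmetric] by blast

section \<open>Energy identities and a priori estimates\<close>

lemma pot_energy:
  assumes u: "u \<in> L2 UNIV" and "\<beta> < 1" "lam < 1"
  shows "(real k)\<^sup>2 * min (1 - \<beta>) (1 - lam) * (L2_norm u)\<^sup>2 \<le> Re (L2_inner (\<lambda>y. of_real (pot b \<beta> k lam y) * u y) u)"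
proof -
  have pu: "(\<lambda>y. of_real (pot b \<beta> k lam y) * u y) \<in> L2 UNIV" by (rule L2_mult_bounded[OF u pot_measurable pot_bound])
  have e: "of_real (pot b \<beta> k lam y) * u y * cnj (u y) = of_real (pot b \<beta> k lam y * (cmod (u y))\<^sup>2)" for y
    by (simp only: of_real_mult complex_norm_square mult.assoc)
  have i: "integrable lebesgue (\<lambda>y. pot b \<beta> k lam y * (cmod (u y))\<^sup>2)"
    using integrable_Re[OF L2_inner_integrable[OF pu u]] unfolding e by simp
  have "(real k)\<^sup>2 * min (1 - \<beta>) (1 - lam) * (L2_norm u)\<^sup>2
      = (LINT y|lebesgue. (real k)\<^sup>2 * min (1 - \<beta>) (1 - lam) * (cmod (u y))\<^sup>2)"
    by (simp add: L2_norm_sq)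
  also have "\<dots> \<le> (LINT y|lebesgue. pot b \<beta> k lam y * (cmod (u y))\<^sup>2)"
  proof (rule integral_mono[OF _ i])
    show "integrable lebesgue (\<lambda>y. (real k)\<^sup>2 * min (1 - \<beta>) (1 - lam) * (cmod (u y))\<^sup>2)"
      using L2_UNIV_D(2)[OF u] by simp
    show "(real k)\<^sup>2 * min (1 - \<beta>) (1 - lam) * (cmod (u y))\<^sup>2 \<le> pot b \<beta> k lam y * (cmod (u y))\<^sup>2" for y
      unfolding pot_cases by (intro mult_right_mono) (auto intro!: mult_left_mono)
  qed
  also have "\<dots> = Re (L2_inner (\<lambda>y. of_real (pot b \<beta> k lam y) * u y) u)"
    unfolding L2_inner_def e integral_complex_of_real by simp
  finally show ?thesis .
qed

text \<open>The real part of the form at \<phi> itself, with the delta term moved to the right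
  because it is controlled separately through u 0.\<close>

lemma energy_estimate:
  assumes "\<beta> < 1" "lam < 1" and r: "H2_rep \<phi> u v1 v2 w" and j: "v1 0 - v2 0 = - of_real \<gamma> * u 0"
  shows "(real k)\<^sup>2 * min (1 - \<beta>) (1 - lam) * (L2_norm \<phi>)\<^sup>2 + (L2_norm (wderiv UNIV \<phi>))\<^sup>2
    \<le> L2_norm (L_op b \<beta> k lam \<phi>) * L2_norm \<phi> + \<gamma> * (cmod (u 0))\<^sup>2"
proof -
  note H = H2_repD(1)[OF r]
  let ?f = "L_op b \<beta> k lam \<phi>" and ?p = "\<lambda>y. of_real (pot b \<beta> k lam y) * u y"
  have "L2_inner ?f \<phi> = of_real ((L2_norm (piece v1 v2))\<^sup>2) - of_real (\<gamma> * (cmod (u 0))\<^sup>2) + L2_inner ?p u"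
    unfolding L_form[OF r j H] L2_inner_self_norm of_real_mult[of \<gamma>] complex_norm_square ..
  then have "Re (L2_inner ?f \<phi>) = (L2_norm (piece v1 v2))\<^sup>2 - \<gamma> * (cmod (u 0))\<^sup>2 + Re (L2_inner ?p u)"
    by (simp only: plus_complex.sel minus_complex.sel Re_complex_of_real)
  moreover have "Re (L2_inner ?f \<phi>) \<le> L2_norm ?f * L2_norm \<phi>"
    using L2_Cauchy_Schwarz[OF L_op_L2(2)[OF r] H1_repD(5)[OF H]] complex_Re_le_cmod order_trans by blast
  ultimately show ?thesis
    using pot_energy[OF H1_repD(1)[OF H] assms(1,2), of k b] unfolding H1_rep_norm(1,2)[OF H] by linarith
qed

text \<open>Pairing with the decaying solution U leaves only boundary terms, and Cauchy-Schwarz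
  brings in the norm of U. Its square is at most 2 \<kappa> / (k^2 min (1 - \<beta>) (1 -
  \<lambda>)) by the energy identity of U, so U never has to be integrated.\<close>

lemma boundary_estimate:
  assumes "b > 0" "k \<ge> 1" "\<beta> < 1" "lam < 1" and r: "H2_rep \<phi> u v1 v2 w" and j: "v1 0 - v2 0 = - of_real \<gamma> * u 0"
  shows "(real k)\<^sup>2 * min (1 - \<beta>) (1 - lam) * ((\<gamma> - 2 * kappa b \<beta> k lam)\<^sup>2 * (cmod (u 0))\<^sup>2)
    \<le> 2 * kappa b \<beta> k lam * (L2_norm (L_op b \<beta> k lam \<phi>))\<^sup>2"
proof -
  let ?\<kappa> = "kappa b \<beta> k lam" and ?pot = "\<lambda>u y. complex_of_real (pot b \<beta> k lam y) * u y" and ?f = "L_op b \<beta> k lam \<phi>"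
  let ?v = "piece v1 v2"
  define c where "c = (real k)\<^sup>2 * min (1 - \<beta>) (1 - lam)"
  have c: "c \<ge> 0" using assms(3,4) by (simp add: c_def)
  note H = H2_repD(1)[OF r]
  obtain U p1 p2 where P: "H2_rep U U p1 p2 (?pot U)" "U 0 = 1" "p1 0 - p2 0 = - of_real (2 * ?\<kappa>)"
    using psi[OF assms(1-4)] by metis
  note HU = H2_repD(1)[OF P(1)]
  let ?p = "piece p1 p2"
  have L: "u \<in> L2 UNIV" "?v \<in> L2 UNIV" "U \<in> L2 UNIV" "?p \<in> L2 UNIV" "?pot U \<in> L2 UNIV"
    by (rule H1_repD(1)[OF H], rule H1_repD(2)[OF H], rule H1_repD(1)[OF HU], rule H1_repD(2)[OF HU], rule H2_repD(2)[OF P(1)])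
  \<comment> \<open>The second derivative of U is the potential times U. Hence Green's formula for U
    tested with \<phi> evaluates, up to conjugation, the same two inner products as the form of
    \<phi> tested with U.\<close>
  have "L2_inner (?pot U) u + L2_inner ?p ?v = of_real (2 * ?\<kappa>) * cnj (u 0)"
    unfolding Green[OF P(1) H] P(3) by simp
  then have "cnj (L2_inner (?pot U) u) + cnj (L2_inner ?p ?v) = of_real (2 * ?\<kappa>) * u 0"
    by (metis complex_cnj_add complex_cnj_mult complex_cnj_complex_of_real complex_cnj_cnj)
  then have G: "L2_inner (?pot u) U + L2_inner ?v ?p = of_real (2 * ?\<kappa>) * u 0"
    unfolding L2.ip_commute[OF L(5,1), symmetric] L2.ip_commute[OF L(4,2), symmetric]
    by (simp only: L2_mult_real_symmetric[of _ u U])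
  have "L2_inner ?f U = L2_inner ?v ?p - of_real \<gamma> * u 0 + L2_inner (?pot u) U"
    unfolding L_form[OF r j HU] P(2) by simp
  also have "\<dots> = - of_real (\<gamma> - 2 * ?\<kappa>) * u 0" using G by (simp add: algebra_simps)
  finally have "cmod (- of_real (\<gamma> - 2 * ?\<kappa>) * u 0) \<le> L2_norm ?f * L2_norm U"
    using L2_Cauchy_Schwarz[OF L_op_L2(2)[OF r] L(3)] by metis
  then have "\<bar>\<gamma> - 2 * ?\<kappa>\<bar> * cmod (u 0) \<le> L2_norm ?f * L2_norm U"
    by (simp only: norm_mult norm_minus_cancel norm_of_real)
  then have "(\<bar>\<gamma> - 2 * ?\<kappa>\<bar> * cmod (u 0))\<^sup>2 \<le> (L2_norm ?f * L2_norm U)\<^sup>2" by (rule power_mono) simp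
  then have 1: "(\<gamma> - 2 * ?\<kappa>)\<^sup>2 * (cmod (u 0))\<^sup>2 \<le> (L2_norm ?f)\<^sup>2 * (L2_norm U)\<^sup>2" by (simp add: power_mult_distrib)
  have "L2_inner (?pot U) U + of_real ((L2_norm ?p)\<^sup>2) = of_real (2 * ?\<kappa>)"
    using Green[OF P(1) HU] unfolding P(2,3) L2_inner_self_norm by simp
  then have "Re (L2_inner (?pot U) U) + (L2_norm ?p)\<^sup>2 = 2 * ?\<kappa>"
    by (metis Re_complex_of_real plus_complex.sel(1))
  then have 2: "c * (L2_norm U)\<^sup>2 \<le> 2 * ?\<kappa>"
    using pot_energy[OF L(3) assms(3,4), of k b] zero_le_power2[of "L2_norm ?p"] unfolding c_def by linarith
  have "c * ((\<gamma> - 2 * ?\<kappa>)\<^sup>2 * (cmod (u 0))\<^sup>2) \<le> c * ((L2_norm ?f)\<^sup>2 * (L2_norm U)\<^sup>2)" by (rule mult_left_mono[OF 1 c])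
  also have "\<dots> = (c * (L2_norm U)\<^sup>2) * (L2_norm ?f)\<^sup>2" by simp
  also have "\<dots> \<le> 2 * ?\<kappa> * (L2_norm ?f)\<^sup>2" by (rule mult_right_mono[OF 2]) simp
  finally show ?thesis unfolding c_def .
qed

text \<open>Young's inequality moves half of c |\<phi>|^2 to the left, and
  \<open>boundary_estimate\<close> replaces |u 0|^2. \<open>c\<close> is any positive lower bound of
  the potential, so that one choice can serve a whole interval of \<lambda>.\<close>

lemma solution_estimate:
  assumes "b > 0" "k \<ge> 1" "\<beta> < 1" "lam < 1" "\<alpha> \<ge> 0" "\<phi> \<in> L_dom \<alpha> k"
    and d: "(real k)\<^sup>2 * \<alpha> - 2 * kappa b \<beta> k lam \<noteq> 0"
    and c: "0 < c" "c \<le> (real k)\<^sup>2 * min (1 - \<beta>) (1 - lam)"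
  shows "c / 2 * (L2_norm \<phi>)\<^sup>2 + (L2_norm (wderiv UNIV \<phi>))\<^sup>2 \<le>
    (1 / (2 * c) + 2 * ((real k)\<^sup>2 * \<alpha>) * kappa b \<beta> k lam / (c * ((real k)\<^sup>2 * \<alpha> - 2 * kappa b \<beta> k lam)\<^sup>2))
      * (L2_norm (L_op b \<beta> k lam \<phi>))\<^sup>2"
proof -
  define \<gamma> \<kappa> where "\<gamma> = (real k)\<^sup>2 * \<alpha>" and "\<kappa> = kappa b \<beta> k lam"
  define F n where "F = L2_norm (L_op b \<beta> k lam \<phi>)" and "n = L2_norm \<phi>"
  obtain u v1 v2 w where r: "H2_rep \<phi> u v1 v2 w" "v1 0 - v2 0 = - of_real \<gamma> * u 0"
    using assms(6) unfolding \<gamma>_def by (rule L_dom_cases)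
  have g0: "\<gamma> \<ge> 0" using assms(5) by (simp add: \<gamma>_def)
  have d2: "(\<gamma> - 2 * \<kappa>)\<^sup>2 > 0" using d by (simp add: \<gamma>_def \<kappa>_def)
  have "c * ((\<gamma> - 2 * \<kappa>)\<^sup>2 * (cmod (u 0))\<^sup>2) \<le> (real k)\<^sup>2 * min (1 - \<beta>) (1 - lam) * ((\<gamma> - 2 * \<kappa>)\<^sup>2 * (cmod (u 0))\<^sup>2)"
    by (rule mult_right_mono[OF c(2)]) simp
  also have "\<dots> \<le> 2 * \<kappa> * F\<^sup>2" using boundary_estimate[OF assms(1-4) r] unfolding \<kappa>_def F_def .
  finally have "(cmod (u 0))\<^sup>2 \<le> 2 * \<kappa> * F\<^sup>2 / (c * (\<gamma> - 2 * \<kappa>)\<^sup>2)"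
    using c(1) d2 by (simp add: pos_le_divide_eq mult_ac)
  then have "\<gamma> * (cmod (u 0))\<^sup>2 \<le> \<gamma> * (2 * \<kappa> * F\<^sup>2 / (c * (\<gamma> - 2 * \<kappa>)\<^sup>2))" by (rule mult_left_mono[OF _ g0])
  moreover have "F * n \<le> F\<^sup>2 / (2 * c) + c / 2 * n\<^sup>2"
  proof -
    have "0 \<le> (F - c * n)\<^sup>2 / (2 * c)" using c(1) by simp
    also have "\<dots> = F\<^sup>2 / (2 * c) + c / 2 * n\<^sup>2 - F * n" using c(1) by (simp add: field_simps power2_eq_square)
    finally show ?thesis by simp
  qed
  moreover have "c * n\<^sup>2 \<le> (real k)\<^sup>2 * min (1 - \<beta>) (1 - lam) * n\<^sup>2" by (rule mult_right_mono[OF c(2)]) simp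
  moreover have "(real k)\<^sup>2 * min (1 - \<beta>) (1 - lam) * n\<^sup>2 + (L2_norm (wderiv UNIV \<phi>))\<^sup>2 \<le> F * n + \<gamma> * (cmod (u 0))\<^sup>2"
    using energy_estimate[OF assms(3,4) r, of k b] unfolding F_def n_def .
  ultimately have "c / 2 * n\<^sup>2 + (L2_norm (wderiv UNIV \<phi>))\<^sup>2 \<le> F\<^sup>2 / (2 * c) + \<gamma> * (2 * \<kappa> * F\<^sup>2 / (c * (\<gamma> - 2 * \<kappa>)\<^sup>2))"
    by simp
  also have "\<dots> = (1 / (2 * c) + 2 * \<gamma> * \<kappa> / (c * (\<gamma> - 2 * \<kappa>)\<^sup>2)) * F\<^sup>2"
    by (simp add: distrib_right)
  finally show ?thesis unfolding n_def F_def \<gamma>_def \<kappa>_def .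
qed

text \<open>The subtracted multiple of U is u 0 and not a projection: it removes the boundary value,
  and with it the delta term. \<open>isolated_simple_eigenvalue_zeroI\<close> accepts any multiple.
  That the mode has no zeros beyond b is recorded for the nondegeneracy of V0.\<close>

lemma zero_mode:
  assumes "b > 0" "k \<ge> 1" "\<beta> < 1" "lam < 1" "\<alpha> \<ge> 0" and res: "(real k)\<^sup>2 * \<alpha> = 2 * kappa b \<beta> k lam"
  obtains \<psi> c where "\<psi> \<in> L_dom \<alpha> k" "eq_ae (L_op b \<beta> k lam \<psi>) (\<lambda>x. 0)" "\<And>y. \<bar>y\<bar> > b \<Longrightarrow> \<psi> y \<noteq> 0" "c > 0"
    "\<And>\<phi>. \<phi> \<in> L_dom \<alpha> k \<Longrightarrow> \<exists>s. L2_norm (\<lambda>x. \<phi> x - s * \<psi> x) \<le> c * L2_norm (L_op b \<beta> k lam \<phi>)"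
proof -
  let ?w = "\<lambda>U y. complex_of_real (pot b \<beta> k lam y) * U y" and ?\<gamma> = "(real k)\<^sup>2 * \<alpha>"
  obtain U p1 p2 where P: "H2_rep U U p1 p2 (?w U)" "U 0 = 1" "p1 0 - p2 0 = - of_real (2 * kappa b \<beta> k lam)"
    and nz: "\<And>y. \<bar>y\<bar> > b \<Longrightarrow> U y \<noteq> 0"
    using psi[OF assms(1-4)] by metis
  have j: "p1 0 - p2 0 = - of_real ?\<gamma> * U 0" unfolding P(2,3) res by simp
  define c where "c = (real k)\<^sup>2 * min (1 - \<beta>) (1 - lam)"
  have c: "c > 0" using assms(2-4) by (simp add: c_def)
  have "U \<in> L_dom \<alpha> k" unfolding L_dom_iff using P(1) j by blast
  moreover have "eq_ae (L_op b \<beta> k lam U) (\<lambda>x. 0)" using L_op_ae[OF P(1), of b \<beta> k lam] by eventually_elim simp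
  moreover have "\<exists>s. L2_norm (\<lambda>x. \<phi> x - s * U x) \<le> (1 / c) * L2_norm (L_op b \<beta> k lam \<phi>)" if \<phi>: "\<phi> \<in> L_dom \<alpha> k" for \<phi>
  proof -
    obtain u v1 v2 w where r: "H2_rep \<phi> u v1 v2 w" "v1 0 - v2 0 = - of_real ?\<gamma> * u 0" using \<phi> by (rule L_dom_cases)
    note q = H2_rep_add[OF r(1) H2_rep_scale[OF P(1), of "- u 0"]]
    have "(v1 0 + - u 0 * p1 0) - (v2 0 + - u 0 * p2 0) = (v1 0 - v2 0) - u 0 * (p1 0 - p2 0)" by (simp add: algebra_simps)
    also have "\<dots> = - of_real ?\<gamma> * (u 0 + - u 0 * U 0)" unfolding r(2) j P(2) by simp
    finally have jq: "(v1 0 + - u 0 * p1 0) - (v2 0 + - u 0 * p2 0) = - of_real ?\<gamma> * (u 0 + - u 0 * U 0)" .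
    define \<xi> where "\<xi> = (\<lambda>x. \<phi> x + - u 0 * U x)"
    have "c * (L2_norm \<xi>)\<^sup>2 + (L2_norm (wderiv UNIV \<xi>))\<^sup>2
        \<le> L2_norm (L_op b \<beta> k lam \<xi>) * L2_norm \<xi> + ?\<gamma> * (cmod (u 0 + - u 0 * U 0))\<^sup>2"
      using energy_estimate[OF assms(3,4) q jq, of k b] unfolding c_def \<xi>_def .
    then have "c * (L2_norm \<xi>)\<^sup>2 + (L2_norm (wderiv UNIV \<xi>))\<^sup>2 \<le> L2_norm (L_op b \<beta> k lam \<xi>) * L2_norm \<xi>"
      by (simp add: P(2))
    then have e: "c * (L2_norm \<xi>)\<^sup>2 \<le> L2_norm (L_op b \<beta> k lam \<xi>) * L2_norm \<xi>"
      using zero_le_power2[of "L2_norm (wderiv UNIV \<xi>)"] by linarith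
    have "c * L2_norm \<xi> \<le> L2_norm (L_op b \<beta> k lam \<xi>)"
    proof (cases "L2_norm \<xi> = 0")
      case False
      then have "L2_norm \<xi> > 0" using L2_norm_nonneg[of \<xi>] by linarith
      then show ?thesis using e by (simp add: power2_eq_square flip: mult.assoc)
    qed (simp add: L2_norm_nonneg)
    also have "L2_norm (L_op b \<beta> k lam \<xi>) = L2_norm (L_op b \<beta> k lam \<phi>)"
    proof (rule L2_norm_cong)
      show "L_op b \<beta> k lam \<xi> \<in> L2 UNIV" unfolding \<xi>_def by (rule L_op_L2(2)[OF q])
      show "eq_ae (L_op b \<beta> k lam \<xi>) (L_op b \<beta> k lam \<phi>)"
        using L_op_ae[OF q, of b \<beta> k lam] L_op_ae[OF r(1), of b \<beta> k lam] unfolding \<xi>_def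
        by eventually_elim (simp add: right_diff_distrib mult.left_commute)
    qed
    finally have "L2_norm \<xi> \<le> (1 / c) * L2_norm (L_op b \<beta> k lam \<phi>)" using c by (simp add: field_simps)
    moreover have "\<xi> = (\<lambda>x. \<phi> x - u 0 * U x)" by (simp add: \<xi>_def)
    ultimately show ?thesis by blast
  qed
  ultimately show ?thesis using that[of U "1 / c"] nz c by simp
qed

section \<open>Growth, injectivity and continuity of the dispersion function\<close>

lemma kappa_bounds:
  assumes "b > 0" "k \<ge> 1" "\<beta> < 1" "lam < 1"
  shows "kappa b \<beta> k lam > 0" "kappa b \<beta> k lam \<le> real k * (sqrt (1 - \<beta>) + sqrt (1 - lam))"
proof -
  let ?a = "sqrt (1 - \<beta>)" and ?m = "sqrt (1 - lam)"
  have p: "?a > 0" "?m > 0" "real k * ?a * b \<ge> 0" using assms by simp_all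
  show "kappa b \<beta> k lam > 0" unfolding kappa_def using disp_ratio_bounds(1)[OF p] p assms(2) by simp
  show "kappa b \<beta> k lam \<le> real k * (?a + ?m)"
    unfolding kappa_def by (rule mult_left_mono[OF disp_ratio_bounds(2)[OF p]]) simp
qed

text \<open>\<open>\<kappa>(k, \<lambda>) / k\<^sup>2\<close> is strictly decreasing in \<open>k\<close>.\<close>

lemma dispersion_unique_k:
  assumes "b > 0" "k \<ge> 1" "l \<ge> 1" "\<beta> < 1" "lam < 1"
    and "(real k)\<^sup>2 * \<alpha> = 2 * kappa b \<beta> k lam" "(real l)\<^sup>2 * \<alpha> = 2 * kappa b \<beta> l lam"
  shows "k = l"
proof -
  define a where "a = sqrt (1 - \<beta>)"
  have a: "a > 0" and m: "sqrt (1 - lam) > 0" using assms by (simp_all add: a_def)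
  \<comment> \<open>At t = n a b the resonance condition says that the ratio divided by t equals a
    value independent of n.\<close>
  have R: "disp_ratio a (sqrt (1 - lam)) (real n * a * b) / (real n * a * b) = \<alpha> / (2 * a\<^sup>2 * b)"
    if "n \<ge> 1" "(real n)\<^sup>2 * \<alpha> = 2 * kappa b \<beta> n lam" for n
  proof -
    have n: "real n > 0" using that(1) by simp
    have "real n * (real n * \<alpha>) = real n * (2 * (a * disp_ratio a (sqrt (1 - lam)) (real n * a * b)))"
      using that(2) by (simp add: kappa_def a_def power2_eq_square)
    then have "real n * \<alpha> = 2 * (a * disp_ratio a (sqrt (1 - lam)) (real n * a * b))" using n by simp
    then have "\<alpha> = 2 * (a * disp_ratio a (sqrt (1 - lam)) (real n * a * b)) / real n" using n by (simp add: field_simps)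
    then show ?thesis using n a assms(1) by (simp add: power2_eq_square)
  qed
  have "\<not> real i * a * b < real j * a * b" if "i \<ge> 1" "(real i)\<^sup>2 * \<alpha> = 2 * kappa b \<beta> i lam"
    "(real j)\<^sup>2 * \<alpha> = 2 * kappa b \<beta> j lam" "j \<ge> 1" for i j
  proof
    assume lt: "real i * a * b < real j * a * b"
    have "0 < real i * a * b" using that(1) a assms(1) by simp
    from disp_ratio_over_decreasing[OF a m this lt] show False using R[OF that(1,2)] R[OF that(4,3)] by simp
  qed
  from this[OF assms(2,6,7,3)] this[OF assms(3,7,6,2)] show ?thesis using a assms(1) by (simp add: mult.assoc)
qed

lemma dispersion_unique_lam:
  assumes "b > 0" "k \<ge> 1" "\<beta> < 1" "lam < 1" "mu < 1" "kappa b \<beta> k lam = kappa b \<beta> k mu"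
  shows "lam = mu"
proof -
  let ?a = "sqrt (1 - \<beta>)"
  have a: "?a > 0" using assms by simp
  have "disp_ratio ?a (sqrt (1 - lam)) (real k * ?a * b) = disp_ratio ?a (sqrt (1 - mu)) (real k * ?a * b)"
    using assms(2,6) a by (simp add: kappa_def)
  then have "sqrt (1 - lam) = sqrt (1 - mu)"
    by (rule disp_ratio_inj_m[rotated -1]) (use assms a in simp_all)
  then show ?thesis by simp
qed

lemma kappa_continuous:
  assumes "b > 0" "\<beta> < 1" "lam < 1" shows "((\<lambda>x. kappa b \<beta> k x) \<longlongrightarrow> kappa b \<beta> k lam) (nhds lam)"
proof -
  let ?a = "sqrt (1 - \<beta>)"
  have d: "?a * cosh (real k * ?a * b) + sqrt (1 - lam) * sinh (real k * ?a * b) \<noteq> 0"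
    using disp_ratio_den_pos[of ?a "sqrt (1 - lam)" "real k * ?a * b"] assms by simp
  have "((\<lambda>x. sqrt (1 - x)) \<longlongrightarrow> sqrt (1 - lam)) (nhds lam)" by (intro tendsto_intros filterlim_ident)
  then show ?thesis unfolding kappa_def disp_ratio_def by (intro tendsto_intros d filterlim_ident)
qed

section \<open>Choice of the interval, uniform constants and nondegeneracy\<close>

theorem corollary2p6:
  fixes b \<alpha> \<beta> lams :: real and ks :: nat
  assumes "b > 0" and "ks \<ge> 1" and "\<beta> < 1" and "lams < 1" and "\<alpha> > 0"
    and "\<alpha> = 2 * sqrt (1 - \<beta>) / real ks *
          ((sqrt (1 - \<beta>) * sinh (real ks * sqrt (1 - \<beta>) * b)
             + sqrt (1 - lams) * cosh (real ks * sqrt (1 - \<beta>) * b)) /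
           (sqrt (1 - \<beta>) * cosh (real ks * sqrt (1 - \<beta>) * b)
             + sqrt (1 - lams) * sinh (real ks * sqrt (1 - \<beta>) * b)))"
  shows "(V0 b \<in> Linf \<and> bounded_operator_H1_Hm1 (V1 b \<beta> \<alpha>)) \<and>
    (\<forall>k\<ge>1. \<forall>lam::real. self_adjoint (L_dom \<alpha> k) (L_op b \<beta> k lam)) \<and>
    (\<exists>I :: real set. open I \<and> is_interval I \<and> lams \<in> I \<and>
       isolated_simple_eigenvalue (L_dom \<alpha> ks) (L_op b \<beta> ks lams) 0 \<and>
       (\<forall>k\<ge>1. \<forall>lam\<in>I. (k, lam) \<noteq> (ks, lams) \<longrightarrow>
          0 \<in> resolvent_set (L_dom \<alpha> k) (L_op b \<beta> k lam)) \<and>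
       (\<exists>C>0. \<exists>k0\<ge>1. \<forall>k\<ge>k0. \<forall>lam\<in>I. \<forall>\<phi>\<in>L_dom \<alpha> k. \<forall>f\<in>L2 UNIV.
          eq_ae (L_op b \<beta> k lam \<phi>) f \<longrightarrow>
            L2_norm \<phi> \<le> C / (real k)\<^sup>2 * L2_norm f \<and>
            L2_norm (wderiv UNIV \<phi>) \<le> C / real k * L2_norm f)) \<and>
    (\<forall>\<phi>s. spans \<phi>s (op_kernel (L_dom \<alpha> ks) (L_op b \<beta> ks lams)) \<longrightarrow>
       L2_inner (\<lambda>y. of_real (V0 b y) * \<phi>s y) \<phi>s \<noteq> 0)"
proof -
  have \<alpha>: "\<alpha> \<ge> 0" using assms(5) by simp
  have sa: "self_adjoint (L_dom \<alpha> k) (L_op b \<beta> k lam)" for k lam by (rule L_self_adjoint[OF \<alpha>])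
  define D where "D k lam = (real k)\<^sup>2 * \<alpha> - 2 * kappa b \<beta> k lam" for k lam
  \<comment> \<open>The prescribed \<alpha> is the resonance condition at (\<open>ks\<close>,
    \<open>lams\<close>).\<close>
  have Ds: "D ks lams = 0"
    unfolding D_def kappa_def disp_ratio_def using assms(2) by (subst assms(6)) (simp add: power2_eq_square)
  then have res: "(real ks)\<^sup>2 * \<alpha> = 2 * kappa b \<beta> ks lams" by (simp add: D_def)
  obtain \<psi> c where \<psi>: "\<psi> \<in> L_dom \<alpha> ks" "eq_ae (L_op b \<beta> ks lams \<psi>) (\<lambda>x. 0)" "\<And>y. \<bar>y\<bar> > b \<Longrightarrow> \<psi> y \<noteq> 0"
    and c: "c > 0" "\<And>\<phi>. \<phi> \<in> L_dom \<alpha> ks \<Longrightarrow> \<exists>s. L2_norm (\<lambda>x. \<phi> x - s * \<psi> x) \<le> c * L2_norm (L_op b \<beta> ks lams \<phi>)"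
  proof (rule zero_mode[OF assms(1-4) \<alpha> res])
    fix \<psi> c
    assume 1: "\<psi> \<in> L_dom \<alpha> ks" "eq_ae (L_op b \<beta> ks lams \<psi>) (\<lambda>x. 0)" "\<And>y. \<bar>y\<bar> > b \<Longrightarrow> \<psi> y \<noteq> 0" "c > 0"
      "\<And>\<phi>. \<phi> \<in> L_dom \<alpha> ks \<Longrightarrow> \<exists>s. L2_norm (\<lambda>x. \<phi> x - s * \<psi> x) \<le> c * L2_norm (L_op b \<beta> ks lams \<phi>)"
    show thesis by (rule that[OF 1])
  qed
  \<comment> \<open>\<psi> has no zero on (b, b + 1), a set of positive measure.\<close>
  have outside: "\<not> (AE y in lebesgue. \<bar>y\<bar> \<ge> b \<longrightarrow> \<psi> y = 0)"
  proof
    assume "AE y in lebesgue. \<bar>y\<bar> \<ge> b \<longrightarrow> \<psi> y = 0"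
    then have "negligible {y. \<not> (\<bar>y\<bar> \<ge> b \<longrightarrow> \<psi> y = 0)}" by (simp only: AE_lebesgue_iff_negligible)
    then have "negligible {b<..<b + 1}" by (rule negligible_subset) (use assms(1) \<psi>(3) in auto)
    then show False using open_not_negligible[of "{b<..<b + 1}"] by simp
  qed
  have \<psi>0: "\<not> eq_ae \<psi> (\<lambda>x. 0)"
  proof
    assume "eq_ae \<psi> (\<lambda>x. 0)"
    then have "AE y in lebesgue. \<bar>y\<bar> \<ge> b \<longrightarrow> \<psi> y = 0" by eventually_elim simp
    then show False using outside by simp
  qed
  note iso = isolated_simple_eigenvalue_zeroI[OF sa \<psi>(1,2) \<psi>0 c]
  \<comment> \<open>For \<lambda> within (1 - lams)/2 of \<open>lams\<close>, 1 - \<lambda> lies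
    between 1/2 and 3/2 of 1 - lams. So M bounds sqrt (1 - \<lambda>) from above and k^2 w bounds
    the potential from below.\<close>
  define a M w where "a = sqrt (1 - \<beta>)" and "M = sqrt (3 * (1 - lams) / 2)" and "w = min (1 - \<beta>) ((1 - lams) / 2)"
  have w: "w > 0" using assms(3,4) by (simp add: w_def)
  have aM: "a > 0" "M > 0" using assms(3,4) by (simp_all add: a_def M_def)
  \<comment> \<open>Beyond this threshold 4 (a + M) <= k \<alpha>, which gives 2 \<kappa> <= k^2
    \<alpha> / 2. In particular ks < k0, since (\<open>ks\<close>, \<open>lams\<close>) is
    resonant.\<close>
  obtain k1 where k1: "4 * (a + M) / \<alpha> \<le> real k1" using real_arch_simple by blast
  define k0 where "k0 = max 1 k1"
  have k0: "k0 \<ge> 1" by (simp add: k0_def)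
  define near where "near lam \<longleftrightarrow> \<bar>lam - lams\<bar> < (1 - lams) / 2" for lam
  have nearD: "lam < 1" "w \<le> min (1 - \<beta>) (1 - lam)" "sqrt (1 - lam) \<le> M" if "near lam" for lam
  proof -
    have *: "lam < lams + (1 - lams) / 2" "lam > lams - (1 - lams) / 2"
      using that unfolding near_def abs_less_iff by linarith+
    then have **: "lam < 1" "(1 - lams) / 2 \<le> 1 - lam" "1 - lam \<le> 3 * (1 - lams) / 2"
      using assms(4) by (simp_all add: field_simps)
    show "lam < 1" by (rule **)
    show "w \<le> min (1 - \<beta>) (1 - lam)" unfolding w_def by (rule min.mono[OF order_refl **(2)])
    show "sqrt (1 - lam) \<le> M" unfolding M_def by (rule real_sqrt_le_mono[OF **(3)])
  qed
  have big: "2 * kappa b \<beta> k lam \<le> (real k)\<^sup>2 * \<alpha> / 2" if k: "k \<ge> k0" and lam: "near lam" for k lam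
  proof -
    have k': "k \<ge> 1" "k1 \<le> k" using k by (simp_all add: k0_def)
    have "4 * (a + M) / \<alpha> \<le> real k" using k1 k'(2) by linarith
    then have *: "4 * (a + M) \<le> real k * \<alpha>" using assms(5) by (simp add: pos_divide_le_eq)
    have "kappa b \<beta> k lam \<le> real k * (a + sqrt (1 - lam))"
      using kappa_bounds(2)[OF assms(1) k'(1) assms(3) nearD(1)[OF lam]] by (simp add: a_def)
    also have "\<dots> \<le> real k * (a + M)" using nearD(3)[OF lam] by (intro mult_left_mono) auto
    also have "\<dots> \<le> real k * (real k * \<alpha> / 4)" using * by (intro mult_left_mono) auto
    finally show ?thesis by (simp add: power2_eq_square)
  qed
  have "\<forall>\<^sub>F lam in nhds lams. \<forall>k\<in>{1..<k0} - {ks}. D k lam \<noteq> 0"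
  proof (rule eventually_ball_finite)
    \<comment> \<open>Finitely many k remain, none of them resonant at \<open>lams\<close> by
      monotonicity in k, so continuity in \<lambda> suffices. \<open>ks\<close> is left out and
      treated by injectivity in \<lambda>.\<close>
    show "\<forall>k\<in>{1..<k0} - {ks}. \<forall>\<^sub>F lam in nhds lams. D k lam \<noteq> 0"
    proof
      fix k assume k: "k \<in> {1..<k0} - {ks}"
      have "D k lams \<noteq> 0"
      proof
        assume "D k lams = 0"
        then have "k = ks" using dispersion_unique_k[OF assms(1) _ assms(2-4) _ res, of k] k by (simp add: D_def)
        then show False using k by simp
      qed
      moreover have "((\<lambda>lam. D k lam) \<longlongrightarrow> D k lams) (nhds lams)"
        unfolding D_def by (intro tendsto_intros kappa_continuous assms)
      ultimately show "\<forall>\<^sub>F lam in nhds lams. D k lam \<noteq> 0" using tendsto_imp_eventually_ne by blast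
    qed
  qed simp
  then obtain r where r: "r > 0" "\<And>lam k. dist lam lams < r \<Longrightarrow> k \<in> {1..<k0} - {ks} \<Longrightarrow> D k lam \<noteq> 0"
    unfolding eventually_nhds_metric by blast
  \<comment> \<open>The radius r keeps the small k away from resonance, the other radius gives
    \<open>near\<close>.\<close>
  define I where "I = ball lams (min r ((1 - lams) / 2))"
  have I: "open I" "is_interval I" "lams \<in> I"
    using r(1) assms(4) by (simp_all add: I_def is_interval_ball_real)
  have near: "near lam" "dist lam lams < r" if "lam \<in> I" for lam
    using that by (auto simp: I_def near_def dist_real_def abs_minus_commute)
  have nz: "D k lam \<noteq> 0" if k: "k \<ge> 1" and lam: "lam \<in> I" and ne: "(k, lam) \<noteq> (ks, lams)" for k lam
  proof -
    note l1 = nearD(1)[OF near(1)[OF lam]]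
    consider "k = ks" | "k \<noteq> ks" "k < k0" | "k \<ge> k0" by linarith
    then show ?thesis
    proof cases
      case 1
      show ?thesis
      proof
        assume "D k lam = 0"
        then have "kappa b \<beta> ks lam = kappa b \<beta> ks lams" using res 1 by (simp add: D_def)
        then have "lam = lams" by (rule dispersion_unique_lam[OF assms(1-3) l1 assms(4)])
        then show False using ne 1 by simp
      qed
    next
      case 2
      then show ?thesis using r(2)[OF near(2)[OF lam]] k by simp
    next
      case 3
      have "(real k)\<^sup>2 * \<alpha> > 0" using k assms(5) by simp
      then show ?thesis using big[OF 3 near(1)[OF lam]] by (simp add: D_def)
    qed
  qed
  have resolvent: "0 \<in> resolvent_set (L_dom \<alpha> k) (L_op b \<beta> k lam)"
    if k: "k \<ge> 1" and lam: "lam \<in> I" and ne: "(k, lam) \<noteq> (ks, lams)" for k lam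
  proof -
    note l1 = nearD(1)[OF near(1)[OF lam]]
    define e where "e = (real k)\<^sup>2 * min (1 - \<beta>) (1 - lam)"
    have e: "e > 0" using k assms(3) l1 by (simp add: e_def)
    define K where "K = 1 / (2 * e) + 2 * ((real k)\<^sup>2 * \<alpha>) * kappa b \<beta> k lam / (e * (D k lam)\<^sup>2)"
    have "L2_norm \<phi> \<le> sqrt (2 / e * K) * L2_norm (L_op b \<beta> k lam \<phi>)" if "\<phi> \<in> L_dom \<alpha> k" for \<phi>
    proof -
      have "e / 2 * (L2_norm \<phi>)\<^sup>2 + (L2_norm (wderiv UNIV \<phi>))\<^sup>2 \<le> K * (L2_norm (L_op b \<beta> k lam \<phi>))\<^sup>2"
        using solution_estimate[OF assms(1) k assms(3) l1 \<alpha> that, of e] nz[OF k lam ne] e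
        unfolding K_def D_def e_def by simp
      then have "e / 2 * (L2_norm \<phi>)\<^sup>2 \<le> K * (L2_norm (L_op b \<beta> k lam \<phi>))\<^sup>2"
        using zero_le_power2[of "L2_norm (wderiv UNIV \<phi>)"] by linarith
      then have "(L2_norm \<phi>)\<^sup>2 \<le> (2 / e * K) * (L2_norm (L_op b \<beta> k lam \<phi>))\<^sup>2"
        using e by (simp add: field_simps)
      then have "sqrt ((L2_norm \<phi>)\<^sup>2) \<le> sqrt ((2 / e * K) * (L2_norm (L_op b \<beta> k lam \<phi>))\<^sup>2)" by (rule real_sqrt_le_mono)
      then show ?thesis by (simp only: real_sqrt_mult[of "2 / e * K"] real_sqrt_abs abs_of_nonneg[OF L2_norm_nonneg])
    qed
    then show ?thesis
      by (intro self_adjoint_resolventI[OF sa, where C = "sqrt (2 / e * K)"]) simp_all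
  qed
  \<comment> \<open>Chosen so that C^2 dominates both 5 / w^2 and 5 / (2 w), the constants of the
    bounds for \<phi> and for its derivative.\<close>
  define C where "C = 1 + 5 / w"
  have C: "C > 0" using w by (simp add: C_def add_pos_pos)
  have C2: "5 / w\<^sup>2 \<le> C\<^sup>2" "5 / (2 * w) \<le> C\<^sup>2"
  proof -
    have "C\<^sup>2 = 1 + 10 / w + 25 / w\<^sup>2" by (simp add: C_def power2_sum power_divide)
    moreover have "0 \<le> 20 / w\<^sup>2" "0 \<le> 15 / (2 * w)" "0 \<le> 25 / w\<^sup>2" "0 \<le> 5 / w" using w by simp_all
    moreover have "25 / w\<^sup>2 = 5 / w\<^sup>2 + 20 / w\<^sup>2" by (simp flip: add_divide_distrib)
    moreover have "10 / w = 5 / (2 * w) + 15 / (2 * w)" by (simp flip: add_divide_distrib)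
    ultimately show "5 / w\<^sup>2 \<le> C\<^sup>2" "5 / (2 * w) \<le> C\<^sup>2" using w by linarith+
  qed
  have est: "L2_norm \<phi> \<le> C / (real k)\<^sup>2 * L2_norm f \<and> L2_norm (wderiv UNIV \<phi>) \<le> C / real k * L2_norm f"
    if k: "k \<ge> k0" and lam: "lam \<in> I" and \<phi>: "\<phi> \<in> L_dom \<alpha> k" and f: "f \<in> L2 UNIV" "eq_ae (L_op b \<beta> k lam \<phi>) f" for k lam \<phi> f
  proof -
    have k': "k \<ge> 1" using k k0 by simp
    note l1 = nearD(1)[OF near(1)[OF lam]]
    define e where "e = (real k)\<^sup>2 * w"
    have e: "e > 0" "e \<le> (real k)\<^sup>2 * min (1 - \<beta>) (1 - lam)"
      using k' w mult_left_mono[OF nearD(2)[OF near(1)[OF lam]], of "(real k)\<^sup>2"] by (simp_all add: e_def)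
    define \<gamma> \<kappa> where "\<gamma> = (real k)\<^sup>2 * \<alpha>" and "\<kappa> = kappa b \<beta> k lam"
    have g: "\<gamma> > 0" using k' assms(5) by (simp add: \<gamma>_def)
    have \<kappa>: "2 * \<kappa> \<le> \<gamma> / 2" "\<kappa> > 0" using big[OF k near(1)[OF lam]] kappa_bounds(1)[OF assms(1) k' assms(3) l1]
      by (simp_all add: \<gamma>_def \<kappa>_def)
    have nf: "L2_norm (L_op b \<beta> k lam \<phi>) = L2_norm f" by (rule L2_norm_cong[OF L2_cong_ae[OF f(1) AE_eq_sym[OF f(2)]] f(2)])
    have d: "\<gamma> - 2 * \<kappa> \<ge> \<gamma> / 2" using \<kappa> by simp
    then have d2: "(\<gamma> - 2 * \<kappa>)\<^sup>2 \<ge> (\<gamma> / 2)\<^sup>2" by (rule power_mono) (use g in simp)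
    \<comment> \<open>From \<kappa> <= \<gamma>/4 and \<gamma> - 2 \<kappa> >= \<gamma>/2 the factor
      \<gamma> cancels, and the boundary term costs at most 2 / e.\<close>
    have "2 * \<gamma> * \<kappa> / (e * (\<gamma> - 2 * \<kappa>)\<^sup>2) \<le> 2 * \<gamma> * (\<gamma> / 4) / (e * (\<gamma> / 2)\<^sup>2)"
      using g \<kappa> e(1) by (intro frac_le mult_left_mono d2) auto
    also have "\<dots> = 2 / e" using g by (simp add: power2_eq_square)
    finally have "2 * \<gamma> * \<kappa> / (e * (\<gamma> - 2 * \<kappa>)\<^sup>2) \<le> 2 / e" .
    moreover have "1 / (2 * e) + 2 / e = 5 / (2 * e)" using e(1) by (simp add: field_simps)
    ultimately have "1 / (2 * e) + 2 * \<gamma> * \<kappa> / (e * (\<gamma> - 2 * \<kappa>)\<^sup>2) \<le> 5 / (2 * e)" by linarith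
    then have "(1 / (2 * e) + 2 * \<gamma> * \<kappa> / (e * (\<gamma> - 2 * \<kappa>)\<^sup>2)) * (L2_norm f)\<^sup>2 \<le> 5 / (2 * e) * (L2_norm f)\<^sup>2"
      by (rule mult_right_mono) simp
    moreover have "\<gamma> - 2 * \<kappa> \<noteq> 0" using d g by linarith
    ultimately have main: "e / 2 * (L2_norm \<phi>)\<^sup>2 + (L2_norm (wderiv UNIV \<phi>))\<^sup>2 \<le> 5 / (2 * e) * (L2_norm f)\<^sup>2"
      using solution_estimate[OF assms(1) k' assms(3) l1 \<alpha> \<phi> _ e] unfolding nf \<gamma>_def \<kappa>_def by linarith
    have kp: "real k > 0" using k' by simp
    \<comment> \<open>The weight e / 2 = k^2 w / 2 supplies the extra factor 1/k compared with the
      bound for the derivative.\<close>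
    have "e / 2 * (L2_norm \<phi>)\<^sup>2 \<le> 5 / (2 * e) * (L2_norm f)\<^sup>2"
      using main zero_le_power2[of "L2_norm (wderiv UNIV \<phi>)"] by linarith
    then have "(L2_norm \<phi>)\<^sup>2 \<le> 5 / e\<^sup>2 * (L2_norm f)\<^sup>2" using e(1) by (simp add: field_simps power2_eq_square)
    also have "5 / e\<^sup>2 = (5 / w\<^sup>2) / ((real k)\<^sup>2)\<^sup>2" by (simp add: e_def power_mult_distrib)
    also have "(5 / w\<^sup>2) / ((real k)\<^sup>2)\<^sup>2 * (L2_norm f)\<^sup>2 \<le> C\<^sup>2 / ((real k)\<^sup>2)\<^sup>2 * (L2_norm f)\<^sup>2"
      by (intro mult_right_mono divide_right_mono C2) auto
    finally have "(L2_norm \<phi>)\<^sup>2 \<le> (C / (real k)\<^sup>2 * L2_norm f)\<^sup>2" by (simp only: power_mult_distrib power_divide)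
    then have 1: "L2_norm \<phi> \<le> C / (real k)\<^sup>2 * L2_norm f"
      by (rule power2_le_imp_le) (use C L2_norm_nonneg[of f] in simp)
    have "(L2_norm (wderiv UNIV \<phi>))\<^sup>2 \<le> 5 / (2 * e) * (L2_norm f)\<^sup>2"
    proof -
      have "0 \<le> e / 2 * (L2_norm \<phi>)\<^sup>2" using e(1) by simp
      then show ?thesis using main by linarith
    qed
    also have "5 / (2 * e) = (5 / (2 * w)) / (real k)\<^sup>2" by (simp add: e_def)
    also have "(5 / (2 * w)) / (real k)\<^sup>2 * (L2_norm f)\<^sup>2 \<le> C\<^sup>2 / (real k)\<^sup>2 * (L2_norm f)\<^sup>2"
      by (intro mult_right_mono divide_right_mono C2) auto
    finally have "(L2_norm (wderiv UNIV \<phi>))\<^sup>2 \<le> (C / real k * L2_norm f)\<^sup>2" by (simp only: power_mult_distrib power_divide)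
    then have "L2_norm (wderiv UNIV \<phi>) \<le> C / real k * L2_norm f"
      by (rule power2_le_imp_le) (use C L2_norm_nonneg[of f] in simp)
    with 1 show ?thesis by blast
  qed
  have nondeg: "L2_inner (\<lambda>y. of_real (V0 b y) * \<phi>s y) \<phi>s \<noteq> 0"
    if s: "spans \<phi>s (op_kernel (L_dom \<alpha> ks) (L_op b \<beta> ks lams))" for \<phi>s
  proof
    assume z: "L2_inner (\<lambda>y. of_real (V0 b y) * \<phi>s y) \<phi>s = 0"
    have "\<phi>s \<in> L_dom \<alpha> ks" using s by (simp add: spans_def op_kernel_def)
    then have \<phi>L: "\<phi>s \<in> L2 UNIV" by (rule L2_operatorD(1)[OF L_operator])
    have "\<psi> \<in> op_kernel (L_dom \<alpha> ks) (L_op b \<beta> ks lams)" using \<psi>(1,2) by (simp add: op_kernel_def)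
    \<comment> \<open>\<psi> is a multiple of every spanning \<open>\<phi>s\<close>, so if the
      V0-weighted norm of \<open>\<phi>s\<close> vanished, \<psi> would vanish for |y| >= b.\<close>
    then obtain t where t: "eq_ae \<psi> (\<lambda>x. t * \<phi>s x)" using s unfolding spans_def by blast
    have "V0 b \<in> borel_measurable lebesgue" using V0_Linf by (simp add: Linf_def)
    then have Vm: "(\<lambda>y. complex_of_real (V0 b y)) \<in> borel_measurable lebesgue" by measurable
    have Vb: "cmod (complex_of_real (V0 b y)) \<le> 1" for y by (simp add: V0_def indicator_def)
    have e: "of_real (V0 b y) * \<phi>s y * cnj (\<phi>s y) = of_real (V0 b y * (cmod (\<phi>s y))\<^sup>2)" for y
      by (simp only: of_real_mult complex_norm_square mult.assoc)
    have i: "integrable lebesgue (\<lambda>y. V0 b y * (cmod (\<phi>s y))\<^sup>2)"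
      using integrable_Re[OF L2_inner_integrable[OF L2_mult_bounded[OF \<phi>L Vm Vb] \<phi>L]] unfolding e by simp
    have "(LINT y|lebesgue. V0 b y * (cmod (\<phi>s y))\<^sup>2) = 0"
      using z unfolding L2_inner_def e integral_complex_of_real by simp
    moreover have "AE y in lebesgue. 0 \<le> V0 b y * (cmod (\<phi>s y))\<^sup>2" by (rule AE_I2) (simp add: V0_def)
    ultimately have "AE y in lebesgue. V0 b y * (cmod (\<phi>s y))\<^sup>2 = 0"
      using integral_nonneg_eq_0_iff_AE[OF i] by blast
    then have "AE y in lebesgue. \<bar>y\<bar> \<ge> b \<longrightarrow> \<psi> y = 0"
      using t by eventually_elim (auto simp: V0_def)
    then show False using outside by simp
  qed
  have "\<exists>I. open I \<and> is_interval I \<and> lams \<in> I \<and>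
       isolated_simple_eigenvalue (L_dom \<alpha> ks) (L_op b \<beta> ks lams) 0 \<and>
       (\<forall>k\<ge>1. \<forall>lam\<in>I. (k, lam) \<noteq> (ks, lams) \<longrightarrow>
          0 \<in> resolvent_set (L_dom \<alpha> k) (L_op b \<beta> k lam)) \<and>
       (\<exists>C>0. \<exists>k0\<ge>1. \<forall>k\<ge>k0. \<forall>lam\<in>I. \<forall>\<phi>\<in>L_dom \<alpha> k. \<forall>f\<in>L2 UNIV.
          eq_ae (L_op b \<beta> k lam \<phi>) f \<longrightarrow>
            L2_norm \<phi> \<le> C / (real k)\<^sup>2 * L2_norm f \<and>
            L2_norm (wderiv UNIV \<phi>) \<le> C / real k * L2_norm f)"
  proof (intro exI[of _ I] conjI I iso(1) allI impI ballI)
    fix k :: nat and lam :: real assume "1 \<le> k" "lam \<in> I" "(k, lam) \<noteq> (ks, lams)"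
    then show "0 \<in> resolvent_set (L_dom \<alpha> k) (L_op b \<beta> k lam)" by (rule resolvent)
  next
    show "\<exists>C>0. \<exists>k0\<ge>1. \<forall>k\<ge>k0. \<forall>lam\<in>I. \<forall>\<phi>\<in>L_dom \<alpha> k. \<forall>f\<in>L2 UNIV.
          eq_ae (L_op b \<beta> k lam \<phi>) f \<longrightarrow>
            L2_norm \<phi> \<le> C / (real k)\<^sup>2 * L2_norm f \<and>
            L2_norm (wderiv UNIV \<phi>) \<le> C / real k * L2_norm f"
      by (rule exI[of _ C], rule conjI[OF C], rule exI[of _ k0], rule conjI[OF k0]) (intro allI impI ballI est)
  qed
  then show ?thesis
    using V0_Linf V1_bounded sa nondeg by blast
qed

end
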